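(* Let $G$ be of type $D_{\ell+1}$ over $\mathbb{C}$ with diagram automorphism $\sigma$ of order $2$ (type $(D_{\ell+1},2)$). For $x\in\mathcal{N}_{\mathfrak p}$, write $x=\begin{pmatrix}0 & -u^T \\ u & 0\end{pmatrix}$ with $u\in\mathbb{C}^{2\ell+1}$. Then the reduced fiber over $x$ of $\pi:\mathcal{M}\to\pi(\mathcal{M})$ satisfies $$\pi^{-1}(x)_{\rm red}\cong\{D\in\mathfrak{so}_{2\ell+1}\mid Du=0,\ D^2=0\}.$$ In particular, $\pi^{-1}(0)_{\rm red}$ is isomorphic to the maximal order 2 nilpotent variety in $\mathfrak{so}_{2\ell+1}$, and $\dim\pi^{-1}(0)_{\rm red}=\ell^2$ if $\ell$ is even, and $\ell^2-1$ if $\ell$ is odd.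
   Context: Let $\widetilde G=\mathrm{Spin}_{2\ell+2}$ with pinning-preserving diagram automorphism $\sigma$ of order $2$, maximal torus $T$, simple coroots $\check\alpha_1,\dots,\check\alpha_{\ell+1}$ ($\sigma$ swaps $\check\alpha_\ell,\check\alpha_{\ell+1}$). $\mathcal{O}=\mathbb{C}[[t]]$, $\mathcal{K}=\mathbb{C}((t))$, $\mathcal{O}^-=\mathbb{C}[t^{-1}]$, with $\sigma(t)=-t$, $\sigma|_{\mathbb C}=\mathrm{Id}$; $\sigma$ acts on $\widetilde G(\mathcal{K})$ etc. through both $\widetilde G$ and $t$. $\mathcal{G}r=\widetilde G(\mathcal{K})^\sigma/\widetilde G(\mathcal{O})^\sigma$ with base point $e_0$. $X_*(T)_\sigma=X_*(T)/(\mathrm{Id}-\sigma)X_*(T)$ is identified with $\mathbb{Z}^\ell$ so that the image of $\check\alpha_i$ is $e_i-e_{i+1}$ for $i<\ell$ and the images of $\check\alpha_\ell,\check\alpha_{\ell+1}$ are $e_\ell$. For $\lambda\in X_*(T)$ with class $\bar\lambda=(a_1\ge\dots\ge a_\ell\ge0)$, $n^\lambda=t^\lambda\sigma(t^\lambda)$ and $\mathcal{G}r_{\bar\lambda}=\widetilde G(\mathcal{O})^\sigma n^\lambda\cdot e_0$. $\mathcal{G}r_0^-=\widetilde G(\mathcal{O}^-)^\sigma\cdot e_0\simeq\widetilde G(\mathcal{O}^-)_0^\sigma$ (subscript $0$: kernel of evaluation at $t=\infty$), $\mathcal{M}_{\bar\lambda}=\mathcal{G}r_{\bar\lambda}\cap\mathcal{G}r_0^-$,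 and $\mathcal{M}$ is the union of $\mathcal{M}_{\bar\lambda}$ over the small dominant weights, which are $\bar\lambda=(1^j0^{\ell-j})$, $0\le j\le\ell$ (those dominant weights not $\succeq2\gamma_0$ in the dominance order of type $B_\ell$, $\gamma_0=(1,0,\dots,0)$). Passing to $\mathrm{SO}_{2\ell+2}$, $\mathcal{G}r_0^-$ is identified with $\mathrm{SO}_{2\ell+2}(\mathcal{O}^-)_0^\sigma$, where $\mathrm{SO}_{2\ell+2}=\{g:g^Tg=I,\det g=1\}$, $\mathfrak{so}_{2\ell+2}$ is the space of skew-symmetric matrices, and $\sigma$ acts on both by conjugation by $w_0=\mathrm{diag}(-1,1,\dots,1)$. $\mathfrak p$ is the $(-1)$-eigenspace of $\sigma$ on $\mathfrak{so}_{2\ell+2}$, i.e. the matrices $\begin{pmatrix}0 & -u^T \\ u & 0\end{pmatrix}$ with $u\in\mathbb{C}^{2\ell+1}$, and $\mathcal{N}_{\mathfrak p}$ its set of nilpotent elements. $\pi$ sends $(1+xt^{-1}+yt^{-2}+\cdots)\cdot e_0$ to $x$. $\mathfrak{so}_{2\ell+1}$ is the space of skew-symmetric $(2\ell+1)\times(2\ell+1)$ matrices; its maximal order 2 nilpotent variety is the closure of the nilpotent orbit with Jordan type $[2^k1^{2\ell+1-2k}]$, $k$ the largest even integer $\le\ell$, which equals $\{D\in\mathfrak{so}_{2\ell+1}:D^2=0\}$. *)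

theory Defs
  imports
    "HOL-Computational_Algebra.Formal_Laurent_Series"
    "HOL-Library.Extended_Nat"
    "HOL-Algebra.Coset"
    "Jordan_Normal_Form.Jordan_Normal_Form"
begin

section \<open>Affine varieties\<close>

text \<open>
  Varieties are reduced and are given by their complex points. A variety is a set \<open>X\<close> together with
  a coordinate map \<open>c\<close> embedding it into an affine space \<open>'i \<Rightarrow> complex\<close>. The index type may be
  infinite (coefficients of matrices over \<open>\<complex>[t\<inverse>]\<close>), but every polynomial function involves only
  finitely many coordinates, and an affine variety is required to live in finitely many coordinates.
\<close>

inductive_set polyfun :: "(('i \<Rightarrow> complex) \<Rightarrow> complex) set" where
  const: "(\<lambda>v. a) \<in> polyfun"
| coord: "(\<lambda>v. v i) \<in> polyfun"
| add: "f \<in> polyfun \<Longrightarrow> g \<in> polyfun \<Longrightarrow> (\<lambda>v. f v + g v) \<in> polyfun"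
| mult: "f \<in> polyfun \<Longrightarrow> g \<in> polyfun \<Longrightarrow> (\<lambda>v. f v * g v) \<in> polyfun"

definition zclosed :: "('i \<Rightarrow> complex) set \<Rightarrow> bool" where
  "zclosed S \<longleftrightarrow> (\<exists>F \<subseteq> polyfun. S = {v. \<forall>f\<in>F. f v = 0})"

definition zclosure :: "('i \<Rightarrow> complex) set \<Rightarrow> ('i \<Rightarrow> complex) set" where
  "zclosure S = \<Inter> {Z. zclosed Z \<and> S \<subseteq> Z}"

definition zirreducible :: "('i \<Rightarrow> complex) set \<Rightarrow> bool" where
  "zirreducible Z \<longleftrightarrow>
     Z \<noteq> {} \<and> (\<forall>A B. zclosed A \<and> zclosed B \<and> Z \<subseteq> A \<union> B \<longrightarrow> Z \<subseteq> A \<or> Z \<subseteq> B)"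

text \<open>Krull dimension of a closed set: the supremum of the lengths \<open>d\<close> of strictly increasing chains
  \<open>Z 0 \<subset> \<dots> \<subset> Z d\<close> of irreducible closed subsets.\<close>

definition krull_dim :: "('i \<Rightarrow> complex) set \<Rightarrow> enat" where
  "krull_dim S = (SUP d \<in> {d. \<exists>Z :: nat \<Rightarrow> ('i \<Rightarrow> complex) set.
        (\<forall>i\<le>d. zclosed (Z i) \<and> zirreducible (Z i) \<and> Z i \<subseteq> S) \<and> (\<forall>i<d. Z i \<subset> Z (Suc i))}. enat d)"

definition affine_variety :: "('p \<Rightarrow> 'i \<Rightarrow> complex) \<Rightarrow> 'p set \<Rightarrow> bool" where
  "affine_variety c X \<longleftrightarrow>
     inj_on c X \<and> zclosed (c ` X) \<and> (\<exists>J. finite J \<and> (\<forall>x\<in>X. \<forall>i. i \<notin> J \<longrightarrow> c x i = 0))"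

definition regular_map ::
  "('p \<Rightarrow> 'i \<Rightarrow> complex) \<Rightarrow> 'p set \<Rightarrow> ('q \<Rightarrow> 'j \<Rightarrow> complex) \<Rightarrow> 'q set \<Rightarrow> ('p \<Rightarrow> 'q) \<Rightarrow> bool" where
  "regular_map c X d Y \<phi> \<longleftrightarrow>
     (\<forall>x\<in>X. \<phi> x \<in> Y) \<and> (\<forall>j. \<exists>f\<in>polyfun. \<forall>x\<in>X. d (\<phi> x) j = f (c x))"

definition variety_iso ::
  "('p \<Rightarrow> 'i \<Rightarrow> complex) \<Rightarrow> 'p set \<Rightarrow> ('q \<Rightarrow> 'j \<Rightarrow> complex) \<Rightarrow> 'q set \<Rightarrow> bool" where
  "variety_iso c X d Y \<longleftrightarrow>
     affine_variety c X \<and> affine_variety d Y \<and>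
     (\<exists>\<phi> \<psi>. regular_map c X d Y \<phi> \<and> regular_map d Y c X \<psi> \<and>
        (\<forall>x\<in>X. \<psi> (\<phi> x) = x) \<and> (\<forall>y\<in>Y. \<phi> (\<psi> y) = y))"

section \<open>Clifford algebra and spin group\<close>

text \<open>
  The Clifford algebra over \<open>R\<close> of the quadratic form \<open>v\<^sub>0\<^sup>2 + \<dots> + v\<^sub>n\<^sub>-\<^sub>1\<^sup>2\<close>, with relations
  \<open>e\<^sub>i\<^sup>2 = 1\<close> and \<open>e\<^sub>i e\<^sub>j = - e\<^sub>j e\<^sub>i\<close>. An element is its coefficient function with respect to the basis
  \<open>e\<^sub>S\<close>, the product in increasing order of the \<open>e\<^sub>i\<close> with \<open>i \<in> S\<close>, for \<open>S \<subseteq> {..<n}\<close>.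
\<close>

type_synonym 'a cliff = "nat set \<Rightarrow> 'a"

definition cl_carrier :: "nat \<Rightarrow> 'a::comm_ring_1 cliff set" where
  "cl_carrier n = {a. \<forall>S. \<not> S \<subseteq> {..<n} \<longrightarrow> a S = 0}"

definition cl_basis :: "nat set \<Rightarrow> 'a::comm_ring_1 cliff" where
  "cl_basis S = (\<lambda>T. if T = S then 1 else 0)"

abbreviation cl_one :: "'a::comm_ring_1 cliff" where
  "cl_one \<equiv> cl_basis {}"

text \<open>\<open>e\<^sub>A e\<^sub>B = cl_sign A B e\<^sub>C\<close>, where \<open>C\<close> is the symmetric difference of \<open>A\<close> and \<open>B\<close>.\<close>

definition cl_sign :: "nat set \<Rightarrow> nat set \<Rightarrow> 'a::comm_ring_1" where
  "cl_sign A B = (-1) ^ card {(i, j). i \<in> A \<and> j \<in> B \<and> j < i}"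

definition cl_mult :: "nat \<Rightarrow> 'a::comm_ring_1 cliff \<Rightarrow> 'a cliff \<Rightarrow> 'a cliff" where
  "cl_mult n a b = (\<lambda>S. \<Sum>(A, B) \<in> {(A, B). A \<subseteq> {..<n} \<and> B \<subseteq> {..<n} \<and> sym_diff A B = S}.
      cl_sign A B * a A * b B)"

text \<open>The anti-automorphism that is the identity on vectors; it reverses products of vectors.\<close>

definition cl_rev :: "'a::comm_ring_1 cliff \<Rightarrow> 'a cliff" where
  "cl_rev a = (\<lambda>S. (-1) ^ (card S choose 2) * a S)"

definition cl_vectors :: "nat \<Rightarrow> 'a::comm_ring_1 cliff set" where
  "cl_vectors n = {a \<in> cl_carrier n. \<forall>S. card S \<noteq> 1 \<longrightarrow> a S = 0}"

text \<open>\<open>Spin\<^sub>n(R)\<close> for a commutative ring \<open>R\<close> containing \<open>1/2\<close>: even elements \<open>s\<close> of spinor norm 1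
  whose conjugation preserves the vectors (note that \<open>cl_rev s\<close> is the inverse of \<open>s\<close>).\<close>

definition spin :: "nat \<Rightarrow> 'a::comm_ring_1 cliff set" where
  "spin n = {s \<in> cl_carrier n.
      (\<forall>S. odd (card S) \<longrightarrow> s S = 0) \<and>
      cl_mult n s (cl_rev s) = cl_one \<and> cl_mult n (cl_rev s) s = cl_one \<and>
      (\<forall>v \<in> cl_vectors n. cl_mult n (cl_mult n s v) (cl_rev s) \<in> cl_vectors n)}"

text \<open>The covering \<open>Spin\<^sub>n \<rightarrow> SO\<^sub>n\<close>: the matrix of \<open>v \<mapsto> s v s\<inverse>\<close> in the basis \<open>e\<^sub>0, \<dots>, e\<^sub>n\<^sub>-\<^sub>1\<close>.\<close>

definition spin_cover :: "nat \<Rightarrow> 'a::comm_ring_1 cliff \<Rightarrow> 'a mat" where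
  "spin_cover n s = mat n n (\<lambda>(i, j). cl_mult n (cl_mult n s (cl_basis {j})) (cl_rev s) {i})"

section \<open>The twisted loop group of type \<open>(D, 2)\<close>\<close>

text \<open>\<open>\<K> = \<complex>((t))\<close> is the type \<open>complex fls\<close>; \<open>\<O> = \<complex>[[t]]\<close> and \<open>\<O>\<^sup>- = \<complex>[t\<inverse>]\<close> are subrings of it.\<close>

definition fls_O :: "complex fls set" where
  "fls_O = {f. \<forall>k<0. fls_nth f k = 0}"

definition fls_Ominus :: "complex fls set" where
  "fls_Ominus = {f. \<forall>k>0. fls_nth f k = 0}"

text \<open>The substitution \<open>t \<mapsto> -t\<close>.\<close>

definition fls_twist :: "complex fls \<Rightarrow> complex fls" where
  "fls_twist f = fls_compose_fps f (- fps_X)"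

text \<open>
  The action of \<open>\<sigma>\<close> on \<open>Spin(\<K>)\<close>: the automorphism of the Clifford algebra with \<open>e\<^sub>0 \<mapsto> -e\<^sub>0\<close> and
  \<open>e\<^sub>i \<mapsto> e\<^sub>i\<close> for \<open>i > 0\<close> (it lifts conjugation by \<open>w\<^sub>0 = diag(-1,1,\<dots>,1)\<close>), combined with \<open>t \<mapsto> -t\<close>.
\<close>

definition spin_sigma :: "complex fls cliff \<Rightarrow> complex fls cliff" where
  "spin_sigma s = (\<lambda>S. (if 0 \<in> S then -1 else 1) * fls_twist (s S))"

definition loop_group :: "nat \<Rightarrow> complex fls cliff monoid" where
  "loop_group l = \<lparr>carrier = {s \<in> spin (2*l+2). spin_sigma s = s},
                   mult = cl_mult (2*l+2), one = cl_one\<rparr>"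

definition loop_O :: "nat \<Rightarrow> complex fls cliff set" where
  "loop_O l = {s \<in> carrier (loop_group l). \<forall>S. s S \<in> fls_O}"

definition loop_Ominus :: "nat \<Rightarrow> complex fls cliff set" where
  "loop_Ominus l = {s \<in> carrier (loop_group l). \<forall>S. s S \<in> fls_Ominus}"

text \<open>The kernel of the evaluation at \<open>t = \<infinity>\<close>.\<close>

definition loop_Ominus0 :: "nat \<Rightarrow> complex fls cliff set" where
  "loop_Ominus0 l = {s \<in> loop_Ominus l. \<forall>S. fls_nth (s S) 0 = cl_one S}"

subsection \<open>Coroots and translation elements\<close>

text \<open>
  Put \<open>f\<^sub>k = (e\<^sub>2\<^sub>k + \<i> e\<^sub>2\<^sub>k\<^sub>+\<^sub>1)/2\<close> and \<open>f\<^sub>k* = (e\<^sub>2\<^sub>k - \<i> e\<^sub>2\<^sub>k\<^sub>+\<^sub>1)/2\<close> for \<open>0 \<le> k \<le> l\<close>, so that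
  \<open>f\<^sub>k f\<^sub>k* + f\<^sub>k* f\<^sub>k = 1\<close>. The element below is
  \<open>z f\<^sub>k f\<^sub>k* + f\<^sub>k* f\<^sub>k = (z+1)/2 - \<i> (z-1)/2 e\<^sub>2\<^sub>k e\<^sub>2\<^sub>k\<^sub>+\<^sub>1\<close>. It has spinor norm \<open>z\<close>, and conjugation by it
  scales \<open>f\<^sub>k\<close> by \<open>z\<close> and \<open>f\<^sub>k*\<close> by \<open>z\<inverse>\<close> and fixes the other \<open>f\<^sub>j\<close>, \<open>f\<^sub>j*\<close>.
\<close>

definition cl_torus :: "nat \<Rightarrow> complex fls \<Rightarrow> complex fls cliff" where
  "cl_torus k z = (\<lambda>S. if S = {} then (z + 1) / 2
                       else if S = {2*k, 2*k+1} then - fls_const \<i> * (z - 1) / 2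
                       else 0)"

text \<open>
  The simple coroots \<open>\<alpha>\<^sub>i\<close>, \<open>1 \<le> i \<le> l+1\<close>, of \<open>Spin\<^sub>2\<^sub>l\<^sub>+\<^sub>2\<close>, as maps from the multiplicative group.
  Let \<open>\<epsilon>\<^sub>i\<close> be the cocharacter of \<open>SO\<close> that acts on \<open>f\<^sub>i\<close> for \<open>i \<le> l\<close>, and let \<open>\<epsilon>\<^sub>l\<^sub>+\<^sub>1\<close> be the one
  acting on \<open>f\<^sub>0\<close>, i.e. on the plane containing \<open>e\<^sub>0\<close>. Then \<open>\<alpha>\<^sub>i = \<epsilon>\<^sub>i - \<epsilon>\<^sub>i\<^sub>+\<^sub>1\<close> for \<open>i \<le> l\<close> and
  \<open>\<alpha>\<^sub>l\<^sub>+\<^sub>1 = \<epsilon>\<^sub>l + \<epsilon>\<^sub>l\<^sub>+\<^sub>1\<close>. Since \<open>\<sigma>\<close> maps \<open>f\<^sub>0\<close> to \<open>-f\<^sub>0*\<close>, it swaps \<open>\<alpha>\<^sub>l\<close> and \<open>\<alpha>\<^sub>l\<^sub>+\<^sub>1\<close> and fixes the others.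
\<close>

definition coroot :: "nat \<Rightarrow> nat \<Rightarrow> complex fls \<Rightarrow> complex fls cliff" where
  "coroot l i z =
     (if i < l then cl_mult (2*l+2) (cl_torus i z) (cl_torus (i+1) (inverse z))
      else if i = l then cl_mult (2*l+2) (cl_torus l z) (cl_torus 0 (inverse z))
      else (\<lambda>S. inverse z * cl_mult (2*l+2) (cl_torus l z) (cl_torus 0 z) S))"

text \<open>As \<open>Spin\<close> is simply connected, \<open>X\<^sub>*(T)\<close> is freely generated by the simple coroots; the
  cocharacter \<open>\<Sum>i=1..l+1. m i \<alpha>\<^sub>i\<close> is represented by \<open>m\<close> (values outside \<open>{1..l+1}\<close> are irrelevant).\<close>

definition t_power :: "nat \<Rightarrow> (nat \<Rightarrow> int) \<Rightarrow> complex fls cliff" where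
  "t_power l m =
     foldr (\<lambda>i. cl_mult (2*l+2) (coroot l i (fls_X powi m i))) [1..<l+2] cl_one"

definition n_elt :: "nat \<Rightarrow> (nat \<Rightarrow> int) \<Rightarrow> complex fls cliff" where
  "n_elt l m = cl_mult (2*l+2) (t_power l m) (spin_sigma (t_power l m))"

text \<open>The identification of \<open>X\<^sub>*(T)\<^sub>\<sigma>\<close> with \<open>\<int>\<^sup>l\<close>: \<open>gam l i\<close> is the image of \<open>\<alpha>\<^sub>i\<close>, namely
  \<open>e\<^sub>i - e\<^sub>i\<^sub>+\<^sub>1\<close> for \<open>i < l\<close> and \<open>e\<^sub>l\<close> for \<open>i = l, l+1\<close>. Vectors are indexed by \<open>{1..l}\<close>.\<close>

definition gam :: "nat \<Rightarrow> nat \<Rightarrow> nat \<Rightarrow> int" where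
  "gam l i k = (if i < l then (if k = i then 1 else if k = i + 1 then -1 else 0)
                else (if k = l then 1 else 0))"

definition coinv_class :: "nat \<Rightarrow> (nat \<Rightarrow> int) \<Rightarrow> nat \<Rightarrow> int" where
  "coinv_class l m = (\<lambda>k. \<Sum>i=1..l+1. m i * gam l i k)"

definition dominant :: "nat \<Rightarrow> (nat \<Rightarrow> int) \<Rightarrow> bool" where
  "dominant l a \<longleftrightarrow> (\<forall>k. 1 \<le> k \<and> k < l \<longrightarrow> a (k+1) \<le> a k) \<and> 0 \<le> a l"

text \<open>The dominance order of type \<open>B\<^sub>l\<close>, with simple roots \<open>gam l 1, \<dots>, gam l l\<close>.\<close>

definition dominance_le :: "nat \<Rightarrow> (nat \<Rightarrow> int) \<Rightarrow> (nat \<Rightarrow> int) \<Rightarrow> bool" where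
  "dominance_le l b a \<longleftrightarrow>
     (\<exists>c :: nat \<Rightarrow> nat. \<forall>k\<in>{1..l}. a k - b k = (\<Sum>i=1..l. int (c i) * gam l i k))"

definition small_dominant :: "nat \<Rightarrow> (nat \<Rightarrow> int) \<Rightarrow> bool" where
  "small_dominant l a \<longleftrightarrow> dominant l a \<and> \<not> dominance_le l (\<lambda>k. if k = 1 then 2 else 0) a"

text \<open>The small dominant weights are the vectors \<open>(1\<^sup>j 0\<^sup>l\<^sup>-\<^sup>j)\<close>.\<close>

lemma sum_gam:
  fixes f :: "nat \<Rightarrow> int"
  assumes "k \<in> {1..l}"
  shows "(\<Sum>i=1..l. f i * gam l i k) = f k - (if k = 1 then 0 else f (k - 1))"
proof -
  have "(\<Sum>i=1..l. f i * gam l i k) =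
        (\<Sum>i=1..l. (if i = k then f i else 0) - (if i = k - 1 then f i else 0))"
    by (rule sum.cong) (use assms in \<open>auto simp: gam_def\<close>)
  also have "\<dots> = f k - (if k = 1 then 0 else f (k - 1))"
    using assms by (cases "k = 1") (auto simp: sum_subtractf)
  finally show ?thesis .
qed

lemma small_dominant_iff:
  assumes "1 \<le> l"
  shows "small_dominant l a \<longleftrightarrow> (\<exists>j\<le>l. \<forall>k\<in>{1..l}. a k = (if k \<le> j then 1 else 0))"
    (is "?L \<longleftrightarrow> ?R")
proof -
  let ?b = "\<lambda>k::nat. if k = 1 then 2 else (0::int)"
  have mono: "a k \<le> a i" if "dominant l a" "1 \<le> i" "i \<le> k" "k \<le> l" for i k
    using that(3,4)
  proof (induction k rule: dec_induct)
    case (step n)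
    then have "a (n + 1) \<le> a n" using that(1,2) by (auto simp: dominant_def)
    then show ?case using step by auto
  qed simp
  have nonneg: "0 \<le> a k" if "dominant l a" "k \<in> {1..l}" for k
    using mono[of k l] that by (auto simp: dominant_def)
  have ge: "dominance_le l ?b a" if dom: "dominant l a" and "2 \<le> a 1"
  proof -
    define c where "c j = nat ((\<Sum>k=1..j. a k) - 2)" for j
    have c: "int (c j) = (\<Sum>k=1..j. a k) - 2" if "j \<in> {1..l}" for j
    proof -
      have "a 1 \<le> (\<Sum>k=1..j. a k)"
        by (rule member_le_sum) (use that nonneg[OF dom] in auto)
      then show ?thesis using \<open>2 \<le> a 1\<close> by (simp add: c_def)
    qed
    have "a k - ?b k = (\<Sum>i=1..l. int (c i) * gam l i k)" if "k \<in> {1..l}" for k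
    proof (cases "k = 1")
      case True
      then show ?thesis using sum_gam[OF that, of "\<lambda>i. int (c i)"] c[OF that] by simp
    next
      case False
      define m where "m = k - 1"
      have m: "k = Suc m" "m \<in> {1..l}" using that False by (auto simp: m_def)
      show ?thesis
        using sum_gam[OF that, of "\<lambda>i. int (c i)"] c[OF that] c[OF m(2)] False m by simp
    qed
    then show ?thesis unfolding dominance_le_def by blast
  qed
  have le: "2 \<le> a 1" if "dominance_le l ?b a"
  proof -
    from that obtain c :: "nat \<Rightarrow> nat"
      where "\<forall>k\<in>{1..l}. a k - ?b k = (\<Sum>i=1..l. int (c i) * gam l i k)"
      unfolding dominance_le_def by blast
    then have "a 1 - ?b 1 = (\<Sum>i=1..l. int (c i) * gam l i 1)"
      using assms by (intro bspec[where x = 1]) auto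
    then have "a 1 - 2 = int (c 1)"
      using sum_gam[of 1 l "\<lambda>i. int (c i)"] assms by simp
    then show ?thesis by simp
  qed
  show ?thesis
  proof
    assume L: ?L
    then have dom: "dominant l a" and a1: "a 1 \<le> 1"
      using ge unfolding small_dominant_def by (blast, force)
    let ?S = "{k \<in> {1..l}. a k = 1}"
    define j where "j = (if ?S = {} then 0 else Max ?S)"
    have "a k = (if k \<le> j then 1 else 0)" if "k \<in> {1..l}" for k
    proof -
      have bounds: "0 \<le> a k" "a k \<le> 1"
        using nonneg[OF dom that] mono[OF dom, of 1 k] a1 that by auto
      show ?thesis
      proof (cases "k \<le> j")
        case True
        then have "?S \<noteq> {}" using that by (auto simp: j_def split: if_splits)
        then have "j \<in> ?S" using Max_in[of ?S] by (auto simp: j_def)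
        then show ?thesis using mono[OF dom, of k j] that True bounds by auto
      next
        case False
        have "k \<notin> ?S"
        proof
          assume k: "k \<in> ?S"
          then have "k \<le> Max ?S" by (intro Max_ge) auto
          moreover have "j = Max ?S" using k unfolding j_def by (metis empty_iff)
          ultimately show False using False by linarith
        qed
        then show ?thesis using that bounds False by auto
      qed
    qed
    moreover have "j \<le> l" using Max_in[of ?S] by (auto simp: j_def)
    ultimately show ?R by blast
  next
    assume ?R
    then obtain j where "j \<le> l" and j: "\<And>k. k \<in> {1..l} \<Longrightarrow> a k = (if k \<le> j then 1 else 0)"
      by blast
    have "dominant l a" using assms by (auto simp: dominant_def j)
    moreover have "a 1 \<le> 1" using assms by (simp add: j)
    ultimately show ?L using le unfolding small_dominant_def by force
  qed
qed

subsection \<open>The twisted affine Grassmannian\<close>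

text \<open>Points of the Grassmannian are left cosets of \<open>loop_O l\<close>; the base point is \<open>loop_O l\<close> itself,
  and \<open>g <# p\<close> is the translate of the point \<open>p\<close> by \<open>g\<close>.\<close>

definition base_point :: "nat \<Rightarrow> complex fls cliff set" where
  "base_point l = loop_O l"

definition Gr_orbit :: "nat \<Rightarrow> (nat \<Rightarrow> int) \<Rightarrow> complex fls cliff set set" where
  "Gr_orbit l m =
     {h <#\<^bsub>loop_group l\<^esub> (n_elt l m <#\<^bsub>loop_group l\<^esub> base_point l) | h. h \<in> loop_O l}"

definition Gr_minus :: "nat \<Rightarrow> complex fls cliff set set" where
  "Gr_minus l = {g <#\<^bsub>loop_group l\<^esub> base_point l | g. g \<in> loop_Ominus l}"

definition small_M :: "nat \<Rightarrow> complex fls cliff set set" where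
  "small_M l = (\<Union>m \<in> {m. small_dominant l (coinv_class l m)}. Gr_orbit l m \<inter> Gr_minus l)"

section \<open>Passage to the special orthogonal group\<close>

definition skew_mats :: "nat \<Rightarrow> complex mat set" where
  "skew_mats n = {A \<in> carrier_mat n n. transpose_mat A = - A}"

definition w0 :: "nat \<Rightarrow> 'a::comm_ring_1 mat" where
  "w0 n = mat n n (\<lambda>(i, j). if i \<noteq> j then 0 else if i = 0 then -1 else 1)"

text \<open>\<open>SO\<^sub>2\<^sub>l\<^sub>+\<^sub>2(\<O>\<^sup>-)\<^sub>0\<^sup>\<sigma>\<close>, where \<open>0\<close> stands for the kernel of the evaluation at \<open>t = \<infinity>\<close>.\<close>

definition SO_Ominus0 :: "nat \<Rightarrow> complex fls mat set" where
  "SO_Ominus0 l = {g \<in> carrier_mat (2*l+2) (2*l+2).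
      transpose_mat g * g = 1\<^sub>m (2*l+2) \<and> det g = 1 \<and>
      elements_mat g \<subseteq> fls_Ominus \<and>
      map_mat (\<lambda>f. fls_nth f 0) g = 1\<^sub>m (2*l+2) \<and>
      w0 (2*l+2) * map_mat fls_twist g * w0 (2*l+2) = g}"

text \<open>\<open>small_M\<close>, transported along the identifications
  \<open>SO(\<O>\<^sup>-)\<^sub>0\<^sup>\<sigma> \<leftarrow> Spin(\<O>\<^sup>-)\<^sub>0\<^sup>\<sigma> \<rightarrow> Gr_minus\<close> given by the covering and by \<open>s \<mapsto> s \<cdot> base_point\<close>.\<close>

definition small_M_SO :: "nat \<Rightarrow> complex fls mat set" where
  "small_M_SO l = {g \<in> SO_Ominus0 l. \<exists>s \<in> loop_Ominus0 l.
      spin_cover (2*l+2) s = g \<and> s <#\<^bsub>loop_group l\<^esub> base_point l \<in> small_M l}"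

text \<open>The coefficient of \<open>t\<inverse>\<close>.\<close>

definition proj_pi :: "complex fls mat \<Rightarrow> complex mat" where
  "proj_pi g = map_mat (\<lambda>f. fls_nth f (-1)) g"

definition pi_fiber :: "nat \<Rightarrow> complex mat \<Rightarrow> complex fls mat set" where
  "pi_fiber l x = {g \<in> small_M_SO l. proj_pi g = x}"

definition p_space :: "nat \<Rightarrow> complex mat set" where
  "p_space l = {x \<in> skew_mats (2*l+2). w0 (2*l+2) * x * w0 (2*l+2) = - x}"

definition nilcone_p :: "nat \<Rightarrow> complex mat set" where
  "nilcone_p l = {x \<in> p_space l. \<exists>k. x ^\<^sub>m k = 0\<^sub>m (2*l+2) (2*l+2)}"

definition p_block :: "complex vec \<Rightarrow> complex mat" where
  "p_block u = four_block_mat (0\<^sub>m 1 1) (- mat_of_rows (dim_vec u) [u])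
                              (mat_of_cols (dim_vec u) [u]) (0\<^sub>m (dim_vec u) (dim_vec u))"

definition mat_coords :: "complex mat \<Rightarrow> nat \<times> nat \<Rightarrow> complex" where
  "mat_coords A = (\<lambda>(i, j). if i < dim_row A \<and> j < dim_col A then A $$ (i, j) else 0)"

text \<open>The closure, in the space of all matrices, of the nilpotent orbit in \<open>\<ss>\<oo>\<^sub>2\<^sub>l\<^sub>+\<^sub>1\<close> of Jordan type
  \<open>[2\<^sup>k 1\<^sup>2\<^sup>l\<^sup>+\<^sup>1\<^sup>-\<^sup>2\<^sup>k]\<close>. The skew-symmetric matrices of a given Jordan type form a single orbit
  because the size \<open>2l+1\<close> is odd.\<close>

definition order2_orbit :: "nat \<Rightarrow> nat \<Rightarrow> complex mat set" where
  "order2_orbit l k = {A \<in> skew_mats (2*l+1).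
      jordan_nf A (replicate k (2, 0) @ replicate (2*l+1 - 2*k) (1, 0))}"

definition max_order2_variety :: "nat \<Rightarrow> complex mat set" where
  "max_order2_variety l = {A \<in> carrier_mat (2*l+1) (2*l+1).
      mat_coords A \<in> zclosure (mat_coords ` order2_orbit l (Max {k. even k \<and> k \<le> l}))}"

text \<open>Coordinates on \<open>SO(\<O>\<^sup>-)\<close>: index \<open>(k, i, j)\<close> is the coefficient of \<open>t\<^sup>-\<^sup>k\<close> in the \<open>(i, j)\<close> entry.\<close>

definition loop_coords :: "complex fls mat \<Rightarrow> nat \<times> nat \<times> nat \<Rightarrow> complex" where
  "loop_coords g = (\<lambda>(k, i, j).
     if i < dim_row g \<and> j < dim_col g then fls_nth (g $$ (i, j)) (- int k) else 0)"

end

theory Submission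
  imports Defs
begin

text \<open>
  An element of the small part of the Grassmannian has a pole of order at most two, so that its
  image in \<open>SO\<close> is \<open>1 + x t\<inverse> + y t\<^sup>-\<^sup>2\<close>. Orthogonality and invariance under \<open>\<sigma>\<close> determine all of \<open>y\<close>
  except its block \<open>D - u u\<^sup>T/2\<close>, and say that \<open>D\<close> is skew with \<open>D u = 0\<close> and \<open>D\<^sup>2 = 0\<close>. Conversely,
  by Witt's theorem such a \<open>D\<close> is a sum of planes \<open>2 w\<^sub>2\<^sub>a \<and> w\<^sub>2\<^sub>a\<^sub>+\<^sub>1\<close> spanned by a totally isotropic
  frame which is a rotation of the standard one and contains the direction of \<open>u\<close>; a product of explicit
  elements of the spin group over \<open>\<O>\<^sup>-\<close> lifts the quadratic loop, and factoring each of its terms in \<open>SL\<^sub>2\<close>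
  exhibits the double coset of a small weight.

  For \<open>u = 0\<close>, giving the missing planes a small weight shows that matrices of maximal rank \<open>K\<close>
  are dense. Near the standard one these are parametrised by an alternating form on a totally isotropic
  \<open>K\<close>-plane, and such planes have an affine chart, which gives the dimension \<open>K (2l - K)\<close>.
\<close>

subsection \<open>Polynomial functions and Krull dimension\<close>

text \<open>Up to sign, the translation element of the weight (1^j 0^(l-j)) is
  \<open>std_n j\<close>. Its action on vectors has poles of order at most 2, and integral factors
  on either side preserve this bound. For the converse a loop must be written as A
  \<open>std_n j\<close> B with A and B integral, inside the twisted spin group and not only in SO.
  Frame vectors f, f' of one plane with dual vectors g, g' give P = f f' and Q = g' g, which
  generate a copy of the 2 by 2 matrices; there 1 + t^-2 P is an upper unipotent, and the
  factorisation passes through a Weyl element to the opposite unipotent. Factors for different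
  planes lie in even subalgebras on disjoint coordinates and commute, so the pieces combine. The
  vector u enters through a factor 1 + c t^-1 e_0 u. If u lies in the image of D, this factor is
  produced by an integral conjugation and j = 2r; otherwise u spans one more isotropic direction and
  j = 2r + 1. The dimension is squeezed between two bounds: from below, chains of coordinate
  subspaces of a chart whose coordinates are read off polynomially; from above, a count of monomials
  of bounded degree.\<close>

lemma polyfun_minus: "f \<in> polyfun \<Longrightarrow> (\<lambda>v. - f v) \<in> polyfun"
  using polyfun.mult[OF polyfun.const[of "-1"]] by fastforce

lemma polyfun_diff: "f \<in> polyfun \<Longrightarrow> g \<in> polyfun \<Longrightarrow> (\<lambda>v. f v - g v) \<in> polyfun"
  using polyfun.add[OF _ polyfun_minus] by fastforce

lemma polyfun_sum: "(\<And>x. x \<in> A \<Longrightarrow> f x \<in> polyfun) \<Longrightarrow> (\<lambda>v. \<Sum>x\<in>A. f x v) \<in> polyfun"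
  by (induction A rule: infinite_finite_induct) (auto intro: polyfun.intros)

lemma polyfun_power: "f \<in> polyfun \<Longrightarrow> (\<lambda>v. f v ^ k) \<in> polyfun"
  by (induction k) (auto intro: polyfun.intros)

lemma polyfun_if: "(b \<Longrightarrow> f \<in> polyfun) \<Longrightarrow> (\<not> b \<Longrightarrow> g \<in> polyfun) \<Longrightarrow> (\<lambda>v. if b then f v else g v) \<in> polyfun"
  by (cases b) auto

lemma polyfun_compose:
  assumes "f \<in> polyfun" "\<And>i. (\<lambda>v. \<phi> v i) \<in> polyfun"
  shows "(\<lambda>v. f (\<phi> v)) \<in> polyfun"
  using assms(1) by induction (auto intro: polyfun.intros assms(2))

lemmas polyfun_intros = polyfun.const polyfun.coord polyfun.add polyfun.mult polyfun_minus
  polyfun_diff polyfun_sum polyfun_power polyfun_if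

lemma polyfun_curve:
  assumes "f \<in> polyfun"
  shows "\<exists>q. \<forall>t. f (\<lambda>i. poly (c i) t) = poly q t"
  using assms
proof induction
  case (const a)
  show ?case by (rule exI[of _ "[:a:]"]) simp
next
  case (add f g)
  then obtain q r where "\<forall>t. f (\<lambda>i. poly (c i) t) = poly q t" "\<forall>t. g (\<lambda>i. poly (c i) t) = poly r t"
    by blast
  then show ?case by (intro exI[of _ "q + r"]) simp
next
  case (mult f g)
  then obtain q r where "\<forall>t. f (\<lambda>i. poly (c i) t) = poly q t" "\<forall>t. g (\<lambda>i. poly (c i) t) = poly r t"
    by blast
  then show ?case by (intro exI[of _ "q * r"]) simp
qed auto

text \<open>This is the way limits are taken: a polynomial vanishing at all but finitely many points
  of a polynomial curve vanishes along the whole curve. It serves both for degenerating the rank and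
  for moving a frame into the chart.\<close>

lemma polyfun_eq_0_by_curve:
  assumes "f \<in> polyfun" "finite B" "\<And>t. t \<notin> B \<Longrightarrow> f (\<lambda>i. poly (c i) t) = 0"
  shows "f (\<lambda>i. poly (c i) t0) = 0"
proof -
  obtain q where q: "\<And>t. f (\<lambda>i. poly (c i) t) = poly q t"
    using polyfun_curve[OF assms(1)] by blast
  have "q = 0"
  proof (rule ccontr)
    assume "q \<noteq> 0"
    then have "finite {t. poly q t = 0}" by (rule poly_roots_finite)
    moreover have "UNIV \<subseteq> B \<union> {t. poly q t = 0}" using assms(3) by (auto simp: q)
    ultimately show False using assms(2) infinite_UNIV_char_0
      by (metis finite_UnI finite_subset)
  qed
  then show ?thesis by (simp add: q)
qed

text \<open>Two polynomial functions that do not vanish identically have a common non-zero on the line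
  through points at which they do not vanish.\<close>

lemma polyfun_line:
  assumes "f \<in> polyfun" "g \<in> polyfun" "f a \<noteq> 0" "g b \<noteq> 0"
  shows "\<exists>t. f (\<lambda>i. a i + t * (b i - a i)) \<noteq> 0 \<and> g (\<lambda>i. a i + t * (b i - a i)) \<noteq> 0"
proof (rule ccontr)
  define c where "c = (\<lambda>i. [:a i, b i - a i:])"
  have c: "(\<lambda>i. poly (c i) t) = (\<lambda>i. a i + t * (b i - a i))" for t
    by (simp add: c_def)
  assume neg: "\<not> ?thesis"
  obtain q where q: "\<And>t. f (\<lambda>i. poly (c i) t) = poly q t"
    using polyfun_curve[OF assms(1)] by blast
  obtain r where r: "\<And>t. g (\<lambda>i. poly (c i) t) = poly r t"
    using polyfun_curve[OF assms(2)] by blast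
  have "poly (q * r) t = 0" for t
  proof -
    have "poly q t = 0 \<or> poly r t = 0" using neg unfolding q[symmetric] r[symmetric] c by blast
    then show ?thesis by auto
  qed
  then have "q * r = 0" using poly_all_0_iff_0 by blast
  moreover have "poly q 0 \<noteq> 0" using q[of 0] assms(3) by (simp add: c)
  moreover have "poly r 1 \<noteq> 0" using r[of 1] assms(4) by (simp add: c)
  ultimately show False by auto
qed

lemma zclosed_polyfun: "f \<in> polyfun \<Longrightarrow> zclosed {v. f v = 0}"
  unfolding zclosed_def by (rule exI[of _ "{f}"]) auto

lemma zclosedI: "F \<subseteq> polyfun \<Longrightarrow> zclosed {v. \<forall>f\<in>F. f v = 0}"
  unfolding zclosed_def by blast

lemma zclosed_separate:
  assumes "zclosed Z" "v \<notin> Z"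
  obtains f where "f \<in> polyfun" "\<And>z. z \<in> Z \<Longrightarrow> f z = 0" "f v \<noteq> 0"
proof -
  obtain F where F: "F \<subseteq> polyfun" "Z = {v. \<forall>f\<in>F. f v = 0}" using assms(1) by (auto simp: zclosed_def)
  then obtain f where "f \<in> F" "f v \<noteq> 0" using assms(2) by auto
  with F show thesis by (intro that[of f]) auto
qed

lemma mem_zclosure_iff: "v \<in> zclosure S \<longleftrightarrow> (\<forall>f\<in>polyfun. (\<forall>s\<in>S. f s = 0) \<longrightarrow> f v = 0)"
proof
  assume "v \<in> zclosure S"
  then show "\<forall>f\<in>polyfun. (\<forall>s\<in>S. f s = 0) \<longrightarrow> f v = 0"
    using zclosed_polyfun unfolding zclosure_def by blast
next
  assume v: "\<forall>f\<in>polyfun. (\<forall>s\<in>S. f s = 0) \<longrightarrow> f v = 0"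
  show "v \<in> zclosure S" unfolding zclosure_def
  proof clarify
    fix Z assume "zclosed Z" "S \<subseteq> Z"
    then obtain F where "F \<subseteq> polyfun" "Z = {v. \<forall>f\<in>F. f v = 0}" unfolding zclosed_def by blast
    with \<open>S \<subseteq> Z\<close> v show "v \<in> Z" by blast
  qed
qed

lemma zclosed_zclosure: "zclosed (zclosure S)"
proof -
  have "zclosure S = {v. \<forall>f\<in>{f \<in> polyfun. \<forall>s\<in>S. f s = 0}. f v = 0}"
    by (auto simp: mem_zclosure_iff)
  then show ?thesis using zclosedI[of "{f \<in> polyfun. \<forall>s\<in>S. f s = 0}"] by auto
qed

lemma zclosure_superset: "S \<subseteq> zclosure S"
  by (auto simp: mem_zclosure_iff)

lemma zclosure_minimal: "zclosed Z \<Longrightarrow> S \<subseteq> Z \<Longrightarrow> zclosure S \<subseteq> Z"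
  unfolding zclosure_def by blast

text \<open>The image of an affine space is irreducible. If neither closed set contained it, each
  would be avoided by a polynomial that is non-zero somewhere on the image, and pulled back to the
  affine space these two have a common non-zero.\<close>

lemma zirreducible_zclosure_image:
  assumes \<phi>: "\<And>i. (\<lambda>p. \<phi> p i) \<in> polyfun"
  shows "zirreducible (zclosure (\<phi> ` {p. \<forall>j. j \<notin> J \<longrightarrow> p j = 0}))" (is "zirreducible (zclosure (\<phi> ` ?P))")
  unfolding zirreducible_def
proof (intro conjI allI impI)
  have "\<phi> (\<lambda>_. 0) \<in> \<phi> ` ?P" by (rule imageI) simp
  then have "\<phi> (\<lambda>_. 0) \<in> zclosure (\<phi> ` ?P)" by (rule subsetD[OF zclosure_superset])
  then show "zclosure (\<phi> ` ?P) \<noteq> {}" by (metis empty_iff)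
next
  fix A B
  assume AB: "zclosed A \<and> zclosed B \<and> zclosure (\<phi> ` ?P) \<subseteq> A \<union> B"
  show "zclosure (\<phi> ` ?P) \<subseteq> A \<or> zclosure (\<phi> ` ?P) \<subseteq> B"
  proof (rule ccontr)
  assume neg: "\<not> ?thesis"
  have A: "zclosed A" and B: "zclosed B" and sub: "zclosure (\<phi> ` ?P) \<subseteq> A \<union> B" using AB by auto
  have ex: "\<exists>f p. f \<in> polyfun \<and> (\<forall>x\<in>C. f x = 0) \<and> p \<in> ?P \<and> f (\<phi> p) \<noteq> 0"
    if C: "zclosed C" and nsub: "\<not> zclosure (\<phi> ` ?P) \<subseteq> C" for C
  proof -
    have "\<not> \<phi> ` ?P \<subseteq> C" using nsub zclosure_minimal[OF C] by blast
    then obtain p where p: "p \<in> ?P" "\<phi> p \<notin> C" by (auto simp: image_subset_iff)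
    from zclosed_separate[OF C p(2)] obtain f
      where "f \<in> polyfun" "\<And>z. z \<in> C \<Longrightarrow> f z = 0" "f (\<phi> p) \<noteq> 0" by metis
    with p(1) show ?thesis by (intro exI[of _ f] exI[of _ p]) simp
  qed
  have "\<not> zclosure (\<phi> ` ?P) \<subseteq> A" "\<not> zclosure (\<phi> ` ?P) \<subseteq> B" using neg by auto
  from ex[OF A this(1)] ex[OF B this(2)] obtain f g p q
    where f: "f \<in> polyfun" "\<forall>x\<in>A. f x = 0" "p \<in> ?P" "f (\<phi> p) \<noteq> 0"
    and g: "g \<in> polyfun" "\<forall>x\<in>B. g x = 0" "q \<in> ?P" "g (\<phi> q) \<noteq> 0"
    by (elim exE conjE)
  have pf: "(\<lambda>p. f (\<phi> p)) \<in> polyfun" by (rule polyfun_compose[OF f(1)]) (rule \<phi>)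
  have pg: "(\<lambda>p. g (\<phi> p)) \<in> polyfun" by (rule polyfun_compose[OF g(1)]) (rule \<phi>)
  \<comment> \<open>The line through \<open>p\<close> and \<open>q\<close> stays in the coordinate
    subspace, so a common non-zero on it maps into \<open>A \<union> B\<close>.\<close>
  define r where "r t = (\<lambda>i. p i + t * (q i - p i))" for t
  have "\<exists>t. f (\<phi> (r t)) \<noteq> 0 \<and> g (\<phi> (r t)) \<noteq> 0"
    unfolding r_def using polyfun_line[OF pf pg, of p q] f(4) g(4) by simp
  then obtain t where t: "f (\<phi> (r t)) \<noteq> 0" "g (\<phi> (r t)) \<noteq> 0" by auto
  have "r t \<in> ?P" using f(3) g(3) by (simp add: r_def)
  then have "\<phi> (r t) \<in> A \<union> B" using sub zclosure_superset[of "\<phi> ` ?P"] imageI[of "r t" ?P \<phi>] by (meson subsetD)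
  then show False using t f(2) g(2) by auto
  qed
qed

text \<open>This form of irreducibility permits cancelling a function that does not vanish
  identically.\<close>

lemma zirreducible_domain:
  assumes "zirreducible Z" "f \<in> polyfun" "g \<in> polyfun" "\<forall>v\<in>Z. f v * g v = 0"
  shows "(\<forall>v\<in>Z. f v = 0) \<or> (\<forall>v\<in>Z. g v = 0)"
  using assms(1,4) zclosed_polyfun[OF assms(2)] zclosed_polyfun[OF assms(3)]
  unfolding zirreducible_def by (auto simp: subset_iff)

text \<open>The chain is formed by the closures of the images of the coordinate subspaces belonging
  to initial segments of \<open>js\<close>. The function \<open>h\<close> reads off the coordinate
  added last, which makes each inclusion strict. It has to do so only while all later coordinates
  vanish, so the order of \<open>js\<close> can be chosen to simplify the formulas for
  \<open>h\<close>.\<close>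

lemma krull_dim_ge:
  fixes \<phi> :: "('j \<Rightarrow> complex) \<Rightarrow> 'i \<Rightarrow> complex"
  assumes \<phi>: "\<And>i. (\<lambda>p. \<phi> p i) \<in> polyfun"
    and js: "distinct js"
    and h: "\<And>j. h j \<in> polyfun"
    and h\<phi>: "\<And>i p. i < length js \<Longrightarrow> (\<And>j. j \<notin> set (take (Suc i) js) \<Longrightarrow> p j = 0) \<Longrightarrow> h (js ! i) (\<phi> p) = p (js ! i)"
    and S: "zclosed S" "\<And>p. (\<And>j. j \<notin> set js \<Longrightarrow> p j = 0) \<Longrightarrow> \<phi> p \<in> S"
  shows "enat (length js) \<le> krull_dim S"
proof -
  define P where "P i = {p :: 'j \<Rightarrow> complex. \<forall>j. j \<notin> set (take i js) \<longrightarrow> p j = 0}" for i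
  define Z where "Z i = zclosure (\<phi> ` P i)" for i
  have sub: "P i \<subseteq> P (Suc i)" for i
    using set_take_subset_set_take[of i "Suc i" js] by (auto simp: P_def)
  have "Z i \<subseteq> S" for i
    unfolding Z_def using S(2) by (intro zclosure_minimal S(1)) (auto simp: P_def dest: in_set_takeD)
  moreover have "Z i \<subset> Z (Suc i)" if i: "i < length js" for i
  proof
    show "Z i \<subseteq> Z (Suc i)" unfolding Z_def using sub[of i]
      by (intro zclosure_minimal zclosed_zclosure) (blast intro: subsetD[OF zclosure_superset])
    \<comment> \<open>At this unit vector \<open>h\<close> takes the value 1, whereas it vanishes on
      the image of the smaller subspace and hence on its closure.\<close>
    define p where "p = (\<lambda>j. if j = js ! i then 1 else (0::complex))"
    have p: "p \<in> P (Suc i)" using i by (auto simp: P_def p_def take_Suc_conv_app_nth)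
    have "js ! i \<notin> set (take i js)"
      using js i by (auto simp: in_set_conv_nth nth_eq_iff_index_eq)
    then have "h (js ! i) (\<phi> q) = 0" if "q \<in> P i" for q
      using h\<phi>[OF i, of q] that sub[of i] by (auto simp: P_def subset_iff)
    moreover have "h (js ! i) (\<phi> p) = 1" using h\<phi>[OF i, of p] p by (auto simp: P_def p_def)
    ultimately have "\<phi> p \<notin> Z i" unfolding Z_def mem_zclosure_iff using h by force
    moreover have "\<phi> p \<in> Z (Suc i)" unfolding Z_def using p zclosure_superset by blast
    ultimately show "Z i \<noteq> Z (Suc i)" by blast
  qed
  moreover have "zclosed (Z i)" "zirreducible (Z i)" for i
    unfolding Z_def P_def by (auto intro: zclosed_zclosure zirreducible_zclosure_image \<phi>)
  ultimately have "\<exists>Z :: nat \<Rightarrow> ('i \<Rightarrow> complex) set.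
        (\<forall>i\<le>length js. zclosed (Z i) \<and> zirreducible (Z i) \<and> Z i \<subseteq> S) \<and> (\<forall>i<length js. Z i \<subset> Z (Suc i))"
    by blast
  then show ?thesis unfolding krull_dim_def by (intro SUP_upper) simp
qed

section \<open>Upper bounds for the Krull dimension by counting monomials\<close>

text \<open>Gaussian elimination: if the equation \<open>\<tau>0\<close> has a non-zero coefficient,
  its unknown is used as a pivot, and one equation and one unknown disappear together.\<close>

lemma homogeneous_system_solution:
  fixes A :: "'a \<Rightarrow> 'b \<Rightarrow> complex"
  assumes "finite T" "finite I" "card T < card I"
  shows "\<exists>c. (\<exists>i\<in>I. c i \<noteq> 0) \<and> (\<forall>\<tau>\<in>T. (\<Sum>i\<in>I. c i * A i \<tau>) = 0)"
  using assms
proof (induction T arbitrary: I A rule: finite_induct)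
  case empty
  then obtain i where "i \<in> I" by (metis card.empty card_gt_0_iff ex_in_conv)
  then show ?case by (intro exI[of _ "\<lambda>_. 1"]) auto
next
  case (insert \<tau>0 T)
  show ?case
  proof (cases "\<forall>i\<in>I. A i \<tau>0 = 0")
    case True
    obtain c where "\<exists>i\<in>I. c i \<noteq> 0" "\<forall>\<tau>\<in>T. (\<Sum>i\<in>I. c i * A i \<tau>) = 0"
      using insert.IH[of I A] insert.prems insert.hyps by auto
    then show ?thesis using True by (intro exI[of _ c]) auto
  next
    case False
    then obtain i0 where i0: "i0 \<in> I" "A i0 \<tau>0 \<noteq> 0" by blast
    define A' where "A' i \<tau> = A i \<tau> - A i \<tau>0 / A i0 \<tau>0 * A i0 \<tau>" for i \<tau>
    have "card T < card (I - {i0})" using insert.prems insert.hyps i0 by auto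
    then obtain c where c: "\<exists>i\<in>I-{i0}. c i \<noteq> 0" "\<forall>\<tau>\<in>T. (\<Sum>i\<in>I-{i0}. c i * A' i \<tau>) = 0"
      using insert.IH[of "I - {i0}" A'] insert.prems by auto
    \<comment> \<open>The value of the pivot unknown is the one that solves the eliminated
      equation.\<close>
    define s where "s = - (\<Sum>i\<in>I-{i0}. c i * A i \<tau>0) / A i0 \<tau>0"
    have "(\<Sum>i\<in>I. (c(i0 := s)) i * A i \<tau>) = s * A i0 \<tau> + (\<Sum>i\<in>I-{i0}. c i * A i \<tau>)" for \<tau>
      using i0 insert.prems by (subst sum.remove[of _ i0]) auto
    also have "\<dots> \<tau> = (\<Sum>i\<in>I-{i0}. c i * A' i \<tau>)" for \<tau>
      by (simp add: s_def A'_def algebra_simps sum_subtractf sum_distrib_left sum_divide_distrib)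
    finally have eq: "(\<Sum>i\<in>I. (c(i0 := s)) i * A i \<tau>) = (\<Sum>i\<in>I-{i0}. c i * A' i \<tau>)" for \<tau> .
    have "A' i \<tau>0 = 0" for i using i0 by (simp add: A'_def)
    then have "\<forall>\<tau>\<in>insert \<tau>0 T. (\<Sum>i\<in>I. (c(i0 := s)) i * A i \<tau>) = 0"
      unfolding eq using c(2) by simp
    moreover have "\<exists>i\<in>I. (c(i0 := s)) i \<noteq> 0" using c(1) by auto
    ultimately show ?thesis by blast
  qed
qed

text \<open>Polynomial functions of degree at most \<open>e\<close> in each of the variables in \<open>J\<close>.\<close>

definition poly_box :: "'j set \<Rightarrow> nat \<Rightarrow> (('j \<Rightarrow> complex) \<Rightarrow> complex) \<Rightarrow> bool" where
  "poly_box J e f \<longleftrightarrow> (\<exists>c. \<forall>p. f p = (\<Sum>a\<in>Pi\<^sub>E J (\<lambda>_. {..e}). c a * (\<Prod>j\<in>J. p j ^ a j)))"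

lemma poly_box_0: "poly_box J e (\<lambda>_. 0)"
  unfolding poly_box_def by (intro exI[of _ "\<lambda>_. 0"]) simp

lemma poly_box_add: "poly_box J e f \<Longrightarrow> poly_box J e g \<Longrightarrow> poly_box J e (\<lambda>p. f p + g p)"
  unfolding poly_box_def
proof clarify
  fix c d
  assume "\<forall>p. f p = (\<Sum>a\<in>Pi\<^sub>E J (\<lambda>_. {..e}). c a * (\<Prod>j\<in>J. p j ^ a j))"
    "\<forall>p. g p = (\<Sum>a\<in>Pi\<^sub>E J (\<lambda>_. {..e}). d a * (\<Prod>j\<in>J. p j ^ a j))"
  then show "\<exists>c. \<forall>p. f p + g p = (\<Sum>a\<in>Pi\<^sub>E J (\<lambda>_. {..e}). c a * (\<Prod>j\<in>J. p j ^ a j))"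
    by (intro exI[of _ "\<lambda>a. c a + d a"]) (simp add: distrib_right sum.distrib)
qed

lemma poly_box_cmult: "poly_box J e f \<Longrightarrow> poly_box J e (\<lambda>p. b * f p)"
  unfolding poly_box_def
proof clarify
  fix c
  assume "\<forall>p. f p = (\<Sum>a\<in>Pi\<^sub>E J (\<lambda>_. {..e}). c a * (\<Prod>j\<in>J. p j ^ a j))"
  then show "\<exists>c. \<forall>p. b * f p = (\<Sum>a\<in>Pi\<^sub>E J (\<lambda>_. {..e}). c a * (\<Prod>j\<in>J. p j ^ a j))"
    by (intro exI[of _ "\<lambda>a. b * c a"]) (simp add: sum_distrib_left mult.assoc)
qed

lemma poly_box_sum: "(\<And>x. x \<in> A \<Longrightarrow> poly_box J e (f x)) \<Longrightarrow> poly_box J e (\<lambda>p. \<Sum>x\<in>A. f x p)"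
  by (induction A rule: infinite_finite_induct) (auto intro: poly_box_0 poly_box_add)

lemma poly_box_monomial:
  assumes "finite J" "\<And>j. j \<in> J \<Longrightarrow> a j \<le> e"
  shows "poly_box J e (\<lambda>p. \<Prod>j\<in>J. p j ^ a j)"
proof -
  have fin: "finite (Pi\<^sub>E J (\<lambda>_. {..e}))" using assms(1) by (simp add: finite_PiE)
  have mem: "restrict a J \<in> Pi\<^sub>E J (\<lambda>_. {..e})" using assms(2) by auto
  have "(\<Sum>b\<in>Pi\<^sub>E J (\<lambda>_. {..e}). (if b = restrict a J then 1 else 0) * (\<Prod>j\<in>J. p j ^ b j)) =
        (\<Prod>j\<in>J. p j ^ a j)" for p :: "'a \<Rightarrow> complex"
  proof -
    have "(\<Sum>b\<in>Pi\<^sub>E J (\<lambda>_. {..e}). (if b = restrict a J then 1 else 0) * (\<Prod>j\<in>J. p j ^ b j)) =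
          (\<Sum>b\<in>Pi\<^sub>E J (\<lambda>_. {..e}). if b = restrict a J then (\<Prod>j\<in>J. p j ^ b j) else 0)"
      by (rule sum.cong) auto
    then show ?thesis using fin mem by simp
  qed
  then show ?thesis unfolding poly_box_def by (intro exI[of _ "\<lambda>b. if b = restrict a J then 1 else 0"] allI) simp
qed

lemma poly_box_mult:
  assumes "finite J" "poly_box J e f" "poly_box J e' g"
  shows "poly_box J (e + e') (\<lambda>p. f p * g p)"
proof -
  let ?B = "\<lambda>e. Pi\<^sub>E J (\<lambda>_. {..e})"
  obtain c d where f: "\<And>p. f p = (\<Sum>a\<in>?B e. c a * (\<Prod>j\<in>J. p j ^ a j))"
    and g: "\<And>p. g p = (\<Sum>a\<in>?B e'. d a * (\<Prod>j\<in>J. p j ^ a j))"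
    using assms unfolding poly_box_def by blast
  have "(\<lambda>p. f p * g p) = (\<lambda>p. \<Sum>a\<in>?B e. \<Sum>b\<in>?B e'. (c a * d b) * (\<Prod>j\<in>J. p j ^ (a j + b j)))"
    unfolding f g sum_product by (simp add: power_add prod.distrib mult_ac)
  moreover have "poly_box J (e + e') \<dots>"
    by (intro poly_box_sum poly_box_cmult poly_box_monomial assms(1)) (auto intro!: add_mono simp: PiE_iff)
  ultimately show ?thesis by simp
qed

lemma poly_box_mono: "finite J \<Longrightarrow> poly_box J e f \<Longrightarrow> e \<le> e' \<Longrightarrow> poly_box J e' f"
  using poly_box_mult[of J e f "e' - e" "\<lambda>_. 1"] poly_box_monomial[of J "\<lambda>_. 0" "e' - e"] by simp

lemma poly_box_power: "finite J \<Longrightarrow> poly_box J e f \<Longrightarrow> poly_box J (k * e) (\<lambda>p. f p ^ k)"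
proof (induction k)
  case 0
  then show ?case using poly_box_monomial[of J "\<lambda>_. 0" 0] by simp
next
  case (Suc k)
  then show ?case using poly_box_mult[of J e f "k * e" "\<lambda>p. f p ^ k"] by simp
qed

text \<open>Putting the variables outside \<open>J\<close> to zero leaves finitely many variables,
  for which one degree bound exists although \<open>polyfun\<close> does not record any
  degree.\<close>

lemma polyfun_poly_box:
  assumes "finite J" "f \<in> polyfun"
  shows "\<exists>e. poly_box J e (\<lambda>p. f (\<lambda>j. if j \<in> J then p j else 0))"
  using assms(2)
proof induction
  case (const a)
  show ?case using poly_box_cmult[OF poly_box_monomial[of J "\<lambda>_. 0" 0], of a] assms(1) by auto
next
  case (coord i)
  show ?case
  proof (cases "i \<in> J")
    case True
    have "(\<Prod>j\<in>J. p j ^ (if j = i then 1 else 0)) = p i" for p :: "'a \<Rightarrow> complex"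
    proof -
      have "(\<Prod>j\<in>J. p j ^ (if j = i then 1 else 0)) = (\<Prod>j\<in>J. if j = i then p j else 1)"
        by (rule prod.cong) auto
      then show ?thesis using True assms(1) by simp
    qed
    then show ?thesis using True poly_box_monomial[of J "\<lambda>j. if j = i then 1 else 0" 1] assms(1)
      by (intro exI[of _ 1]) auto
  qed (auto intro: poly_box_0)
next
  case (add f g)
  then obtain e e' where "poly_box J e (\<lambda>p. f (\<lambda>j. if j \<in> J then p j else 0))"
    "poly_box J e' (\<lambda>p. g (\<lambda>j. if j \<in> J then p j else 0))" by blast
  then show ?case
    by (intro exI[of _ "e + e'"] poly_box_add) (auto intro: poly_box_mono[OF assms(1)])
next
  case (mult f g)
  then show ?case using poly_box_mult[OF assms(1)] by fast
qed

text \<open>The exponents are listed from the last function down: the head belongs to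
  \<open>f (length as)\<close>. An induction on the list thus strips off the function that separates
  the two largest members of the chain.\<close>

fun chain_mon :: "(nat \<Rightarrow> 'v \<Rightarrow> complex) \<Rightarrow> nat list \<Rightarrow> 'v \<Rightarrow> complex" where
  "chain_mon f [] v = 1"
| "chain_mon f (e # as) v = f (length as) v ^ e * chain_mon f as v"

lemma sum_lists_Suc:
  fixes F :: "'a list \<Rightarrow> 'b::comm_monoid_add"
  shows "(\<Sum>as\<in>{as. set as \<subseteq> A \<and> length as = Suc i}. F as) =
    (\<Sum>e\<in>A. \<Sum>as\<in>{as. set as \<subseteq> A \<and> length as = i}. F (e # as))"
proof -
  have "{as. set as \<subseteq> A \<and> length as = Suc i} = (\<lambda>(e, as). e # as) ` (A \<times> {as. set as \<subseteq> A \<and> length as = i})"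
    by (auto simp: length_Suc_conv image_iff)
  then have "(\<Sum>as\<in>{as. set as \<subseteq> A \<and> length as = Suc i}. F as) =
      (\<Sum>(e, as)\<in>A \<times> {as. set as \<subseteq> A \<and> length as = i}. F (e # as))"
    by (simp add: sum.reindex inj_on_def case_prod_unfold)
  then show ?thesis by (simp add: sum.cartesian_product)
qed

lemma chain_mon_polyfun: "(\<And>k. k < length as \<Longrightarrow> f k \<in> polyfun) \<Longrightarrow> chain_mon f as \<in> polyfun"
proof (induction as)
  case Nil
  then show ?case using polyfun.const[of 1] by (simp add: chain_mon.simps(1)[abs_def])
next
  case (Cons e as)
  then have "(\<lambda>v. f (length as) v ^ e * chain_mon f as v) \<in> polyfun"
    by (intro polyfun.mult polyfun_power) auto
  then show ?case by (simp add: chain_mon.simps(2)[abs_def])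
qed

text \<open>If \<open>f k\<close> vanishes on the \<open>k\<close>-th but not on the next member of a chain of irreducible closed
  sets, then the \<open>f k\<close> are algebraically independent: restricting a relation to the smaller set
  kills its terms divisible by the last function, and that function can be cancelled on the
  larger set.\<close>

lemma chain_mon_independent:
  assumes irr: "\<And>k. k \<le> d \<Longrightarrow> zirreducible (Z k)"
    and sub: "\<And>k. k < d \<Longrightarrow> Z k \<subseteq> Z (Suc k)"
    and f: "\<And>k. k < d \<Longrightarrow> f k \<in> polyfun" "\<And>k v. k < d \<Longrightarrow> v \<in> Z k \<Longrightarrow> f k v = 0"
      "\<And>k. k < d \<Longrightarrow> \<exists>v\<in>Z (Suc k). f k v \<noteq> 0"
  shows "i \<le> d \<Longrightarrow> (\<And>v. v \<in> Z i \<Longrightarrow> (\<Sum>as\<in>{as. set as \<subseteq> {..N} \<and> length as = i}. c as * chain_mon f as v) = 0)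
    \<Longrightarrow> set as \<subseteq> {..N} \<Longrightarrow> length as = i \<Longrightarrow> c as = 0"
proof (induction i arbitrary: c as)
  case 0
  obtain v where "v \<in> Z 0" using irr[of 0] unfolding zirreducible_def by auto
  moreover have "{as. set as \<subseteq> {..N} \<and> length as = 0} = {[]}" by auto
  ultimately show ?case using 0 by auto
next
  case (Suc i)
  let ?L = "\<lambda>i. {as. set as \<subseteq> {..N} \<and> length as = i}"
  define g where "g e v = (\<Sum>as\<in>?L i. c (e # as) * chain_mon f as v)" for e v
  have g: "g e \<in> polyfun" for e
    unfolding g_def using Suc.prems(1) f(1)
    by (intro polyfun_intros chain_mon_polyfun) auto
  have total: "(\<Sum>e\<le>N. g e v * f i v ^ e) = 0" if "v \<in> Z (Suc i)" for v
  proof -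
    have "(\<Sum>e\<le>N. g e v * f i v ^ e) = (\<Sum>as\<in>?L (Suc i). c as * chain_mon f as v)"
      unfolding sum_lists_Suc g_def sum_distrib_right by (intro sum.cong) auto
    then show ?thesis using Suc.prems(2)[OF that] by simp
  qed
  have coef: "\<forall>as\<in>?L i. c (e # as) = 0" if "e \<le> N" for e
    using that
  proof (induction e rule: less_induct)
    case (less e)
    have zero: "g e' v = 0" if "e' < e" for e' v
      using less that by (auto simp: g_def)
    \<comment> \<open>\<open>r\<close> is the relation divided by \<open>f i ^ e\<close>, possible
      because the coefficients below \<open>e\<close> are already zero. Cancellation makes it vanish
      on the larger set, and on the smaller one only its constant term \<open>g e\<close>
      survives.\<close>
    define r where "r v = (\<Sum>e'\<in>{e..N}. g e' v * f i v ^ (e' - e))" for v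
    have r: "r \<in> polyfun" unfolding r_def using f(1)[of i] Suc.prems(1) by (intro polyfun_intros g) auto
    have "f i v ^ e * r v = 0" if "v \<in> Z (Suc i)" for v
    proof -
      have "(\<Sum>e'\<le>N. g e' v * f i v ^ e') = (\<Sum>e'\<in>{e..N}. g e' v * f i v ^ e')"
        using zero by (intro sum.mono_neutral_right) auto
      also have "\<dots> = f i v ^ e * r v"
        unfolding r_def sum_distrib_left
        by (intro sum.cong) (auto simp: mult_ac simp flip: power_add)
      finally show ?thesis using total[OF that] by simp
    qed
    moreover have "\<exists>v\<in>Z (Suc i). f i v ^ e \<noteq> 0" using f(3)[of i] Suc.prems(1) by auto
    ultimately have r0: "\<forall>v\<in>Z (Suc i). r v = 0"
      using zirreducible_domain[OF irr[OF Suc.prems(1)] polyfun_power[OF f(1)[of i]] r, of e] Suc.prems(1)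
      by auto
    have "g e v = 0" if v: "v \<in> Z i" for v
    proof -
      have "r v = (\<Sum>e'\<in>{e..N}. if e' = e then g e v else 0)"
        unfolding r_def using f(2)[OF _ v] Suc.prems(1) by (intro sum.cong) auto
      then show ?thesis using r0 sub[of i] v Suc.prems(1) less.prems by auto
    qed
    then have "c (e # as) = 0" if "as \<in> ?L i" for as
      using Suc.IH[of "\<lambda>as. c (e # as)" as] Suc.prems(1) that unfolding g_def by simp
    then show ?case by simp
  qed
  obtain e as' where "as = e # as'" using Suc.prems by (cases as) auto
  then show ?case using coef Suc.prems by auto
qed

text \<open>A chain of length \<open>d\<close> yields \<open>d\<close> functions that are
  algebraically independent on its top member, hence \<open>(N + 1) ^ d\<close> linearly independent
  monomials. Pulled back along \<open>\<phi>\<close> these are polynomials in \<open>card J\<close>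
  variables of degree at most \<open>N * E\<close> in each. For \<open>d > card J\<close> and large
  \<open>N\<close> there are too few such polynomials, and a linear relation on the range of
  \<open>\<phi>\<close> extends to its closure.\<close>

lemma krull_dim_le:
  fixes \<phi> :: "('j \<Rightarrow> complex) \<Rightarrow> 'i \<Rightarrow> complex"
  assumes \<phi>: "\<And>i. (\<lambda>p. \<phi> p i) \<in> polyfun"
    and J: "finite J"
    and dense: "S \<subseteq> zclosure (range \<phi>)"
    and supp: "\<And>p. \<phi> (\<lambda>j. if j \<in> J then p j else 0) = \<phi> p"
  shows "krull_dim S \<le> enat (card J)"
  unfolding krull_dim_def
proof (rule SUP_least, unfold mem_Collect_eq, elim exE conjE)
  fix d and Z :: "nat \<Rightarrow> ('i \<Rightarrow> complex) set"
  assume Z: "\<forall>i\<le>d. zclosed (Z i) \<and> zirreducible (Z i) \<and> Z i \<subseteq> S" and chain: "\<forall>i<d. Z i \<subset> Z (Suc i)"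
  show "enat d \<le> enat (card J)"
  proof (rule ccontr)
    assume "\<not> enat d \<le> enat (card J)"
    then have d: "\<not> d \<le> card J" by simp
    have "\<exists>f. k < d \<longrightarrow> f \<in> polyfun \<and> (\<forall>v\<in>Z k. f v = 0) \<and> (\<exists>v\<in>Z (Suc k). f v \<noteq> 0)" for k
    proof (cases "k < d")
      case that: True
      have "Z k \<subset> Z (Suc k)" using chain that by simp
      then obtain v where v: "v \<in> Z (Suc k)" "v \<notin> Z k" by blast
      have "zclosed (Z k)" using Z that by simp
      from zclosed_separate[OF this v(2)] obtain f
        where "f \<in> polyfun" "\<And>z. z \<in> Z k \<Longrightarrow> f z = 0" "f v \<noteq> 0" by metis
      then show ?thesis using v(1) by (intro exI[of _ f]) auto
    qed simp
    then have "\<forall>k. \<exists>f. k < d \<longrightarrow> f \<in> polyfun \<and> (\<forall>v\<in>Z k. f v = 0) \<and> (\<exists>v\<in>Z (Suc k). f v \<noteq> 0)" ..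
    from choice[OF this] obtain f
      where f0: "\<forall>k. k < d \<longrightarrow> f k \<in> polyfun \<and> (\<forall>v\<in>Z k. f k v = 0) \<and> (\<exists>v\<in>Z (Suc k). f k v \<noteq> 0)" ..
    have f: "\<And>k. k < d \<Longrightarrow> f k \<in> polyfun" "\<And>k v. k < d \<Longrightarrow> v \<in> Z k \<Longrightarrow> f k v = 0"
      "\<And>k. k < d \<Longrightarrow> \<exists>v\<in>Z (Suc k). f k v \<noteq> 0"
      using f0 by auto
    have "\<exists>e. poly_box J e (\<lambda>p. f k (\<phi> p))" if "k < d" for k
      using polyfun_poly_box[OF J polyfun_compose[OF f(1)[OF that] \<phi>]] by (simp add: supp)
    then obtain e where e: "\<And>k. k < d \<Longrightarrow> poly_box J (e k) (\<lambda>p. f k (\<phi> p))" by metis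
    define E where "E = (\<Sum>k<d. e k)"
    \<comment> \<open>This choice gives \<open>(N * E + 1) ^ card J \<le> (N + 1) ^ card J * N < (N
      + 1) ^ Suc (card J)\<close>, which is what the count requires.\<close>
    define N where "N = (E + 1) ^ card J"
    let ?L = "{as. set as \<subseteq> {..N} \<and> length as = d}"
    have box: "poly_box J (N * (\<Sum>k<i. e k)) (\<lambda>p. chain_mon f as (\<phi> p))"
      if "i \<le> d" "set as \<subseteq> {..N}" "length as = i" for i as
      using that
    proof (induction as arbitrary: i)
      case Nil
      then show ?case using poly_box_monomial[OF J, of "\<lambda>_. 0" 0] by simp
    next
      case (Cons a as)
      have "poly_box J (a * e (length as) + N * (\<Sum>k<length as. e k))
          (\<lambda>p. f (length as) (\<phi> p) ^ a * chain_mon f as (\<phi> p))"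
        using Cons by (intro poly_box_mult poly_box_power J e Cons.IH) auto
      moreover have "a * e (length as) + N * (\<Sum>k<length as. e k) \<le> N * (\<Sum>k<i. e k)"
        using Cons by (auto simp: algebra_simps)
      ultimately show ?case using poly_box_mono[OF J] by simp
    qed
    have "\<forall>as\<in>?L. \<exists>b. \<forall>p. chain_mon f as (\<phi> p) = (\<Sum>a\<in>Pi\<^sub>E J (\<lambda>_. {..N * E}). b a * (\<Prod>j\<in>J. p j ^ a j))"
      using box[of d] unfolding E_def poly_box_def by simp
    from bchoice[OF this] obtain b where b: "\<forall>as\<in>?L. \<forall>p.
        chain_mon f as (\<phi> p) = (\<Sum>a\<in>Pi\<^sub>E J (\<lambda>_. {..N * E}). b as a * (\<Prod>j\<in>J. p j ^ a j))" ..
    have "card (Pi\<^sub>E J (\<lambda>_. {..N * E})) = (N * E + 1) ^ card J" using J by (simp add: card_PiE)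
    also have "\<dots> \<le> ((N + 1) * (E + 1)) ^ card J" by (intro power_mono) auto
    also have "\<dots> = (N + 1) ^ card J * N" unfolding power_mult_distrib by (simp only: N_def)
    also have "\<dots> < (N + 1) ^ Suc (card J)" by simp
    also have "\<dots> \<le> (N + 1) ^ d" using d by (intro power_increasing) auto
    also have "\<dots> = card ?L" by (simp add: card_lists_length_eq)
    finally obtain c where c: "\<exists>as\<in>?L. c as \<noteq> 0"
      "\<forall>a\<in>Pi\<^sub>E J (\<lambda>_. {..N * E}). (\<Sum>as\<in>?L. c as * b as a) = 0"
      using homogeneous_system_solution[of "Pi\<^sub>E J (\<lambda>_. {..N * E})" ?L b] J
      by (auto simp: finite_PiE finite_lists_length_eq)
    define q where "q v = (\<Sum>as\<in>?L. c as * chain_mon f as v)" for v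
    have "q (\<phi> p) = 0" for p
    proof -
      have "q (\<phi> p) = (\<Sum>as\<in>?L. \<Sum>a\<in>Pi\<^sub>E J (\<lambda>_. {..N * E}). c as * b as a * (\<Prod>j\<in>J. p j ^ a j))"
        unfolding q_def by (intro sum.cong refl) (simp add: b sum_distrib_left mult.assoc)
      also have "\<dots> = (\<Sum>a\<in>Pi\<^sub>E J (\<lambda>_. {..N * E}). (\<Sum>as\<in>?L. c as * b as a) * (\<Prod>j\<in>J. p j ^ a j))"
        by (subst sum.swap) (simp add: sum_distrib_right)
      also have "\<dots> = 0" using c(2) by (intro sum.neutral) auto
      finally show ?thesis .
    qed
    moreover have "q \<in> polyfun" unfolding q_def using f(1) by (intro polyfun_intros chain_mon_polyfun) auto
    ultimately have "q v = 0" if "v \<in> zclosure (range \<phi>)" for v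
      using that unfolding mem_zclosure_iff by auto
    then have q0: "q v = 0" if "v \<in> Z d" for v
      using dense Z that by (meson order_refl subsetD)
    have "c as = 0" if "as \<in> ?L" for as
      by (rule chain_mon_independent[where d=d and Z=Z and f=f and i=d and N=N and c=c and as=as])
        (use Z chain f that q0 in \<open>auto simp: q_def psubset_imp_subset\<close>)
    then show False using c(1) by blast
  qed
qed

subsection \<open>Isotropic frames and skew matrices of square zero\<close>

definition dot :: "nat \<Rightarrow> (nat \<Rightarrow> 'a) \<Rightarrow> (nat \<Rightarrow> 'a) \<Rightarrow> 'a::comm_ring_1" where
  "dot n x y = (\<Sum>i<n. x i * y i)"

lemma dot_commute: "dot n x y = dot n y x"
  by (simp add: dot_def mult.commute)

lemma dot_add_left: "dot n (\<lambda>i. x i + y i) z = dot n x z + dot n y z"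
  and dot_diff_left: "dot n (\<lambda>i. x i - y i) z = dot n x z - dot n y z"
  and dot_cmult_left: "dot n (\<lambda>i. c * x i) z = c * dot n x z"
  and dot_zero_left: "dot n (\<lambda>i. 0) z = 0"
  by (simp_all add: dot_def algebra_simps sum.distrib sum_subtractf sum_distrib_left)

lemma dot_sum_left: "dot n (\<lambda>i. \<Sum>a\<in>A. f a i) z = (\<Sum>a\<in>A. dot n (f a) z)"
  unfolding dot_def sum_distrib_right by (rule sum.swap)

lemma dot_mult_right_left: "dot n (\<lambda>i. x i * c) z = c * dot n x z"
  using dot_cmult_left[of n c x z] by (simp add: mult.commute)

lemmas dot_left = dot_add_left dot_diff_left dot_cmult_left dot_mult_right_left dot_sum_left dot_zero_left

lemma dot_right: "dot n z (\<lambda>i. x i + y i) = dot n z x + dot n z y"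
  "dot n z (\<lambda>i. x i - y i) = dot n z x - dot n z y"
  "dot n z (\<lambda>i. c * x i) = c * dot n z x"
  "dot n z (\<lambda>i. x i * c) = c * dot n z x"
  "dot n z (\<lambda>i. \<Sum>a\<in>A. f a i) = (\<Sum>a\<in>A. dot n z (f a))"
  "dot n z (\<lambda>i. 0) = 0"
  by (simp_all add: dot_left dot_commute[of n z])

lemma dot_delta_left: "j < n \<Longrightarrow> dot n (\<lambda>i. if i = j then 1 else 0) x = x j"
  and dot_delta_right: "j < n \<Longrightarrow> dot n x (\<lambda>i. if i = j then 1 else 0) = x j"
  by (simp_all add: dot_def if_distrib if_distribR cong: if_cong)

section \<open>Reflections, the standard isotropic frame and Witt's theorem\<close>

definition supported :: "nat \<Rightarrow> (nat \<Rightarrow> 'a::zero) \<Rightarrow> bool" where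
  "supported n x \<longleftrightarrow> (\<forall>i\<ge>n. x i = 0)"

definition refl :: "nat \<Rightarrow> (nat \<Rightarrow> 'a) \<Rightarrow> (nat \<Rightarrow> 'a) \<Rightarrow> nat \<Rightarrow> 'a::comm_ring_1" where
  "refl n v x = (\<lambda>i. x i - 2 * dot n v x * v i)"

definition refls :: "nat \<Rightarrow> (nat \<Rightarrow> 'a) list \<Rightarrow> (nat \<Rightarrow> 'a) \<Rightarrow> nat \<Rightarrow> 'a::comm_ring_1" where
  "refls n vs x = foldr (refl n) vs x"

definition units :: "nat \<Rightarrow> (nat \<Rightarrow> 'a::comm_ring_1) list \<Rightarrow> bool" where
  "units n vs \<longleftrightarrow> (\<forall>v\<in>set vs. supported n v \<and> dot n v v = 1)"

lemma refls_simps [simp]: "refls n [] x = x" "refls n (v # vs) x = refl n v (refls n vs x)"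
  "refls n (vs @ ws) x = refls n vs (refls n ws x)"
  by (simp_all add: refls_def)

lemma refl_dot: "dot n v v = 1 \<Longrightarrow> dot n (refl n v x) (refl n v y) = dot n x y"
  unfolding refl_def dot_left dot_right dot_commute[of n x v] by (simp add: algebra_simps)

lemma refl_refl: "dot n v v = 1 \<Longrightarrow> refl n v (refl n v x) = x"
  unfolding refl_def dot_left dot_right by (simp add: fun_eq_iff algebra_simps)

lemma supported_refl: "supported n v \<Longrightarrow> supported n x \<Longrightarrow> supported n (refl n v x)"
  by (simp add: refl_def supported_def)

lemma refls_dot: "units n vs \<Longrightarrow> dot n (refls n vs x) (refls n vs y) = dot n x y"
  by (induction vs) (simp_all add: units_def refl_dot)

lemma refls_rev: "units n vs \<Longrightarrow> refls n (rev vs) (refls n vs x) = x"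
  by (induction vs arbitrary: x) (simp_all add: units_def refl_refl)

lemma units_rev: "units n (rev vs) \<longleftrightarrow> units n vs"
  by (simp add: units_def)

lemma supported_refls: "units n vs \<Longrightarrow> supported n x \<Longrightarrow> supported n (refls n vs x)"
  by (induction vs) (simp_all add: units_def supported_refl)

lemma refl_sum: "refl n v (\<lambda>i. \<Sum>a\<in>A. c a * x a i) = (\<lambda>i. \<Sum>a\<in>A. c a * refl n v (x a) i)"
  unfolding refl_def dot_right
  by (simp add: fun_eq_iff sum_distrib_left sum_distrib_right right_diff_distrib sum_subtractf mult_ac)

lemma refls_sum: "refls n vs (\<lambda>i. \<Sum>a\<in>A. c a * x a i) = (\<lambda>i. \<Sum>a\<in>A. c a * refls n vs (x a) i)"
  by (induction vs) (simp_all add: refl_sum)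

text \<open>The coordinates \<open>Suc (2*a)\<close> and \<open>Suc (Suc (2*a))\<close> span a
  hyperbolic plane with isotropic lines \<open>iso_F a\<close> and \<open>iso_G a\<close>;
  coordinate 0 is left over as the anisotropic direction. The pairing 1/2 makes the anticommutator
  of the two vectors in the Clifford algebra equal to 1.\<close>

definition iso_F :: "nat \<Rightarrow> nat \<Rightarrow> complex" where
  "iso_F a i = (if i = Suc (2*a) then 1/2 else if i = Suc (Suc (2*a)) then \<i>/2 else 0)"

definition iso_G :: "nat \<Rightarrow> nat \<Rightarrow> complex" where
  "iso_G a i = (if i = Suc (2*a) then 1/2 else if i = Suc (Suc (2*a)) then -\<i>/2 else 0)"

lemma supported_iso: "a < l \<Longrightarrow> supported (Suc (2*l)) (iso_F a)" "a < l \<Longrightarrow> supported (Suc (2*l)) (iso_G a)"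
  by (auto simp: supported_def iso_F_def iso_G_def)

lemma sum_pairs: "(\<Sum>i<Suc (2*l). g i) = g 0 + (\<Sum>a<l. g (Suc (2*a)) + g (Suc (Suc (2*a)) :: nat) :: 'a::comm_monoid_add)"
  by (induction l) (simp_all add: add_ac)

lemma suc_double_neq: "Suc (Suc (2*a)) \<noteq> Suc (2*b)" "Suc (2*b) \<noteq> Suc (Suc (2*a))" for a b :: nat
  by presburger+

lemma dot_iso:
  assumes "a < l"
  shows "dot (Suc (2*l)) (iso_F a) x = (x (Suc (2*a)) + \<i> * x (Suc (Suc (2*a)))) / 2"
    and "dot (Suc (2*l)) (iso_G a) x = (x (Suc (2*a)) - \<i> * x (Suc (Suc (2*a)))) / 2"
proof -
  have F: "iso_F a (Suc (2*b)) * x (Suc (2*b)) + iso_F a (Suc (Suc (2*b))) * x (Suc (Suc (2*b))) =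
      (if b = a then (x (Suc (2*a)) + \<i> * x (Suc (Suc (2*a)))) / 2 else 0)" for b
    by (simp add: iso_F_def suc_double_neq[simplified] add_divide_distrib)
  have G: "iso_G a (Suc (2*b)) * x (Suc (2*b)) + iso_G a (Suc (Suc (2*b))) * x (Suc (Suc (2*b))) =
      (if b = a then (x (Suc (2*a)) - \<i> * x (Suc (Suc (2*a)))) / 2 else 0)" for b
    by (simp add: iso_G_def suc_double_neq[simplified] diff_divide_distrib)
  have "iso_F a 0 = 0" "iso_G a 0 = 0" by (simp_all add: iso_F_def iso_G_def)
  then show "dot (Suc (2*l)) (iso_F a) x = (x (Suc (2*a)) + \<i> * x (Suc (Suc (2*a)))) / 2"
    and "dot (Suc (2*l)) (iso_G a) x = (x (Suc (2*a)) - \<i> * x (Suc (Suc (2*a)))) / 2"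
    unfolding dot_def sum_pairs F G using assms by simp_all
qed

lemma dot_iso_iso:
  assumes "a < l"
  shows "dot (Suc (2*l)) (iso_F a) (iso_F b) = 0"
    and "dot (Suc (2*l)) (iso_G a) (iso_G b) = 0"
    and "dot (Suc (2*l)) (iso_F a) (iso_G b) = (if a = b then 1/2 else 0)"
    and "dot (Suc (2*l)) (iso_G a) (iso_F b) = (if a = b then 1/2 else 0)"
  by (auto simp: dot_iso[OF assms] iso_F_def iso_G_def suc_double_neq[simplified])

text \<open>The reflection is the one in \<open>x - y\<close>. Its norm is
  \<open>- 2 * dot n x y\<close>, non-zero by assumption, and a complex square root normalises
  it.\<close>

lemma refl_swap:
  fixes x y :: "nat \<Rightarrow> complex"
  assumes "supported n x" "supported n y" "dot n x x = 0" "dot n y y = 0" "dot n x y \<noteq> 0"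
  shows "\<exists>v. supported n v \<and> dot n v v = 1 \<and> refl n v x = y \<and>
    (\<forall>z. dot n x z = 0 \<longrightarrow> dot n y z = 0 \<longrightarrow> refl n v z = z)"
proof -
  define s where "s = csqrt (- 2 * dot n x y)"
  have s2: "s * s = - 2 * dot n x y" unfolding s_def using power2_csqrt by (simp add: power2_eq_square)
  then have s0: "s \<noteq> 0" using assms(5) by auto
  define v where "v = (\<lambda>i. (1/s) * (x i - y i))"
  have vz: "dot n v z = (dot n x z - dot n y z) / s" for z
    unfolding v_def by (simp only: dot_left) simp
  have yx: "dot n y x = dot n x y" by (rule dot_commute)
  have "dot n v v = 1"
  proof -
    have "dot n v v = (dot n v x - dot n v y) / s"
      unfolding vz[of v] dot_commute[of n x v] dot_commute[of n y v] ..
    also have "\<dots> = 1" unfolding vz assms(3,4) yx using s0 s2 assms(5) by (simp add: field_simps)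
    finally show ?thesis .
  qed
  moreover have "refl n v x = y"
  proof
    fix i
    have "refl n v x i = x i - 2 * (- dot n x y / s) * ((x i - y i) / s)"
      by (simp add: refl_def vz assms(3) yx) (simp add: v_def)
    also have "\<dots> = x i + 2 * dot n x y * (x i - y i) / (s * s)" by simp
    also have "\<dots> = y i" unfolding s2 using assms(5) by (simp add: field_simps)
    finally show "refl n v x i = y i" .
  qed
  moreover have "refl n v z = z" if "dot n x z = 0" "dot n y z = 0" for z
    by (simp add: refl_def vz that)
  moreover have "supported n v" using assms(1,2) by (simp add: supported_def v_def)
  ultimately show ?thesis by auto
qed

text \<open>Otherwise \<open>w\<close> vanishes in the planes from \<open>k\<close> on, and in a
  plane \<open>a < k\<close> orthogonality to \<open>iso_F a\<close> leaves only a multiple of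
  \<open>iso_F a\<close>. Isotropy then kills coordinate 0, and \<open>w\<close> is in the excluded
  span.\<close>

lemma isotropic_witness:
  assumes "k \<le> l" and w: "supported (Suc (2*l)) w" "dot (Suc (2*l)) w w = 0"
    and orth: "\<And>a. a < k \<Longrightarrow> dot (Suc (2*l)) (iso_F a) w = 0"
    and nspan: "\<not> (\<exists>c. w = (\<lambda>i. \<Sum>a<k. c a * iso_F a i))"
  shows "\<exists>m. k \<le> m \<and> m < l \<and> (dot (Suc (2*l)) (iso_F m) w \<noteq> 0 \<or> dot (Suc (2*l)) (iso_G m) w \<noteq> 0)"
proof (rule ccontr)
  assume neg: "\<not> ?thesis"
  have hi: "w (Suc (2*m)) = 0 \<and> w (Suc (Suc (2*m))) = 0" if "k \<le> m" "m < l" for m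
  proof -
    have eqs: "w (Suc (2*m)) + \<i> * w (Suc (Suc (2*m))) = 0" "w (Suc (2*m)) - \<i> * w (Suc (Suc (2*m))) = 0"
      using neg that by (auto simp: dot_iso)
    have "2 * w (Suc (2*m)) = 0"
      using eqs by (metis add_0 add_diff_cancel_right' diff_add_cancel mult_2)
    then show ?thesis using eqs by auto
  qed
  have lo: "w (Suc (Suc (2*m))) = \<i> * w (Suc (2*m))" if "m < k" for m
  proof -
    have "w (Suc (2*m)) + \<i> * w (Suc (Suc (2*m))) = 0" using orth[OF that] that \<open>k \<le> l\<close> by (auto simp: dot_iso)
    then have "\<i> * (w (Suc (2*m)) + \<i> * w (Suc (Suc (2*m)))) = 0" by simp
    then show ?thesis by (simp add: algebra_simps)
  qed
  have "w (Suc (2*a)) * w (Suc (2*a)) + w (Suc (Suc (2*a))) * w (Suc (Suc (2*a))) = 0" if "a < l" for a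
    using hi[of a] lo[of a] that by (cases "a < k") (auto simp: mult_ac)
  then have "dot (Suc (2*l)) w w = w 0 * w 0" unfolding dot_def sum_pairs by simp
  then have w0: "w 0 = 0" using w(2) by simp
  have "w i = (\<Sum>a<k. 2 * w (Suc (2*a)) * iso_F a i)" for i
  proof -
    consider "i = 0" | b where "i = Suc (2*b)" | b where "i = Suc (Suc (2*b))"
    proof -
      have "i = 0 \<or> (\<exists>b. i = Suc (2*b)) \<or> (\<exists>b. i = Suc (Suc (2*b)))" by presburger
      then show "(i = 0 \<Longrightarrow> thesis) \<Longrightarrow> (\<And>b. i = Suc (2*b) \<Longrightarrow> thesis) \<Longrightarrow> (\<And>b. i = Suc (Suc (2*b)) \<Longrightarrow> thesis) \<Longrightarrow> thesis"
        by blast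
    qed
    then show ?thesis
    proof cases
      case 1
      then show ?thesis by (simp add: w0 iso_F_def)
    next
      case 2
      then have neq: "\<And>a. i \<noteq> Suc (Suc (2*a))" by presburger
      have "(\<Sum>a<k. 2 * w (Suc (2*a)) * iso_F a i) = (\<Sum>a<k. if a = b then w i else 0)"
        using neq 2 by (intro sum.cong) (auto simp: iso_F_def)
      then show ?thesis using hi[of b] w(1) 2 by (cases "b < l") (auto simp: supported_def)
    next
      case 3
      then have neq: "\<And>a. i \<noteq> Suc (2*a)" by presburger
      have "(\<Sum>a<k. 2 * w (Suc (2*a)) * iso_F a i) = (\<Sum>a<k. if a = b then w i else 0)"
        using neq 3 lo by (intro sum.cong) (auto simp: iso_F_def)
      then show ?thesis using hi[of b] w(1) 3 by (cases "b < l") (auto simp: supported_def)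
    qed
  qed
  then have "\<exists>c. w = (\<lambda>i. \<Sum>a<k. c a * iso_F a i)" by (intro exI[of _ "\<lambda>a. 2 * w (Suc (2*a))"] ext)
  then show False using nspan by simp
qed

text \<open>One reflection is enough if \<open>w\<close> is not orthogonal to
  \<open>iso_F k\<close>. If it is, two reflections go through an isotropic vector \<open>y\<close>
  that is orthogonal to neither and is orthogonal to the earlier frame vectors, so that these stay
  fixed.\<close>

lemma witt_step:
  assumes "k \<le> l" and w: "supported (Suc (2*l)) w" "dot (Suc (2*l)) w w = 0"
    and orth: "\<And>a. a < k \<Longrightarrow> dot (Suc (2*l)) (iso_F a) w = 0"
    and nspan: "\<not> (\<exists>c. w = (\<lambda>i. \<Sum>a<k. c a * iso_F a i))"
  shows "k < l \<and> (\<exists>vs. units (Suc (2*l)) vs \<and> refls (Suc (2*l)) vs w = iso_F k \<and>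
    (\<forall>a<k. refls (Suc (2*l)) vs (iso_F a) = iso_F a))"
proof -
  let ?n = "Suc (2*l)"
  obtain m where m: "k \<le> m" "m < l" "dot ?n (iso_F m) w \<noteq> 0 \<or> dot ?n (iso_G m) w \<noteq> 0"
    using isotropic_witness[OF assms] by auto
  then have kl: "k < l" by simp
  have Fk: "supported ?n (iso_F k)" "dot ?n (iso_F k) (iso_F k) = 0"
    using kl by (simp_all add: supported_iso dot_iso_iso)
  have wF: "dot ?n w (iso_F a) = 0" if "a < k" for a
    using orth[OF that] by (simp add: dot_commute)
  show ?thesis
  proof (cases "dot ?n w (iso_F k) = 0")
    case False
    then obtain v where "supported ?n v" "dot ?n v v = 1" "refl ?n v w = iso_F k"
      "\<forall>z. dot ?n w z = 0 \<longrightarrow> dot ?n (iso_F k) z = 0 \<longrightarrow> refl ?n v z = z"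
      using refl_swap[OF w(1) Fk(1) w(2) Fk(2)] by auto
    then show ?thesis using kl wF by (intro conjI exI[of _ "[v]"]) (simp_all add: units_def dot_iso_iso)
  next
    case True
    have "\<exists>y. supported ?n y \<and> dot ?n y y = 0 \<and> dot ?n w y \<noteq> 0 \<and> dot ?n y (iso_F k) \<noteq> 0 \<and>
        (\<forall>a<k. dot ?n y (iso_F a) = 0)"
    proof (cases "dot ?n w (iso_G k) = 0")
      case False
      then show ?thesis using kl
        by (intro exI[of _ "iso_G k"]) (simp add: supported_iso dot_iso_iso)
    next
      case w0: True
      have km: "m \<noteq> k" using m(3) True w0 by (auto simp: dot_commute)
      define z where "z = (if dot ?n (iso_F m) w \<noteq> 0 then iso_F m else iso_G m)"
      have wz: "dot ?n w z \<noteq> 0" using m(3) by (auto simp: z_def dot_commute)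
      have z: "supported ?n z" "dot ?n z z = 0" "dot ?n (iso_G k) z = 0" "\<And>a. a \<le> k \<Longrightarrow> dot ?n z (iso_F a) = 0"
        using m(1,2) kl km by (auto simp: z_def supported_iso dot_iso_iso)
      \<comment> \<open>\<open>iso_G k\<close> supplies the pairing with \<open>iso_F k\<close> and
        \<open>z\<close> the pairing with \<open>w\<close>; as the two summands are isotropic and
        orthogonal, so is their sum.\<close>
      define y where "y = (\<lambda>i. iso_G k i + z i)"
      have "dot ?n y y = 0" unfolding y_def dot_left dot_right
        using z(2,3) kl dot_commute[of ?n z "iso_G k"] by (simp add: dot_iso_iso)
      moreover have "dot ?n w y \<noteq> 0" unfolding y_def dot_right using w0 wz by simp
      moreover have "dot ?n y (iso_F a) = (if a = k then 1/2 else 0)" if "a \<le> k" for a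
        unfolding y_def dot_left using kl that z(4)[OF that] by (simp add: dot_iso_iso)
      moreover have "supported ?n y" using z(1) supported_iso(2)[OF kl] by (simp add: y_def supported_def)
      ultimately show ?thesis by (intro exI[of _ y]) simp
    qed
    then obtain y where y: "supported ?n y" "dot ?n y y = 0" "dot ?n w y \<noteq> 0" "dot ?n y (iso_F k) \<noteq> 0"
      "\<And>a. a < k \<Longrightarrow> dot ?n y (iso_F a) = 0" by auto
    obtain v where v: "supported ?n v" "dot ?n v v = 1" "refl ?n v w = y"
      "\<forall>z. dot ?n w z = 0 \<longrightarrow> dot ?n y z = 0 \<longrightarrow> refl ?n v z = z"
      using refl_swap[OF w(1) y(1) w(2) y(2,3)] by auto
    obtain v' where v': "supported ?n v'" "dot ?n v' v' = 1" "refl ?n v' y = iso_F k"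
      "\<forall>z. dot ?n y z = 0 \<longrightarrow> dot ?n (iso_F k) z = 0 \<longrightarrow> refl ?n v' z = z"
      using refl_swap[OF y(1) Fk(1) y(2) Fk(2) y(4)] by auto
    show ?thesis using kl v v' wF y(5)
      by (intro conjI exI[of _ "[v', v]"]) (simp_all add: units_def dot_iso_iso)
  qed
qed

definition indep :: "nat \<Rightarrow> (nat \<Rightarrow> nat \<Rightarrow> complex) \<Rightarrow> bool" where
  "indep j w \<longleftrightarrow> (\<forall>c. (\<forall>i. (\<Sum>a<j. c a * w a i) = 0) \<longrightarrow> (\<forall>a<j. c a = 0))"

lemma indepD: "indep j w \<Longrightarrow> (\<And>i. (\<Sum>a<j. c a * w a i) = 0) \<Longrightarrow> a < j \<Longrightarrow> c a = 0"
  unfolding indep_def by simp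

text \<open>Besides the isometry this gives the bound of the Witt index, \<open>j \<le> l\<close>,
  which later guarantees that the weights found for a matrix exist.\<close>

lemma witt:
  assumes "\<And>a. a < j \<Longrightarrow> supported (Suc (2*l)) (w a)"
    and "\<And>a b. a < j \<Longrightarrow> b < j \<Longrightarrow> dot (Suc (2*l)) (w a) (w b) = 0"
    and "indep j w"
  shows "j \<le> l \<and> (\<exists>vs. units (Suc (2*l)) vs \<and> (\<forall>a<j. refls (Suc (2*l)) vs (w a) = iso_F a))"
  using assms
proof (induction j)
  case 0
  show ?case by (auto intro!: exI[of _ "[]"] simp: units_def)
next
  case (Suc j)
  let ?n = "Suc (2*l)"
  have "indep j w" unfolding indep_def
  proof (intro allI impI)
    fix c a assume c: "\<forall>i. (\<Sum>a<j. c a * w a i) = 0" and a: "a < j"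
    show "c a = 0"
      using indepD[OF Suc.prems(3), of "c(j := 0)" a] c a by simp
  qed
  then have "j \<le> l \<and> (\<exists>vs. units ?n vs \<and> (\<forall>a<j. refls ?n vs (w a) = iso_F a))"
    using Suc by auto
  then obtain vs where jl: "j \<le> l" and vs: "units ?n vs" "\<And>a. a < j \<Longrightarrow> refls ?n vs (w a) = iso_F a" by auto
  let ?w = "refls ?n vs (w j)"
  have "\<not> (\<exists>c. ?w = (\<lambda>i. \<Sum>a<j. c a * iso_F a i))"
  proof
    assume "\<exists>c. ?w = (\<lambda>i. \<Sum>a<j. c a * iso_F a i)"
    then obtain c where c: "?w = (\<lambda>i. \<Sum>a<j. c a * iso_F a i)" by auto
    have "w j = refls ?n (rev vs) ?w" using refls_rev[OF vs(1)] by simp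
    also have "\<dots> = (\<lambda>i. \<Sum>a<j. c a * refls ?n (rev vs) (iso_F a) i)" unfolding c by (rule refls_sum)
    also have "\<dots> = (\<lambda>i. \<Sum>a<j. c a * w a i)"
    proof (intro ext sum.cong refl)
      fix i a assume "a \<in> {..<j}"
      then have "refls ?n (rev vs) (iso_F a) = w a" using vs(2)[of a] refls_rev[OF vs(1), of "w a"] by simp
      then show "c a * refls ?n (rev vs) (iso_F a) i = c a * w a i" by simp
    qed
    \<comment> \<open>The inverse reflections turn a dependence on the standard frame into a
      relation between the original vectors, with coefficient -1 at \<open>w j\<close>.\<close>
    finally have "(\<Sum>a<Suc j. (c(j := -1)) a * w a i) = 0" for i by (simp add: fun_eq_iff)
    from indepD[OF Suc.prems(3) this, of j] show False by simp
  qed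
  moreover have "dot ?n (iso_F a) ?w = 0" if "a < j" for a
    using refls_dot[OF vs(1), of "w a" "w j"] vs(2)[OF that] Suc.prems(2)[of a j] that by simp
  moreover have "dot ?n ?w ?w = 0" using refls_dot[OF vs(1), of "w j" "w j"] Suc.prems(2)[of j j] by simp
  moreover have "supported ?n ?w" using supported_refls[OF vs(1)] Suc.prems(1) by simp
  ultimately obtain us where us: "j < l" "units ?n us" "refls ?n us ?w = iso_F j"
      "\<forall>a<j. refls ?n us (iso_F a) = iso_F a"
    using witt_step[OF jl, of ?w] by auto
  show ?case using us vs
    by (intro conjI exI[of _ "us @ vs"]) (auto simp: units_def less_Suc_eq)
qed

section \<open>Normal form of a skew map of square zero\<close>

definition mapply :: "nat \<Rightarrow> (nat \<Rightarrow> nat \<Rightarrow> complex) \<Rightarrow> (nat \<Rightarrow> complex) \<Rightarrow> nat \<Rightarrow> complex" where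
  "mapply n D x = (\<lambda>i. \<Sum>j<n. D i j * x j)"

definition wedge :: "(nat \<Rightarrow> 'a) \<Rightarrow> (nat \<Rightarrow> 'a) \<Rightarrow> nat \<Rightarrow> nat \<Rightarrow> 'a::comm_ring_1" where
  "wedge x y i j = x i * y j - y i * x j"

text \<open>Functions on all pairs of indices that vanish outside the square of size
  \<open>n\<close> are exactly what \<open>mat_coords\<close> produces, so no matrix type is carried
  through the linear algebra.\<close>

definition skew_nil :: "nat \<Rightarrow> (nat \<Rightarrow> nat \<Rightarrow> complex) \<Rightarrow> bool" where
  "skew_nil n D \<longleftrightarrow> (\<forall>i j. D i j = - D j i) \<and> (\<forall>i j. i \<ge> n \<longrightarrow> D i j = 0) \<and>
     (\<forall>i j. (\<Sum>k<n. D i k * D k j) = 0)"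

lemma skew_nilD:
  assumes "skew_nil n D"
  shows "D i j = - D j i" "i \<ge> n \<Longrightarrow> D i j = 0" "j \<ge> n \<Longrightarrow> D i j = 0" "(\<Sum>k<n. D i k * D k j) = 0"
    "D i j = 0 \<Longrightarrow> D j i = 0"
proof -
  show skew: "D i j = - D j i" for i j using assms unfolding skew_nil_def by blast
  show "i \<ge> n \<Longrightarrow> D i j = 0" and sq: "(\<Sum>k<n. D i k * D k j) = 0" for i j
    using assms unfolding skew_nil_def by blast+
  then show "j \<ge> n \<Longrightarrow> D i j = 0" by (subst skew) simp
  show "D i j = 0 \<Longrightarrow> D j i = 0" by (subst skew) simp
qed

lemma mapply_add: "mapply n D (\<lambda>i. x i + y i) = (\<lambda>i. mapply n D x i + mapply n D y i)"
  and mapply_cmult: "mapply n D (\<lambda>i. c * x i) = (\<lambda>i. c * mapply n D x i)"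
  by (simp_all add: mapply_def algebra_simps sum.distrib sum_distrib_left)

lemma mapply_wedge: "mapply n (wedge p q) x = (\<lambda>i. p i * dot n q x - q i * dot n p x)"
  by (simp add: mapply_def wedge_def dot_def left_diff_distrib sum_subtractf sum_distrib_left mult.assoc)

lemma mapply_delta: "j < n \<Longrightarrow> mapply n D (\<lambda>i. if i = j then 1 else 0) = (\<lambda>i. D i j)"
  by (simp add: mapply_def if_distrib if_distribR cong: if_cong)

lemma skew_nil_dot:
  assumes "skew_nil n D"
  shows "dot n (mapply n D x) y = - dot n x (mapply n D y)"
proof -
  have "dot n (mapply n D x) y = (\<Sum>i<n. \<Sum>j<n. D i j * x j * y i)"
    by (simp add: dot_def mapply_def sum_distrib_right)
  also have "\<dots> = (\<Sum>j<n. \<Sum>i<n. - (x j * (D j i * y i)))"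
    by (subst sum.swap, intro sum.cong refl, subst skew_nilD(1)[OF assms]) simp
  finally show ?thesis by (simp add: dot_def mapply_def sum_distrib_left sum_negf)
qed

lemma skew_nil_sq: "skew_nil n D \<Longrightarrow> mapply n D (mapply n D x) = (\<lambda>_. 0)"
proof
  fix i assume D: "skew_nil n D"
  have "mapply n D (mapply n D x) i = (\<Sum>k<n. \<Sum>j<n. D i k * D k j * x j)"
    by (simp add: mapply_def sum_distrib_left mult.assoc)
  also have "\<dots> = (\<Sum>j<n. (\<Sum>k<n. D i k * D k j) * x j)"
    by (subst sum.swap) (simp add: sum_distrib_right)
  finally show "mapply n D (mapply n D x) i = 0" by (simp add: skew_nilD(4)[OF D])
qed

lemma skew_nil_isotropic: "skew_nil n D \<Longrightarrow> dot n (mapply n D x) (mapply n D y) = 0"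
  by (simp add: skew_nil_dot skew_nil_sq dot_right)

lemma skew_nil_self: "skew_nil n D \<Longrightarrow> dot n (mapply n D x) x = 0"
  using skew_nil_dot[of n D x x] by (simp add: dot_commute)

lemma skew_nil_supported: "skew_nil n D \<Longrightarrow> supported n (mapply n D x)"
  by (simp add: supported_def mapply_def skew_nilD(2))

text \<open>The vectors \<open>w a\<close> form a basis of the image, so \<open>2*r\<close> is the
  rank. The factor 2 matches the conjugation action of \<open>1 + t^-2 w w'\<close> in the Clifford
  algebra.\<close>

definition normal_form :: "nat \<Rightarrow> (nat \<Rightarrow> nat \<Rightarrow> complex) \<Rightarrow> nat \<Rightarrow> (nat \<Rightarrow> nat \<Rightarrow> complex) \<Rightarrow> bool" where
  "normal_form n D r w \<longleftrightarrow> (\<forall>a<2*r. \<exists>x. w a = mapply n D x) \<and> indep (2*r) w \<and>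
     (\<forall>i j. D i j = (\<Sum>a<r. 2 * wedge (w (2*a)) (w (Suc (2*a))) i j))"

text \<open>A multiple of the bivector of \<open>D y\<close> and \<open>D z\<close> is added so that
  \<open>y\<close> and \<open>z\<close> are killed. The square stays zero because the image does not
  grow, and the image of \<open>D\<close> is isotropic and annihilated by \<open>D\<close>. The last
  claim says that zero columns persist, which gives the measure of an induction.\<close>

lemma skew_nil_split:
  assumes D: "skew_nil n D" and c: "c = dot n z (mapply n D y)" "c \<noteq> 0"
    and D': "D' = (\<lambda>i j. D i j + wedge (mapply n D y) (mapply n D z) i j / c)"
  shows "skew_nil n D'" "mapply n D' y = (\<lambda>_. 0)" "mapply n D' z = (\<lambda>_. 0)"
    "\<And>x. \<exists>x'. mapply n D' x = mapply n D x'"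
    "\<And>i. (\<forall>j. D j i = 0) \<Longrightarrow> D' j i = 0"
proof -
  let ?y = "mapply n D y" and ?z = "mapply n D z"
  have ap: "mapply n D' x = (\<lambda>i. mapply n D x i + (?y i * dot n ?z x - ?z i * dot n ?y x) / c)" for x
  proof -
    have "mapply n D' x = (\<lambda>i. mapply n D x i + mapply n (wedge ?y ?z) x i / c)"
      unfolding D' by (simp add: mapply_def distrib_right sum.distrib sum_divide_distrib)
    then show ?thesis by (simp add: mapply_wedge)
  qed
  have dots: "dot n ?z y = - c" "dot n ?y z = c" "dot n ?y y = 0" "dot n ?z z = 0"
    using skew_nil_dot[OF D, of z y] skew_nil_self[OF D] by (simp_all add: c dot_commute)
  show "mapply n D' y = (\<lambda>_. 0)" "mapply n D' z = (\<lambda>_. 0)"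
    unfolding ap dots using c(2) by (simp_all add: fun_eq_iff)
  have im: "mapply n D' x = mapply n D (\<lambda>i. x i + ((dot n ?z x / c) * y i + (- dot n ?y x / c) * z i))" for x
    unfolding ap mapply_add mapply_cmult by (simp add: fun_eq_iff field_simps diff_divide_distrib)
  then show "\<exists>x'. mapply n D' x = mapply n D x'" for x by auto
  have "mapply n D' (mapply n D' x) = (\<lambda>_. 0)" for x
  proof -
    obtain x' where x': "mapply n D' x = mapply n D x'" using im by auto
    show ?thesis unfolding x' by (subst ap) (simp add: skew_nil_isotropic[OF D] skew_nil_sq[OF D])
  qed
  then have sq: "(\<Sum>k<n. D' i k * D' k j) = 0" if "j < n" for i j
  proof -
    have "(\<Sum>k<n. D' i k * D' k j) = mapply n D' (mapply n D' (\<lambda>i. if i = j then 1 else 0)) i"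
      unfolding mapply_delta[OF that] by (simp add: mapply_def)
    then show ?thesis by (simp add: \<open>\<And>x. mapply n D' (mapply n D' x) = (\<lambda>_. 0)\<close>)
  qed
  have skew: "D' i j = - D' j i" for i j
    unfolding D' wedge_def using skew_nilD(1)[OF D, of i j] by (simp add: diff_divide_distrib mult.commute)
  have out: "D' i j = 0" if "i \<ge> n" for i j
  proof -
    have "D i k = 0" for k using skew_nilD(2)[OF D that] .
    then show ?thesis by (simp add: D' wedge_def mapply_def)
  qed
  have sq': "(\<Sum>k<n. D' i k * D' k j) = 0" for i j
  proof (cases "j < n")
    case False
    then have "D' k j = 0" for k using out[of j k] skew[of k j] by simp
    then show ?thesis by simp
  qed (rule sq)
  show "skew_nil n D'" unfolding skew_nil_def by (intro conjI allI impI) (rule skew out sq', assumption?)+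
  show "D' j i = 0" if "\<forall>j. D j i = 0" for i
  proof -
    have "D i j = 0" for j using that skew_nilD(5)[OF D] by simp
    then have "?y i = 0" "?z i = 0" by (simp_all add: mapply_def)
    then show ?thesis using that by (simp add: D' wedge_def)
  qed
qed

text \<open>For the independence a relation is paired with \<open>y\<close> and with
  \<open>z\<close>. The old vectors lie in the image of \<open>D'\<close> and are orthogonal to
  both, while \<open>D y\<close> and \<open>D z\<close> pair with them to \<open>c\<close>,
  \<open>-c\<close> and 0.\<close>

lemma normal_form_extend:
  assumes D: "skew_nil n D" and c: "c = dot n z (mapply n D y)" "c \<noteq> 0"
    and D': "D' = (\<lambda>i j. D i j + wedge (mapply n D y) (mapply n D z) i j / c)"
    and nf: "normal_form n D' r w"
  shows "normal_form n D (Suc r) (w(2*r := (\<lambda>i. - mapply n D y i / (2*c)), Suc (2*r) := mapply n D z))"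
    (is "normal_form n D _ ?w")
proof -
  note split = skew_nil_split[OF D c D']
  let ?y = "mapply n D y" and ?z = "mapply n D z"
  have w: "\<exists>x. w a = mapply n D' x" if "a < 2*r" for a using nf that by (simp add: normal_form_def)
  have "\<exists>x. ?w a = mapply n D x" if "a < 2 * Suc r" for a
  proof -
    have "a < 2*r \<or> a = 2*r \<or> a = Suc (2*r)" using that by auto
    then consider "a < 2*r" | "a = 2*r" | "a = Suc (2*r)" by blast
    then show ?thesis
    proof cases
      case 1
      then show ?thesis using w[of a] split(4) by auto
    next
      case 2
      then show ?thesis using mapply_cmult[of n D "-1/(2*c)" y]
        by (intro exI[of _ "\<lambda>i. - 1 / (2*c) * y i"]) simp
    qed auto
  qed
  moreover have "indep (2 * Suc r) ?w"
    unfolding indep_def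
  proof (intro allI impI)
    fix b a assume b: "\<forall>i. (\<Sum>a<2 * Suc r. b a * ?w a i) = 0" and a: "a < 2 * Suc r"
    have eq: "(\<Sum>a<2 * Suc r. b a * ?w a i) = (\<Sum>a<2*r. b a * w a i) - b (2*r) / (2*c) * ?y i + b (Suc (2*r)) * ?z i" for i
      by simp
    have comb: "(\<Sum>a<2*r. b a * dot n (w a) x) - b (2*r) / (2*c) * dot n ?y x + b (Suc (2*r)) * dot n ?z x = 0" for x
    proof -
      have "dot n (\<lambda>i. (\<Sum>a<2*r. b a * w a i) - b (2*r) / (2*c) * ?y i + b (Suc (2*r)) * ?z i) x = dot n (\<lambda>_. 0) x"
        using b unfolding eq by simp
      then show ?thesis unfolding dot_left .
    qed
    have wyz: "dot n (w a) y = 0" "dot n (w a) z = 0" if a: "a < 2*r" for a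
    proof -
      obtain x where "w a = mapply n D' x" using w[OF a] by auto
      then show "dot n (w a) y = 0" "dot n (w a) z = 0"
        using skew_nil_dot[OF split(1), of x] split(2,3) by (simp_all add: dot_right)
    qed
    have dots: "dot n ?z y = - c" "dot n ?y z = c" "dot n ?y y = 0" "dot n ?z z = 0"
      using skew_nil_dot[OF D, of z y] skew_nil_self[OF D] by (simp_all add: c dot_commute)
    have b1: "b (2*r) = 0" using comb[of z] wyz c(2) dots by simp
    have b2: "b (Suc (2*r)) = 0" using comb[of y] wyz c(2) dots by simp
    have "(\<Sum>a<2*r. b a * w a i) = 0" for i using b eq[of i] b1 b2 by simp
    then have "\<forall>a<2*r. b a = 0" using nf indepD[of "2*r" w b] unfolding normal_form_def by simp
    then show "b a = 0" using b1 b2 a by (cases "a < 2*r") (auto simp: less_Suc_eq)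
  qed
  moreover have "D i j = (\<Sum>a<Suc r. 2 * wedge (?w (2*a)) (?w (Suc (2*a))) i j)" for i j
  proof -
    have "(\<Sum>a<r. 2 * wedge (?w (2*a)) (?w (Suc (2*a))) i j) = (\<Sum>a<r. 2 * wedge (w (2*a)) (w (Suc (2*a))) i j)"
    proof (intro sum.cong refl)
      fix a assume "a \<in> {..<r}"
      then have "2*a \<noteq> 2*r" "2*a \<noteq> Suc (2*r)" "Suc (2*a) \<noteq> 2*r" "Suc (2*a) \<noteq> Suc (2*r)" by auto
      then show "2 * wedge (?w (2*a)) (?w (Suc (2*a))) i j = 2 * wedge (w (2*a)) (w (Suc (2*a))) i j" by simp
    qed
    also have "\<dots> = D' i j" using nf unfolding normal_form_def by (elim conjE) metis
    finally have "(\<Sum>a<Suc r. 2 * wedge (?w (2*a)) (?w (Suc (2*a))) i j) = D' i j + 2 * wedge (\<lambda>i. - ?y i / (2*c)) ?z i j"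
      by simp
    also have "2 * wedge (\<lambda>i. - ?y i / (2*c)) ?z i j = - wedge ?y ?z i j / c"
      unfolding wedge_def using c(2) by (simp add: field_simps)
    finally show ?thesis by (simp add: D')
  qed
  ultimately show ?thesis unfolding normal_form_def by simp
qed

text \<open>Induction on the number of non-zero columns: with coordinate vectors for
  \<open>y\<close> and \<open>z\<close> at a non-zero entry, the split clears column
  \<open>j\<close> and creates no new one.\<close>

lemma normal_form_exists:
  assumes "skew_nil n D"
  shows "\<exists>r w. normal_form n D r w"
  using assms
proof (induction "card {j. \<exists>i. D i j \<noteq> 0}" arbitrary: D rule: less_induct)
  case less
  have D: "skew_nil n D" by (rule less.prems)
  show ?case
  proof (cases "\<forall>i j. D i j = 0")
    case True
    then show ?thesis by (intro exI[of _ 0]) (auto simp: normal_form_def indep_def)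
  next
    case False
    then obtain i j where ij: "D i j \<noteq> 0" by auto
    then have n: "i < n" "j < n" using skew_nilD(2,3)[OF D] by (meson not_le)+
    define y z :: "nat \<Rightarrow> complex" where "y = (\<lambda>k. if k = j then 1 else 0)" and "z = (\<lambda>k. if k = i then 1 else 0)"
    define c where "c = dot n z (mapply n D y)"
    have c: "c \<noteq> 0" unfolding c_def y_def z_def using n ij by (simp add: mapply_delta dot_delta_left)
    define D' where "D' = (\<lambda>i j. D i j + wedge (mapply n D y) (mapply n D z) i j / c)"
    note split = skew_nil_split[OF D c_def c D'_def]
    have col: "D' k j = 0" for k
      using split(2) n unfolding y_def by (simp add: mapply_delta fun_eq_iff)
    have "{j. \<exists>i. D' i j \<noteq> 0} \<subset> {j. \<exists>i. D i j \<noteq> 0}"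
    proof
      show "{j. \<exists>i. D' i j \<noteq> 0} \<subseteq> {j. \<exists>i. D i j \<noteq> 0}" using split(5) by auto
      show "{j. \<exists>i. D' i j \<noteq> 0} \<noteq> {j. \<exists>i. D i j \<noteq> 0}" using col ij by auto
    qed
    moreover have "finite {j. \<exists>i. D i j \<noteq> 0}"
    proof (rule finite_subset)
      show "{j. \<exists>i. D i j \<noteq> 0} \<subseteq> {..<n}"
      proof
        fix j assume "j \<in> {j. \<exists>i. D i j \<noteq> 0}"
        then obtain i where "D i j \<noteq> 0" by auto
        then show "j \<in> {..<n}" using skew_nilD(3)[OF D, of j i] unfolding lessThan_iff by (meson not_le)
      qed
    qed simp
    ultimately have "card {j. \<exists>i. D' i j \<noteq> 0} < card {j. \<exists>i. D i j \<noteq> 0}" by (simp add: psubset_card_mono)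
    then obtain r w where "normal_form n D' r w" using less.hyps[OF _ split(1)] by auto
    then show ?thesis using normal_form_extend[OF D c_def c D'_def] by auto
  qed
qed

lemma normal_form_isotropic:
  assumes "skew_nil n D" "normal_form n D r w" "a < 2*r"
  shows "supported n (w a)" "b < 2*r \<Longrightarrow> dot n (w a) (w b) = 0"
proof -
  obtain x where x: "w a = mapply n D x" using assms by (auto simp: normal_form_def)
  then show "supported n (w a)" using skew_nil_supported[OF assms(1)] by simp
  assume "b < 2*r"
  then obtain y where "w b = mapply n D y" using assms by (auto simp: normal_form_def)
  then show "dot n (w a) (w b) = 0" using x skew_nil_isotropic[OF assms(1)] by simp
qed

text \<open>Three positions of \<open>u\<close> are distinguished: zero, in the image of
  \<open>D\<close>, or outside it. In the second case the first split is made along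
  \<open>u\<close>, which places \<open>u\<close> in the last plane; in the third, \<open>u\<close>
  is isotropic and orthogonal to the image because \<open>D u = 0\<close>, and extends the frame.
  The factor -2 is that of the action of \<open>el0\<close>.\<close>

lemma skew_nil_standard_form:
  assumes D: "skew_nil (Suc (2*l)) D" and u: "supported (Suc (2*l)) u" "dot (Suc (2*l)) u u = 0" "mapply (Suc (2*l)) D u = (\<lambda>_. 0)"
  shows "\<exists>r vs. units (Suc (2*l)) vs \<and> 2*r \<le> l \<and>
     (\<forall>i j. D i j = (\<Sum>a<r. 2 * wedge (refls (Suc (2*l)) vs (iso_F (2*a))) (refls (Suc (2*l)) vs (iso_F (Suc (2*a)))) i j)) \<and>
     ((r = 0 \<and> u = (\<lambda>_. 0)) \<or>
      (r > 0 \<and> (\<exists>c. u = (\<lambda>i. - 2 * c * refls (Suc (2*l)) vs (iso_F (2*r-2)) i))) \<or>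
      (2*r < l \<and> u = (\<lambda>i. - 2 * refls (Suc (2*l)) vs (iso_F (2*r)) i)))"
proof -
  let ?n = "Suc (2*l)"
  have conclude: ?thesis if nf: "normal_form ?n D r w" and j: "2*r \<le> j" "\<And>a. a < j \<Longrightarrow> supported ?n (w a)"
      "\<And>a b. a < j \<Longrightarrow> b < j \<Longrightarrow> dot ?n (w a) (w b) = 0" "indep j w"
    and uw: "(r = 0 \<and> u = (\<lambda>_. 0)) \<or> (r > 0 \<and> (\<exists>c. u = (\<lambda>i. - 2 * c * w (2*r-2) i))) \<or>
      (2*r < j \<and> u = (\<lambda>i. - 2 * w (2*r) i))"
    for r w j
  proof -
    obtain vs where jl: "j \<le> l" and vs: "units ?n vs" "\<And>a. a < j \<Longrightarrow> refls ?n vs (w a) = iso_F a"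
      using witt[OF j(2-4)] by auto
    have w: "refls ?n (rev vs) (iso_F a) = w a" if "a < j" for a
      using vs(2)[OF that] refls_rev[OF vs(1), of "w a"] by simp
    have "D i k = (\<Sum>a<r. 2 * wedge (refls ?n (rev vs) (iso_F (2*a))) (refls ?n (rev vs) (iso_F (Suc (2*a)))) i k)" for i k
    proof -
      have "D i k = (\<Sum>a<r. 2 * wedge (w (2*a)) (w (Suc (2*a))) i k)" using nf by (simp add: normal_form_def)
      also have "\<dots> = (\<Sum>a<r. 2 * wedge (refls ?n (rev vs) (iso_F (2*a))) (refls ?n (rev vs) (iso_F (Suc (2*a)))) i k)"
        using j(1) by (intro sum.cong refl) (simp add: w)
      finally show ?thesis .
    qed
    moreover have "(r = 0 \<and> u = (\<lambda>_. 0)) \<or>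
      (r > 0 \<and> (\<exists>c. u = (\<lambda>i. - 2 * c * refls ?n (rev vs) (iso_F (2*r-2)) i))) \<or>
      (2*r < l \<and> u = (\<lambda>i. - 2 * refls ?n (rev vs) (iso_F (2*r)) i))"
    proof -
      have "w (2*r-2) = refls ?n (rev vs) (iso_F (2*r-2))" if "r > 0" using w[of "2*r-2"] j(1) that by simp
      moreover have "w (2*r) = refls ?n (rev vs) (iso_F (2*r))" "2*r < l" if "2*r < j" using w[of "2*r"] jl that by simp_all
      ultimately show ?thesis using uw by auto
    qed
    ultimately show ?thesis using vs(1) j(1) jl by (intro exI[of _ r] exI[of _ "rev vs"]) (simp add: units_rev)
  qed
  consider "u = (\<lambda>_. 0)" | y where "u \<noteq> (\<lambda>_. 0)" "u = mapply ?n D y" | "u \<noteq> (\<lambda>_. 0)" "\<And>y. u \<noteq> mapply ?n D y" by auto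
  then show ?thesis
  proof cases
    case 1
    obtain r w where nf: "normal_form ?n D r w" using normal_form_exists[OF D] by auto
    show ?thesis
    proof (rule conclude[OF nf order_refl])
      show "(r = 0 \<and> u = (\<lambda>_. 0)) \<or> (r > 0 \<and> (\<exists>c. u = (\<lambda>i. - 2 * c * w (2*r-2) i))) \<or>
          (2*r < 2*r \<and> u = (\<lambda>i. - 2 * w (2*r) i))"
        using 1 by (cases "r = 0") (auto intro!: exI[of _ 0])
      show "indep (2*r) w" using nf unfolding normal_form_def by blast
    qed (rule normal_form_isotropic[OF D nf]; assumption)+
  next
    case (2 y)
    then obtain i where i: "u i \<noteq> 0" by auto
    then have "i < ?n" using u(1) unfolding supported_def by (meson not_le)
    \<comment> \<open>The coordinate vector at a non-zero entry of \<open>u = D y\<close>; splitting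
      along \<open>y\<close> and this vector makes the first vector of the last pair proportional to
      \<open>u\<close>.\<close>
    define z :: "nat \<Rightarrow> complex" where "z = (\<lambda>k. if k = i then 1 else 0)"
    define c where "c = dot ?n z (mapply ?n D y)"
    have c: "c \<noteq> 0" unfolding c_def z_def 2(2)[symmetric] using \<open>i < ?n\<close> i by (simp add: dot_delta_left)
    define D' where "D' = (\<lambda>i j. D i j + wedge (mapply ?n D y) (mapply ?n D z) i j / c)"
    note split = skew_nil_split[OF D c_def c D'_def]
    obtain r w where "normal_form ?n D' r w" using normal_form_exists[OF split(1)] by auto
    note nf = normal_form_extend[OF D c_def c D'_def this]
    let ?w = "w(2*r := (\<lambda>i. - mapply ?n D y i / (2*c)), Suc (2*r) := mapply ?n D z)"
    show ?thesis
    proof (rule conclude[OF nf order_refl])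
      have "u = (\<lambda>i. - 2 * c * ?w (2 * Suc r - 2) i)" using c 2(2) by simp
      then show "(Suc r = 0 \<and> u = (\<lambda>_. 0)) \<or> (Suc r > 0 \<and> (\<exists>c. u = (\<lambda>i. - 2 * c * ?w (2*Suc r-2) i))) \<or>
          (2*Suc r < 2*Suc r \<and> u = (\<lambda>i. - 2 * ?w (2*Suc r) i))" by blast
      show "indep (2*Suc r) ?w" using nf unfolding normal_form_def by blast
    qed (rule normal_form_isotropic[OF D nf]; assumption)+
  next
    case 3
    obtain r w where nf: "normal_form ?n D r w" using normal_form_exists[OF D] by auto
    have im: "\<exists>x. w a = mapply ?n D x" if "a < 2*r" for a using nf that by (simp add: normal_form_def)
    define w' where "w' = w(2*r := (\<lambda>i. - u i / 2))"
    have w'w: "w' a = w a" if "a < 2*r" for a using that by (simp add: w'_def)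
    have w'r: "w' (2*r) = (\<lambda>i. (-1/2) * u i)" by (simp add: w'_def)
    have nf': "normal_form ?n D r w'"
    proof -
      have "indep (2*r) w' = indep (2*r) w" unfolding indep_def using w'w by simp
      moreover have "wedge (w' (2*a)) (w' (Suc (2*a))) = wedge (w (2*a)) (w (Suc (2*a)))" if "a < r" for a
        using w'w[of "2*a"] w'w[of "Suc (2*a)"] that by simp
      ultimately show ?thesis using nf w'w by (simp add: normal_form_def)
    qed
    show ?thesis
    proof (rule conclude[OF nf', of "Suc (2*r)"])
      show "supported ?n (w' a)" if "a < Suc (2*r)" for a
        using that normal_form_isotropic(1)[OF D nf, of a] u(1) w'r w'w[of a]
        by (cases "a < 2*r") (auto simp: supported_def less_Suc_eq)
      have dot_w'r: "dot ?n (w' (2*r)) x = (-1/2) * dot ?n u x" "dot ?n x (w' (2*r)) = (-1/2) * dot ?n x u" for x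
        unfolding w'r by (rule dot_cmult_left dot_right(3))+
      have uw: "dot ?n u (w a) = 0" if a: "a < 2*r" for a
      proof -
        obtain x where "w a = mapply ?n D x" using im[OF a] by auto
        then show ?thesis using skew_nil_dot[OF D, of u x] u(3) by (simp add: dot_left)
      qed
      show "dot ?n (w' a) (w' b) = 0" if "a < Suc (2*r)" "b < Suc (2*r)" for a b
        using that uw[of a] uw[of b] normal_form_isotropic(2)[OF D nf, of a b] u(2) w'w[of a] w'w[of b]
          dot_commute[of ?n "w a" u] dot_w'r
        by (cases "a < 2*r"; cases "b < 2*r") (auto simp: less_Suc_eq)
      show "indep (Suc (2*r)) w'" unfolding indep_def
      proof (intro allI impI)
        fix b a assume b: "\<forall>i. (\<Sum>a<Suc (2*r). b a * w' a i) = 0" and a: "a < Suc (2*r)"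
        have eq: "(\<Sum>a<2*r. b a * w a i) = b (2*r) / 2 * u i" for i using b[rule_format, of i] w'w w'r by simp
        \<comment> \<open>A non-zero coefficient of \<open>u\<close> would express it through the
          vectors \<open>w a\<close>, which are values of \<open>D\<close>, contrary to the
          case.\<close>
        have "b (2*r) = 0"
        proof (rule ccontr)
          assume b0: "b (2*r) \<noteq> 0"
          obtain x where x: "\<And>a. a < 2*r \<Longrightarrow> w a = mapply ?n D (x a)" using im by metis
          have "u i = mapply ?n D (\<lambda>k. \<Sum>a<2*r. 2 * b a / b (2*r) * x a k) i" for i
          proof -
            have "mapply ?n D (\<lambda>k. \<Sum>a<2*r. 2 * b a / b (2*r) * x a k) i
                = (\<Sum>a<2*r. 2 * b a / b (2*r) * mapply ?n D (x a) i)"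
              unfolding mapply_def sum_distrib_left by (subst sum.swap) (simp add: mult_ac)
            also have "\<dots> = (\<Sum>a<2*r. 2 / b (2*r) * (b a * w a i))" using x by (intro sum.cong) auto
            also have "\<dots> = 2 / b (2*r) * (b (2*r) / 2 * u i)" by (simp only: sum_distrib_left[symmetric] eq)
            finally show ?thesis using b0 by simp
          qed
          then show False using 3(2) by blast
        qed
        then have "\<forall>i. (\<Sum>a<2*r. b a * w a i) = 0" using eq by simp
        then have "\<forall>a<2*r. b a = 0" using nf indepD[of "2*r" w b] unfolding normal_form_def by simp
        then show "b a = 0" using a \<open>b (2*r) = 0\<close> by (auto simp: less_Suc_eq)
      qed
    qed (use w'r in auto)
  qed
qed

subsection \<open>The closure of the maximal orbit\<close>

lemma skew_nil_mat_iff: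
  assumes A: "A \<in> carrier_mat n n"
  shows "skew_nil n (\<lambda>i j. mat_coords A (i, j)) \<longleftrightarrow> A \<in> skew_mats n \<and> A * A = 0\<^sub>m n n"
proof -
  have 1: "A \<in> skew_mats n \<longleftrightarrow> (\<forall>i<n. \<forall>j<n. A $$ (j, i) = - A $$ (i, j))"
    using A by (auto simp: skew_mats_def mat_eq_iff)
  have 2: "A * A = 0\<^sub>m n n \<longleftrightarrow> (\<forall>i<n. \<forall>j<n. (\<Sum>k<n. A $$ (i, k) * A $$ (k, j)) = 0)"
    using A by (simp add: mat_eq_iff scalar_prod_def lessThan_atLeast0)
  have 3: "(\<forall>i j. mat_coords A (i, j) = - mat_coords A (j, i)) \<longleftrightarrow> (\<forall>i<n. \<forall>j<n. A $$ (j, i) = - A $$ (i, j))"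
    using A by (auto simp: mat_coords_def)
  have 4: "(\<Sum>k<n. mat_coords A (i, k) * mat_coords A (k, j)) =
      (if i < n \<and> j < n then (\<Sum>k<n. A $$ (i, k) * A $$ (k, j)) else 0)" for i j
    using A by (auto simp: mat_coords_def)
  have 5: "n \<le> i \<longrightarrow> mat_coords A (i, j) = 0" for i j using A by (auto simp: mat_coords_def)
  have "(\<forall>i j. (if i < n \<and> j < n then (\<Sum>k<n. A $$ (i, k) * A $$ (k, j)) else 0) = 0) \<longleftrightarrow>
      (\<forall>i<n. \<forall>j<n. (\<Sum>k<n. A $$ (i, k) * A $$ (k, j)) = 0)" by auto
  then show ?thesis unfolding skew_nil_def 1 2 3 4 using 5 by blast
qed

lemma mult_mat_entry:
  "A \<in> carrier_mat r n \<Longrightarrow> B \<in> carrier_mat n c \<Longrightarrow> i < r \<Longrightarrow> j < c \<Longrightarrow> (A * B) $$ (i, j) = (\<Sum>k<n. A $$ (i, k) * B $$ (k, j))"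
  by (simp add: scalar_prod_def lessThan_atLeast0)

lemma zclosed_skew_nil: "zclosed {v. skew_nil n (\<lambda>i j. v (i, j))}"
proof -
  let ?F = "(\<lambda>(i, j) v. v (i, j) + v (j, i)) ` UNIV \<union> (\<lambda>(i, j) v. if n \<le> i then v (i, j) else 0) ` UNIV \<union>
    (\<lambda>(i, j) v. \<Sum>k<n. v (i, k) * v (k, j)) ` UNIV :: ((nat \<times> nat \<Rightarrow> complex) \<Rightarrow> complex) set"
  have F: "?F \<subseteq> polyfun" by (auto intro!: polyfun_intros)
  have "{v. skew_nil n (\<lambda>i j. v (i, j))} = {v. \<forall>f\<in>?F. f v = 0}"
    unfolding ball_Un ball_simps skew_nil_def by (auto simp: eq_neg_iff_add_eq_0)
  then show ?thesis using zclosedI[OF F] by simp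
qed

section \<open>Jordan type of matrices of square zero\<close>

lemma jordan_matrix_two_one:
  "i < 2*K + m \<Longrightarrow> j < 2*K + m \<Longrightarrow> jordan_matrix (replicate K (2, 0) @ replicate m (1, 0)) $$ (i, j) =
    (if j < 2*K \<and> odd j \<and> Suc i = j then 1 else 0 :: 'a::{zero,one})"
proof (induction K arbitrary: i j)
  case 0
  have "i < m \<Longrightarrow> j < m \<Longrightarrow> jordan_matrix (replicate m (1, 0 :: 'a)) $$ (i, j) = 0"
  proof (induction m arbitrary: i j)
    case (Suc m)
    have "jordan_matrix (replicate (Suc m) (1, 0 :: 'a)) = four_block_mat (jordan_block 1 0)
       (0\<^sub>m 1 m) (0\<^sub>m m 1) (jordan_matrix (replicate m (1, 0)))"
      by (simp add: jordan_matrix_def Let_def dim_diag_block_mat sum_list_replicate)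
    then show ?case using Suc by (simp add: sum_list_replicate)
  qed simp
  then show ?case using 0 by simp
next
  case (Suc K)
  define M where "M = jordan_matrix (replicate K (2, 0 :: 'a) @ replicate m (1, 0))"
  have M: "dim_row M = 2*K + m" "dim_col M = 2*K + m"
    by (simp_all add: M_def sum_list_replicate)
  have J: "jordan_matrix (replicate (Suc K) (2, 0 :: 'a) @ replicate m (1, 0)) =
      four_block_mat (jordan_block 2 0) (0\<^sub>m 2 (2*K + m)) (0\<^sub>m (2*K + m) 2) M"
    using M unfolding M_def by (simp add: jordan_matrix_def Let_def)
  show ?case
  proof (cases "2 \<le> i \<and> 2 \<le> j")
    case True
    then obtain i' j' where ij: "i = Suc (Suc i')" "j = Suc (Suc j')" by (metis add_2_eq_Suc le_Suc_ex)
    have "M $$ (i', j') = (if j' < 2*K \<and> odd j' \<and> Suc i' = j' then 1 else 0)"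
      unfolding M_def by (rule Suc.IH) (use Suc.prems ij in auto)
    then show ?thesis unfolding J using Suc.prems by (simp add: M ij)
  next
    case False
    then show ?thesis unfolding J using Suc.prems by (auto simp: M less_2_cases_iff)
  qed
qed

text \<open>The vectors \<open>p j\<close> are the columns of the base change, and the dual system
  \<open>q\<close> provides its inverse without computing a determinant.\<close>

lemma jordan_nf_two_oneI:
  assumes n: "2*K \<le> n" and dual: "\<And>i j. i < n \<Longrightarrow> j < n \<Longrightarrow> dot n (q i) (p j) = (if i = j then 1 else 0)"
    and D: "\<And>i j. i < n \<Longrightarrow> j < n \<Longrightarrow> mapply n D (p j) i = (if j < 2*K \<and> odd j then p (j - 1) i else 0)"
  shows "jordan_nf (mat n n (\<lambda>(i, j). D i j)) (replicate K (2, 0) @ replicate (n - 2*K) (1, 0))"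
proof -
  define J where "J = (jordan_matrix (replicate K (2, 0) @ replicate (n - 2*K) (1, 0)) :: complex mat)"
  define A where "A = mat n n (\<lambda>(i, j). D i j)"
  define P where "P = mat n n (\<lambda>(i, j). p j i)"
  define Q where "Q = mat n n (\<lambda>(i, j). q i j)"
  have c: "A \<in> carrier_mat n n" "P \<in> carrier_mat n n" "Q \<in> carrier_mat n n" by (auto simp: A_def P_def Q_def)
  have J: "J \<in> carrier_mat n n" using n jordan_matrix_carrier[of "replicate K (2, 0) @ replicate (n - 2*K) (1, 0 :: complex)"]
    by (simp add: J_def sum_list_replicate)
  have Jij: "J $$ (i, j) = (if j < 2*K \<and> odd j \<and> Suc i = j then 1 else 0)" if "i < n" "j < n" for i j
    unfolding J_def by (rule jordan_matrix_two_one) (use that n in auto)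
  have QP: "Q * P = 1\<^sub>m n"
    by (rule eq_matI) (simp_all add: Q_def P_def scalar_prod_def lessThan_atLeast0[symmetric] dual[unfolded dot_def])
  then have PQ: "P * Q = 1\<^sub>m n" by (rule mat_mult_left_right_inverse[OF c(3,2)])
  have "A * P = P * J"
  proof (rule eq_matI)
    fix i j assume "i < dim_row (P * J)" "j < dim_col (P * J)"
    then have ij: "i < n" "j < n" using c J by auto
    have "(P * J) $$ (i, j) = (\<Sum>k<n. p k i * J $$ (k, j))"
      unfolding mult_mat_entry[OF c(2) J ij] using ij by (simp add: P_def)
    also have "\<dots> = (\<Sum>k<n. if k = j - 1 then (if j < 2*K \<and> odd j then p (j - 1) i else 0) else 0)"
      by (rule sum.cong) (use ij in \<open>auto simp: Jij\<close>)
    also have "\<dots> = mapply n D (p j) i" using ij D[OF ij] by (simp add: less_imp_diff_less)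
    also have "\<dots> = (A * P) $$ (i, j)"
      using ij by (simp add: A_def P_def scalar_prod_def lessThan_atLeast0[symmetric] mapply_def)
    finally show "(A * P) $$ (i, j) = (P * J) $$ (i, j)" by simp
  qed (use c J in auto)
  then have "P * J * Q = A * (P * Q)" using c by (metis assoc_mult_mat)
  then have "A = P * J * Q" using PQ c by simp
  then have "similar_mat A J" unfolding similar_mat_def similar_mat_wit_def Let_def
    using c J PQ QP by (intro exI[of _ P] exI[of _ Q]) simp
  then show ?thesis unfolding jordan_nf_def A_def J_def by auto
qed

lemma jordan_nf_two_one_square:
  assumes A: "A \<in> carrier_mat n n" and n: "2*K \<le> n" and J: "jordan_nf A (replicate K (2, 0) @ replicate (n - 2*K) (1, 0 :: complex))"
  shows "A * A = 0\<^sub>m n n"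
proof -
  define J where "J = (jordan_matrix (replicate K (2, 0) @ replicate (n - 2*K) (1, 0)) :: complex mat)"
  have Jc: "J \<in> carrier_mat n n" using n jordan_matrix_carrier[of "replicate K (2, 0) @ replicate (n - 2*K) (1, 0 :: complex)"]
    by (simp add: J_def sum_list_replicate)
  have Jij: "J $$ (i, j) = (if j < 2*K \<and> odd j \<and> Suc i = j then 1 else 0)" if "i < n" "j < n" for i j
    unfolding J_def by (rule jordan_matrix_two_one) (use that n in auto)
  obtain P Q where PQ: "P \<in> carrier_mat n n" "Q \<in> carrier_mat n n" "Q * P = 1\<^sub>m n" "A = P * J * Q"
    using J A unfolding jordan_nf_def J_def[symmetric] similar_mat_def similar_mat_wit_def Let_def by auto
  have JJ: "J * J = 0\<^sub>m n n"
  proof (rule eq_matI)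
    fix i j assume "i < dim_row (0\<^sub>m n n :: complex mat)" "j < dim_col (0\<^sub>m n n :: complex mat)"
    then have ij: "i < n" "j < n" by auto
    have "(J * J) $$ (i, j) = (\<Sum>k<n. J $$ (i, k) * J $$ (k, j))"
      by (rule mult_mat_entry[OF Jc Jc ij])
    also have "\<dots> = 0"
      by (rule sum.neutral) (use ij in \<open>auto simp: Jij\<close>)
    finally show "(J * J) $$ (i, j) = 0\<^sub>m n n $$ (i, j)" using ij by simp
  qed (use Jc in auto)
  have "A * A = P * J * (Q * P) * (J * Q)"
    unfolding PQ(4) using PQ(1,2) Jc by (simp add: assoc_mult_mat[of _ n n _ n _ n])
  also have "\<dots> = P * (J * J) * Q"
    unfolding PQ(3) using PQ(1,2) Jc by (simp add: assoc_mult_mat[of _ n n _ n _ n])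
  finally show ?thesis unfolding JJ using PQ(1,2) by simp
qed

text \<open>The involution exchanging \<open>2*a\<close> and \<open>Suc (2*a)\<close>, the two
  indices of one plane.\<close>

definition partner :: "nat \<Rightarrow> nat" where
  "partner b = (if even b then Suc b else b - 1)"

lemma partner_less: "even K \<Longrightarrow> b < K \<Longrightarrow> partner b < K" and partner_eq: "partner a = partner b \<longleftrightarrow> a = b"
  unfolding partner_def by (auto elim!: evenE oddE) presburger+

lemma sum_double: "(\<Sum>b<2*k. f b) = (\<Sum>a<k. f (2*a) + f (Suc (2*a)) :: 'a::comm_monoid_add)" for k :: nat
  by (induction k) (simp_all add: add_ac)

text \<open>The bivector of plane \<open>a\<close> maps \<open>iso_G (Suc (2*a))\<close> to a
  multiple of \<open>iso_F (2*a)\<close>, and \<open>iso_G (2*a)\<close> to a multiple of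
  \<open>iso_F (Suc (2*a))\<close>. Each \<open>iso_F b\<close> with its preimage
  \<open>iso_G (partner b)\<close> therefore gives a Jordan block of size 2, and the remaining
  coordinate vectors are in the kernel. The reflections transport this basis.\<close>

lemma jordan_nf_wedges:
  assumes vs: "units (Suc (2*l)) vs" and k: "2*k \<le> l" and d: "\<And>a. a < k \<Longrightarrow> d a \<noteq> 0"
    and w: "w = (\<lambda>a. refls (Suc (2*l)) vs (iso_F a))"
    and D: "D = (\<lambda>i j. \<Sum>a<k. d a * wedge (w (2*a)) (w (Suc (2*a))) i j)"
  shows "jordan_nf (mat (Suc (2*l)) (Suc (2*l)) (\<lambda>(i, j). D i j)) (replicate (2*k) (2, 0) @ replicate (Suc (2*l) - 2*(2*k)) (1, 0))"
proof -
  let ?n = "Suc (2*l)"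
  define R where "R = refls ?n vs"
  \<comment> \<open>The factor 1/2 is the pairing of \<open>iso_F\<close> with \<open>iso_G\<close>;
    the sign depends on the position of the vector in the bivector.\<close>
  define s where "s b = (if even b then d (b div 2) / 2 else - d (b div 2) / 2)" for b
  have s: "s b \<noteq> 0" if "b < 2*k" for b using d[of "b div 2"] that by (auto simp: s_def)
  \<comment> \<open>The planes occupy the coordinates from 1 to \<open>4*k\<close>, but their Jordan
    chains the indices below \<open>4*k\<close>. Index \<open>4*k\<close> therefore stands for
    coordinate 0.\<close>
  define e :: "nat \<Rightarrow> nat \<Rightarrow> complex" where "e j = (\<lambda>i. if i = (if j = 4*k then 0 else j) then 1 else 0)" for j
  define p where "p j = (if j < 4*k then if even j then (\<lambda>i. s (j div 2) * iso_F (j div 2) i) else iso_G (partner (j div 2)) else e j)" for j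
  define q where "q j = (if j < 4*k then if even j then (\<lambda>i. 2 / s (j div 2) * iso_G (j div 2) i) else (\<lambda>i. 2 * iso_F (partner (j div 2)) i) else e j)" for j
  have iso: "dot ?n (iso_F a) (iso_F b) = 0" "dot ?n (iso_G a) (iso_G b) = 0"
    "dot ?n (iso_F a) (iso_G b) = (if a = b then 1/2 else 0)" "dot ?n (iso_G a) (iso_F b) = (if a = b then 1/2 else 0)"
    if "a < 2*k" for a b
    using dot_iso_iso[of a l b] that k by auto
  have ed: "dot ?n (e j) x = x (if j = 4*k then 0 else j)" "dot ?n x (e j) = x (if j = 4*k then 0 else j)" if "j < ?n" for j x
    unfolding e_def using that by (auto intro: dot_delta_left dot_delta_right)
  have F0: "iso_F b (if j = 4*k then 0 else j) = 0" "iso_G b (if j = 4*k then 0 else j) = 0" if "b < 2*k" "\<not> j < 4*k" for b j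
    using that by (auto simp: iso_F_def iso_G_def)
  have half: "j div 2 < 2*k" "partner (j div 2) < 2*k" if "j < 4*k" for j
    using that partner_less[of "2*k" "j div 2"] by auto
  have p: "p (2*b) = (\<lambda>i. s b * iso_F b i)" "p (Suc (2*b)) = iso_G (partner b)"
    and q: "q (2*b) = (\<lambda>i. 2 / s b * iso_G b i)" "q (Suc (2*b)) = (\<lambda>i. 2 * iso_F (partner b) i)" if "b < 2*k" for b
    using that by (simp_all add: p_def q_def)
  have pq': "p j = e j" "q j = e j" if "\<not> j < 4*k" for j using that by (simp_all add: p_def q_def)
  note pl = partner_less[of "2*k", simplified]
  have cases: "(\<exists>b<2*k. j = 2*b) \<or> (\<exists>b<2*k. j = Suc (2*b)) \<or> \<not> j < 4*k" for j by presburger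
  have neq: "2*a \<noteq> Suc (2*b)" "Suc (2*b) \<noteq> 2*a" for a b :: nat by presburger+
  have dual: "dot ?n (q i) (p j) = (if i = j then 1 else 0)" if ij: "i < ?n" "j < ?n" for i j
    using cases[of i] cases[of j]
  proof (elim disjE exE conjE)
    fix a b assume "a < 2*k" "i = 2*a" "b < 2*k" "j = 2*b"
    then show ?thesis using s[of b] by (simp only: p q dot_left dot_right iso) auto
  next
    fix a b assume "a < 2*k" "i = 2*a" "b < 2*k" "j = Suc (2*b)"
    then show ?thesis by (simp only: p q dot_left dot_right iso neq mult_zero_right if_False)
  next
    fix a assume a: "a < 2*k" "i = 2*a" "\<not> j < 4*k"
    then show ?thesis using F0[of a j] by (simp add: q pq' ed(2)[OF ij(2)])
  next
    fix a b assume "a < 2*k" "i = Suc (2*a)" "b < 2*k" "j = 2*b"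
    then show ?thesis by (simp only: p q dot_left dot_right iso pl neq mult_zero_right if_False)
  next
    fix a b assume "a < 2*k" "i = Suc (2*a)" "b < 2*k" "j = Suc (2*b)"
    then show ?thesis by (simp add: p q dot_left dot_right iso pl partner_eq)
  next
    fix a assume a: "a < 2*k" "i = Suc (2*a)" "\<not> j < 4*k"
    then show ?thesis using F0[OF pl[OF a(1)], of j] by (simp add: q pq' ed(2)[OF ij(2)])
  next
    fix a assume a: "\<not> i < 4*k" "a < 2*k" "j = 2*a"
    then show ?thesis using F0[of a i] by (simp add: p pq' ed(1)[OF ij(1)])
  next
    fix a assume a: "\<not> i < 4*k" "a < 2*k" "j = Suc (2*a)"
    then show ?thesis using F0[OF pl[OF a(2)], of i] by (simp add: p pq' ed(1)[OF ij(1)])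
  next
    assume a: "\<not> i < 4*k" "\<not> j < 4*k"
    show ?thesis unfolding pq'(1)[OF a(2)] pq'(2)[OF a(1)] ed(1)[OF ij(1)] using a by (auto simp: e_def)
  qed
  have "dot ?n (R (q i)) (R (p j)) = (if i = j then 1 else 0)" if "i < ?n" "j < ?n" for i j
    unfolding R_def refls_dot[OF vs] using dual that by simp
  moreover have "mapply ?n D (R (p j)) i = (if j < 2*(2*k) \<and> odd j then R (p (j - 1)) i else 0)" if "i < ?n" "j < ?n" for i j
  proof -
    have "mapply ?n D x i = (\<Sum>a<k. d a * mapply ?n (wedge (w (2*a)) (w (Suc (2*a)))) x i)" for x
      unfolding D mapply_def sum_distrib_left sum_distrib_right by (subst sum.swap) (simp only: mult.assoc)
    note Dx0 = this
    have Dx: "mapply ?n D (R x) i = (\<Sum>a<k. d a * (w (2*a) i * dot ?n (iso_F (Suc (2*a))) x - w (Suc (2*a)) i * dot ?n (iso_F (2*a)) x))" for x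
      using Dx0[of "R x"] unfolding mapply_wedge w R_def refls_dot[OF vs] .
    consider "\<not> j < 4*k" | "j < 4*k" "even j" | "j < 4*k" "odd j" by blast
    then show ?thesis
    proof cases
      case 1
      then show ?thesis unfolding Dx p_def using F0[OF _ 1] ed(2)[OF that(2)] by (auto intro!: sum.neutral)
    next
      case 2
      then show ?thesis unfolding Dx p_def by (auto intro!: sum.neutral simp: dot_right iso)
    next
      case 3
      define b where "b = j div 2"
      have b: "b < 2*k" "j = Suc (2*b)" using 3 by (auto simp: b_def)
      have Rp: "R (p (j - 1)) i = s b * w b i"
        using b unfolding p_def w R_def using refls_sum[of ?n vs "\<lambda>_. s b" "\<lambda>_. iso_F b" "{0::nat}"] by simp
      have "mapply ?n D (R (p j)) i = (\<Sum>a<k. if a = b div 2 then s b * w b i else 0)"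
        unfolding Dx
      proof (rule sum.cong)
        fix a assume "a \<in> {..<k}"
        then have a: "2*a < 2*k" "Suc (2*a) < 2*k" by auto
        have pj: "p j = iso_G (partner b)" using b by (simp add: p_def)
        show "d a * (w (2*a) i * dot ?n (iso_F (Suc (2*a))) (p j) - w (Suc (2*a)) i * dot ?n (iso_F (2*a)) (p j)) =
          (if a = b div 2 then s b * w b i else 0)"
          unfolding pj iso(3)[OF a(1)] iso(3)[OF a(2)]
          by (cases "even b") (auto simp: partner_def s_def elim!: evenE oddE)
      qed simp
      also have "\<dots> = s b * w b i" using b by simp
      finally show ?thesis using 3 Rp by simp
    qed
  qed
  ultimately show ?thesis by (intro jordan_nf_two_oneI[where p = "\<lambda>j. R (p j)" and q = "\<lambda>j. R (q j)"]) (use k in auto)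
qed


lemma sum_product_swap:
  "(\<Sum>k\<in>C. (\<Sum>a\<in>A. f a k) * (\<Sum>b\<in>B. g b k)) = (\<Sum>a\<in>A. \<Sum>b\<in>B. \<Sum>k\<in>C. f a k * g b k :: 'a::semiring_0)"
  unfolding sum_product by (subst sum.swap) (intro sum.cong refl, rule sum.swap)

lemma skew_nil_wedges:
  assumes w: "\<And>a. a < 2*r \<Longrightarrow> supported n (w a)" "\<And>a b. a < 2*r \<Longrightarrow> b < 2*r \<Longrightarrow> dot n (w a) (w b) = 0"
  shows "skew_nil n (\<lambda>i j. \<Sum>a<r. d a * wedge (w (2*a)) (w (Suc (2*a))) i j)" (is "skew_nil n ?D")
proof -
  have "?D i j = - ?D j i" for i j by (simp add: wedge_def sum_negf[symmetric] algebra_simps)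
  moreover have "?D i j = 0" if "n \<le> i" for i j
    using w(1) that by (auto intro!: sum.neutral simp: supported_def wedge_def)
  moreover have "(\<Sum>k<n. ?D i k * ?D k j) = 0" for i j
  proof -
    have "(\<Sum>k<n. wedge (w (2*a)) (w (Suc (2*a))) i k * wedge (w (2*b)) (w (Suc (2*b))) k j) = 0" if "a < r" "b < r" for a b
    proof -
      have d: "dot n (w x) (w y) = 0" if "x \<in> {2*a, Suc (2*a)}" "y \<in> {2*b, Suc (2*b)}" for x y
        using w(2)[of x y] that \<open>a < r\<close> \<open>b < r\<close> by auto
      have "(\<Sum>k<n. wedge p q i k * wedge p' q' k j) = p i * dot n q p' * q' j - p i * dot n q q' * p' j - q i * dot n p p' * q' j + q i * dot n p q' * p' j"
        for p q p' q' :: "nat \<Rightarrow> complex"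
        unfolding dot_def wedge_def sum_distrib_left sum_distrib_right sum_subtractf[symmetric] sum.distrib[symmetric]
        by (rule sum.cong) (simp_all add: algebra_simps)
      then show ?thesis using d by simp
    qed
    note z = this
    have "(\<Sum>k<n. ?D i k * ?D k j) = (\<Sum>a<r. \<Sum>b<r. d a * d b * (\<Sum>k<n. wedge (w (2*a)) (w (Suc (2*a))) i k * wedge (w (2*b)) (w (Suc (2*b))) k j))"
      unfolding sum_product_swap by (simp add: sum_distrib_left mult_ac)
    also have "\<dots> = 0" by (intro sum.neutral ballI) (simp add: z)
    finally show ?thesis .
  qed
  ultimately show ?thesis unfolding skew_nil_def by blast
qed

lemma mat_coords_mat: "supported n (\<lambda>i. D i j) \<Longrightarrow> supported n (D i) \<Longrightarrow> mat_coords (mat n n (\<lambda>(i, j). D i j)) (i, j) = D i j"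
  by (auto simp: mat_coords_def supported_def)

lemma Max_even: "Max {k. even k \<and> k \<le> l} = 2 * (l div 2)" for l :: nat
proof (rule Max_eqI)
  show "finite {k. even k \<and> k \<le> l}" by (rule finite_subset[of _ "{..l}"]) auto
qed (auto elim!: evenE)

text \<open>A matrix of smaller rank is a limit of matrices of maximal rank: complete the isotropic
  frame of its image and give the additional planes a small weight.\<close>

lemma max_order2_variety_eq:
  "max_order2_variety l = {A \<in> skew_mats (Suc (2*l)). A * A = 0\<^sub>m (Suc (2*l)) (Suc (2*l))}"
proof (intro Set.set_eqI iffI)
  let ?n = "Suc (2*l)"
  let ?O = "order2_orbit l (2 * (l div 2))"
  have mv: "A \<in> max_order2_variety l \<longleftrightarrow> A \<in> carrier_mat ?n ?n \<and> mat_coords A \<in> zclosure (mat_coords ` ?O)" for A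
    unfolding max_order2_variety_def Max_even by simp
  have k4: "2 * (2 * (l div 2)) \<le> ?n" by presburger
  {
    fix A assume "A \<in> max_order2_variety l"
    then have A: "A \<in> carrier_mat ?n ?n" "mat_coords A \<in> zclosure (mat_coords ` ?O)" using mv by auto
    have "skew_nil ?n (\<lambda>i j. mat_coords B (i, j))" if "B \<in> ?O" for B
    proof -
      have B: "B \<in> skew_mats ?n" "jordan_nf B (replicate (2 * (l div 2)) (2, 0) @ replicate (?n - 2 * (2 * (l div 2))) (1, 0))"
        using that unfolding order2_orbit_def by simp_all
      then have "B \<in> carrier_mat ?n ?n" by (simp add: skew_mats_def)
      then show ?thesis using skew_nil_mat_iff jordan_nf_two_one_square[OF _ k4 B(2)] B(1) by blast
    qed
    then have "zclosure (mat_coords ` ?O) \<subseteq> {v. skew_nil ?n (\<lambda>i j. v (i, j))}"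
      by (intro zclosure_minimal zclosed_skew_nil) auto
    then have "skew_nil ?n (\<lambda>i j. mat_coords A (i, j))" using A(2) by blast
    then show "A \<in> {A \<in> skew_mats ?n. A * A = 0\<^sub>m ?n ?n}" using skew_nil_mat_iff[OF A(1)] by simp
  }
  fix A assume "A \<in> {A \<in> skew_mats ?n. A * A = 0\<^sub>m ?n ?n}"
  then have A: "A \<in> carrier_mat ?n ?n" "A \<in> skew_mats ?n" "A * A = 0\<^sub>m ?n ?n" by (auto simp: skew_mats_def)
  define D where "D = (\<lambda>i j. mat_coords A (i, j))"
  have "skew_nil ?n D" unfolding D_def skew_nil_mat_iff[OF A(1)] using A by simp
  then obtain r vs where vs: "units ?n vs" and r: "2*r \<le> l"
    and Dw: "\<And>i j. D i j = (\<Sum>a<r. 2 * wedge (refls ?n vs (iso_F (2*a))) (refls ?n vs (iso_F (Suc (2*a)))) i j)"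
    using skew_nil_standard_form[of l D "\<lambda>_. 0"] by (auto simp: supported_def dot_left mapply_def)
  define w where "w = (\<lambda>a. refls ?n vs (iso_F a))"
  define W where "W a i j = wedge (w (2*a)) (w (Suc (2*a))) i j" for a i j
  define k where "k = l div 2"
  have k: "2*k \<le> l" "r \<le> k" using r unfolding k_def by auto
  define E where "E t = (\<lambda>i j. \<Sum>a<k. (if a < r then 2 else t) * W a i j)" for t
  have supp: "supported ?n (w a)" if "a < 2*k" for a
    unfolding w_def using that k by (intro supported_refls[OF vs] supported_iso) auto
  have iso: "dot ?n (w a) (w b) = 0" if "a < 2*k" "b < 2*k" for a b
    unfolding w_def refls_dot[OF vs] using that k by (simp add: dot_iso_iso)
  have snE: "skew_nil ?n (E t)" for t unfolding E_def W_def by (rule skew_nil_wedges) (auto intro: supp iso)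
  define M where "M t = mat ?n ?n (\<lambda>(i, j). E t i j)" for t
  have cM: "mat_coords (M t) = (\<lambda>(i, j). E t i j)" for t
    unfolding M_def by (rule ext, clarify, rule mat_coords_mat) (auto simp: supported_def skew_nilD(2,3)[OF snE])
  have MO: "M t \<in> ?O" if "t \<noteq> 0" for t
  proof -
    have Mc: "M t \<in> carrier_mat ?n ?n" by (simp add: M_def)
    have "M t \<in> skew_mats ?n" using skew_nil_mat_iff[OF Mc] snE[of t] unfolding cM by simp
    moreover have "jordan_nf (M t) (replicate (2 * k) (2, 0) @ replicate (?n - 2 * (2 * k)) (1, 0))"
      unfolding M_def by (rule jordan_nf_wedges[OF vs k(1) _ w_def, of "\<lambda>a. if a < r then 2 else t"])
        (use that in \<open>auto simp: E_def W_def\<close>)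
    ultimately show ?thesis unfolding order2_orbit_def k_def by simp
  qed
  \<comment> \<open>The curve is affine in \<open>t\<close>: the planes of \<open>A\<close> keep
    weight 2, the added ones have weight \<open>t\<close>. It meets the maximal orbit for
    \<open>t \<noteq> 0\<close> and is \<open>A\<close> at \<open>t = 0\<close>.\<close>
  define c where "c = (\<lambda>(i, j). [:E 0 i j, \<Sum>a<k. if a < r then 0 else W a i j:])"
  have c: "(\<lambda>ij. poly (c ij) t) = mat_coords (M t)" for t
    unfolding cM c_def E_def
    by (rule ext, clarsimp simp: sum_distrib_left sum.distrib[symmetric], rule sum.cong) auto
  have E0: "mat_coords (M 0) = mat_coords A"
  proof (rule ext, clarify)
    fix i j
    have "E 0 i j = (\<Sum>a<r. 2 * W a i j)" unfolding E_def
      by (rule sum.mono_neutral_cong_right) (use k(2) in auto)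
    then show "mat_coords (M 0) (i, j) = mat_coords A (i, j)" using Dw[of i j] unfolding cM D_def W_def w_def by simp
  qed
  have "f (mat_coords A) = 0" if f: "f \<in> polyfun" "\<forall>s\<in>mat_coords ` ?O. f s = 0" for f
    using polyfun_eq_0_by_curve[OF f(1), of "{0}" c 0] f(2) MO unfolding c E0 by auto
  then show "A \<in> max_order2_variety l" unfolding mv mem_zclosure_iff using A(1) by blast
qed

subsection \<open>The dimension of the variety of skew matrices of square zero\<close>

text \<open>The product W X W^T, where the columns of W are the frame vectors. The single sum over
  pairs lets a product of two such expressions be reordered in one interchange.\<close>

definition frame_mat :: "nat \<Rightarrow> (nat \<Rightarrow> nat \<Rightarrow> complex) \<Rightarrow> (nat \<Rightarrow> nat \<Rightarrow> complex) \<Rightarrow> nat \<Rightarrow> nat \<Rightarrow> complex" where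
  "frame_mat K X w i j = (\<Sum>P\<in>{..<K} \<times> {..<K}. X (fst P) (snd P) * w (fst P) i * w (snd P) j)"

lemma frame_mat_sum: "frame_mat K X w i j = (\<Sum>a<K. \<Sum>b<K. X a b * w a i * w b j)"
  unfolding frame_mat_def sum.cartesian_product by (simp add: case_prod_beta)

lemma skew_nil_frame_mat:
  assumes X: "\<And>a b. a < K \<Longrightarrow> b < K \<Longrightarrow> X a b = - X b a"
    and w: "\<And>a. a < K \<Longrightarrow> supported n (w a)" "\<And>a b. a < K \<Longrightarrow> b < K \<Longrightarrow> dot n (w a) (w b) = 0"
  shows "skew_nil n (frame_mat K X w)"
proof -
  have "frame_mat K X w i j = - frame_mat K X w j i" for i j
  proof -
    have "frame_mat K X w i j = (\<Sum>b<K. \<Sum>a<K. X a b * w a i * w b j)" unfolding frame_mat_sum by (rule sum.swap)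
    also have "\<dots> = (\<Sum>b<K. \<Sum>a<K. - (X b a * w b j * w a i))"
    proof -
      have "X a b * w a i * w b j = - (X b a * w b j * w a i)" if "a < K" "b < K" for a b
        using X[OF that] by (simp add: mult_ac)
      then show ?thesis by simp
    qed
    finally show ?thesis by (simp add: frame_mat_sum sum_negf)
  qed
  moreover have "frame_mat K X w i j = 0" if "n \<le> i" for i j
    unfolding frame_mat_sum using w(1) that by (auto intro!: sum.neutral simp: supported_def)
  moreover have "(\<Sum>k<n. frame_mat K X w i k * frame_mat K X w k j) = 0" for i j
    unfolding frame_mat_def sum_product_swap
  proof (rule sum.neutral, rule ballI, rule sum.neutral, rule ballI)
    fix P Q assume PQ: "P \<in> {..<K} \<times> {..<K}" "Q \<in> {..<K} \<times> {..<K}"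
    have "(\<Sum>k<n. X (fst P) (snd P) * w (fst P) i * w (snd P) k * (X (fst Q) (snd Q) * w (fst Q) k * w (snd Q) j)) =
      X (fst P) (snd P) * w (fst P) i * X (fst Q) (snd Q) * w (snd Q) j * dot n (w (snd P)) (w (fst Q))"
      unfolding dot_def sum_distrib_left by (rule sum.cong) (simp_all add: mult_ac)
    then show "(\<Sum>k<n. X (fst P) (snd P) * w (fst P) i * w (snd P) k * (X (fst Q) (snd Q) * w (fst Q) k * w (snd Q) j)) = 0"
      using w(2)[of "snd P" "fst Q"] PQ by auto
  qed
  ultimately show ?thesis unfolding skew_nil_def by blast
qed

lemma frame_mat_dot: "dot n x (mapply n (frame_mat K X w) y) = (\<Sum>a<K. \<Sum>b<K. X a b * dot n x (w a) * dot n y (w b))"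
proof -
  have "mapply n (frame_mat K X w) y = (\<lambda>i. \<Sum>P\<in>{..<K} \<times> {..<K}. (X (fst P) (snd P) * dot n y (w (snd P))) * w (fst P) i)"
    unfolding mapply_def frame_mat_def dot_def sum_distrib_left sum_distrib_right
    by (rule ext, subst sum.swap, intro sum.cong HOL.refl) (simp add: mult_ac)
  note e = this
  show ?thesis unfolding e dot_right sum.cartesian_product by (simp add: case_prod_beta mult_ac)
qed

text \<open>A change of frame acts on the coefficient matrix by congruence.\<close>

lemma frame_mat_change:
  assumes "\<And>b i. b < K \<Longrightarrow> w b i = (\<Sum>a<K. T a b * m a i)"
  shows "frame_mat K X w = frame_mat K (\<lambda>a b. \<Sum>c<K. \<Sum>d<K. X c d * T a c * T b d) m"
proof (intro ext)
  fix i j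
  let ?S = "{..<K} \<times> {..<K}"
  have in_prod: "(\<Sum>a<K. T a c * m a i) * (\<Sum>b<K. T b d * m b j) = (\<Sum>Q\<in>?S. T (fst Q) c * m (fst Q) i * (T (snd Q) d * m (snd Q) j))" for c d
    by (simp add: sum_product sum.cartesian_product case_prod_beta)
  have out: "(\<Sum>c<K. \<Sum>d<K. X c d * T a c * T b d) = (\<Sum>P\<in>?S. X (fst P) (snd P) * T a (fst P) * T b (snd P))" for a b
    by (simp add: sum.cartesian_product case_prod_beta)
  have "frame_mat K X w i j = (\<Sum>P\<in>?S. X (fst P) (snd P) * ((\<Sum>a<K. T a (fst P) * m a i) * (\<Sum>b<K. T b (snd P) * m b j)))"
    unfolding frame_mat_def by (intro sum.cong HOL.refl) (auto simp: assms mult.assoc)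
  also have "\<dots> = frame_mat K (\<lambda>a b. \<Sum>c<K. \<Sum>d<K. X c d * T a c * T b d) m i j"
    unfolding frame_mat_def in_prod out unfolding sum_distrib_right sum_distrib_left
    by (subst sum.swap[of _ ?S ?S], intro sum.cong HOL.refl) (simp only: mult_ac)
  finally show "frame_mat K X w i j = frame_mat K (\<lambda>a b. \<Sum>c<K. \<Sum>d<K. X c d * T a c * T b d) m i j" .
qed

text \<open>The isotropic \<open>K\<close>-planes transversal to \<open>\<langle>iso_G a | a < K\<rangle>\<^sup>\<bottom>\<close> form an affine space,
  with coordinates an alternating matrix \<open>p (1, _, _)\<close> and an arbitrary matrix \<open>p (2, _, _)\<close>.
  The alternating matrix \<open>p (0, _, _)\<close> then describes a skew matrix with image in the plane.\<close>

definition alt :: "(nat \<times> nat \<times> nat \<Rightarrow> complex) \<Rightarrow> nat \<Rightarrow> nat \<Rightarrow> nat \<Rightarrow> complex" where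
  "alt p c a b = (if a < b then p (c, a, b) else if b < a then - p (c, b, a) else 0)"

text \<open>The coordinates orthogonal to the first \<open>K\<close> planes,
  \<open>2*l + 1 - 2*K\<close> in number.\<close>

definition rest :: "nat \<Rightarrow> nat \<Rightarrow> nat set" where
  "rest l K = insert 0 {Suc (2*K)..<Suc (2*l)}"

text \<open>A frame vector is \<open>iso_F a\<close> plus a free component in the complement plus a
  component along the \<open>iso_G b\<close>. Isotropy prescribes the symmetric part of the last
  matrix, the subtracted sum; its alternating part is free.\<close>

definition chart :: "nat \<Rightarrow> nat \<Rightarrow> (nat \<times> nat \<times> nat \<Rightarrow> complex) \<Rightarrow> nat \<Rightarrow> nat \<Rightarrow> complex" where
  "chart l K p a i = iso_F a i + (\<Sum>c\<in>rest l K. p (2, c, a) * (if i = c then 1 else 0)) +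
     (\<Sum>b<K. (alt p 1 b a - (\<Sum>c\<in>rest l K. p (2, c, a) * p (2, c, b))) * iso_G b i)"

definition param :: "nat \<Rightarrow> nat \<Rightarrow> (nat \<times> nat \<times> nat \<Rightarrow> complex) \<Rightarrow> nat \<times> nat \<Rightarrow> complex" where
  "param l K p = (\<lambda>(i, j). frame_mat K (alt p 0) (chart l K p) i j)"

lemma alt_skew: "alt p c a b = - alt p c b a"
  by (simp add: alt_def)

lemma finite_rest [simp]: "finite (rest l K)"
  by (simp add: rest_def)

lemma polyfun_param: "(\<lambda>p. param l K p ij) \<in> polyfun"
proof (cases ij)
  case (Pair i j)
  have "(\<lambda>p. alt p c a b) \<in> polyfun" for c a b unfolding alt_def by (intro polyfun_intros)
  then show ?thesis unfolding Pair param_def frame_mat_def chart_def prod.case by (intro polyfun_intros)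
qed

lemma rest_iso:
  assumes "K \<le> l" "a < K" "c \<in> rest l K"
  shows "iso_F a c = 0" "iso_G a c = 0" "c < Suc (2*l)"
  using assms by (auto simp: rest_def iso_F_def iso_G_def)

lemma dot_chart:
  assumes K: "K \<le> l" and a: "a < K"
  shows "b < K \<Longrightarrow> dot (Suc (2*l)) (iso_G b) (chart l K p a) = (if b = a then 1/2 else 0)"
    and "c \<in> rest l K \<Longrightarrow> dot (Suc (2*l)) (\<lambda>i. if i = c then 1 else 0) (chart l K p a) = p (2, c, a)"
    and "b < K \<Longrightarrow> dot (Suc (2*l)) (iso_F b) (chart l K p a) = (alt p 1 b a - (\<Sum>c\<in>rest l K. p (2, c, a) * p (2, c, b))) / 2"
proof -
  note iso = dot_iso_iso[OF order_less_le_trans[OF _ K]] and r = rest_iso[OF K]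
  {
    assume b: "b < K"
    have rs: "(\<Sum>c\<in>rest l K. f c * dot (Suc (2*l)) (iso_G b) (\<lambda>i. if i = c then 1 else 0)) = 0"
      "(\<Sum>c\<in>rest l K. f c * dot (Suc (2*l)) (iso_F b) (\<lambda>i. if i = c then 1 else 0)) = 0" for f :: "nat \<Rightarrow> complex"
      by (rule sum.neutral, intro ballI, simp add: dot_delta_right r[OF b])+
    show "dot (Suc (2*l)) (iso_G b) (chart l K p a) = (if b = a then 1/2 else 0)"
      unfolding chart_def dot_right rs iso[OF b] by (simp add: sum.neutral)
    show "dot (Suc (2*l)) (iso_F b) (chart l K p a) = (alt p 1 b a - (\<Sum>c\<in>rest l K. p (2, c, a) * p (2, c, b))) / 2"
      unfolding chart_def dot_right rs iso[OF b] using b by (simp add: if_distrib cong: if_cong)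
  }
  assume c: "c \<in> rest l K"
  have "(\<Sum>c'\<in>rest l K. p (2, c', a) * (if c = c' then 1 else 0)) = p (2, c, a)"
    using c by (simp add: if_distrib cong: if_cong)
  moreover have "(\<Sum>b<K. f b * iso_G b c) = 0" for f :: "nat \<Rightarrow> complex" by (rule sum.neutral) (simp add: r(2)[OF _ c])
  ultimately show "dot (Suc (2*l)) (\<lambda>i. if i = c then 1 else 0) (chart l K p a) = p (2, c, a)"
    unfolding dot_delta_left[OF r(3)[OF a c]] chart_def by (simp add: r(1)[OF a c])
qed

lemma supported_chart:
  assumes K: "K \<le> l" and a: "a < K"
  shows "supported (Suc (2*l)) (chart l K p a)"
  unfolding supported_def chart_def
proof (intro allI impI)
  fix i assume i: "Suc (2*l) \<le> i"
  have "iso_F a i = 0" "\<And>b. b < K \<Longrightarrow> iso_G b i = 0" using supported_iso K a i unfolding supported_def by auto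
  moreover have "i \<notin> rest l K" using i by (auto simp: rest_def)
  ultimately show "iso_F a i + (\<Sum>c\<in>rest l K. p (2, c, a) * (if i = c then 1 else 0)) +
     (\<Sum>b<K. (alt p 1 b a - (\<Sum>c\<in>rest l K. p (2, c, a) * p (2, c, b))) * iso_G b i) = 0" by (auto intro!: sum.neutral)
qed

lemma chart_isotropic:
  assumes K: "K \<le> l" and ab: "a < K" "b < K"
  shows "dot (Suc (2*l)) (chart l K p a) (chart l K p b) = 0"
proof -
  let ?n = "Suc (2*l)"
  have 1: "dot ?n (chart l K p a) x = dot ?n (iso_F a) x + (\<Sum>c\<in>rest l K. p (2, c, a) * dot ?n (\<lambda>i. if i = c then 1 else 0) x)
      + (\<Sum>b<K. (alt p 1 b a - (\<Sum>c\<in>rest l K. p (2, c, a) * p (2, c, b))) * dot ?n (iso_G b) x)" for x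
    by (subst chart_def[abs_def]) (simp only: dot_left)
  have "(\<Sum>c\<in>rest l K. p (2, c, a) * dot ?n (\<lambda>i. if i = c then 1 else 0) (chart l K p b)) = (\<Sum>c\<in>rest l K. p (2, c, a) * p (2, c, b))"
    by (intro sum.cong HOL.refl) (simp only: dot_chart(2)[OF K ab(2)])
  moreover have e: "(\<Sum>b'<K. f b' * dot ?n (iso_G b') (chart l K p b)) = f b / 2" for f
  proof -
    have "(\<Sum>b'<K. f b' * dot ?n (iso_G b') (chart l K p b)) = (\<Sum>b'<K. if b' = b then f b / 2 else 0)"
      by (intro sum.cong HOL.refl) (simp add: dot_chart(1)[OF K ab(2)])
    then show ?thesis using ab by simp
  qed
  moreover have "(\<Sum>c\<in>rest l K. p (2, c, b) * p (2, c, a)) = (\<Sum>c\<in>rest l K. p (2, c, a) * p (2, c, b))" by (simp add: mult.commute)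
  ultimately show ?thesis unfolding 1 e dot_chart(3)[OF K ab(2,1)] using alt_skew[of p 1 a b] by (simp add: diff_divide_distrib)
qed

lemma skew_nil_param: "K \<le> l \<Longrightarrow> skew_nil (Suc (2*l)) (\<lambda>i j. param l K p (i, j))"
  unfolding param_def prod.case by (rule skew_nil_frame_mat[OF alt_skew supported_chart chart_isotropic])

lemma expand:
  assumes K: "K \<le> l" and x: "supported (Suc (2*l)) x"
  shows "x i = (\<Sum>a<K. 2 * dot (Suc (2*l)) (iso_G a) x * iso_F a i) + (\<Sum>c\<in>rest l K. x c * (if i = c then 1 else 0)) +
     (\<Sum>b<K. 2 * dot (Suc (2*l)) (iso_F b) x * iso_G b i)"
proof -
  have d: "2 * dot (Suc (2*l)) (iso_G a) x = x (Suc (2*a)) - \<i> * x (Suc (Suc (2*a)))"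
    "2 * dot (Suc (2*l)) (iso_F a) x = x (Suc (2*a)) + \<i> * x (Suc (Suc (2*a)))" if "a < K" for a
    using that K by (simp_all add: dot_iso)
  have "(\<Sum>a<K. 2 * dot (Suc (2*l)) (iso_G a) x * iso_F a i) + (\<Sum>b<K. 2 * dot (Suc (2*l)) (iso_F b) x * iso_G b i) =
      (\<Sum>a<K. (if i = Suc (2*a) then x i else 0) + (if i = Suc (Suc (2*a)) then x i else 0))"
    unfolding sum.distrib[symmetric]
  proof (rule sum.cong)
    fix a assume "a \<in> {..<K}"
    then have "a < K" by simp
    then show "2 * dot (Suc (2*l)) (iso_G a) x * iso_F a i + 2 * dot (Suc (2*l)) (iso_F a) x * iso_G a i =
      (if i = Suc (2*a) then x i else 0) + (if i = Suc (Suc (2*a)) then x i else 0)"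
      unfolding d[OF \<open>a < K\<close>] by (simp add: iso_F_def iso_G_def algebra_simps)
  qed simp
  also have "\<dots> = (\<Sum>j<2*K. if j = i - 1 \<and> i > 0 then x i else 0)"
    unfolding sum_double by (rule sum.cong) auto
  also have "\<dots> = (if 0 < i \<and> i \<le> 2*K then x i else 0)" by (cases i) (simp_all add: less_eq_Suc_le)
  finally have 1: "(\<Sum>a<K. 2 * dot (Suc (2*l)) (iso_G a) x * iso_F a i) + (\<Sum>b<K. 2 * dot (Suc (2*l)) (iso_F b) x * iso_G b i) =
    (if 0 < i \<and> i \<le> 2*K then x i else 0)" .
  have 2: "(\<Sum>c\<in>rest l K. x c * (if i = c then 1 else 0)) = (if i \<in> rest l K then x i else 0)"
    by (simp add: if_distrib cong: if_cong)
  have "x i = (if 0 < i \<and> i \<le> 2*K then x i else 0) + (if i \<in> rest l K then x i else 0)"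
    using x by (auto simp: rest_def supported_def not_less_eq_eq)
  then show ?thesis using 1 2 by (simp add: add_ac)
qed

lemma dot_expand:
  assumes K: "K \<le> l" and x: "supported (Suc (2*l)) x"
  shows "dot (Suc (2*l)) x y = (\<Sum>a<K. 2 * dot (Suc (2*l)) (iso_G a) x * dot (Suc (2*l)) (iso_F a) y) + (\<Sum>c\<in>rest l K. x c * y c) +
     (\<Sum>b<K. 2 * dot (Suc (2*l)) (iso_F b) x * dot (Suc (2*l)) (iso_G b) y)"
proof -
  have x': "x = (\<lambda>i. (\<Sum>a<K. 2 * dot (Suc (2*l)) (iso_G a) x * iso_F a i) + (\<Sum>c\<in>rest l K. x c * (if i = c then 1 else 0)) +
     (\<Sum>b<K. 2 * dot (Suc (2*l)) (iso_F b) x * iso_G b i))"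
    by (rule ext) (rule expand[OF K x])
  have "dot (Suc (2*l)) (\<lambda>i. if i = c then 1 else 0) y = y c" if "c \<in> rest l K" for c
    using that K by (intro dot_delta_left) (auto simp: rest_def)
  then have "(\<Sum>c\<in>rest l K. x c * dot (Suc (2*l)) (\<lambda>i. if i = c then 1 else 0) y) = (\<Sum>c\<in>rest l K. x c * y c)"
    by simp
  then show ?thesis by (subst x') (simp only: dot_left)
qed

text \<open>Expanding the isotropy condition gives
  \<open>\<beta> b a + \<beta> a b = - 2 * S a b\<close>. After adding the symmetric
  \<open>S\<close> the matrix is alternating, so its entries above the diagonal determine
  it.\<close>

lemma chartI:
  assumes K: "K \<le> l" and m: "\<And>a. a < K \<Longrightarrow> supported (Suc (2*l)) (m a)" "\<And>a b. a < K \<Longrightarrow> b < K \<Longrightarrow> dot (Suc (2*l)) (m a) (m b) = 0"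
    and G: "\<And>a b. a < K \<Longrightarrow> b < K \<Longrightarrow> dot (Suc (2*l)) (iso_G a) (m b) = (if a = b then 1/2 else 0)"
    and p: "\<And>a b. p (1, a, b) = 2 * dot (Suc (2*l)) (iso_F a) (m b) + (\<Sum>c\<in>rest l K. m a c * m b c)" "\<And>c a. p (2, c, a) = m a c"
    and a: "a < K"
  shows "m a i = chart l K p a i"
proof -
  let ?n = "Suc (2*l)"
  define S where "S a b = (\<Sum>c\<in>rest l K. m a c * m b c)" for a b
  define \<beta> where "\<beta> b a = 2 * dot ?n (iso_F b) (m a)" for b a
  have S: "S b a = S a b" for a b unfolding S_def by (simp add: mult.commute)
  have key: "\<beta> b a + \<beta> a b = - 2 * S a b" if ab: "a < K" "b < K" for a b
  proof -
    have "(\<Sum>c<K. 2 * dot ?n (iso_G c) (m a) * dot ?n (iso_F c) (m b)) = (\<Sum>c<K. if c = a then dot ?n (iso_F a) (m b) else 0)"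
      by (intro sum.cong HOL.refl) (simp add: G ab)
    moreover have "(\<Sum>c<K. 2 * dot ?n (iso_F c) (m a) * dot ?n (iso_G c) (m b)) = (\<Sum>c<K. if c = b then dot ?n (iso_F b) (m a) else 0)"
      by (intro sum.cong HOL.refl) (simp add: G ab)
    ultimately have "0 = dot ?n (iso_F a) (m b) + S a b + dot ?n (iso_F b) (m a)"
      using dot_expand[OF K m(1)[OF ab(1)], of "m b"] m(2)[OF ab] ab by (simp add: S_def)
    moreover have "\<beta> b a + \<beta> a b = 2 * (dot ?n (iso_F a) (m b) + S a b + dot ?n (iso_F b) (m a)) - 2 * S a b"
      unfolding \<beta>_def by (simp add: algebra_simps)
    ultimately show ?thesis by simp
  qed
  have \<beta>: "alt p 1 b a - (\<Sum>c\<in>rest l K. p (2, c, a) * p (2, c, b)) = \<beta> b a" if b: "b < K" for b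
  proof -
    have "alt p 1 b a = \<beta> b a + S a b"
      using key[OF a b] S[of a b] unfolding alt_def p S_def[symmetric] \<beta>_def[symmetric]
      by (cases a b rule: linorder_cases) (auto simp: algebra_simps)
    then show ?thesis unfolding p S_def[symmetric] by simp
  qed
  have "(\<Sum>c<K. 2 * dot ?n (iso_G c) (m a) * iso_F c i) = (\<Sum>c<K. if c = a then iso_F a i else 0)"
    by (intro sum.cong HOL.refl) (simp add: G a)
  moreover have "(\<Sum>b<K. (alt p 1 b a - (\<Sum>c\<in>rest l K. p (2, c, a) * p (2, c, b))) * iso_G b i) = (\<Sum>b<K. 2 * dot ?n (iso_F b) (m a) * iso_G b i)"
    by (intro sum.cong HOL.refl) (simp only: \<beta> \<beta>_def lessThan_iff)
  ultimately show ?thesis using expand[OF K m(1)[OF a], of i] a unfolding chart_def p(2) by simp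
qed

text \<open>The determinant condition says that the plane is transversal. The inverse matrix
  replaces its frame by the one dual to the \<open>iso_G a\<close>, which lies in the chart, and the
  form is changed by the corresponding congruence.\<close>

lemma paramI:
  assumes K: "K \<le> l" and X: "\<And>a b. X a b = - X b a"
    and w: "\<And>a. a < K \<Longrightarrow> supported (Suc (2*l)) (w a)" "\<And>a b. a < K \<Longrightarrow> b < K \<Longrightarrow> dot (Suc (2*l)) (w a) (w b) = 0"
    and det: "det (mat K K (\<lambda>(a, b). 2 * dot (Suc (2*l)) (iso_G a) (w b))) \<noteq> 0"
  shows "\<exists>p. (\<lambda>(i, j). frame_mat K X w i j) = param l K p"
proof -
  let ?n = "Suc (2*l)"
  define T where "T a b = 2 * dot ?n (iso_G a) (w b)" for a b
  define M where "M = mat K K (\<lambda>(a, b). T a b)"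
  have M: "M \<in> carrier_mat K K" "det M \<noteq> 0" using det by (simp_all add: M_def T_def)
  obtain N where N: "N \<in> carrier_mat K K" "M * N = 1\<^sub>m K" "N * M = 1\<^sub>m K"
    using det_non_zero_imp_unit[OF M, of undefined] unfolding Units_def ring_mat_simps by auto
  define U where "U a b = N $$ (a, b)" for a b
  have TU: "(\<Sum>c<K. T a c * U c b) = (if a = b then 1 else 0)" "(\<Sum>c<K. U a c * T c b) = (if a = b then 1 else 0)" if "a < K" "b < K" for a b
    using mult_mat_entry[OF M(1) N(1) that] mult_mat_entry[OF N(1) M(1) that] that unfolding N(2,3) by (simp_all add: M_def U_def)
  define m where "m a i = (\<Sum>b<K. U b a * w b i)" for a i
  have wm: "w b i = (\<Sum>a<K. T a b * m a i)" if b: "b < K" for b i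
  proof -
    have "(\<Sum>a<K. T a b * m a i) = (\<Sum>c<K. (\<Sum>a<K. U c a * T a b) * w c i)"
      unfolding m_def sum_distrib_left sum_distrib_right by (subst sum.swap) (simp add: mult_ac)
    also have "\<dots> = (\<Sum>c<K. if c = b then w b i else 0)" by (intro sum.cong HOL.refl) (simp add: TU b)
    finally show ?thesis using b by simp
  qed
  have mdef: "m a = (\<lambda>i. \<Sum>b<K. U b a * w b i)" for a by (rule ext) (rule m_def)
  have G: "dot ?n (iso_G a) (m b) = (if a = b then 1/2 else 0)" if "a < K" "b < K" for a b
  proof -
    have "2 * dot ?n (iso_G a) (m b) = (\<Sum>c<K. T a c * U c b)"
      unfolding mdef dot_right sum_distrib_left T_def by (simp add: mult_ac)
    then have "dot ?n (iso_G a) (m b) = (\<Sum>c<K. T a c * U c b) / 2" by (simp add: mult.commute)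
    then show ?thesis unfolding TU(1)[OF that] by (cases "a = b") simp_all
  qed
  have ms: "supported ?n (m a)" for a unfolding mdef supported_def using w(1) by (auto intro!: sum.neutral simp: supported_def)
  have mi: "dot ?n (m a) (m b) = 0" for a b unfolding mdef dot_left dot_right using w(2) by (auto intro!: sum.neutral)
  define Y where "Y a b = (\<Sum>c<K. \<Sum>d<K. X c d * T a c * T b d)" for a b
  have Y: "Y a b = - Y b a" for a b
  proof -
    have "Y a b = (\<Sum>d<K. \<Sum>c<K. X c d * T a c * T b d)" unfolding Y_def by (rule sum.swap)
    also have "\<dots> = (\<Sum>d<K. \<Sum>c<K. - (X d c * T b d * T a c))"
      by (intro sum.cong HOL.refl, subst X) simp
    finally show ?thesis by (simp add: Y_def sum_negf)
  qed
  define p where "p = (\<lambda>(k, a, b). if k = 0 then Y a b else if k = (1::nat)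
    then 2 * dot ?n (iso_F a) (m b) + (\<Sum>c\<in>rest l K. m a c * m b c) else m b a)"
  have "chart l K p a i = m a i" if "a < K" for a i
    by (rule chartI[OF K ms mi G _ _ that, symmetric]) (simp_all add: p_def)
  moreover have "alt p 0 a b = Y a b" for a b
    using Y[of a b] Y[of a a] unfolding alt_def p_def by (cases a b rule: linorder_cases) auto
  ultimately have "frame_mat K (alt p 0) (chart l K p) = frame_mat K Y m"
    by (intro ext) (simp add: frame_mat_sum)
  moreover have "frame_mat K X w = frame_mat K Y m" unfolding Y_def[abs_def] by (rule frame_mat_change) (rule wm)
  ultimately show ?thesis unfolding param_def by (intro exI[of _ p]) (simp only:)
qed


section \<open>Polynomial deformation of frames and density of the chart\<close>

text \<open>The reflection multiplied by the norm of \<open>v\<close>. This is polynomial in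
  \<open>v\<close>, so it makes sense along a curve that passes through vectors which are not of
  norm 1.\<close>

definition hrefl :: "nat \<Rightarrow> (nat \<Rightarrow> 'a) \<Rightarrow> (nat \<Rightarrow> 'a) \<Rightarrow> nat \<Rightarrow> 'a::comm_ring_1" where
  "hrefl n v x = (\<lambda>i. dot n v v * x i - 2 * dot n v x * v i)"

lemma hrefl_dot: "dot n (hrefl n v x) (hrefl n v y) = dot n v v ^ 2 * dot n x y"
  unfolding hrefl_def dot_left dot_right dot_commute[of n x v] by (simp add: algebra_simps power2_eq_square)

lemma poly_dot: "poly (dot n x y) t = dot n (\<lambda>i. poly (x i) t) (\<lambda>i. poly (y i) t)"
  by (simp add: dot_def poly_sum)

lemma poly_hrefl: "poly (hrefl n v x i) t = hrefl n (\<lambda>i. poly (v i) t) (\<lambda>i. poly (x i) t) i"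
  by (simp add: hrefl_def poly_dot)

text \<open>A product of reflections deforms polynomially into a scalar, because the vectors of the
  reflections can be moved to a common one; for isotropic \<open>x\<close> no normalisation is needed.\<close>

lemma refls_deform:
  assumes vs: "units (Suc n) vs"
  obtains W :: "(nat \<Rightarrow> complex) \<Rightarrow> nat \<Rightarrow> complex poly" where
    "\<And>x i. poly (W x i) 1 = refls (Suc n) vs x i"
    "\<And>x i. x 0 = 0 \<Longrightarrow> poly (W x i) 0 = x i"
    "\<And>x i t. supported (Suc n) x \<Longrightarrow> supported (Suc n) (\<lambda>i. poly (W x i) t)"
    "\<And>x y t. dot (Suc n) x y = 0 \<Longrightarrow> dot (Suc n) (\<lambda>i. poly (W x i) t) (\<lambda>i. poly (W y i) t) = 0"
proof -
  \<comment> \<open>The segment from the coordinate vector 0 at \<open>t = 0\<close> to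
    \<open>v\<close> at \<open>t = 1\<close>. At the start all factors are the same reflection,
    which fixes every vector without component at 0.\<close>
  define mix :: "(nat \<Rightarrow> complex) \<Rightarrow> nat \<Rightarrow> complex poly" where
    "mix v i = [:if i = 0 then 1 else 0, v i - (if i = 0 then 1 else 0):]" for v i
  define W :: "(nat \<Rightarrow> complex) \<Rightarrow> nat \<Rightarrow> complex poly" where
    "W x = foldr (\<lambda>v. hrefl (Suc n) (mix v)) vs (\<lambda>i. [:x i:])" for x
  have m: "poly (mix v i) 1 = v i" "poly (mix v i) 0 = (if i = 0 then 1 else 0)" for v i by (simp_all add: mix_def)
  have r1: "hrefl (Suc n) v x = refl (Suc n) v x" if "dot (Suc n) v v = 1" for v x :: "nat \<Rightarrow> complex"
    unfolding hrefl_def refl_def that by simp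
  have r0: "hrefl (Suc n) (\<lambda>i. if i = 0 then 1 else 0) x = x" if "x 0 = 0" for x :: "nat \<Rightarrow> complex"
    unfolding hrefl_def dot_delta_left[OF zero_less_Suc] using that by simp
  show thesis
  proof (rule that[of W])
    fix x y :: "nat \<Rightarrow> complex" and i t
    show "poly (W x i) 1 = refls (Suc n) vs x i"
      using vs unfolding W_def by (induction vs arbitrary: i) (simp_all add: poly_hrefl m r1 units_def)
    show "poly (W x i) 0 = x i" if x: "x 0 = 0"
      unfolding W_def using x by (induction vs arbitrary: i) (simp_all add: poly_hrefl m r0)
    show "supported (Suc n) (\<lambda>i. poly (W x i) t)" if x: "supported (Suc n) x"
      using vs x unfolding W_def
      by (induction vs) (simp_all add: poly_hrefl supported_def units_def hrefl_def mix_def)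
    show "dot (Suc n) (\<lambda>i. poly (W x i) t) (\<lambda>i. poly (W y i) t) = 0" if xy: "dot (Suc n) x y = 0"
      unfolding W_def using xy by (induction vs) (simp_all add: poly_hrefl hrefl_dot)
  qed
qed

lemma frame_mat_partner:
  assumes X: "\<And>a b. X a b = (if b = partner a then (if even a then x (a div 2) else - x (a div 2)) else 0)"
  shows "frame_mat (2*k) X w i j = (\<Sum>a<k. x a * wedge (w (2*a)) (w (Suc (2*a))) i j)"
proof -
  have "(\<Sum>b<2*k. X a b * w a i * w b j) = X a (partner a) * w a i * w (partner a) j" if "a < 2*k" for a
  proof -
    have "(\<Sum>b<2*k. X a b * w a i * w b j) = (\<Sum>b<2*k. if b = partner a then X a (partner a) * w a i * w (partner a) j else 0)"
      by (intro sum.cong HOL.refl) (simp add: X)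
    then show ?thesis using partner_less[of "2*k" a] that by simp
  qed
  then have "frame_mat (2*k) X w i j = (\<Sum>a<2*k. X a (partner a) * w a i * w (partner a) j)"
    unfolding frame_mat_sum by (intro sum.cong HOL.refl) simp
  also have "\<dots> = (\<Sum>a<k. x a * wedge (w (2*a)) (w (Suc (2*a))) i j)"
    unfolding sum_double by (intro sum.cong HOL.refl) (simp add: X partner_def wedge_def algebra_simps)
  finally show ?thesis .
qed

text \<open>The frame of the matrix is deformed to the standard frame. The determinant that decides
  about the chart is a polynomial in \<open>t\<close> with value 1 at \<open>t = 0\<close>, so the
  curve lies in the parametrised set except at finitely many \<open>t\<close>, and its value at
  \<open>t = 1\<close> is the given matrix.\<close>

lemma skew_nil_in_closure:
  assumes v: "skew_nil (Suc (2*l)) (\<lambda>i j. v (i, j))"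
  shows "v \<in> zclosure (range (param l (2 * (l div 2))))"
  unfolding mem_zclosure_iff
proof (intro ballI impI)
  let ?n = "Suc (2*l)" and ?k = "l div 2"
  fix f assume f: "f \<in> polyfun" "\<forall>s\<in>range (param l (2*?k)). f s = 0"
  obtain r vs where vs: "units ?n vs" and r: "2*r \<le> l"
    and Dw: "\<And>i j. v (i, j) = (\<Sum>a<r. 2 * wedge (refls ?n vs (iso_F (2*a))) (refls ?n vs (iso_F (Suc (2*a)))) i j)"
    using skew_nil_standard_form[OF v, of "\<lambda>_. 0"] by (auto simp: supported_def dot_left mapply_def)
  have k: "2*?k \<le> l" "r \<le> ?k" using r by auto
  define X where "X a b = (if b = partner a then if even a then (if a div 2 < r then 2 else 0) else - (if a div 2 < r then 2 else 0) else 0 :: complex)" for a b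
  have X: "X a b = - X b a" for a b
    unfolding X_def partner_def by (auto elim!: evenE oddE)
  obtain W where W: "\<And>x i. poly (W x i) 1 = refls ?n vs x i"
    "\<And>x i. x 0 = 0 \<Longrightarrow> poly (W x i) 0 = x i"
    "\<And>x i t. supported ?n x \<Longrightarrow> supported ?n (\<lambda>i. poly (W x i) t)"
    "\<And>x y t. dot ?n x y = 0 \<Longrightarrow> dot ?n (\<lambda>i. poly (W x i) t) (\<lambda>i. poly (W y i) t) = 0"
    using refls_deform[OF vs] by blast
  define w where "w t a i = poly (W (iso_F a) i) t" for t a i
  have w: "supported ?n (w t a)" "dot ?n (w t a) (w t b) = 0" if "a < 2*?k" "b < 2*?k" for t a b
    unfolding w_def using that k by (auto intro!: W(3,4) supported_iso simp: dot_iso_iso)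
  define c where "c = (\<lambda>(i, j). \<Sum>P\<in>{..<2*?k} \<times> {..<2*?k}. [:X (fst P) (snd P):] * W (iso_F (fst P)) i * W (iso_F (snd P)) j)"
  have c: "(\<lambda>ij. poly (c ij) t) = (\<lambda>(i, j). frame_mat (2*?k) X (w t) i j)" for t
    unfolding c_def frame_mat_def w_def by (rule ext, clarify) (simp add: poly_sum mult.assoc)
  define d where "d = det (mat (2*?k) (2*?k) (\<lambda>(a, b). 2 * dot ?n (\<lambda>i. [:iso_G a i:]) (W (iso_F b))))"
  have d: "poly d t = det (mat (2*?k) (2*?k) (\<lambda>(a, b). 2 * dot ?n (iso_G a) (w t b)))" for t
  proof -
    have hom: "comm_ring_hom (\<lambda>q. poly q t)" by unfold_locales auto
    have "map_mat (\<lambda>q. poly q t) (mat (2*?k) (2*?k) (\<lambda>(a, b). 2 * dot ?n (\<lambda>i. [:iso_G a i:]) (W (iso_F b)))) =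
      mat (2*?k) (2*?k) (\<lambda>(a, b). 2 * dot ?n (iso_G a) (w t b))"
      by (rule eq_matI) (simp_all add: poly_dot w_def[abs_def])
    then show ?thesis unfolding d_def using comm_ring_hom.hom_det[OF hom] by metis
  qed
  have "mat (2*?k) (2*?k) (\<lambda>(a, b). 2 * dot ?n (iso_G a) (w 0 b)) = 1\<^sub>m (2*?k)"
  proof (rule eq_matI)
    fix a b assume "a < dim_row (1\<^sub>m (2*?k) :: complex mat)" "b < dim_col (1\<^sub>m (2*?k) :: complex mat)"
    then have ab: "a < 2*?k" "b < 2*?k" by auto
    then have "w 0 b = iso_F b" unfolding w_def by (intro ext W(2)) (simp add: iso_F_def)
    then show "mat (2*?k) (2*?k) (\<lambda>(a, b). 2 * dot ?n (iso_G a) (w 0 b)) $$ (a, b) = 1\<^sub>m (2*?k) $$ (a, b)"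
      using ab k dot_iso_iso(4)[of a l b] by simp
  qed simp_all
  then have "poly d 0 \<noteq> 0" unfolding d by simp
  then have d0: "d \<noteq> 0" by auto
  have "f (\<lambda>ij. poly (c ij) t) = 0" if t: "t \<notin> {t. poly d t = 0}" for t
  proof -
    have "\<exists>p. (\<lambda>(i, j). frame_mat (2*?k) X (w t) i j) = param l (2*?k) p"
      by (rule paramI[OF k(1) X w]) (use t in \<open>simp_all add: d\<close>)
    then show ?thesis unfolding c using f(2) by auto
  qed
  then have "f (\<lambda>ij. poly (c ij) 1) = 0"
    by (rule polyfun_eq_0_by_curve[OF f(1) poly_roots_finite[OF d0]])
  moreover have "(\<lambda>ij. poly (c ij) 1) = v"
  proof (rule ext, clarify)
    fix i j
    have w1: "w 1 a = refls ?n vs (iso_F a)" for a unfolding w_def W(1) ..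
    have "poly (c (i, j)) 1 = frame_mat (2*?k) X (w 1) i j" using fun_cong[OF c[of 1], of "(i, j)"] by simp
    also have "\<dots> = (\<Sum>a<?k. (if a < r then 2 else 0) * wedge (w 1 (2*a)) (w 1 (Suc (2*a))) i j)"
      by (rule frame_mat_partner[of X "\<lambda>a. if a < r then 2 else 0"]) (rule X_def)
    also have "\<dots> = (\<Sum>a<r. 2 * wedge (w 1 (2*a)) (w 1 (Suc (2*a))) i j)"
      by (rule sum.mono_neutral_cong_right) (use k(2) in auto)
    finally show "poly (c (i, j)) 1 = v (i, j)" unfolding w1 Dw[of i j] .
  qed
  ultimately show "f v = 0" by simp
qed


section \<open>Counting parameters and computing the dimension\<close>

lemma dot_mapply_sum: "(\<Sum>i<n. \<Sum>j<n. x i * y j * D i j) = dot n x (mapply n D y)"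
  by (simp add: dot_def mapply_def sum_distrib_left mult_ac)

lemma card_pairs_less: "2 * card {(a, b). a < b \<and> b < (K :: nat)} = K * (K - 1)"
proof -
  have "{(a, b). a < b \<and> b < K} = (\<lambda>(b, a). (a, b)) ` (SIGMA b:{..<K}. {..<b})" by auto
  then have "card {(a, b). a < b \<and> b < K} = card (SIGMA b:{..<K}. {..<b})"
    by (simp add: card_image inj_on_def)
  then have "card {(a, b). a < b \<and> b < K} = (\<Sum>b<K. b)" by simp
  moreover have "2 * (\<Sum>b<K. b) = K * (K - 1)" by (induction K) (auto simp: algebra_simps gr0_conv_Suc split: nat_diff_split)
  ultimately show ?thesis by simp
qed

text \<open>Only the coordinates of the isotropic plane. Those of the form on it are kept apart
  because they have to come last in the chain for the lower bound.\<close>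

definition params :: "nat \<Rightarrow> nat \<Rightarrow> (nat \<times> nat \<times> nat) set" where
  "params l K = Pair 2 ` (rest l K \<times> {..<K}) \<union> Pair 1 ` {(a, b). a < b \<and> b < K}"

lemma finite_pairs_less [simp]: "finite {(a, b). a < b \<and> b < (K :: nat)}"
  by (rule finite_subset[of _ "{..<K} \<times> {..<K}"]) auto

text \<open>The complement contributes \<open>K * (2*l + 1 - 2*K)\<close>, and each of the two
  alternating matrices half of \<open>K * (K - 1)\<close>.\<close>

lemma card_params:
  assumes "K \<le> l"
  shows "finite (params l K)" "card (params l K) + card (Pair (0::nat) ` {(a, b). a < b \<and> b < K}) = K * (2*l - K)"
proof -
  show "finite (params l K)" by (simp add: params_def)
  have "card (rest l K) = 2*l + 1 - 2*K" using assms by (simp add: rest_def)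
  moreover have "card (params l K) = card (Pair (2::nat) ` (rest l K \<times> {..<K})) + card (Pair (1::nat) ` {(a, b). a < b \<and> b < K})"
    unfolding params_def by (rule card_Un_disjoint) auto
  ultimately have "card (params l K) + card (Pair (0::nat) ` {(a, b). a < b \<and> b < K}) = (2*l + 1 - 2*K) * K + 2 * card {(a, b). a < b \<and> b < K}"
    by (simp add: card_image inj_on_def card_cartesian_product)
  also have "\<dots> = K * (2*l - K)"
  proof (cases K)
    case (Suc K')
    then obtain d where "l = Suc K' + d" using assms by (metis le_Suc_ex)
    then show ?thesis unfolding card_pairs_less by (simp add: Suc algebra_simps)
  qed simp
  finally show "card (params l K) + card (Pair (0::nat) ` {(a, b). a < b \<and> b < K}) = K * (2*l - K)" .
qed

lemma krull_dim_skew_nil_le: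
  fixes L :: "(nat \<times> nat \<Rightarrow> complex) \<Rightarrow> 'i \<Rightarrow> complex"
  assumes L: "\<And>c. (\<lambda>v. L v c) \<in> polyfun"
  shows "krull_dim (L ` {v. skew_nil (Suc (2*l)) (\<lambda>i j. v (i, j))}) \<le> enat (2 * (l div 2) * (2*l - 2 * (l div 2)))"
proof -
  let ?K = "2 * (l div 2)"
  let ?J = "params l ?K \<union> Pair 0 ` {(a, b). a < b \<and> b < ?K}"
  have K: "?K \<le> l" by simp
  have "krull_dim (L ` {v. skew_nil (Suc (2*l)) (\<lambda>i j. v (i, j))}) \<le> enat (card ?J)"
  proof (rule krull_dim_le[where \<phi> = "\<lambda>p. L (param l ?K p)"])
    show "(\<lambda>p. L (param l ?K p) i) \<in> polyfun" for i by (rule polyfun_compose[OF L polyfun_param])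
    show "finite ?J" using card_params(1)[OF K] by simp
    show "L ` {v. skew_nil (Suc (2*l)) (\<lambda>i j. v (i, j))} \<subseteq> zclosure (range (\<lambda>p. L (param l ?K p)))"
    proof (clarsimp simp only: mem_zclosure_iff)
      fix v f assume v: "skew_nil (Suc (2*l)) (\<lambda>i j. v (i, j))" and f: "f \<in> polyfun" "\<forall>s\<in>range (\<lambda>p. L (param l ?K p)). f s = 0"
      have "(\<lambda>v. f (L v)) \<in> polyfun" by (rule polyfun_compose[OF f(1) L])
      then show "f (L v) = 0" using skew_nil_in_closure[OF v] f(2) unfolding mem_zclosure_iff by auto
    qed
    fix p :: "nat \<times> nat \<times> nat \<Rightarrow> complex"
    define q where "q = (\<lambda>j. if j \<in> ?J then p j else 0)"
    have a: "alt q c a b = alt p c a b" if "a < ?K" "b < ?K" "c = 0 \<or> c = 1" for c a b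
      using that unfolding alt_def q_def params_def by (auto simp: image_iff)
    have r: "q (2, c, a) = p (2, c, a)" if "c \<in> rest l ?K" "a < ?K" for c a
      using that unfolding q_def params_def by (auto simp: image_iff)
    have "chart l ?K q a i = chart l ?K p a i" if "a < ?K" for a i
      unfolding chart_def using that by (simp add: a r)
    then have "frame_mat ?K (alt q 0) (chart l ?K q) = frame_mat ?K (alt p 0) (chart l ?K p)"
      by (intro ext) (simp add: frame_mat_sum a)
    then show "L (param l ?K q) = L (param l ?K p)" unfolding param_def by (simp only:)
  qed
  also have "card ?J \<le> ?K * (2*l - ?K)"
    unfolding card_params(2)[OF K, symmetric] by (rule card_Un_le)
  finally show ?thesis by simp
qed

text \<open>The form is translated by a fixed non-degenerate one. As long as its own parameters are
  zero, pairing the matrix with \<open>iso_G (partner b)\<close> returns the frame vector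
  \<open>b\<close> up to a constant, so the coordinates of the plane are polynomial in the matrix.
  Afterwards pairing with two vectors \<open>iso_G\<close> returns the form.\<close>

lemma krull_dim_skew_nil_ge:
  fixes L :: "(nat \<times> nat \<Rightarrow> complex) \<Rightarrow> 'i \<Rightarrow> complex"
  assumes L: "\<And>c. (\<lambda>v. L v c) \<in> polyfun" and \<iota>: "\<And>v ij. L v (\<iota> ij) = v ij"
    and S: "zclosed (L ` {v. skew_nil (Suc (2*l)) (\<lambda>i j. v (i, j))})" and K: "even K" "K \<le> l"
  shows "enat (K * (2*l - K)) \<le> krull_dim (L ` {v. skew_nil (Suc (2*l)) (\<lambda>i j. v (i, j))})"
proof -
  let ?n = "Suc (2*l)"
  obtain js1 where js1: "set js1 = params l K" "distinct js1" using finite_distinct_list card_params(1)[OF K(2)] by blast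
  obtain js0 where js0: "set js0 = Pair (0::nat) ` {(a, b). a < b \<and> b < K}" "distinct js0"
    using finite_distinct_list[OF finite_imageI[OF finite_pairs_less[of K], of "Pair (0::nat)"]] by auto
  have len: "length (js1 @ js0) = K * (2*l - K)"
    unfolding card_params(2)[OF K(2), symmetric] js1(1)[symmetric] js0(1)[symmetric] using js1(2) js0(2) by (simp add: distinct_card)
  \<comment> \<open>The standard symplectic matrix; \<open>K\<close> has to be even for it to be
    non-degenerate.\<close>
  define X0 where "X0 a b = (if b = partner a then (if even a then 1 else -1) else 0 :: complex)" for a b
  define shift where "shift p = (\<lambda>(c, a, b). p (c, a, b) + (if c = 0 \<and> a < b then X0 a b else 0))" for p :: "nat \<times> nat \<times> nat \<Rightarrow> complex"
  have X0: "X0 a b = - X0 b a" for a b unfolding X0_def partner_def by (auto elim!: evenE oddE)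
  have s0: "alt (shift p) 0 a b = alt p 0 a b + X0 a b" for p a b
    using X0[of a b] X0[of a a] unfolding alt_def shift_def by (cases a b rule: linorder_cases) auto
  have s1: "alt (shift p) 1 a b = alt p 1 a b" "shift p (2, a, b) = p (2, a, b)" for p a b
    unfolding alt_def shift_def by auto
  define \<epsilon> where "\<epsilon> a = (if even a then 1 else -1 :: complex)" for a :: nat
  define bil where "bil x y w = (\<Sum>i<?n. \<Sum>j<?n. x i * y j * w (\<iota> (i, j)))" for x y :: "nat \<Rightarrow> complex" and w
  define \<delta> :: "nat \<Rightarrow> nat \<Rightarrow> complex" where "\<delta> c i = (if i = c then 1 else 0)" for c i
  \<comment> \<open>For the alternating coordinates the two components along \<open>iso_G\<close>
    are subtracted, which removes the symmetric quadratic correction of the chart. The constants 4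
    and 2 undo the pairings 1/2.\<close>
  define h where "h = (\<lambda>(k, a, b). if k = 0 then (\<lambda>w. 4 * bil (iso_G a) (iso_G b) w - X0 a b)
     else if k = (1::nat) then (\<lambda>w. 2 * \<epsilon> b * bil (iso_F a) (iso_G (partner b)) w - 2 * \<epsilon> a * bil (iso_F b) (iso_G (partner a)) w)
     else (\<lambda>w. 2 * \<epsilon> b * bil (\<delta> a) (iso_G (partner b)) w))"
  define m where "m p = chart l K (shift p)" for p
  define \<phi> where "\<phi> p = L (param l K (shift p))" for p
  have bil: "2 * bil x (iso_G b) (\<phi> p) = (\<Sum>a<K. (alt p 0 a b + X0 a b) * dot ?n x (m p a))" if b: "b < K" for x b p
  proof -
    have "bil x (iso_G b) (\<phi> p) = dot ?n x (mapply ?n (frame_mat K (alt (shift p) 0) (m p)) (iso_G b))"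
      unfolding bil_def \<phi>_def \<iota> param_def m_def prod.case by (rule dot_mapply_sum)
    also have "\<dots> = (\<Sum>a<K. \<Sum>b'<K. if b' = b then (alt p 0 a b + X0 a b) * dot ?n x (m p a) / 2 else 0)"
      unfolding frame_mat_dot s0 m_def by (intro sum.cong HOL.refl) (simp add: dot_chart(1)[OF K(2) _ b])
    finally show ?thesis using b by (simp add: sum_divide_distrib[symmetric] mult.commute)
  qed
  have bil0: "2 * \<epsilon> b * bil x (iso_G (partner b)) (\<phi> p) = dot ?n x (m p b)"
    if b: "b < K" and p: "\<And>a b. p (0, a, b) = 0" for x b p
  proof -
    have "alt p 0 a c = 0" for a c by (simp add: alt_def p)
    then have "2 * bil x (iso_G (partner b)) (\<phi> p) = (\<Sum>a<K. if a = b then \<epsilon> b * dot ?n x (m p b) else 0)"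
      unfolding bil[OF partner_less[OF K(1) b]] by (intro sum.cong HOL.refl) (auto simp: X0_def \<epsilon>_def partner_eq)
    then have "2 * bil x (iso_G (partner b)) (\<phi> p) = \<epsilon> b * dot ?n x (m p b)" using b by simp
    moreover have "\<epsilon> b * \<epsilon> b = 1" by (simp add: \<epsilon>_def)
    moreover have "2 * \<epsilon> b * bil x (iso_G (partner b)) (\<phi> p) = \<epsilon> b * (2 * bil x (iso_G (partner b)) (\<phi> p))" by simp
    ultimately show ?thesis by (simp only: mult.assoc[symmetric]) simp
  qed
  have "enat (length (js1 @ js0)) \<le> krull_dim (L ` {v. skew_nil ?n (\<lambda>i j. v (i, j))})"
  proof (rule krull_dim_ge[where \<phi> = \<phi> and h = h])
    have "(\<lambda>p. shift p j) \<in> polyfun" for j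
      unfolding shift_def by (cases j) (auto intro!: polyfun_intros)
    then show "(\<lambda>p. \<phi> p i) \<in> polyfun" for i
      unfolding \<phi>_def by (intro polyfun_compose[OF L] polyfun_compose[OF polyfun_param])
    show "distinct (js1 @ js0)" using js1 js0 by (auto simp: params_def)
    have "bil x y \<in> polyfun" for x y unfolding bil_def[abs_def] by (intro polyfun_intros)
    then have bp: "(\<lambda>w. bil x y w) \<in> polyfun" for x y by simp
    show "h j \<in> polyfun" for j
    proof (cases j)
      case (fields k a b)
      show ?thesis unfolding h_def fields prod.case
        by (cases "k = 0"; cases "k = 1") (auto intro!: polyfun_intros bp simp del: One_nat_def)
    qed
    show "zclosed (L ` {v. skew_nil ?n (\<lambda>i j. v (i, j))})" by (rule S)
    show "\<phi> p \<in> L ` {v. skew_nil ?n (\<lambda>i j. v (i, j))}" for p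
      unfolding \<phi>_def using skew_nil_param[OF K(2)] by simp
    fix i and p :: "nat \<times> nat \<times> nat \<Rightarrow> complex"
    assume i: "i < length (js1 @ js0)" and p: "\<And>j. j \<notin> set (take (Suc i) (js1 @ js0)) \<Longrightarrow> p j = 0"
    show "h ((js1 @ js0) ! i) (\<phi> p) = p ((js1 @ js0) ! i)"
    proof (cases "i < length js1")
      case True
      then have mem: "(js1 @ js0) ! i \<in> params l K" using js1(1) nth_mem[of i js1] by (simp add: nth_append)
      have "set (take (Suc i) (js1 @ js0)) \<subseteq> params l K" using True js1(1) set_take_subset[of "Suc i" js1] by simp
      then have p0: "p (0, a, b) = 0" for a b by (intro p) (auto simp: params_def)
      have b0: "2 * \<epsilon> b * bil x (iso_G (partner b)) (\<phi> p) = dot ?n x (m p b)" if "b < K" for x b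
        by (rule bil0[OF that]) (rule p0)
      consider c a where "(js1 @ js0) ! i = (2, c, a)" "c \<in> rest l K" "a < K" | a b where "(js1 @ js0) ! i = (1, a, b)" "a < b" "b < K"
        using mem unfolding params_def by auto
      then show ?thesis
      proof cases
        case 1
        then show ?thesis using b0[OF 1(3), of "\<delta> c"] dot_chart(2)[OF K(2) 1(3,2), of "shift p"]
          by (simp add: h_def m_def \<delta>_def[abs_def] s1)
      next
        case 2
        then have a: "a < K" by simp
        have "(\<Sum>c\<in>rest l K. p (2, c, a) * p (2, c, b)) = (\<Sum>c\<in>rest l K. p (2, c, b) * p (2, c, a))" by (simp add: mult.commute)
        then have "h (1, a, b) (\<phi> p) = (alt p 1 a b - alt p 1 b a) / 2"
          unfolding h_def prod.case using b0[OF a, of "iso_F b"] b0[OF 2(3), of "iso_F a"]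
            dot_chart(3)[OF K(2) a 2(3), of "shift p"] dot_chart(3)[OF K(2) 2(3) a, of "shift p"]
          unfolding m_def s1 by (simp add: diff_divide_distrib)
        then show ?thesis unfolding 2(1) using 2(2) by (simp add: alt_def)
      qed
    next
      case False
      then have "(js1 @ js0) ! i \<in> set js0" using i nth_mem[of "i - length js1" js0] by (simp add: nth_append)
      then obtain a b where ab: "(js1 @ js0) ! i = (0, a, b)" "a < b" "b < K" using js0(1) by auto
      have "2 * bil (iso_G a) (iso_G b) (\<phi> p) = (\<Sum>c<K. if c = a then (alt p 0 a b + X0 a b) / 2 else 0)"
        unfolding bil[OF ab(3)] using ab by (intro sum.cong HOL.refl) (simp add: m_def dot_chart(1)[OF K(2)])
      then have "2 * (2 * bil (iso_G a) (iso_G b) (\<phi> p)) = p (0, a, b) + X0 a b"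
        using ab by (simp only:) (simp add: alt_def)
      then show ?thesis unfolding ab(1) h_def by (simp add: algebra_simps)
    qed
  qed
  then show ?thesis unfolding len .
qed

subsection \<open>The Clifford algebra\<close>

text \<open>On elements with bounded support \<open>cl_mult n\<close> does not depend on
  \<open>n\<close> once \<open>n\<close> is large enough. Collecting all ranks in one type gives a
  \<open>ring_1\<close> instance, so that Clifford computations become ordinary ring
  computations.\<close>

typedef (overloaded) 'a clf = "{a :: nat set \<Rightarrow> 'a::comm_ring_1. \<exists>n. \<forall>S. \<not> S \<subseteq> {..<n} \<longrightarrow> a S = 0}"
  morphisms coef Clf
  by (rule exI[of _ "\<lambda>_. 0"]) simp

lemma clf_eqI: "(\<And>S. coef x S = coef y S) \<Longrightarrow> x = y"
  using coef_inject[of x y] by auto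

definition supp_in :: "nat \<Rightarrow> 'a::comm_ring_1 clf \<Rightarrow> bool" where
  "supp_in n x \<longleftrightarrow> coef x \<in> cl_carrier n"

lemma supp_inD: "supp_in n x \<Longrightarrow> \<not> S \<subseteq> {..<n} \<Longrightarrow> coef x S = 0"
  by (simp add: supp_in_def cl_carrier_def)

lemma supp_inI: "(\<And>S. \<not> S \<subseteq> {..<n} \<Longrightarrow> coef x S = 0) \<Longrightarrow> supp_in n x"
  by (simp add: supp_in_def cl_carrier_def)

lemma supp_in_ex: "\<exists>n. supp_in n x"
  using coef[of x] by (auto simp: supp_in_def cl_carrier_def)

lemma supp_in_mono: "supp_in m x \<Longrightarrow> m \<le> n \<Longrightarrow> supp_in n x"
  by (intro supp_inI, erule supp_inD) auto

lemma supp_in_common: "\<exists>n. supp_in n x \<and> supp_in n y \<and> supp_in n z"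
proof -
  obtain a b c where "supp_in a x" "supp_in b y" "supp_in c z" using supp_in_ex by metis
  then have "supp_in (a + b + c) x" "supp_in (a + b + c) y" "supp_in (a + b + c) z"
    by (auto intro: supp_in_mono)
  then show ?thesis by blast
qed

lemma coef_Clf: "a \<in> cl_carrier n \<Longrightarrow> coef (Clf a) = a"
  by (rule Clf_inverse) (auto simp: cl_carrier_def)

lemma minus_one_power_sym_diff:
  assumes "finite X" "finite Y"
  shows "(-1) ^ card (sym_diff X Y) = ((-1) ^ card X * (-1) ^ card Y :: 'a::comm_ring_1)"
proof -
  have "card X = card (X - Y) + card (X \<inter> Y)" "card Y = card (Y - X) + card (X \<inter> Y)"
    using card_Diff_subset_Int[of X Y] card_Diff_subset_Int[of Y X] assms
      card_mono[of X "X \<inter> Y"] card_mono[of Y "X \<inter> Y"] by (simp_all add: Int_commute)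
  moreover have "card (sym_diff X Y) = card (X - Y) + card (Y - X)"
    using assms by (intro card_Un_disjoint) auto
  ultimately show ?thesis by (simp add: power_add mult_ac flip: mult.assoc)
qed

lemma finite_inversions: "finite A \<Longrightarrow> finite B \<Longrightarrow> finite {(i, j). i \<in> A \<and> j \<in> B \<and> j < (i :: nat)}"
  by (rule finite_subset[of _ "A \<times> B"]) auto

text \<open>The inversions with a fixed second set form a symmetric difference as well, so the sign
  is multiplicative in each argument. Associativity of the product rests on this and its mirror
  image.\<close>

lemma cl_sign_sym_diff_left:
  assumes "finite A" "finite B" "finite C"
  shows "cl_sign (sym_diff A B) C = (cl_sign A C * cl_sign B C :: 'a::comm_ring_1)"
proof -
  have "{(i, j). i \<in> sym_diff A B \<and> j \<in> C \<and> j < i} =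
      sym_diff {(i, j). i \<in> A \<and> j \<in> C \<and> j < i} {(i, j). i \<in> B \<and> j \<in> C \<and> j < i}" by auto
  then show ?thesis unfolding cl_sign_def
    using minus_one_power_sym_diff[OF finite_inversions[OF assms(1,3)] finite_inversions[OF assms(2,3)]] by simp
qed

lemma cl_sign_sym_diff_right:
  assumes "finite A" "finite B" "finite C"
  shows "cl_sign C (sym_diff A B) = (cl_sign C A * cl_sign C B :: 'a::comm_ring_1)"
proof -
  have "{(i, j). i \<in> C \<and> j \<in> sym_diff A B \<and> j < i} =
      sym_diff {(i, j). i \<in> C \<and> j \<in> A \<and> j < i} {(i, j). i \<in> C \<and> j \<in> B \<and> j < i}" by auto
  then show ?thesis unfolding cl_sign_def
    using minus_one_power_sym_diff[OF finite_inversions[OF assms(3,1)] finite_inversions[OF assms(3,2)]] by simp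
qed

lemma sym_diff_assoc: "sym_diff (sym_diff A B) C = sym_diff A (sym_diff B C)"
  by auto

instantiation clf :: (comm_ring_1) ab_group_add
begin

definition zero_clf :: "'a clf" where "zero_clf = Clf (\<lambda>_. 0)"
definition plus_clf :: "'a clf \<Rightarrow> 'a clf \<Rightarrow> 'a clf" where "plus_clf x y = Clf (\<lambda>S. coef x S + coef y S)"
definition uminus_clf :: "'a clf \<Rightarrow> 'a clf" where "uminus_clf x = Clf (\<lambda>S. - coef x S)"
definition minus_clf :: "'a clf \<Rightarrow> 'a clf \<Rightarrow> 'a clf" where "minus_clf x y = Clf (\<lambda>S. coef x S - coef y S)"

lemma coef_0 [simp]: "coef (0 :: 'a clf) S = 0"
  unfolding zero_clf_def by (subst coef_Clf[of _ 0]) (simp_all add: cl_carrier_def)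

lemma coef_add [simp]: "coef (x + y :: 'a clf) S = coef x S + coef y S"
proof -
  obtain n where "supp_in n x" "supp_in n y" using supp_in_common by blast
  then have "(\<lambda>S. coef x S + coef y S) \<in> cl_carrier n" by (simp add: supp_in_def cl_carrier_def)
  then show ?thesis unfolding plus_clf_def by (simp add: coef_Clf)
qed

lemma coef_uminus [simp]: "coef (- x :: 'a clf) S = - coef x S"
proof -
  obtain n where "supp_in n x" using supp_in_ex by blast
  then have "(\<lambda>S. - coef x S) \<in> cl_carrier n" by (simp add: supp_in_def cl_carrier_def)
  then show ?thesis unfolding uminus_clf_def by (simp add: coef_Clf)
qed

lemma coef_diff [simp]: "coef (x - y :: 'a clf) S = coef x S - coef y S"
proof -
  obtain n where "supp_in n x" "supp_in n y" using supp_in_common by blast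
  then have "(\<lambda>S. coef x S - coef y S) \<in> cl_carrier n" by (simp add: supp_in_def cl_carrier_def)
  then show ?thesis unfolding minus_clf_def by (simp add: coef_Clf)
qed

instance
proof
  fix a b c :: "'a clf"
  show "a + b + c = a + (b + c)" "a + b = b + a" "0 + a = a" "- a + a = 0" "a - b = a + - b"
    by (rule clf_eqI; simp add: add_ac)+
qed

end

lemma coef_sum [simp]: "coef (\<Sum>i\<in>I. f i) S = (\<Sum>i\<in>I. coef (f i) S)"
  by (induction I rule: infinite_finite_induct) simp_all

lemma finite_Pow_lessThan: "finite (Pow {..<n :: nat})" by simp

lemma cl_mult_eq_sum:
  "cl_mult n a b S = (\<Sum>A\<in>Pow {..<n}. \<Sum>B\<in>Pow {..<n}. if sym_diff A B = S then cl_sign A B * a A * b B else 0)"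
proof -
  have eq: "{(A, B). A \<subseteq> {..<n} \<and> B \<subseteq> {..<n} \<and> sym_diff A B = S} =
      {p \<in> Pow {..<n} \<times> Pow {..<n}. sym_diff (fst p) (snd p) = S}" by auto
  have "cl_mult n a b S = (\<Sum>p\<in>{p \<in> Pow {..<n} \<times> Pow {..<n}. sym_diff (fst p) (snd p) = S}.
      cl_sign (fst p) (snd p) * a (fst p) * b (snd p))"
    unfolding cl_mult_def by (rule sum.cong[OF eq]) (simp add: case_prod_unfold)
  also have "\<dots> = (\<Sum>p\<in>Pow {..<n} \<times> Pow {..<n}.
      if sym_diff (fst p) (snd p) = S then cl_sign (fst p) (snd p) * a (fst p) * b (snd p) else 0)"
    by (rule sum.inter_filter) simp
  finally show ?thesis by (simp add: sum.cartesian_product case_prod_unfold)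
qed

lemma cl_mult_carrier: "cl_mult n a b \<in> cl_carrier n"
  unfolding cl_carrier_def mem_Collect_eq cl_mult_eq_sum
  by (intro allI impI sum.neutral ballI) auto

lemma cl_mult_mono:
  assumes "a \<in> cl_carrier m" "b \<in> cl_carrier m" "m \<le> n"
  shows "cl_mult n a b = cl_mult m a b"
proof
  fix S
  have sub: "Pow {..<m} \<subseteq> Pow {..<n}" using assms(3) by auto
  have "cl_mult n a b S = (\<Sum>A\<in>Pow {..<m}. \<Sum>B\<in>Pow {..<n}. if sym_diff A B = S then cl_sign A B * a A * b B else 0)"
    unfolding cl_mult_eq_sum
    by (rule sum.mono_neutral_right[OF _ sub]) (use assms(1) in \<open>auto simp: cl_carrier_def intro!: sum.neutral\<close>)
  also have "\<dots> = cl_mult m a b S" unfolding cl_mult_eq_sum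
    by (intro sum.cong refl sum.mono_neutral_right[OF _ sub]) (use assms(2) in \<open>auto simp: cl_carrier_def\<close>)
  finally show "cl_mult n a b S = cl_mult m a b S" .
qed

definition E :: "nat set \<Rightarrow> 'a::comm_ring_1 clf" where
  "E S = Clf (if finite S then cl_basis S else (\<lambda>_. 0))"

lemma finite_set_bounded: "finite S \<Longrightarrow> \<exists>n. S \<subseteq> {..<n :: nat}"
  using finite_nat_iff_bounded by blast

lemma coef_E: "coef (E S :: 'a::comm_ring_1 clf) T = (if finite S \<and> T = S then 1 else 0)"
proof (cases "finite S")
  case True
  then obtain n where "S \<subseteq> {..<n}" using finite_set_bounded by blast
  then have "(cl_basis S :: 'a cliff) \<in> cl_carrier n" by (auto simp: cl_basis_def cl_carrier_def)
  then have "coef (E S :: 'a clf) = cl_basis S" using True by (simp only: E_def if_True coef_Clf)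
  then show ?thesis using True by (simp add: cl_basis_def)
next
  case False
  have "coef (E S :: 'a clf) = (\<lambda>_. 0)" unfolding E_def if_not_P[OF False]
    by (intro coef_Clf[of _ 0]) (simp add: cl_carrier_def)
  then show ?thesis using False by simp
qed

lemma cl_mult_basis:
  assumes "A \<subseteq> {..<n}"
  shows "cl_mult n (\<lambda>T. if T = A then c else 0) b S = (\<Sum>B\<in>Pow {..<n}. if sym_diff A B = S then cl_sign A B * c * b B else 0)"
proof -
  have "cl_mult n (\<lambda>T. if T = A then c else 0) b S =
    (\<Sum>A'\<in>Pow {..<n}. if A' = A then (\<Sum>B\<in>Pow {..<n}. if sym_diff A B = S then cl_sign A B * c * b B else 0) else 0)"
    unfolding cl_mult_eq_sum by (intro sum.cong refl) (simp cong: if_cong)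
  then show ?thesis using assms by simp
qed

lemma cl_sign_empty [simp]: "cl_sign {} B = 1" "cl_sign A {} = 1"
  by (simp_all add: cl_sign_def)

instantiation clf :: (comm_ring_1) ring_1
begin

definition one_clf :: "'a clf" where "one_clf = E {}"
text \<open>The least bound is only a canonical choice; \<open>coef_mult\<close> shows that every
  common bound gives the same product.\<close>

definition times_clf :: "'a clf \<Rightarrow> 'a clf \<Rightarrow> 'a clf" where
  "times_clf x y = Clf (cl_mult (LEAST n. supp_in n x \<and> supp_in n y) (coef x) (coef y))"

lemma coef_mult:
  assumes "supp_in n x" "supp_in n y"
  shows "coef (x * y :: 'a clf) = cl_mult n (coef x) (coef y)"
proof -
  let ?m = "LEAST n. supp_in n x \<and> supp_in n y"
  have "supp_in ?m x \<and> supp_in ?m y" using LeastI[of "\<lambda>n. supp_in n x \<and> supp_in n y" n] assms by simp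
  moreover have "?m \<le> n" using Least_le[of "\<lambda>n. supp_in n x \<and> supp_in n y" n] assms by simp
  ultimately show ?thesis unfolding times_clf_def supp_in_def
    unfolding coef_Clf[OF cl_mult_carrier] using cl_mult_mono[of "coef x" ?m "coef y" n] by (simp add: supp_in_def)
qed

lemma coef_mult_sum:
  assumes "supp_in n x" "supp_in n y"
  shows "coef (x * y :: 'a clf) S =
    (\<Sum>A\<in>Pow {..<n}. \<Sum>B\<in>Pow {..<n}. if sym_diff A B = S then cl_sign A B * coef x A * coef y B else 0)"
  by (simp only: coef_mult[OF assms] cl_mult_eq_sum)

lemma supp_in_mult:
  assumes "supp_in n x" "supp_in n y"
  shows "supp_in n (x * y :: 'a clf)"
  unfolding supp_in_def coef_mult[OF assms] by (rule cl_mult_carrier)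

lemma if_push_sum: "(if P then c * (\<Sum>a\<in>I. \<Sum>b\<in>J. g a b) * d else 0) =
    (\<Sum>a\<in>I. \<Sum>b\<in>J. if P then c * g a b * d else 0)"
  and if_push_sum': "(if P then c * (\<Sum>a\<in>I. \<Sum>b\<in>J. g a b) else 0) =
    (\<Sum>a\<in>I. \<Sum>b\<in>J. if P then c * g a b else 0)" for c d :: "'b::comm_ring_1"
  by (simp_all add: sum_distrib_left sum_distrib_right)

text \<open>Both sides become a sum over triples of basis sets with the symmetric sign
  \<open>cl_sign A B * cl_sign A C * cl_sign B C\<close>.\<close>

lemma mult_assoc_clf: "(x * y) * z = x * (y * z :: 'a clf)"
proof (rule clf_eqI)
  fix S
  obtain n where n: "supp_in n x" "supp_in n y" "supp_in n z" using supp_in_common by blast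
  let ?P = "Pow {..<n}"
  define F where "F A B C = cl_sign A B * cl_sign A C * cl_sign B C * coef x A * coef y B * coef z C" for A B C
  have fin: "finite A" if "A \<in> ?P" for A using that finite_subset by auto
  have sd: "sym_diff A B \<in> ?P" if "A \<in> ?P" "B \<in> ?P" for A B using that by auto
  have "coef ((x * y) * z) S = (\<Sum>X\<in>?P. \<Sum>C\<in>?P. \<Sum>A\<in>?P. \<Sum>B\<in>?P.
      if sym_diff A B = X then (if sym_diff X C = S then cl_sign X C * (cl_sign A B * coef x A * coef y B) * coef z C else 0) else 0)"
    unfolding coef_mult_sum[OF supp_in_mult[OF n(1,2)] n(3)] coef_mult_sum[OF n(1,2)] if_push_sum
    by (intro sum.cong refl) simp
  also have "\<dots> = (\<Sum>C\<in>?P. \<Sum>A\<in>?P. \<Sum>B\<in>?P. \<Sum>X\<in>?P.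
      if sym_diff A B = X then (if sym_diff X C = S then cl_sign X C * (cl_sign A B * coef x A * coef y B) * coef z C else 0) else 0)"
    by (subst sum.swap, rule sum.cong[OF refl], subst sum.swap, rule sum.cong[OF refl], rule sum.swap)
  also have "\<dots> = (\<Sum>C\<in>?P. \<Sum>A\<in>?P. \<Sum>B\<in>?P. if sym_diff (sym_diff A B) C = S then F A B C else 0)"
  proof (intro sum.cong refl)
    fix A B C assume P: "C \<in> ?P" "A \<in> ?P" "B \<in> ?P"
    have "cl_sign (sym_diff A B) C = (cl_sign A C * cl_sign B C :: 'a)"
      using P fin by (intro cl_sign_sym_diff_left) auto
    then show "(\<Sum>X\<in>?P. if sym_diff A B = X then (if sym_diff X C = S then cl_sign X C * (cl_sign A B * coef x A * coef y B) * coef z C else 0) else 0)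
      = (if sym_diff (sym_diff A B) C = S then F A B C else 0)"
      using sd[OF P(2,3)] by (simp add: sum.delta' F_def mult_ac)
  qed
  also have "\<dots> = (\<Sum>A\<in>?P. \<Sum>B\<in>?P. \<Sum>C\<in>?P. if sym_diff (sym_diff A B) C = S then F A B C else 0)"
    by (subst sum.swap, rule sum.cong[OF refl], rule sum.swap)
  finally have L: "coef ((x * y) * z) S = \<dots>" .
  have "coef (x * (y * z)) S = (\<Sum>A\<in>?P. \<Sum>X\<in>?P. \<Sum>B\<in>?P. \<Sum>C\<in>?P.
      if sym_diff B C = X then (if sym_diff A X = S then cl_sign A X * coef x A * (cl_sign B C * coef y B * coef z C) else 0) else 0)"
    unfolding coef_mult_sum[OF n(1) supp_in_mult[OF n(2,3)]] coef_mult_sum[OF n(2,3)] if_push_sum'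
    by (intro sum.cong refl) simp
  also have "\<dots> = (\<Sum>A\<in>?P. \<Sum>B\<in>?P. \<Sum>C\<in>?P. \<Sum>X\<in>?P.
      if sym_diff B C = X then (if sym_diff A X = S then cl_sign A X * coef x A * (cl_sign B C * coef y B * coef z C) else 0) else 0)"
    by (rule sum.cong[OF refl], subst sum.swap, rule sum.cong[OF refl], rule sum.swap)
  also have "\<dots> = (\<Sum>A\<in>?P. \<Sum>B\<in>?P. \<Sum>C\<in>?P. if sym_diff (sym_diff A B) C = S then F A B C else 0)"
  proof (intro sum.cong refl)
    fix A B C assume P: "A \<in> ?P" "B \<in> ?P" "C \<in> ?P"
    have "cl_sign A (sym_diff B C) = (cl_sign A B * cl_sign A C :: 'a)"
      using P fin by (intro cl_sign_sym_diff_right) auto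
    then show "(\<Sum>X\<in>?P. if sym_diff B C = X then (if sym_diff A X = S then cl_sign A X * coef x A * (cl_sign B C * coef y B * coef z C) else 0) else 0)
      = (if sym_diff (sym_diff A B) C = S then F A B C else 0)"
      using sd[OF P(2,3)] unfolding sym_diff_assoc by (simp add: sum.delta' F_def mult_ac)
  qed
  finally show "coef ((x * y) * z) S = coef (x * (y * z)) S" unfolding L by simp
qed

lemma supp_in_E: "S \<subseteq> {..<n} \<Longrightarrow> supp_in n (E S)"
  by (rule supp_inI) (auto simp: coef_E)

lemma coef_E_fun: "finite A \<Longrightarrow> coef (E A) = (\<lambda>T. if T = A then 1 else 0)"
  by (simp add: coef_E fun_eq_iff)

lemma one_mult_clf: "1 * x = (x :: 'a clf)"
proof (rule clf_eqI)
  fix S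
  obtain n where n: "supp_in n x" using supp_in_ex by blast
  have "coef (1 * x) S = (\<Sum>B\<in>Pow {..<n}. if B = S then coef x B else 0)"
    unfolding one_clf_def coef_mult[OF supp_in_E[OF empty_subsetI] n] coef_E_fun[OF finite.emptyI]
      cl_mult_basis[OF empty_subsetI] by (rule sum.cong) auto
  then show "coef (1 * x) S = coef x S" using supp_inD[OF n] by (auto simp: finite_Pow_lessThan)
qed

lemma mult_one_clf: "x * 1 = (x :: 'a clf)"
proof (rule clf_eqI)
  fix S
  obtain n where n: "supp_in n x" using supp_in_ex by blast
  have "coef (x * 1) S = (\<Sum>A\<in>Pow {..<n}. \<Sum>B\<in>Pow {..<n}. if B = {} then (if A = S then coef x A else 0) else 0)"
    unfolding one_clf_def coef_mult_sum[OF n supp_in_E[OF empty_subsetI]]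
    by (intro sum.cong refl) (auto simp: coef_E)
  also have "\<dots> = (\<Sum>A\<in>Pow {..<n}. if A = S then coef x A else 0)"
    by (intro sum.cong refl) (simp add: finite_Pow_lessThan sum.delta)
  finally show "coef (x * 1) S = coef x S" using supp_inD[OF n] by (auto simp: finite_Pow_lessThan)
qed

lemma supp_in_add: "supp_in n x \<Longrightarrow> supp_in n y \<Longrightarrow> supp_in n (x + y :: 'a clf)"
  by (rule supp_inI) (simp add: supp_inD)

instance
proof
  fix x y z :: "'a clf"
  show "x * y * z = x * (y * z)" by (rule mult_assoc_clf)
  show "1 * x = x" "x * 1 = x" by (rule one_mult_clf mult_one_clf)+
  obtain n where n: "supp_in n x" "supp_in n y" "supp_in n z" using supp_in_common by blast
  show "(x + y) * z = x * z + y * z"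
    by (rule clf_eqI, unfold coef_mult_sum[OF supp_in_add[OF n(1,2)] n(3)] coef_mult_sum[OF n(1) n(3)]
      coef_mult_sum[OF n(2) n(3)] coef_add sum.distrib[symmetric], intro sum.cong refl) (simp add: algebra_simps)
  show "x * (y + z) = x * y + x * z"
    by (rule clf_eqI, unfold coef_mult_sum[OF n(1) supp_in_add[OF n(2,3)]] coef_mult_sum[OF n(1,2)]
      coef_mult_sum[OF n(1) n(3)] coef_add sum.distrib[symmetric], intro sum.cong refl) (simp add: algebra_simps)
  have "coef (0 :: 'a clf) {} \<noteq> coef 1 {}" by (simp add: one_clf_def coef_E)
  then show "(0 :: 'a clf) \<noteq> 1" by metis
qed

end

lemma coef_1: "coef 1 S = (if S = {} then 1 else 0)"
  by (simp add: one_clf_def coef_E)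

lemma coef_1_fun: "coef 1 = cl_one"
  by (simp add: coef_1 cl_basis_def fun_eq_iff)

definition cst :: "'a::comm_ring_1 \<Rightarrow> 'a clf" where
  "cst c = Clf (\<lambda>S. if S = {} then c else 0)"

lemma coef_cst: "coef (cst c) S = (if S = {} then c else 0)"
  unfolding cst_def using coef_Clf[of "\<lambda>S. if S = {} then c else 0" 0] by (simp add: cl_carrier_def)

lemma supp_in_cst [simp]: "supp_in n (cst c)"
  by (rule supp_inI) (auto simp: coef_cst)

lemma coef_cst_mult [simp]: "coef (cst c * x) S = c * coef x S"
proof -
  obtain n where n: "supp_in n x" using supp_in_ex by blast
  have cst: "coef (cst c) = (\<lambda>T. if T = {} then c else 0)" by (simp add: coef_cst fun_eq_iff)
  have "coef (cst c * x) S = (\<Sum>B\<in>Pow {..<n}. if B = S then c * coef x B else 0)"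
    unfolding coef_mult[OF supp_in_cst n] cst cl_mult_basis[OF empty_subsetI] by (rule sum.cong) auto
  then show ?thesis using supp_inD[OF n] by (auto simp: finite_Pow_lessThan)
qed

lemma cst_commute: "x * cst c = cst c * x"
proof (rule clf_eqI)
  fix S
  obtain n where n: "supp_in n x" using supp_in_ex by blast
  have "coef (x * cst c) S = (\<Sum>A\<in>Pow {..<n}. \<Sum>B\<in>Pow {..<n}. if B = {} then (if A = S then c * coef x A else 0) else 0)"
    unfolding coef_mult_sum[OF n supp_in_cst]
    by (intro sum.cong refl) (auto simp: coef_cst)
  also have "\<dots> = (\<Sum>A\<in>Pow {..<n}. if A = S then c * coef x A else 0)"
    by (intro sum.cong refl) (simp add: finite_Pow_lessThan sum.delta)
  finally show "coef (x * cst c) S = coef (cst c * x) S" using supp_inD[OF n] by (auto simp: finite_Pow_lessThan)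
qed

lemma cst_left_commute: "x * (cst c * y) = cst c * (x * y)"
  by (simp only: mult.assoc[symmetric] cst_commute[of x])

lemma cst_0 [simp]: "cst 0 = 0" and cst_1 [simp]: "cst 1 = 1"
  and cst_add: "cst (a + b) = cst a + cst b" and cst_diff: "cst (a - b) = cst a - cst b"
  and cst_minus: "cst (- a) = - cst a"
  by (rule clf_eqI; simp add: coef_cst coef_1)+

lemma cst_mult: "cst (a * b) = cst a * cst b"
  by (rule clf_eqI) (simp add: coef_cst)

lemma cst_sum: "cst (\<Sum>i\<in>I. f i) = (\<Sum>i\<in>I. cst (f i))"
  by (rule clf_eqI) (simp add: coef_cst)

lemma E_mult:
  assumes "finite A" "finite B"
  shows "E A * E B = (cst (cl_sign A B) * E (sym_diff A B) :: 'a::comm_ring_1 clf)"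
proof (rule clf_eqI)
  fix S
  obtain n where n: "A \<union> B \<subseteq> {..<n}" using finite_set_bounded assms by (meson finite_UnI)
  then have AB: "A \<subseteq> {..<n}" "B \<subseteq> {..<n}" by auto
  have "coef (E A * E B :: 'a clf) S = (\<Sum>B'\<in>Pow {..<n}. if B' = B then (if sym_diff A B = S then cl_sign A B else 0) else 0)"
    unfolding coef_mult[OF supp_in_E[OF AB(1)] supp_in_E[OF AB(2)]] coef_E_fun[OF assms(1)] cl_mult_basis[OF AB(1)]
    by (rule sum.cong) (auto simp: coef_E assms)
  also have "\<dots> = (if sym_diff A B = S then cl_sign A B else 0)" using AB(2) by (simp add: finite_Pow_lessThan)
  finally show "coef (E A * E B :: 'a clf) S = coef (cst (cl_sign A B) * E (sym_diff A B)) S"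
    using assms by (simp add: coef_E)
qed

definition rev_cl :: "'a::comm_ring_1 clf \<Rightarrow> 'a clf" where
  "rev_cl x = Clf (cl_rev (coef x))"

lemma coef_rev_fun: "coef (rev_cl x) = cl_rev (coef x)"
proof -
  obtain n where "supp_in n x" using supp_in_ex by blast
  then have "cl_rev (coef x) \<in> cl_carrier n" by (simp add: supp_in_def cl_carrier_def cl_rev_def)
  then show ?thesis unfolding rev_cl_def by (simp add: coef_Clf)
qed

lemma coef_rev: "coef (rev_cl x) S = (-1) ^ (card S choose 2) * coef x S"
  by (simp add: coef_rev_fun cl_rev_def)

lemma supp_in_rev: "supp_in n x \<Longrightarrow> supp_in n (rev_cl x)"
  by (rule supp_inI) (simp add: coef_rev supp_inD)

text \<open>The pairs \<open>(i, j)\<close> with \<open>i \<in> A\<close>, \<open>j \<in> B\<close>, \<open>i \<noteq> j\<close> are counted by \<open>|A| |B| - |A \<inter> B|\<close>.\<close>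

lemma rev_sign:
  assumes "finite A" "finite B"
  shows "(-1) ^ (card (sym_diff A B) choose 2) * cl_sign A B =
    ((-1) ^ (card A choose 2) * (-1) ^ (card B choose 2) * cl_sign B A :: 'a::comm_ring_1)"
proof -
  define a b c where "a = card (A - B)" and "b = card (B - A)" and "c = card (A \<inter> B)"
  have A: "card A = a + c" and B: "card B = b + c"
    using card_Diff_subset_Int[of A B] card_Diff_subset_Int[of B A] assms
      card_mono[of A "A \<inter> B"] card_mono[of B "A \<inter> B"] by (simp_all add: Int_commute a_def b_def c_def)
  have AB: "card (sym_diff A B) = a + b" unfolding a_def b_def using assms by (intro card_Un_disjoint) auto
  let ?X = "{(i, j). i \<in> A \<and> j \<in> B \<and> j < i}" and ?Y = "{(i, j). i \<in> B \<and> j \<in> A \<and> j < i}"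
  have "A \<times> B = ?X \<union> (prod.swap ` ?Y \<union> (\<lambda>i. (i, i)) ` (A \<inter> B))" by (auto simp: image_iff)
  moreover have "?X \<inter> (prod.swap ` ?Y \<union> (\<lambda>i. (i, i)) ` (A \<inter> B)) = {}" "prod.swap ` ?Y \<inter> (\<lambda>i. (i, i)) ` (A \<inter> B) = {}"
    by auto
  ultimately have "card (A \<times> B) = card ?X + (card (prod.swap ` ?Y) + card ((\<lambda>i. (i, i)) ` (A \<inter> B)))"
    using finite_inversions[OF assms] finite_inversions[OF assms(2,1)] assms by (simp add: card_Un_disjoint)
  then have count: "(a + c) * (b + c) = card ?X + card ?Y + c"
    by (simp add: card_image inj_on_def card_cartesian_product A B c_def)
  have ch: "(m + k choose 2) = (m choose 2) + (k choose 2) + m * k" for m k :: nat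
  proof (induction k)
    case (Suc k)
    have "(Suc x choose 2) = (x choose 2) + x" for x by (simp add: numeral_2_eq_2)
    then show ?case using Suc by simp
  qed simp
  have "(a + b choose 2) + card ?X + (((a + c) choose 2) + ((b + c) choose 2) + card ?Y)
      = 2 * ((a choose 2) + (b choose 2) + (c choose 2) + a * b + a * c + b * c) + (c * c - c)"
    using count by (simp add: ch algebra_simps)
  moreover have "even (c * c - c)" by simp
  ultimately have "even ((a + b choose 2) + card ?X + (((a + c) choose 2) + ((b + c) choose 2) + card ?Y))" by simp
  then have "(-1) ^ ((a + b choose 2) + card ?X) = ((-1) ^ (((a + c) choose 2) + ((b + c) choose 2) + card ?Y) :: 'a)"
    by (simp add: minus_one_power_iff)
  then show ?thesis by (simp add: AB A B cl_sign_def power_add)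
qed

lemma rev_mult: "rev_cl (x * y) = rev_cl y * rev_cl x"
proof (rule clf_eqI)
  fix S
  obtain n where n: "supp_in n x" "supp_in n y" using supp_in_common by blast
  let ?P = "Pow {..<n}"
  have fin: "finite A" if "A \<in> ?P" for A using that finite_subset by auto
  have sd: "sym_diff A B = sym_diff B A" for A B :: "nat set" by auto
  have "coef (rev_cl (x * y)) S = (\<Sum>A\<in>?P. \<Sum>B\<in>?P.
      if sym_diff A B = S then ((-1) ^ (card (sym_diff A B) choose 2) * cl_sign A B) * coef x A * coef y B else 0)"
    unfolding coef_rev coef_mult_sum[OF n] sum_distrib_left by (intro sum.cong refl) (auto simp: mult_ac)
  also have "\<dots> = (\<Sum>A\<in>?P. \<Sum>B\<in>?P. if sym_diff B A = S then cl_sign B A * ((-1) ^ (card B choose 2) * coef y B) * ((-1) ^ (card A choose 2) * coef x A) else 0)"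
  proof (intro sum.cong refl)
    fix A B assume P: "A \<in> ?P" "B \<in> ?P"
    show "(if sym_diff A B = S then ((-1) ^ (card (sym_diff A B) choose 2) * cl_sign A B) * coef x A * coef y B else 0) =
      (if sym_diff B A = S then cl_sign B A * ((-1) ^ (card B choose 2) * coef y B) * ((-1) ^ (card A choose 2) * coef x A) else 0)"
      unfolding rev_sign[OF fin[OF P(1)] fin[OF P(2)]] sd[of B A] by (simp add: mult_ac)
  qed
  also have "\<dots> = coef (rev_cl y * rev_cl x) S"
    unfolding coef_mult_sum[OF supp_in_rev[OF n(2)] supp_in_rev[OF n(1)]] coef_rev by (rule sum.swap)
  finally show "coef (rev_cl (x * y)) S = coef (rev_cl y * rev_cl x) S" .
qed

lemma rev_add: "rev_cl (x + y) = rev_cl x + rev_cl y"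
  and rev_minus: "rev_cl (- x) = - rev_cl x" and rev_diff: "rev_cl (x - y) = rev_cl x - rev_cl y"
  and rev_0 [simp]: "rev_cl 0 = 0"
  by (rule clf_eqI; simp add: coef_rev algebra_simps)+

lemma rev_cst [simp]: "rev_cl (cst c) = cst c"
  by (rule clf_eqI) (simp add: coef_rev coef_cst binomial_eq_0)

lemma rev_1 [simp]: "rev_cl 1 = 1"
  using rev_cst[of 1] by simp

lemma rev_rev [simp]: "rev_cl (rev_cl x) = x"
  by (rule clf_eqI) (simp add: coef_rev mult.assoc[symmetric] power_mult_distrib[symmetric])

lemma rev_sum: "rev_cl (\<Sum>i\<in>I. f i) = (\<Sum>i\<in>I. rev_cl (f i))"
  by (induction I rule: infinite_finite_induct) (simp_all add: rev_add)

section \<open>Laurent series, their subrings and the substitution of -t for t\<close>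

abbreviation X :: "complex fls" where "X \<equiv> fls_X"
abbreviation Xi :: "complex fls" where "Xi \<equiv> fls_X_inv"

lemma X_Xi: "X * Xi = 1" "Xi * X = 1"
  by (simp_all add: fls_X_inv_times_conv_shift)

lemma fls_times_nth_zero:
  assumes "\<And>k. fls_nth f k * fls_nth g (n - k) = 0"
  shows "fls_nth (f * g :: 'a::comm_ring_1 fls) n = 0"
  unfolding fls_times_nth(2) by (rule sum.neutral) (simp add: assms)

text \<open>One notion for both \<open>fls_O\<close> and \<open>fls_Ominus\<close>, so that
  integrality of products in the Clifford algebra is proved once.\<close>

definition subring_K :: "complex fls set \<Rightarrow> bool" where
  "subring_K R \<longleftrightarrow> 0 \<in> R \<and> 1 \<in> R \<and> (\<forall>f\<in>R. - f \<in> R) \<and> (\<forall>f\<in>R. \<forall>g\<in>R. f + g \<in> R \<and> f * g \<in> R)"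

lemma subring_O: "subring_K fls_O"
  unfolding subring_K_def fls_O_def
proof (intro conjI ballI)
  fix f g :: "complex fls"
  assume fg: "f \<in> {f. \<forall>k<0. fls_nth f k = 0}" "g \<in> {f. \<forall>k<0. fls_nth f k = 0}"
  have "fls_nth (f * g) k = 0" if "k < 0" for k
  proof (rule fls_times_nth_zero)
    fix i have "i < 0 \<or> k - i < 0" using that by linarith
    then show "fls_nth f i * fls_nth g (k - i) = 0" using fg by auto
  qed
  then show "f * g \<in> {f. \<forall>k<0. fls_nth f k = 0}" by simp
qed auto

lemma subring_Ominus: "subring_K fls_Ominus"
  unfolding subring_K_def fls_Ominus_def
proof (intro conjI ballI)
  fix f g :: "complex fls"
  assume fg: "f \<in> {f. \<forall>k>0. fls_nth f k = 0}" "g \<in> {f. \<forall>k>0. fls_nth f k = 0}"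
  have "fls_nth (f * g) k = 0" if "k > 0" for k
  proof (rule fls_times_nth_zero)
    fix i have "i > 0 \<or> k - i > 0" using that by linarith
    then show "fls_nth f i * fls_nth g (k - i) = 0" using fg by auto
  qed
  then show "f * g \<in> {f. \<forall>k>0. fls_nth f k = 0}" by simp
qed auto

lemma subring_sum: "subring_K R \<Longrightarrow> (\<And>i. i \<in> I \<Longrightarrow> f i \<in> R) \<Longrightarrow> sum f I \<in> R"
  by (induction I rule: infinite_finite_induct) (auto simp: subring_K_def)

lemma subring_prod: "subring_K R \<Longrightarrow> (\<And>i. i \<in> I \<Longrightarrow> f i \<in> R) \<Longrightarrow> prod f I \<in> R"
  by (induction I rule: infinite_finite_induct) (auto simp: subring_K_def)

lemma subring_power: "subring_K R \<Longrightarrow> f \<in> R \<Longrightarrow> f ^ k \<in> R"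
  by (induction k) (auto simp: subring_K_def)

lemma subring_diff: "subring_K R \<Longrightarrow> f \<in> R \<Longrightarrow> g \<in> R \<Longrightarrow> f - g \<in> R"
  unfolding subring_K_def by (metis add_uminus_conv_diff)

lemma subring_uminus: "subring_K R \<Longrightarrow> f \<in> R \<Longrightarrow> - f \<in> R"
  and subring_add: "subring_K R \<Longrightarrow> f \<in> R \<Longrightarrow> g \<in> R \<Longrightarrow> f + g \<in> R"
  and subring_mult: "subring_K R \<Longrightarrow> f \<in> R \<Longrightarrow> g \<in> R \<Longrightarrow> f * g \<in> R"
  and subring_0: "subring_K R \<Longrightarrow> 0 \<in> R" and subring_1: "subring_K R \<Longrightarrow> 1 \<in> R"
  by (simp_all add: subring_K_def)

lemma fls_const_O: "fls_const c \<in> fls_O" and fls_const_Ominus: "fls_const c \<in> fls_Ominus"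
  and X_O: "X \<in> fls_O" and Xi_Ominus: "Xi \<in> fls_Ominus"
  by (simp_all add: fls_O_def fls_Ominus_def)

lemma fls_twist_nth: "fls_nth (fls_twist f) k = fls_nth f k * (-1) powi k"
proof -
  have "(- fps_X :: complex fps) = fps_const (-1) * fps_X" by (simp flip: fps_const_neg)
  then show ?thesis unfolding fls_twist_def by (simp only:) (rule fls_nth_fls_compose_fps_linear, simp)
qed

lemma fls_twist_simps [simp]:
  "fls_twist (f * g) = fls_twist f * fls_twist g" "fls_twist (f + g) = fls_twist f + fls_twist g"
  "fls_twist (- f) = - fls_twist f" "fls_twist 0 = 0" "fls_twist 1 = 1" "fls_twist (fls_const c) = fls_const c"
  "fls_twist X = - X" "fls_twist Xi = - Xi" "fls_twist (f - g) = fls_twist f - fls_twist g"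
  "fls_twist (f ^ j) = fls_twist f ^ j" "fls_twist (f powi i) = fls_twist f powi i"
  "fls_twist (inverse f) = inverse (fls_twist f)"
proof -
  have nz: "- fps_X \<noteq> (0 :: complex fps)" "fps_nth (- fps_X :: complex fps) 0 = 0" by simp_all
  show "fls_twist (f * g) = fls_twist f * fls_twist g" "fls_twist (f + g) = fls_twist f + fls_twist g"
    "fls_twist (f ^ j) = fls_twist f ^ j" "fls_twist (f powi i) = fls_twist f powi i"
    "fls_twist (inverse f) = inverse (fls_twist f)" "fls_twist (f - g) = fls_twist f - fls_twist g"
    unfolding fls_twist_def using nz
    by (simp_all add: fls_compose_fps_mult fls_compose_fps_add fls_compose_fps_power fls_compose_fps_powi
        fls_compose_fps_inverse fls_compose_fps_diff)
  show "fls_twist (- f) = - fls_twist f" "fls_twist 0 = 0" "fls_twist 1 = 1" "fls_twist (fls_const c) = fls_const c"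
    by (simp_all add: fls_twist_def)
  show "fls_twist X = - X" "fls_twist Xi = - Xi"
    by (rule fls_eqI; simp add: fls_twist_nth)+
qed

lemma fls_twist_sum: "fls_twist (\<Sum>i\<in>I. f i) = (\<Sum>i\<in>I. fls_twist (f i))"
  by (induction I rule: infinite_finite_induct) simp_all

subsection \<open>Vectors\<close>

lemma E_sq: "E {i} * E {i} = 1"
proof -
  have "{(i', j). i' \<in> {i} \<and> j \<in> {i} \<and> j < i'} = {}" by auto
  then have "cl_sign {i} {i} = (1 :: 'a::comm_ring_1)" unfolding cl_sign_def by (simp only: card.empty power_0)
  then show ?thesis by (simp add: E_mult one_clf_def[symmetric])
qed

lemma E_anticommute: "i \<noteq> j \<Longrightarrow> E {i} * E {j} = - (E {j} * E {i})"
proof -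
  assume "i \<noteq> j"
  have "{(i', j'). i' \<in> {i} \<and> j' \<in> {j} \<and> j' < i'} = (if j < i then {(i, j)} else {})" for i j :: nat by auto
  then have "cl_sign {i} {j} = (if j < i then -1 else 1 :: 'a::comm_ring_1)" for i j
    unfolding cl_sign_def by (simp only:) simp
  moreover have "sym_diff {i} {j} = sym_diff {j} {i}" by auto
  ultimately show ?thesis using \<open>i \<noteq> j\<close> by (cases "i < j") (simp_all add: E_mult cst_minus)
qed

definition vecn :: "nat \<Rightarrow> (nat \<Rightarrow> 'a) \<Rightarrow> 'a::comm_ring_1 clf" where
  "vecn n v = (\<Sum>i<n. cst (v i) * E {i})"

lemma coef_vecn_single: "i < n \<Longrightarrow> coef (vecn n v) {i} = v i"
proof -
  assume i: "i < n"
  have "coef (vecn n v) {i} = (\<Sum>j<n. if j = i then v j else 0)"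
    unfolding vecn_def coef_sum coef_cst_mult by (intro sum.cong refl) (auto simp: coef_E)
  then show ?thesis using i by simp
qed

lemma coef_vecn_other: "(\<And>i. i < n \<Longrightarrow> S \<noteq> {i}) \<Longrightarrow> coef (vecn n v) S = 0"
  unfolding vecn_def coef_sum coef_cst_mult by (intro sum.neutral ballI) (auto simp: coef_E)

lemma supp_in_vecn: "supp_in n (vecn n v)"
  by (rule supp_inI, rule coef_vecn_other) auto

lemma vecn_add: "vecn n (\<lambda>i. v i + w i) = vecn n v + vecn n w"
  and vecn_diff: "vecn n (\<lambda>i. v i - w i) = vecn n v - vecn n w"
  and vecn_cmult: "vecn n (\<lambda>i. c * v i) = cst c * vecn n v"
  by (simp_all add: vecn_def cst_add cst_diff cst_mult algebra_simps sum.distrib sum_subtractf sum_distrib_left mult.assoc)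

lemma vecn_eqI: "(\<And>i. i < n \<Longrightarrow> v i = w i) \<Longrightarrow> vecn n v = vecn n w"
  unfolding vecn_def by (intro sum.cong) auto

lemma vecn_delta: "j < n \<Longrightarrow> vecn n (\<lambda>i. if i = j then 1 else 0) = E {j}"
proof -
  assume j: "j < n"
  have "vecn n (\<lambda>i. if i = j then 1 else 0 :: 'a::comm_ring_1) = (\<Sum>i<n. if i = j then E {i} else 0)"
    unfolding vecn_def by (intro sum.cong) auto
  then show ?thesis using j by simp
qed

lemma cst_mult_pair: "cst a * x * (cst b * y) = cst (a * b) * (x * y)"
  by (simp only: cst_mult mult.assoc cst_left_commute[of x b y])

lemma vecn_anticommutator: "vecn n v * vecn n w + vecn n w * vecn n v = cst (2 * dot n v w)"
proof -
  have "vecn n v * vecn n w = (\<Sum>i<n. \<Sum>j<n. cst (v i * w j) * (E {i} * E {j}))"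
    unfolding vecn_def sum_product cst_mult_pair ..
  moreover have "vecn n w * vecn n v = (\<Sum>i<n. \<Sum>j<n. cst (v i * w j) * (E {j} * E {i}))"
    unfolding vecn_def sum_product cst_mult_pair by (subst sum.swap) (simp only: mult.commute[of "w _"])
  ultimately have "vecn n v * vecn n w + vecn n w * vecn n v =
      (\<Sum>i<n. \<Sum>j<n. cst (v i * w j) * (E {i} * E {j} + E {j} * E {i}))"
    by (simp add: sum.distrib distrib_left)
  also have "\<dots> = (\<Sum>i<n. \<Sum>j<n. if j = i then cst (2 * (v i * w i)) else 0)"
  proof (intro sum.cong refl)
    fix i j
    show "cst (v i * w j) * (E {i} * E {j} + E {j} * E {i}) = (if j = i then cst (2 * (v i * w i)) else 0)"
    proof (cases "j = i")
      case True
      have "cst (2 * (v i * w i)) = cst (v i * w i) + cst (v i * w i)" by (simp only: mult_2 cst_add)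
      then show ?thesis unfolding True by (simp only: E_sq distrib_left mult_1_right if_True refl)
    next
      case False
      then have ij: "i \<noteq> j" by simp
      show ?thesis unfolding E_anticommute[OF ij] using False by simp
    qed
  qed
  also have "\<dots> = (\<Sum>i<n. cst (2 * (v i * w i)))" by (intro sum.cong refl) simp
  finally show ?thesis by (simp add: dot_def sum_distrib_left cst_sum)
qed

lemma vecn_sq: "vecn n v * vecn n v = cst (dot n v v :: complex fls)"
proof -
  have "cst (1/2) * (vecn n v * vecn n v + vecn n v * vecn n v) = cst (1/2) * cst (2 * dot n v v)"
    by (simp only: vecn_anticommutator)
  then show ?thesis unfolding distrib_left distrib_right[symmetric] mult.assoc[symmetric] cst_add[symmetric] cst_mult[symmetric]
    by simp
qed

lemma vecn_commute: "vecn n v * vecn n w = cst (2 * dot n v w) - vecn n w * vecn n v"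
  using vecn_anticommutator[of n v w] by (simp add: eq_diff_eq)

lemma rev_E_single [simp]: "rev_cl (E {i}) = E {i}"
  by (rule clf_eqI) (simp add: coef_rev coef_E binomial_eq_0)

lemma rev_vecn [simp]: "rev_cl (vecn n v) = vecn n v"
  unfolding vecn_def rev_sum rev_mult by (simp add: cst_commute)

text \<open>For orthogonal \<open>v\<close>, \<open>w\<close> with \<open>w\<close> isotropic the
  product of the two vectors has square zero and is negated by reversal.\<close>

lemma el_inverse:
  assumes "dot n v w = 0" "dot n w w = (0 :: complex fls)"
  shows "rev_cl (1 + vecn n v * vecn n w) = 1 - vecn n v * vecn n w"
    and "(1 + vecn n v * vecn n w) * (1 - vecn n v * vecn n w) = 1"
    and "(1 - vecn n v * vecn n w) * (1 + vecn n v * vecn n w) = 1"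
proof -
  have wv: "vecn n w * vecn n v = - (vecn n v * vecn n w)"
    using vecn_commute[of n w v] assms(1) by (simp add: dot_commute)
  show "rev_cl (1 + vecn n v * vecn n w) = 1 - vecn n v * vecn n w"
    by (simp add: rev_add rev_mult wv)
  have "vecn n v * vecn n w * (vecn n v * vecn n w) = vecn n v * (vecn n w * vecn n v) * vecn n w"
    by (simp only: mult.assoc)
  also have "\<dots> = 0" unfolding wv by (simp add: mult.assoc vecn_sq assms(2))
  finally have "vecn n v * vecn n w * (vecn n v * vecn n w) = 0" .
  then show "(1 + vecn n v * vecn n w) * (1 - vecn n v * vecn n w) = 1"
    "(1 - vecn n v * vecn n w) * (1 + vecn n v * vecn n w) = 1"
    by (simp_all add: algebra_simps)
qed

text \<open>The resulting map is an Eichler transvection. For isotropic \<open>v\<close> its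
  quadratic term is absent; for \<open>v\<close> a multiple of e_0 by t^-1 it produces the term
  \<open>- u u^T / 2\<close> of the loops.\<close>

lemma el_conj:
  assumes vw: "dot n v w = 0" and ww: "dot n w w = (0 :: complex fls)"
  shows "(1 + vecn n v * vecn n w) * vecn n x * rev_cl (1 + vecn n v * vecn n w) =
    vecn n (\<lambda>i. x i + 2 * dot n w x * v i - 2 * dot n v x * w i - 2 * dot n v v * dot n w x * w i)"
proof -
  define V W Z where "V = vecn n v" and "W = vecn n w" and "Z = vecn n x"
  define a b q where "a = cst (2 * dot n v x)" and "b = cst (2 * dot n w x)" and "q = cst (dot n v v)"
  have b: "y * (b * z) = b * (y * z)" "y * b = b * y" and a: "y * (a * z) = a * (y * z)" "y * a = a * y"
    and q: "y * (q * z) = q * (y * z)" "y * q = q * y" for y z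
    unfolding a_def b_def q_def by (rule cst_left_commute cst_commute)+
  have bq: "b * q = cst (2 * dot n v v * dot n w x)" unfolding b_def q_def by (simp add: mult_ac flip: cst_mult)
  have WV: "W * V = - (V * W)" using vecn_commute[of n w v] vw by (simp add: dot_commute V_def W_def)
  have WW: "W * W = 0" using ww by (simp add: vecn_sq W_def)
  have VV: "V * V = q" by (simp add: vecn_sq V_def q_def)
  have WZ: "W * Z = b - Z * W" unfolding W_def Z_def b_def by (rule vecn_commute)
  have VZ: "V * Z = a - Z * V" unfolding V_def Z_def a_def by (rule vecn_commute)
  have VWZ: "V * W * Z = b * V - a * W + Z * V * W"
  proof -
    have "V * W * Z = V * (b - Z * W)" by (simp add: mult.assoc WZ)
    also have "\<dots> = b * V - (V * Z) * W" by (simp add: right_diff_distrib b mult.assoc)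
    also have "\<dots> = b * V - a * W + Z * V * W" unfolding VZ by (simp add: left_diff_distrib)
    finally show ?thesis .
  qed
  have "W * (V * W) = (W * V) * W" by (simp only: mult.assoc)
  also have "\<dots> = 0" unfolding WV by (simp add: mult.assoc WW)
  finally have WVW: "W * (V * W) = 0" .
  have VVW: "V * (V * W) = q * W" using VV by (simp only: mult.assoc[symmetric])
  have "V * W * Z * (V * W) = b * (V * (V * W)) - a * (W * (V * W)) + Z * (V * (W * (V * W)))"
    unfolding VWZ by (simp only: left_diff_distrib distrib_right mult.assoc)
  then have 2: "V * W * Z * (V * W) = b * q * W"
    by (simp only: VVW WVW mult_zero_right diff_zero add_0_right mult.assoc)
  have "(1 + V * W) * Z * (1 - V * W) = Z + V * W * Z - Z * V * W - V * W * Z * (V * W)"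
    by (simp add: algebra_simps)
  also have "\<dots> = Z + V * W * Z - Z * V * W - b * q * W" unfolding 2 ..
  also have "\<dots> = Z + b * V - a * W - b * q * W" unfolding VWZ by (simp add: algebra_simps)
  also have "\<dots> = vecn n (\<lambda>i. x i + 2 * dot n w x * v i - 2 * dot n v x * w i - 2 * dot n v v * dot n w x * w i)"
    unfolding vecn_diff vecn_add vecn_cmult bq by (simp only: V_def W_def Z_def a_def b_def)
  finally show ?thesis unfolding el_inverse(1)[OF assms] V_def W_def Z_def .
qed

text \<open>The sign is the reason why only products of an even number of unit vectors act by the
  product of the reflections.\<close>

lemma refl_conj:
  assumes "dot n v v = (1 :: complex fls)"
  shows "vecn n v * vecn n x * vecn n v = - vecn n (refl n v x)"
proof -
  have "vecn n v * vecn n x * vecn n v = cst (2 * dot n v x) * vecn n v - vecn n x * (vecn n v * vecn n v)"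
    unfolding vecn_commute[of n v x] by (simp add: left_diff_distrib mult.assoc)
  also have "\<dots> = - vecn n (refl n v x)" unfolding refl_def vecn_diff vecn_cmult vecn_sq assms by simp
  finally show ?thesis .
qed

subsection \<open>Spinors\<close>

definition evn :: "'a::comm_ring_1 clf \<Rightarrow> bool" where
  "evn x \<longleftrightarrow> (\<forall>S. odd (card S) \<longrightarrow> coef x S = 0)"

lemma even_card_sym_diff:
  assumes "finite A" "finite B"
  shows "even (card (sym_diff A B)) \<longleftrightarrow> (even (card A) \<longleftrightarrow> even (card B))"
  using minus_one_power_sym_diff[OF assms, where 'a = int] by (auto simp: minus_one_power_iff split: if_splits)

lemma evn_mult: "evn x \<Longrightarrow> evn y \<Longrightarrow> evn (x * y)"
  unfolding evn_def
proof (intro allI impI)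
  fix S :: "nat set" assume x: "\<forall>S. odd (card S) \<longrightarrow> coef x S = 0" and y: "\<forall>S. odd (card S) \<longrightarrow> coef y S = 0" and S: "odd (card S)"
  obtain n where n: "supp_in n x" "supp_in n y" using supp_in_common by blast
  show "coef (x * y) S = 0" unfolding coef_mult_sum[OF n]
  proof (intro sum.neutral ballI)
    fix A B assume "A \<in> Pow {..<n}" "B \<in> Pow {..<n}"
    then have fin: "finite A" "finite B" using finite_subset by auto
    show "(if sym_diff A B = S then cl_sign A B * coef x A * coef y B else 0) = 0"
    proof (cases "sym_diff A B = S")
      case True
      then have "odd (card A) \<or> odd (card B)" using S even_card_sym_diff[OF fin] by auto
      then show ?thesis using x y by auto
    qed simp
  qed
qed

lemma evn_vecn_mult: "evn (vecn n v * vecn n w)"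
  unfolding evn_def
proof (intro allI impI)
  fix S :: "nat set" assume S: "odd (card S)"
  show "coef (vecn n v * vecn n w) S = 0" unfolding coef_mult_sum[OF supp_in_vecn supp_in_vecn]
  proof (intro sum.neutral ballI)
    fix A B assume "A \<in> Pow {..<n}" "B \<in> Pow {..<n}"
    then have fin: "finite A" "finite B" using finite_subset by auto
    show "(if sym_diff A B = S then cl_sign A B * coef (vecn n v) A * coef (vecn n w) B else 0) = 0"
    proof (cases "sym_diff A B = S")
      case True
      then have "even (card A) \<or> even (card B)" using S even_card_sym_diff[OF fin] by auto
      then have "coef (vecn n v) A = 0 \<or> coef (vecn n w) B = 0" by (auto intro!: coef_vecn_other)
      then show ?thesis by auto
    qed simp
  qed
qed

lemma evn_cst: "evn (cst c)" and evn_add: "evn x \<Longrightarrow> evn y \<Longrightarrow> evn (x + y)"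
  by (auto simp: evn_def coef_cst)

definition spinor :: "nat \<Rightarrow> complex fls clf \<Rightarrow> bool" where
  "spinor n x \<longleftrightarrow> supp_in n x \<and> evn x \<and> x * rev_cl x = 1 \<and> rev_cl x * x = 1 \<and>
     (\<forall>v. \<exists>w. x * vecn n v * rev_cl x = vecn n w)"

lemma spinor_mult:
  assumes "spinor n x" "spinor n y"
  shows "spinor n (x * y)"
proof -
  have inv: "x * rev_cl x = 1" "rev_cl x * x = 1" "y * rev_cl y = 1" "rev_cl y * y = 1"
    using assms by (simp_all add: spinor_def)
  have "x * y * rev_cl (x * y) = x * (y * rev_cl y) * rev_cl x" by (simp only: rev_mult mult.assoc)
  then have 1: "x * y * rev_cl (x * y) = 1" by (simp add: inv)
  have "rev_cl (x * y) * (x * y) = rev_cl y * (rev_cl x * x) * y" by (simp only: rev_mult mult.assoc)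
  then have 2: "rev_cl (x * y) * (x * y) = 1" by (simp add: inv)
  have 3: "\<exists>w. x * y * vecn n v * rev_cl (x * y) = vecn n w" for v
  proof -
    obtain u where u: "y * vecn n v * rev_cl y = vecn n u" using assms(2) by (auto simp: spinor_def)
    obtain w where w: "x * vecn n u * rev_cl x = vecn n w" using assms(1) by (auto simp: spinor_def)
    have "x * y * vecn n v * rev_cl (x * y) = x * (y * vecn n v * rev_cl y) * rev_cl x" by (simp only: rev_mult mult.assoc)
    then show ?thesis using u w by auto
  qed
  show ?thesis using assms 1 2 3 unfolding spinor_def by (auto intro: supp_in_mult evn_mult)
qed

lemma supp_in_1: "supp_in n 1" by (rule supp_inI) (auto simp: coef_1)

lemma spinor_el:
  assumes "dot n v w = 0" "dot n w w = (0 :: complex fls)"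
  shows "spinor n (1 + vecn n v * vecn n w)"
  unfolding spinor_def el_conj[OF assms]
  using el_inverse[OF assms] evn_cst[of 1]
  by (auto intro: supp_in_add supp_in_1 supp_in_mult supp_in_vecn evn_add evn_vecn_mult)

lemma spinor_pair:
  assumes "dot n v v = 1" "dot n w w = (1 :: complex fls)"
  shows "spinor n (vecn n v * vecn n w)"
proof -
  have conj: "vecn n v * vecn n w * vecn n x * rev_cl (vecn n v * vecn n w) = vecn n (refl n v (refl n w x))" for x
  proof -
    have "vecn n v * vecn n w * vecn n x * rev_cl (vecn n v * vecn n w) = vecn n v * (vecn n w * vecn n x * vecn n w) * vecn n v"
      by (simp only: rev_mult rev_vecn mult.assoc)
    then show ?thesis by (simp add: refl_conj[OF assms(1)] refl_conj[OF assms(2)])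
  qed
  have "vecn n v * vecn n w * rev_cl (vecn n v * vecn n w) = vecn n v * (vecn n w * vecn n w) * vecn n v"
    "rev_cl (vecn n v * vecn n w) * (vecn n v * vecn n w) = vecn n w * (vecn n v * vecn n v) * vecn n w"
    by (simp_all only: rev_mult rev_vecn mult.assoc)
  then show ?thesis unfolding spinor_def conj
    by (auto simp: vecn_sq assms intro: supp_in_mult supp_in_vecn evn_vecn_mult)
qed

lemma spinor_sign: "spinor n 1" "spinor n (-1)"
  unfolding spinor_def using evn_cst[of 1] evn_cst[of "-1"] supp_in_cst[of n "-1"] supp_in_1[of n]
  by (auto simp: rev_minus cst_minus)

subsection \<open>The twisted action and coefficient rings\<close>

definition sg :: "complex fls clf \<Rightarrow> complex fls clf" where
  "sg x = Clf (spin_sigma (coef x))"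

lemma coef_sg_fun: "coef (sg x) = spin_sigma (coef x)"
proof -
  obtain n where "supp_in n x" using supp_in_ex by blast
  then have "spin_sigma (coef x) \<in> cl_carrier n" by (simp add: supp_in_def cl_carrier_def spin_sigma_def)
  then show ?thesis unfolding sg_def by (simp add: coef_Clf)
qed

lemma coef_sg: "coef (sg x) S = (if 0 \<in> S then -1 else 1) * fls_twist (coef x S)"
  by (simp add: coef_sg_fun spin_sigma_def)

lemma supp_in_sg: "supp_in n x \<Longrightarrow> supp_in n (sg x)"
  by (rule supp_inI) (simp add: coef_sg supp_inD)

lemma sg_add: "sg (x + y) = sg x + sg y" and sg_minus: "sg (- x) = - sg x" and sg_diff: "sg (x - y) = sg x - sg y"
  and sg_cst [simp]: "sg (cst c) = cst (fls_twist c)"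
  by (rule clf_eqI; simp add: coef_sg coef_cst)+

lemma sg_1 [simp]: "sg 1 = 1"
  using sg_cst[of 1] by (simp del: sg_cst)

lemma sg_0 [simp]: "sg 0 = 0"
  using sg_cst[of 0] by (simp del: sg_cst)

lemma sg_sum: "sg (\<Sum>i\<in>I. f i) = (\<Sum>i\<in>I. sg (f i))"
  by (induction I rule: infinite_finite_induct) (simp_all add: sg_add)

lemma fls_twist_sign: "fls_twist (cl_sign A B) = cl_sign A B"
  by (simp add: cl_sign_def)

lemma sg_mult: "sg (x * y) = sg x * sg y"
proof (rule clf_eqI)
  fix S
  obtain n where n: "supp_in n x" "supp_in n y" using supp_in_common by blast
  define \<chi> where "\<chi> S = (if 0 \<in> S then -1 else 1 :: complex fls)" for S :: "nat set"
  have \<chi>: "\<chi> (sym_diff A B) = \<chi> A * \<chi> B" for A B by (auto simp: \<chi>_def)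
  have tw: "fls_twist (if P then f else 0) = (if P then fls_twist f else 0)" for P f by simp
  show "coef (sg (x * y)) S = coef (sg x * sg y) S"
    unfolding coef_mult_sum[OF supp_in_sg[OF n(1)] supp_in_sg[OF n(2)]] coef_sg coef_mult_sum[OF n]
      fls_twist_sum tw sum_distrib_left \<chi>_def[symmetric]
    by (intro sum.cong refl) (auto simp: \<chi> fls_twist_sign mult_ac)
qed

lemma sg_vecn: "sg (vecn n v) = vecn n (\<lambda>i. (if i = 0 then -1 else 1) * fls_twist (v i))"
proof -
  have "sg (E {i}) = cst (if i = 0 then -1 else 1) * E {i}" for i
    by (rule clf_eqI) (auto simp: coef_sg coef_E)
  then show ?thesis unfolding vecn_def sg_sum sg_mult
    by (intro sum.cong refl) (simp add: cst_mult cst_minus)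
qed

definition coefs_in :: "complex fls set \<Rightarrow> complex fls clf \<Rightarrow> bool" where
  "coefs_in R x \<longleftrightarrow> (\<forall>S. coef x S \<in> R)"

lemma cl_sign_in: "subring_K R \<Longrightarrow> cl_sign A B \<in> R"
  unfolding cl_sign_def by (intro subring_power subring_uminus subring_1)

lemma coefs_in_mult: "subring_K R \<Longrightarrow> coefs_in R x \<Longrightarrow> coefs_in R y \<Longrightarrow> coefs_in R (x * y)"
  unfolding coefs_in_def
proof
  fix S assume R: "subring_K R" and x: "\<forall>S. coef x S \<in> R" and y: "\<forall>S. coef y S \<in> R"
  obtain n where n: "supp_in n x" "supp_in n y" using supp_in_common by blast
  show "coef (x * y) S \<in> R" unfolding coef_mult_sum[OF n] using x y
    by (auto intro!: subring_sum[OF R] subring_mult[OF R] cl_sign_in[OF R] subring_0[OF R])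
qed

lemma coefs_in_add: "subring_K R \<Longrightarrow> coefs_in R x \<Longrightarrow> coefs_in R y \<Longrightarrow> coefs_in R (x + y)"
  and coefs_in_minus: "subring_K R \<Longrightarrow> coefs_in R x \<Longrightarrow> coefs_in R (- x)"
  by (simp_all add: coefs_in_def subring_add subring_uminus subring_diff)

lemma coefs_in_cst: "subring_K R \<Longrightarrow> c \<in> R \<Longrightarrow> coefs_in R (cst c)"
  by (auto simp: coefs_in_def coef_cst subring_0)

lemma coefs_in_1: "subring_K R \<Longrightarrow> coefs_in R 1"
  using coefs_in_cst[OF _ subring_1] by simp

lemma coefs_in_E: "subring_K R \<Longrightarrow> coefs_in R (E S)"
  by (auto simp: coefs_in_def coef_E subring_0 subring_1)

lemma coefs_in_sum: "subring_K R \<Longrightarrow> (\<And>i. i \<in> I \<Longrightarrow> coefs_in R (f i)) \<Longrightarrow> coefs_in R (sum f I)"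
  by (simp add: coefs_in_def subring_sum)

lemma coefs_in_vecn: "subring_K R \<Longrightarrow> (\<And>i. i < n \<Longrightarrow> v i \<in> R) \<Longrightarrow> coefs_in R (vecn n v)"
  unfolding vecn_def by (intro coefs_in_sum coefs_in_mult coefs_in_cst coefs_in_E) auto

lemma coefs_in_rev: "subring_K R \<Longrightarrow> coefs_in R x \<Longrightarrow> coefs_in R (rev_cl x)"
  by (auto simp: coefs_in_def coef_rev intro!: subring_mult subring_power subring_uminus subring_1)

definition loop_el :: "nat \<Rightarrow> complex fls clf \<Rightarrow> bool" where
  "loop_el n x \<longleftrightarrow> spinor n x \<and> sg x = x"

definition loop_O_el :: "nat \<Rightarrow> complex fls clf \<Rightarrow> bool" where
  "loop_O_el n x \<longleftrightarrow> loop_el n x \<and> coefs_in fls_O x"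

text \<open>The reversal is the inverse of a spinor. It must be integral too, since a right factor
  is moved across the base point by its inverse.\<close>

definition unit_O :: "nat \<Rightarrow> complex fls clf \<Rightarrow> bool" where
  "unit_O n x \<longleftrightarrow> loop_O_el n x \<and> loop_O_el n (rev_cl x)"

lemma loop_el_mult: "loop_el n x \<Longrightarrow> loop_el n y \<Longrightarrow> loop_el n (x * y)"
  by (simp add: loop_el_def spinor_mult sg_mult)

lemma loop_O_el_mult: "loop_O_el n x \<Longrightarrow> loop_O_el n y \<Longrightarrow> loop_O_el n (x * y)"
  by (simp add: loop_O_el_def loop_el_mult coefs_in_mult[OF subring_O])

lemma unit_O_mult: "unit_O n x \<Longrightarrow> unit_O n y \<Longrightarrow> unit_O n (x * y)"
  by (simp add: unit_O_def loop_O_el_mult rev_mult)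

lemma unit_O_rev: "unit_O n x \<Longrightarrow> unit_O n (rev_cl x)"
  by (simp add: unit_O_def)

lemma unit_O_inverse: "unit_O n x \<Longrightarrow> x * rev_cl x = 1" "unit_O n x \<Longrightarrow> rev_cl x * x = 1"
  by (simp_all add: unit_O_def loop_O_el_def loop_el_def spinor_def)

lemma unit_O_sign: "unit_O n 1" "unit_O n (-1)"
  unfolding unit_O_def loop_O_el_def loop_el_def using spinor_sign[of n]
  by (simp_all add: sg_minus rev_minus coefs_in_1[OF subring_O] coefs_in_minus[OF subring_O])

section \<open>Torus elements and normalised translation elements\<close>

abbreviation ee :: "nat \<Rightarrow> complex fls clf" where
  "ee i \<equiv> E {i}"

definition bivec :: "nat \<Rightarrow> complex fls clf" where
  "bivec k = ee (2*k) * ee (Suc (2*k))"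

definition torus :: "nat \<Rightarrow> complex fls \<Rightarrow> complex fls clf" where
  "torus k z = cst ((z + 1) / 2) - cst (fls_const \<i> * (z - 1) / 2) * bivec k"

lemma E_anti':
  assumes "i \<noteq> j"
  shows "ee i * (ee j * x) = - (ee j * (ee i * x))"
  unfolding mult.assoc[symmetric] E_anticommute[OF assms] by simp

lemma E_sq': "ee i * (ee i * x) = x"
  by (simp only: mult.assoc[symmetric] E_sq mult_1_left)

lemma double_neq: "2*k \<noteq> Suc (2*j)" "Suc (2*j) \<noteq> 2*k" for j k :: nat
  by presburger+

lemma bivec_sq: "bivec k * bivec k = -1"
proof -
  have "bivec k * bivec k = ee (2*k) * (ee (Suc (2*k)) * (ee (2*k) * ee (Suc (2*k))))"
    by (simp only: bivec_def mult.assoc)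
  also have "\<dots> = -1" unfolding E_anti'[of "Suc (2*k)" "2*k", OF double_neq(2)] by (simp add: E_sq E_sq')
  finally show ?thesis .
qed

lemma bivec_E_other:
  assumes "i \<noteq> 2*k" "i \<noteq> Suc (2*k)"
  shows "bivec k * ee i = ee i * bivec k"
proof -
  have "bivec k * ee i = ee (2*k) * (ee (Suc (2*k)) * ee i)" by (simp only: bivec_def mult.assoc)
  also have "\<dots> = - (ee (2*k) * (ee i * ee (Suc (2*k))))" unfolding E_anticommute[OF assms(2)[symmetric]] by simp
  also have "\<dots> = ee i * bivec k" unfolding bivec_def E_anti'[OF assms(1)] ..
  finally show ?thesis .
qed

lemma bivec_E_same: "i = 2*k \<or> i = Suc (2*k) \<Longrightarrow> bivec k * ee i = - (ee i * bivec k)"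
proof (elim disjE)
  assume i: "i = 2*k"
  have "bivec k * ee i = ee (2*k) * (ee (Suc (2*k)) * ee (2*k))" by (simp only: bivec_def mult.assoc i)
  also have "\<dots> = - (ee (2*k) * (ee (2*k) * ee (Suc (2*k))))" unfolding E_anticommute[OF double_neq(2)] by simp
  finally show ?thesis by (simp only: bivec_def i)
next
  assume i: "i = Suc (2*k)"
  have "ee i * bivec k = ee (Suc (2*k)) * (ee (2*k) * ee (Suc (2*k)))" by (simp only: bivec_def mult.assoc i)
  also have "\<dots> = - (ee (2*k) * (ee (Suc (2*k)) * ee (Suc (2*k))))" by (rule E_anti'[OF double_neq(2)])
  finally show ?thesis by (simp only: bivec_def i mult.assoc minus_minus)
qed

lemma bivec_commute: "bivec j * bivec k = bivec k * bivec j"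
proof (cases "j = k")
  case False
  have c: "bivec j * ee (2*k) = ee (2*k) * bivec j" "bivec j * ee (Suc (2*k)) = ee (Suc (2*k)) * bivec j"
    using False by (intro bivec_E_other; presburger)+
  have "bivec j * bivec k = (bivec j * ee (2*k)) * ee (Suc (2*k))" by (simp only: bivec_def[of k] mult.assoc)
  also have "\<dots> = ee (2*k) * (bivec j * ee (Suc (2*k)))" by (simp only: c(1) mult.assoc)
  also have "\<dots> = bivec k * bivec j" by (simp only: c(2) bivec_def[of k] mult.assoc)
  finally show ?thesis .
qed simp

lemma rev_bivec: "rev_cl (bivec k) = - bivec k"
  unfolding bivec_def rev_mult rev_E_single by (rule E_anticommute[OF double_neq(2)])

lemma sg_E_single: "sg (ee i) = (if i = 0 then - ee i else ee i)"
  by (rule clf_eqI) (auto simp: coef_sg coef_E)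

lemma sg_bivec: "sg (bivec k) = (if k = 0 then - bivec k else bivec k)"
  unfolding bivec_def sg_mult sg_E_single by simp

lemma coef_bivec: "coef (bivec k) S = (if S = {2*k, Suc (2*k)} then 1 else 0)"
proof -
  have "{(i, j). i \<in> {2*k} \<and> j \<in> {Suc (2*k)} \<and> j < i} = {}" by auto
  then have "cl_sign {2*k} {Suc (2*k)} = (1 :: complex fls)" unfolding cl_sign_def by (simp only: card.empty power_0)
  moreover have "sym_diff {2*k} {Suc (2*k)} = {2*k, Suc (2*k)}" by auto
  ultimately have "bivec k = E {2*k, Suc (2*k)}" unfolding bivec_def by (simp add: E_mult)
  then show ?thesis by (simp add: coef_E)
qed

lemma coef_torus: "coef (torus k z) = cl_torus k z"
  unfolding torus_def cl_torus_def by (rule ext) (simp add: coef_cst coef_bivec)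

lemma supp_in_E_single: "i < n \<Longrightarrow> supp_in n (E {i})"
  by (rule supp_in_E) simp

lemma supp_in_diff: "supp_in n x \<Longrightarrow> supp_in n y \<Longrightarrow> supp_in n (x - y :: 'a::comm_ring_1 clf)"
  by (rule supp_inI) (simp add: supp_inD)

lemma supp_in_bivec: "Suc (2*k) < n \<Longrightarrow> supp_in n (bivec k)"
  unfolding bivec_def by (intro supp_in_mult supp_in_E_single) auto

lemma supp_in_torus: "Suc (2*k) < n \<Longrightarrow> supp_in n (torus k z)"
  unfolding torus_def by (intro supp_in_diff supp_in_mult supp_in_cst supp_in_bivec)

lemma torus_1 [simp]: "torus k 1 = 1"
  by (simp add: torus_def)

lemma torus_commute: "bivec k * x = x * bivec k \<Longrightarrow> torus k z * x = x * torus k z"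
  unfolding torus_def left_diff_distrib right_diff_distrib
  by (simp only: mult.assoc cst_commute[of x] cst_left_commute[of x])

lemma torus_torus_commute: "torus j z * torus k w = torus k w * torus j z"
  by (intro torus_commute torus_commute[symmetric] bivec_commute)

lemma torus_mult: "torus k z * torus k w = torus k (z * w)"
proof -
  define a b a' b' where "a = (z + 1) / 2" and "b = fls_const \<i> * (z - 1) / 2"
    and "a' = (w + 1) / 2" and "b' = fls_const \<i> * (w - 1) / 2"
  have ii: "fls_const \<i> * fls_const \<i> = -1" 
    unfolding fls_const_mult_const by (rule fls_eqI) simp
  have "b * b' = (fls_const \<i> * fls_const \<i>) * ((z - 1) * (w - 1)) / 4"
    unfolding b_def b'_def by (simp only: times_divide_eq_left times_divide_eq_right divide_divide_eq_left mult_ac) simp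
  then have bb: "b * b' = - ((z - 1) * (w - 1) / 4)" unfolding ii by simp
  have "torus k z * torus k w = cst a * cst a' - cst a * (cst b' * bivec k) - cst b * bivec k * cst a' + cst b * bivec k * (cst b' * bivec k)"
    unfolding torus_def a_def[symmetric] b_def[symmetric] a'_def[symmetric] b'_def[symmetric] by (simp add: algebra_simps)
  also have "cst b * bivec k * (cst b' * bivec k) = cst (b * b') * (-1)"
    by (simp only: cst_mult_pair bivec_sq)
  also have "cst b * bivec k * cst a' = cst (b * a') * bivec k"
    by (simp only: cst_mult mult.assoc cst_commute[of "bivec k"])
  also have "cst a * cst a' - cst a * (cst b' * bivec k) - cst (b * a') * bivec k + cst (b * b') * (-1)
      = cst (a * a' - b * b') - cst (a * b' + b * a') * bivec k"
    by (simp add: cst_diff cst_add cst_mult algebra_simps) (simp only: mult.commute flip: cst_mult)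
  also have "a * a' - b * b' = (z * w + 1) / 2" unfolding bb by (simp add: a_def a'_def field_simps)
  also have "a * b' + b * a' = fls_const \<i> * (z * w - 1) / 2" by (simp add: a_def a'_def b_def b'_def field_simps)
  finally show ?thesis by (simp only: torus_def)
qed

lemma fls_twist_half [simp]: "fls_twist (f / 2) = fls_twist f / 2"
proof -
  have "fls_twist (1 + 1) = 1 + 1" by (simp only: fls_twist_simps)
  then have "fls_twist 2 = 2" by (simp only: one_add_one)
  then show ?thesis by (simp only: divide_inverse fls_twist_simps)
qed

lemma sg_torus_pos: "k \<noteq> 0 \<Longrightarrow> sg (torus k z) = torus k (fls_twist z)"
  by (simp add: torus_def sg_diff sg_mult sg_bivec)

text \<open>The twisted action exchanges the two isotropic lines of the plane containing e_0. With y
  the twist of \<open>z\<close>, the idempotent that carried \<open>z\<close> now carries 1 and the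
  other one y, which is y times the torus element of its inverse.\<close>

lemma sg_torus_0: "z \<noteq> 0 \<Longrightarrow> sg (torus 0 z) = cst (fls_twist z) * torus 0 (inverse (fls_twist z))"
proof -
  assume z: "z \<noteq> 0"
  have nz: "fls_twist z \<noteq> 0"
  proof
    assume "fls_twist z = 0"
    then have "fls_twist (z * inverse z) = 0" by (simp only: fls_twist_simps mult_zero_left)
    then show False using z by simp
  qed
  define y where "y = fls_twist z"
  have y: "y \<noteq> 0" using nz by (simp add: y_def)
  have "cst y * torus 0 (inverse y) = cst (y * ((inverse y + 1) / 2)) - cst (y * (fls_const \<i> * (inverse y - 1) / 2)) * bivec 0"
    unfolding torus_def by (simp only: right_diff_distrib cst_mult mult.assoc)
  also have "y * ((inverse y + 1) / 2) = (y + 1) / 2" using y by (simp add: field_simps)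
  also have "y * (fls_const \<i> * (inverse y - 1) / 2) = - (fls_const \<i> * (y - 1) / 2)" using y by (simp add: field_simps)
  finally show ?thesis unfolding y_def[symmetric]
    by (simp add: torus_def sg_diff sg_mult sg_bivec y_def[symmetric] cst_minus)
qed

fun torus_prod :: "complex fls \<Rightarrow> nat \<Rightarrow> complex fls clf" where
  "torus_prod z 0 = 1"
| "torus_prod z (Suc j) = torus_prod z j * torus (Suc j) z"

lemma torus_prod_commute: "(\<And>k. 1 \<le> k \<Longrightarrow> k \<le> j \<Longrightarrow> bivec k * x = x * bivec k) \<Longrightarrow> torus_prod z j * x = x * torus_prod z j"
proof (induction j)
  case (Suc j)
  have "torus_prod z (Suc j) * x = torus_prod z j * (torus (Suc j) z * x)" by (simp add: mult.assoc)
  also have "torus (Suc j) z * x = x * torus (Suc j) z" by (rule torus_commute) (use Suc.prems in auto)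
  also have "torus_prod z j * (x * torus (Suc j) z) = torus_prod z j * x * torus (Suc j) z" by (simp only: mult.assoc)
  also have "torus_prod z j * x = x * torus_prod z j" using Suc by auto
  finally show ?case by (simp add: mult.assoc)
qed simp

lemma torus_prod_torus_commute: "torus_prod z j * torus k w = torus k w * torus_prod z j"
  by (intro torus_prod_commute torus_commute[symmetric] bivec_commute)

lemma torus_prod_mult: "torus_prod z j * torus_prod w j = torus_prod (z * w) j"
proof (induction j)
  case (Suc j)
  have "torus_prod z (Suc j) * torus_prod w (Suc j) = torus_prod z j * (torus (Suc j) z * torus_prod w j) * torus (Suc j) w"
    by (simp add: mult.assoc)
  also have "\<dots> = (torus_prod z j * torus_prod w j) * (torus (Suc j) z * torus (Suc j) w)"
    unfolding torus_prod_torus_commute[symmetric] by (simp add: mult.assoc)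
  finally show ?case using Suc by (simp add: torus_mult)
qed simp

lemma sg_torus_prod: "sg (torus_prod z j) = torus_prod (fls_twist z) j"
  by (induction j) (simp_all add: sg_mult sg_torus_pos)

definition coroot_el :: "nat \<Rightarrow> nat \<Rightarrow> complex fls \<Rightarrow> complex fls clf" where
  "coroot_el l i z = (if i < l then torus i z * torus (i+1) (inverse z)
     else if i = l then torus l z * torus 0 (inverse z)
     else cst (inverse z) * (torus l z * torus 0 z))"

lemma coef_coroot_el:
  "coef (coroot_el l i z) = coroot l i z" "supp_in (2*l+2) (coroot_el l i z)"
proof -
  have T: "supp_in (2*l+2) (torus k z)" if "k \<le> l" for k z using that by (intro supp_in_torus) simp
  show "supp_in (2*l+2) (coroot_el l i z)" unfolding coroot_el_def
    using T by (auto intro!: supp_in_mult)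
  show "coef (coroot_el l i z) = coroot l i z"
    unfolding coroot_el_def coroot_def
    by (auto simp: coef_mult[OF T T] coef_torus fun_eq_iff)
qed

definition t_power_el :: "nat \<Rightarrow> (nat \<Rightarrow> int) \<Rightarrow> complex fls clf" where
  "t_power_el l m = prod_list (map (\<lambda>i. coroot_el l i (X powi m i)) [1..<l+2])"

lemma coef_prod_list:
  assumes "\<And>i. i \<in> set is \<Longrightarrow> supp_in n (f i)"
  shows "coef (prod_list (map f is)) = foldr (\<lambda>i. cl_mult n (coef (f i))) is cl_one \<and> supp_in n (prod_list (map f is))"
  using assms
proof (induction "is")
  case (Cons i "is")
  then have IH: "coef (prod_list (map f is)) = foldr (\<lambda>i. cl_mult n (coef (f i))) is cl_one" "supp_in n (prod_list (map f is))"
    and i: "supp_in n (f i)" by simp_all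
  show ?case using supp_in_mult[OF i IH(2)] by (simp add: coef_mult[OF i IH(2)] IH(1))
qed (simp add: coef_1_fun supp_in_1)

lemma coef_t_power_el: "coef (t_power_el l m) = t_power l m" "supp_in (2*l+2) (t_power_el l m)"
  using coef_prod_list[of "[1..<l+2]" "2*l+2" "\<lambda>i. coroot_el l i (X powi m i)"] coef_coroot_el
  by (simp_all add: t_power_el_def t_power_def)

definition n_el :: "nat \<Rightarrow> (nat \<Rightarrow> int) \<Rightarrow> complex fls clf" where
  "n_el l m = t_power_el l m * sg (t_power_el l m)"

lemma coef_n_el: "coef (n_el l m) = n_elt l m" "supp_in (2*l+2) (n_el l m)"
  using supp_in_mult[OF coef_t_power_el(2) supp_in_sg[OF coef_t_power_el(2)], of l m m]
  by (simp_all only: n_el_def n_elt_def coef_mult[OF coef_t_power_el(2) supp_in_sg[OF coef_t_power_el(2)]]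
      coef_t_power_el(1) coef_sg_fun)

text \<open>The product telescopes: the second torus factor of one coroot meets the first factor of
  the next. The inverse in coordinate \<open>Suc k\<close> is still waiting for its partner.\<close>

lemma coroot_prod:
  assumes "k < l" and z: "\<And>i. z i \<noteq> 0" and c: "\<And>i. 1 \<le> i \<Longrightarrow> i \<le> k \<Longrightarrow> c i = z i / (if i = 1 then 1 else z (i - 1))"
  shows "prod_list (map (\<lambda>i. coroot_el l i (z i)) [1..<Suc k]) =
    prod_list (map (\<lambda>i. torus i (c i)) [1..<Suc k]) * torus (Suc k) (if k = 0 then 1 else inverse (z k))"
  using assms(1) c
proof (induction k)
  case (Suc k)
  have "prod_list (map (\<lambda>i. coroot_el l i (z i)) [1..<Suc (Suc k)]) =
    prod_list (map (\<lambda>i. torus i (c i)) [1..<Suc k]) * torus (Suc k) (if k = 0 then 1 else inverse (z k)) * coroot_el l (Suc k) (z (Suc k))"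
    using Suc by simp
  also have "coroot_el l (Suc k) (z (Suc k)) = torus (Suc k) (z (Suc k)) * torus (Suc (Suc k)) (inverse (z (Suc k)))"
    using Suc.prems by (simp add: coroot_el_def)
  also have "prod_list (map (\<lambda>i. torus i (c i)) [1..<Suc k]) * torus (Suc k) (if k = 0 then 1 else inverse (z k)) * \<dots> =
    prod_list (map (\<lambda>i. torus i (c i)) [1..<Suc k]) * (torus (Suc k) (if k = 0 then 1 else inverse (z k)) * torus (Suc k) (z (Suc k))) * torus (Suc (Suc k)) (inverse (z (Suc k)))"
    by (simp only: mult.assoc)
  also have "torus (Suc k) (if k = 0 then 1 else inverse (z k)) * torus (Suc k) (z (Suc k)) = torus (Suc k) (c (Suc k))"
    using Suc.prems(2)[of "Suc k"] by (simp add: torus_mult field_simps)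
  finally show ?case by (simp add: mult.assoc)
qed simp

lemma torus_prod_eq:
  assumes "j \<le> k"
  shows "prod_list (map (\<lambda>i. torus i (if i \<le> j then z else 1)) [1..<Suc k]) = torus_prod z j"
  using assms
proof (induction k rule: dec_induct)
  case base
  have "map (\<lambda>i. torus i (if i \<le> j then z else 1)) [1..<Suc j] = map (\<lambda>i. torus i z) [1..<Suc j]" by simp
  then show ?case by (simp only:) (induction j; simp)
qed simp

text \<open>The class prescribes all telescoped coordinates, t up to \<open>j\<close> and 1 beyond.
  Of \<open>m l\<close> and \<open>m (l+1)\<close> only the sum is prescribed; their difference
  shows up in the torus of the plane of e_0, and \<open>m (l+1)\<close> in a scalar.\<close>

lemma t_power_el_eq:
  assumes l: "1 \<le> l" and j: "j \<le> l" and a: "\<And>k. k \<in> {1..l} \<Longrightarrow> coinv_class l m k = (if k \<le> j then 1 else 0)"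
  shows "t_power_el l m = cst (X powi (- m (l+1))) * (torus_prod X j * torus 0 (X powi (m (l+1) - m l)))"
    and "m l + m (l+1) = int j"
proof -
  have coinv: "coinv_class l m k = (m k - (if k = 1 then 0 else m (k - 1))) + (if k = l then m (l+1) else 0)"
    if "k \<in> {1..l}" for k
    unfolding coinv_class_def using sum_gam[OF that, of m] by (simp add: gam_def)
  have partial: "m k = int (min k j)" if "k < l" "1 \<le> k" for k
    using that(2,1)
  proof (induction k rule: dec_induct)
    case base
    then show ?case using coinv[of 1] a[of 1] by (simp split: if_splits)
  next
    case (step k)
    then show ?case using coinv[of "Suc k"] a[of "Suc k"] by (simp split: if_splits)
  qed
  have ml: "m l + m (l+1) - (if l = 1 then 0 else m (l - 1)) = (if l \<le> j then 1 else 0)"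
    using coinv[of l] a[of l] l by simp
  then show sum: "m l + m (l+1) = int j" using partial[of "l - 1"] l j by (cases "l = 1") (auto split: if_splits)
  obtain p where p: "l = Suc p" using l by (cases l) auto
  define z where "z i = X powi m i" for i
  have z0: "z i \<noteq> 0" for i by (simp add: z_def)
  define c where "c i = (if i \<le> j then X else 1)" for i
  have c: "c i = z i / (if i = 1 then 1 else z (i - 1))" if "1 \<le> i" "i \<le> p" for i
  proof -
    have "m i - (if i = 1 then 0 else m (i - 1)) = (if i \<le> j then 1 else 0)"
      using coinv[of i] a[of i] that p by simp
    then have "m i = (if i = 1 then 0 else m (i - 1)) + (if i \<le> j then 1 else 0)" by linarith
    then have "z i = (if i = 1 then 1 else z (i - 1)) * c i"
      unfolding z_def c_def by (auto simp: power_int_add simp del: fls_X_power_int)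
    then show ?thesis using z0[of "i - 1"] by simp
  qed
  have cl: "(if p = 0 then 1 else inverse (z p)) * z l * z (l+1) = c l"
  proof -
    have "z l * z (l+1) = (if p = 0 then 1 else z p) * c l"
    proof -
      have "m l + m (l+1) = (if p = 0 then 0 else m p) + (if l \<le> j then 1 else 0)" using ml p by (auto split: if_splits)
      moreover have "z l * z (l+1) = X powi (m l + m (l+1))" unfolding z_def by (rule power_int_add[symmetric]) simp
      ultimately show ?thesis unfolding z_def c_def by (auto simp: power_int_add simp del: fls_X_power_int)
    qed
    then show ?thesis using z0[of p] by (auto simp: mult.assoc)
  qed
  let ?w = "if p = 0 then 1 else inverse (z p)"
  have "[1..<l+2] = [1..<Suc p] @ [l, l+1]" unfolding p by simp
  then have "t_power_el l m = prod_list (map (\<lambda>i. coroot_el l i (z i)) [1..<Suc p]) * (coroot_el l l (z l) * coroot_el l (l+1) (z (l+1)))"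
    unfolding t_power_el_def z_def[symmetric] by simp
  also have "prod_list (map (\<lambda>i. coroot_el l i (z i)) [1..<Suc p]) = prod_list (map (\<lambda>i. torus i (c i)) [1..<Suc p]) * torus l ?w"
    using coroot_prod[of p l z c] z0 c p by simp
  also have "coroot_el l l (z l) * coroot_el l (l+1) (z (l+1)) =
    cst (inverse (z (l+1))) * (torus l (z l) * (torus 0 (inverse (z l)) * torus l (z (l+1))) * torus 0 (z (l+1)))"
    by (simp add: coroot_el_def cst_left_commute mult.assoc)
  also have "torus 0 (inverse (z l)) * torus l (z (l+1)) = torus l (z (l+1)) * torus 0 (inverse (z l))" by (rule torus_torus_commute)
  also have "torus l (z l) * (torus l (z (l+1)) * torus 0 (inverse (z l))) * torus 0 (z (l+1)) =
    (torus l (z l) * torus l (z (l+1))) * (torus 0 (inverse (z l)) * torus 0 (z (l+1)))" by (simp only: mult.assoc)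
  also have "\<dots> = torus l (z l * z (l+1)) * torus 0 (inverse (z l) * z (l+1))" by (simp only: torus_mult)
  also have "prod_list (map (\<lambda>i. torus i (c i)) [1..<Suc p]) * torus l ?w * (cst (inverse (z (l+1))) * \<dots>) =
    cst (inverse (z (l+1))) * (prod_list (map (\<lambda>i. torus i (c i)) [1..<Suc p]) * (torus l ?w * torus l (z l * z (l+1))) * torus 0 (inverse (z l) * z (l+1)))"
    by (simp only: cst_left_commute mult.assoc)
  also have "torus l ?w * torus l (z l * z (l+1)) = torus l (c l)" using cl by (simp add: torus_mult mult.assoc)
  also have "prod_list (map (\<lambda>i. torus i (c i)) [1..<Suc p]) * torus l (c l) = prod_list (map (\<lambda>i. torus i (c i)) [1..<Suc l])"
    using p by simp
  also have "\<dots> = torus_prod X j" unfolding c_def using torus_prod_eq[OF j] .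
  also have "inverse (z (l+1)) = X powi (- m (l+1))" unfolding z_def by (simp add: power_int_minus del: fls_X_power_int)
  also have "inverse (z l) * z (l+1) = X powi (m (l+1) - m l)" unfolding z_def
    by (simp add: power_int_diff divide_inverse mult.commute del: fls_X_power_int)
  finally show "t_power_el l m = cst (X powi (- m (l+1))) * (torus_prod X j * torus 0 (X powi (m (l+1) - m l)))" .
qed

lemma cst_mult_triple: "(cst a * x) * (cst b * (y * (cst c * z))) = cst (a * b * c) * (x * y * z)"
proof -
  have "cst b * (y * (cst c * z)) = cst (b * c) * (y * z)" by (simp only: cst_left_commute[of y] cst_mult mult.assoc)
  then have "(cst a * x) * (cst b * (y * (cst c * z))) = (cst a * x) * (cst (b * c) * (y * z))" by (simp only:)
  also have "\<dots> = cst (a * (b * c)) * (x * (y * z))" by (rule cst_mult_pair)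
  finally show ?thesis by (simp only: mult.assoc)
qed

text \<open>On each of the first \<open>j\<close> planes t times its twist is
  \<open>- (X ^ 2)\<close>. The scalar brings the spinor norm back to 1, and a sign remains on the
  plane of e_0.\<close>

definition std_n :: "nat \<Rightarrow> complex fls clf" where
  "std_n j = cst (Xi ^ j) * (torus_prod (- (X ^ 2)) j * torus 0 ((-1) ^ j))"

lemma sign_powi: "(-1 :: complex fls) powi k = (if even k then 1 else -1)"
  by (simp add: power_int_minus_left)

text \<open>The choice of a lift of the class changes the translation element only by a sign, which
  is central and integral and so leaves the orbit unchanged.\<close>

lemma n_el_eq:
  assumes l: "1 \<le> l" and j: "j \<le> l" and a: "\<And>k. k \<in> {1..l} \<Longrightarrow> coinv_class l m k = (if k \<le> j then 1 else 0)"
  shows "n_el l m = std_n j \<or> n_el l m = - std_n j"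
proof -
  note tp = t_power_el_eq[OF assms]
  define p c w where "p = X powi (- m (l+1))" and "c = m (l+1) - m l" and "w = X powi c"
  have tp1: "t_power_el l m = cst p * (torus_prod X j * torus 0 w)" unfolding p_def c_def w_def by (rule tp(1))
  have negX: "(- X) powi k = (-1) powi k * X powi k" for k
    using power_int_mult_distrib[of "-1" X k] by simp
  have w0: "w \<noteq> 0" by (simp add: w_def)
  have tw: "fls_twist w = (-1) powi c * w" "fls_twist p = (-1) powi (m (l+1)) * p"
    unfolding w_def p_def fls_twist_simps negX by (simp_all add: power_int_minus_left)
  \<comment> \<open>\<open>c\<close> and \<open>j\<close> are the difference and the sum of the same
    two integers and have equal parity.\<close>
  have tww: "inverse (fls_twist w) * w = (-1) ^ j"
  proof -
    have "even c \<longleftrightarrow> even j" using tp(2) unfolding c_def by presburger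
    then show ?thesis using w0 unfolding tw sign_powi by (auto simp: minus_one_power_iff)
  qed
  have "n_el l m = (cst p * (torus_prod X j * torus 0 w)) * (cst (fls_twist p) * (torus_prod (- X) j * (cst (fls_twist w) * torus 0 (inverse (fls_twist w)))))"
    unfolding n_el_def tp1 sg_mult sg_cst sg_torus_prod sg_torus_0[OF w0] fls_twist_simps(7) ..
  also have "\<dots> = cst (p * fls_twist p * fls_twist w) * (torus_prod X j * (torus 0 w * torus_prod (- X) j) * torus 0 (inverse (fls_twist w)))"
    unfolding cst_mult_triple by (simp only: mult.assoc)
  also have "torus_prod X j * (torus 0 w * torus_prod (- X) j) * torus 0 (inverse (fls_twist w)) =
     (torus_prod X j * torus_prod (- X) j) * (torus 0 w * torus 0 (inverse (fls_twist w)))"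
    unfolding torus_prod_torus_commute[symmetric] by (simp only: mult.assoc)
  also have "\<dots> = torus_prod (- (X ^ 2)) j * torus 0 ((-1) ^ j)"
    unfolding torus_prod_mult torus_mult mult.commute[of w] tww by (simp add: power2_eq_square)
  also have "p * fls_twist p * fls_twist w = ((-1) powi (m (l+1)) * (-1) powi c) * (p * p * w)"
    unfolding tw by (simp only: mult_ac)
  also have "p * p * w = Xi ^ j"
  proof -
    have "p * p * w = X powi (- m (l+1) + - m (l+1) + c)"
      unfolding p_def w_def by (simp only: power_int_add[OF disjI1[OF fls_X_nonzero]])
    also have "- m (l+1) + - m (l+1) + c = - int j" using tp(2) by (simp add: c_def)
    finally show ?thesis by (simp add: power_int_minus power_inverse[symmetric] fls_inverse_X del: fls_X_power_int)
  qed
  finally have "n_el l m = cst ((-1) powi (m (l+1)) * (-1) powi c * Xi ^ j) * (torus_prod (- (X ^ 2)) j * torus 0 ((-1) ^ j))" .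
  then show ?thesis unfolding std_n_def sign_powi by (auto simp: cst_minus)
qed

subsection \<open>Even subalgebras\<close>

text \<open>Even elements on disjoint sets of coordinates commute, with no sign. This keeps the
  factorisations of different planes from interfering.\<close>

inductive_set evalg :: "nat set \<Rightarrow> complex fls clf set" for S where
  cst: "cst c \<in> evalg S"
| gen: "a \<in> S \<Longrightarrow> b \<in> S \<Longrightarrow> ee a * ee b \<in> evalg S"
| add: "x \<in> evalg S \<Longrightarrow> y \<in> evalg S \<Longrightarrow> x + y \<in> evalg S"
| mult: "x \<in> evalg S \<Longrightarrow> y \<in> evalg S \<Longrightarrow> x * y \<in> evalg S"

lemma evalg_1: "1 \<in> evalg S"
  using evalg.cst[of 1] by simp

lemma evalg_minus: "x \<in> evalg S \<Longrightarrow> - x \<in> evalg S"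
  using evalg.mult[OF evalg.cst[of "-1"]] by (simp add: cst_minus)

lemma evalg_diff: "x \<in> evalg S \<Longrightarrow> y \<in> evalg S \<Longrightarrow> x - y \<in> evalg S"
  using evalg.add[OF _ evalg_minus] by fastforce

lemmas evalg_intros = evalg.cst evalg_1 evalg.add evalg.mult evalg_minus evalg_diff

lemma evalg_mono: "x \<in> evalg S \<Longrightarrow> S \<subseteq> T \<Longrightarrow> x \<in> evalg T"
  by (induction rule: evalg.induct) (auto intro: evalg.intros)

lemma evalg_commute:
  assumes "x \<in> evalg S" "y \<in> evalg T" "S \<inter> T = {}"
  shows "x * y = y * x"
proof -
  have gens: "ee a * ee b * (ee c * ee d) = ee c * ee d * (ee a * ee b)"
    if "a \<in> S" "b \<in> S" "c \<in> T" "d \<in> T" for a b c d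
  proof -
    have neq: "a \<noteq> c" "a \<noteq> d" "b \<noteq> c" "b \<noteq> d" using that assms(3) by auto
    have "ee a * ee b * (ee c * ee d) = ee a * (ee b * (ee c * ee d))" by (simp only: mult.assoc)
    also have "\<dots> = ee a * (ee c * (ee d * ee b))"
      unfolding E_anti'[OF neq(3)] E_anticommute[OF neq(4)] by simp
    also have "\<dots> = ee c * (ee d * (ee a * ee b))"
      unfolding E_anti'[OF neq(1)] E_anti'[OF neq(2)] by simp
    finally show ?thesis by (simp only: mult.assoc)
  qed
  have one: "ee a * ee b * y = y * (ee a * ee b)" if "a \<in> S" "b \<in> S" for a b
    using assms(2)
  proof induction
    case (cst c) show ?case by (simp only: cst_commute[of "ee a * ee b"])
  next
    case (gen c d) then show ?case using gens that by blast
  next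
    case (add x y) then show ?case by (simp only: distrib_left distrib_right)
  next
    case (mult x y)
    have "ee a * ee b * (x * y) = (ee a * ee b * x) * y" by (simp only: mult.assoc)
    also have "\<dots> = x * (ee a * ee b * y)" unfolding mult.IH(1) by (simp only: mult.assoc)
    also have "\<dots> = (x * y) * (ee a * ee b)" unfolding mult.IH(2) by (simp only: mult.assoc)
    finally show ?case .
  qed
  show ?thesis using assms(1)
  proof induction
    case (cst c) show ?case by (simp only: cst_commute[of y])
  next
    case (gen a b) then show ?case using one by blast
  next
    case (add x y) then show ?case by (simp only: distrib_left distrib_right)
  next
    case (mult x z)
    have "x * z * y = x * (z * y)" by (simp only: mult.assoc)
    also have "\<dots> = (x * y) * z" unfolding mult.IH(2) by (simp only: mult.assoc)
    also have "\<dots> = y * (x * z)" unfolding mult.IH(1) by (simp only: mult.assoc)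
    finally show ?case .
  qed
qed

lemma evalg_bivec: "2*k \<in> S \<Longrightarrow> Suc (2*k) \<in> S \<Longrightarrow> bivec k \<in> evalg S"
  unfolding bivec_def by (rule evalg.gen)

lemma evalg_torus: "2*k \<in> S \<Longrightarrow> Suc (2*k) \<in> S \<Longrightarrow> torus k z \<in> evalg S"
  unfolding torus_def by (intro evalg_intros evalg_bivec)

lemma evalg_torus_prod: "torus_prod z j \<in> evalg {2..<2*j+2}"
proof (induction j)
  case (Suc j)
  have "torus_prod z j \<in> evalg {2..<2 * Suc j + 2}" by (rule evalg_mono[OF Suc]) auto
  then show ?case by (auto intro!: evalg.mult evalg_torus)
qed (simp add: evalg_1)

subsection \<open>Constant vectors fixed by the twisted action\<close>

text \<open>\<open>\<complex>\<^sup>2\<^sup>l\<^sup>+\<^sup>1\<close> is embedded as the orthogonal complement of the coordinate vector \<open>0\<close>.\<close>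

definition emb :: "(nat \<Rightarrow> complex) \<Rightarrow> nat \<Rightarrow> complex fls" where
  "emb x i = (case i of 0 \<Rightarrow> 0 | Suc j \<Rightarrow> fls_const (x j))"

definition vec_emb :: "nat \<Rightarrow> (nat \<Rightarrow> complex) \<Rightarrow> complex fls clf" where
  "vec_emb l x = vecn (Suc (Suc (2*l))) (emb x)"

lemma emb_simps [simp]: "emb x 0 = 0" "emb x (Suc j) = fls_const (x j)"
  by (simp_all add: emb_def)

lemma fls_const_sum: "fls_const (\<Sum>i\<in>I. f i) = (\<Sum>i\<in>I. fls_const (f i :: complex))"
  by (induction I rule: infinite_finite_induct) (simp_all add: fls_plus_const[symmetric])

lemma dot_emb: "dot (Suc m) (emb x) (emb y) = fls_const (dot m x y)"
  unfolding dot_def sum.lessThan_Suc_shift by (simp add: fls_const_sum fls_const_mult_const)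

lemma vec_emb_add: "vec_emb l (\<lambda>i. x i + y i) = vec_emb l x + vec_emb l y"
  and vec_emb_diff: "vec_emb l (\<lambda>i. x i - y i) = vec_emb l x - vec_emb l y"
  and vec_emb_cmult: "vec_emb l (\<lambda>i. c * x i) = cst (fls_const c) * vec_emb l x"
proof -
  have "emb (\<lambda>i. x i + y i) = (\<lambda>i. emb x i + emb y i)" "emb (\<lambda>i. x i - y i) = (\<lambda>i. emb x i - emb y i)"
    "emb (\<lambda>i. c * x i) = (\<lambda>i. fls_const c * emb x i)"
    by (auto simp: fun_eq_iff emb_def fls_const_mult_const fls_plus_const fls_minus_const split: nat.split)
  then show "vec_emb l (\<lambda>i. x i + y i) = vec_emb l x + vec_emb l y"
    "vec_emb l (\<lambda>i. x i - y i) = vec_emb l x - vec_emb l y"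
    "vec_emb l (\<lambda>i. c * x i) = cst (fls_const c) * vec_emb l x"
    by (simp_all add: vec_emb_def vecn_add vecn_diff vecn_cmult)
qed

lemma vec_emb_0: "vec_emb l (\<lambda>_. 0) = 0"
  using vec_emb_cmult[of l 0 "\<lambda>_. 0"] by simp

lemma vec_emb_delta: "j < Suc (2*l) \<Longrightarrow> vec_emb l (\<lambda>i. if i = j then 1 else 0) = ee (Suc j)"
proof -
  assume j: "j < Suc (2*l)"
  have "emb (\<lambda>i. if i = j then 1 else 0) = (\<lambda>i. if i = Suc j then 1 else 0)"
    by (auto simp: fun_eq_iff emb_def split: nat.split)
  then show ?thesis using j by (simp add: vec_emb_def vecn_delta)
qed

lemma ee_0: "ee 0 = vecn (Suc (Suc (2*l))) (\<lambda>i. if i = 0 then 1 else 0)"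
  by (rule vecn_delta[symmetric]) simp

lemma dot_delta0: "dot (Suc m) (\<lambda>i. if i = 0 then c else 0) v = c * v 0"
  unfolding dot_def sum.lessThan_Suc_shift by simp

lemma vec_emb_commute: "vec_emb l x * vec_emb l y = cst (fls_const (2 * dot (Suc (2*l)) x y)) - vec_emb l y * vec_emb l x"
proof -
  have "2 * fls_const (dot (Suc (2*l)) x y) = fls_const (2 * dot (Suc (2*l)) x y)"
    by (rule fls_eqI) simp
  then show ?thesis unfolding vec_emb_def by (subst vecn_commute) (simp add: dot_emb)
qed

lemma vec_emb_sq: "vec_emb l x * vec_emb l x = cst (fls_const (dot (Suc (2*l)) x x))"
  unfolding vec_emb_def vecn_sq dot_emb ..

lemma ee0_vec_emb: "ee 0 * vec_emb l x = - (vec_emb l x * ee 0)"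
  unfolding vec_emb_def ee_0[of l] by (subst vecn_commute) (simp add: dot_delta0)

lemma sg_vec_emb: "sg (vec_emb l x) = vec_emb l x"
  unfolding vec_emb_def sg_vecn by (rule vecn_eqI) (simp add: emb_def split: nat.split)

lemma coefs_in_vec_emb: "subring_K R \<Longrightarrow> (\<And>c. fls_const c \<in> R) \<Longrightarrow> coefs_in R (vec_emb l x)"
  unfolding vec_emb_def by (rule coefs_in_vecn) (auto simp: emb_def subring_0 split: nat.split)

text \<open>As e_0 changes sign under the twisted action, \<open>el1\<close> is fixed when
  \<open>c\<close> is even in t and \<open>el0\<close> when \<open>c\<close> is odd. Hence
  \<open>D\<close> enters with t^-2 and \<open>u\<close> with t^-1.\<close>

definition el1 :: "nat \<Rightarrow> complex fls \<Rightarrow> (nat \<Rightarrow> complex) \<Rightarrow> (nat \<Rightarrow> complex) \<Rightarrow> complex fls clf" where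
  "el1 l c x y = 1 + cst c * (vec_emb l x * vec_emb l y)"

definition el0 :: "nat \<Rightarrow> complex fls \<Rightarrow> (nat \<Rightarrow> complex) \<Rightarrow> complex fls clf" where
  "el0 l c y = 1 + cst c * (ee 0 * vec_emb l y)"

lemma el1_eq: "el1 l c x y = 1 + vecn (Suc (Suc (2*l))) (\<lambda>i. c * emb x i) * vecn (Suc (Suc (2*l))) (emb y)"
  by (simp add: el1_def vecn_cmult vec_emb_def mult.assoc)

lemma el0_eq: "el0 l c y = 1 + vecn (Suc (Suc (2*l))) (\<lambda>i. c * (if i = 0 then 1 else 0)) * vecn (Suc (Suc (2*l))) (emb y)"
  unfolding vecn_cmult ee_0[of l, symmetric] by (simp add: el0_def vec_emb_def mult.assoc)

lemma el1_props:
  assumes xy: "dot (Suc (2*l)) x y = 0" and yy: "dot (Suc (2*l)) y y = 0"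
  shows "spinor (Suc (Suc (2*l))) (el1 l c x y)" "rev_cl (el1 l c x y) = el1 l (- c) x y"
    "el1 l (- c) x y * el1 l c x y = 1"
    "sg (el1 l c x y) = el1 l (fls_twist c) x y"
proof -
  have d: "dot (Suc (Suc (2*l))) (\<lambda>i. c * emb x i) (emb y) = 0" for c
    unfolding dot_left dot_emb xy by simp
  have d': "dot (Suc (Suc (2*l))) (emb y) (emb y) = 0" unfolding dot_emb yy by simp
  show "spinor (Suc (Suc (2*l))) (el1 l c x y)" unfolding el1_eq by (rule spinor_el[OF d d'])
  have yx: "vec_emb l y * vec_emb l x = - (vec_emb l x * vec_emb l y)"
    using vec_emb_commute[of l y x] xy by (simp add: dot_commute)
  show r: "rev_cl (el1 l c x y) = el1 l (- c) x y"
    unfolding el1_def rev_add rev_mult rev_1 rev_cst vec_emb_def rev_vecn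
    unfolding vec_emb_def[symmetric] yx by (simp add: cst_minus cst_commute)
  show "el1 l (- c) x y * el1 l c x y = 1"
    using el_inverse(1,3)[OF d[of c] d'] unfolding el1_eq[symmetric] r[symmetric] by simp
  show "sg (el1 l c x y) = el1 l (fls_twist c) x y" by (simp add: el1_def sg_add sg_mult sg_vec_emb)
qed

lemma el0_props:
  assumes yy: "dot (Suc (2*l)) y y = 0"
  shows "spinor (Suc (Suc (2*l))) (el0 l c y)" "rev_cl (el0 l c y) = el0 l (- c) y"
    "el0 l (- c) y * el0 l c y = 1"
    "sg (el0 l c y) = el0 l (- fls_twist c) y"
proof -
  have d: "dot (Suc (Suc (2*l))) (\<lambda>i. c * (if i = 0 then 1 else 0)) (emb y) = 0" for c
    unfolding dot_left dot_delta0 by simp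
  have d': "dot (Suc (Suc (2*l))) (emb y) (emb y) = 0" unfolding dot_emb yy by simp
  show "spinor (Suc (Suc (2*l))) (el0 l c y)" unfolding el0_eq by (rule spinor_el[OF d d'])
  have yx: "vec_emb l y * ee 0 = - (ee 0 * vec_emb l y)" by (simp add: ee0_vec_emb)
  have rv: "rev_cl (vec_emb l y) = vec_emb l y" by (simp add: vec_emb_def)
  show r: "rev_cl (el0 l c y) = el0 l (- c) y"
    unfolding el0_def rev_add rev_mult rev_1 rev_cst rev_E_single rv yx by (simp add: cst_minus cst_commute)
  show "el0 l (- c) y * el0 l c y = 1"
    using el_inverse(1,3)[OF d[of c] d'] unfolding el0_eq[symmetric] r[symmetric] by simp
  show "sg (el0 l c y) = el0 l (- fls_twist c) y"
    by (simp add: el0_def sg_add sg_mult sg_vec_emb sg_E_single cst_minus)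
qed

lemma coefs_in_el:
  assumes R: "subring_K R" "\<And>c. fls_const c \<in> R" "c \<in> R"
  shows "coefs_in R (el1 l c x y)" "coefs_in R (el0 l c y)"
  unfolding el1_def el0_def
  by (intro coefs_in_add[OF R(1)] coefs_in_mult[OF R(1)] coefs_in_1[OF R(1)] coefs_in_cst[OF R(1,3)]
      coefs_in_vec_emb[OF R(1,2)] coefs_in_E[OF R(1)])+

lemma unit_O_el1:
  assumes "dot (Suc (2*l)) x y = 0" "dot (Suc (2*l)) y y = 0" "c \<in> fls_O" "fls_twist c = c"
  shows "unit_O (Suc (Suc (2*l))) (el1 l c x y)"
  unfolding unit_O_def loop_O_el_def loop_el_def el1_props(2)[OF assms(1,2)]
  using el1_props[OF assms(1,2)] assms(3,4) coefs_in_el(1)[OF subring_O fls_const_O] subring_uminus[OF subring_O assms(3)]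
  by simp

lemma unit_O_el0:
  assumes "dot (Suc (2*l)) y y = 0" "c \<in> fls_O" "fls_twist c = - c"
  shows "unit_O (Suc (Suc (2*l))) (el0 l c y)"
  unfolding unit_O_def loop_O_el_def loop_el_def el0_props(2)[OF assms(1)]
  using el0_props[OF assms(1)] assms(2,3) coefs_in_el(2)[OF subring_O fls_const_O] subring_uminus[OF subring_O assms(2)]
  by simp

lemma unit_O_pair:
  assumes "dot (Suc (2*l)) x x = 1" "dot (Suc (2*l)) y y = 1"
  shows "unit_O (Suc (Suc (2*l))) (vec_emb l x * vec_emb l y)"
proof -
  have "loop_O_el (Suc (Suc (2*l))) (vec_emb l x * vec_emb l y)"
    if "dot (Suc (2*l)) x x = 1" "dot (Suc (2*l)) y y = 1" for x y
  proof -
    have "spinor (Suc (Suc (2*l))) (vec_emb l x * vec_emb l y)"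
      unfolding vec_emb_def by (rule spinor_pair) (simp_all add: dot_emb that)
    then show ?thesis unfolding loop_O_el_def loop_el_def
      by (simp add: sg_mult sg_vec_emb coefs_in_mult[OF subring_O] coefs_in_vec_emb[OF subring_O fls_const_O])
  qed
  then show ?thesis using assms unfolding unit_O_def rev_mult by (simp add: vec_emb_def)
qed

subsection \<open>Matrix units and the factorisations of the unipotent elements\<close>

text \<open>If P and Q have square zero and satisfy PQP = P and QPQ = Q, then PQ, P, Q, QP are the
  matrix units of the 2 by 2 matrices. \<open>rho\<close> is the matrix with entries a, b, c, d
  there and the identity on the complementary idempotent, hence multiplicative.\<close>

definition rho :: "complex fls clf \<Rightarrow> complex fls clf \<Rightarrow> complex fls \<Rightarrow> complex fls \<Rightarrow> complex fls \<Rightarrow> complex fls \<Rightarrow> complex fls clf" where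
  "rho P Q a b c d = 1 + (cst (a - 1) * (P * Q) + cst b * P + cst c * Q + cst (d - 1) * (Q * P))"

lemma rho_mult:
  assumes P: "P * P = 0" and Q: "Q * Q = 0" and PQP: "P * Q * P = P" and QPQ: "Q * P * Q = Q"
  shows "rho P Q a b c d * rho P Q a' b' c' d' =
    rho P Q (a * a' + b * c') (a * b' + b * d') (c * a' + d * c') (c * b' + d * d')"
proof -
  define u v where "u = P * Q" and "v = Q * P"
  have units: "u * u = u" "u * P = P" "u * Q = 0" "u * v = 0"
    "P * u = 0" "P * P = 0" "P * Q = u" "P * v = P"
    "Q * u = Q" "Q * P = v" "Q * Q = 0" "Q * v = 0"
    "v * u = 0" "v * P = 0" "v * Q = Q" "v * v = v"
  proof -
    have PQP': "P * (Q * P) = P" and QPQ': "Q * (P * Q) = Q" using PQP QPQ by (simp_all only: mult.assoc)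
    have PP': "P * (P * x) = 0" and QQ': "Q * (Q * x) = 0" for x
      using P Q by (simp_all only: mult.assoc[symmetric] mult_zero_left)
    show "u * u = u" "u * P = P" "u * Q = 0" "u * v = 0"
      "P * u = 0" "P * P = 0" "P * Q = u" "P * v = P"
      "Q * u = Q" "Q * P = v" "Q * Q = 0" "Q * v = 0"
      "v * u = 0" "v * P = 0" "v * Q = Q" "v * v = v"
      unfolding u_def v_def by (simp_all only: mult.assoc PQP' QPQ' P Q PP' QQ' mult_zero_right)
  qed
  define m where "m a b c d = cst a * u + cst b * P + cst c * Q + cst d * v" for a b c d
  have rho: "rho P Q a b c d = 1 + m (a - 1) b c (d - 1)" for a b c d
    unfolding rho_def m_def u_def v_def ..
  have mm: "m a b c d * m a' b' c' d' = m (a * a' + b * c') (a * b' + b * d') (c * a' + d * c') (c * b' + d * d')"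
    for a b c d a' b' c' d'
    unfolding m_def
    by (simp only: distrib_left distrib_right cst_mult_pair units cst_add mult_zero_right add_0_right add_0_left add_ac)
  have ma: "m a b c d + m a' b' c' d' = m (a + a') (b + b') (c + c') (d + d')" for a b c d a' b' c' d'
    unfolding m_def by (simp only: distrib_right cst_add add_ac)
  have "rho P Q a b c d * rho P Q a' b' c' d' =
      1 + (m (a - 1) b c (d - 1) + m (a' - 1) b' c' (d' - 1) + m (a - 1) b c (d - 1) * m (a' - 1) b' c' (d' - 1))"
    unfolding rho by (simp add: algebra_simps)
  also have "\<dots> = rho P Q (a * a' + b * c') (a * b' + b * d') (c * a' + d * c') (c * b' + d * d')"
    unfolding mm ma rho by (simp add: algebra_simps)
  finally show ?thesis .
qed

definition ff :: "nat \<Rightarrow> nat \<Rightarrow> complex fls clf" where "ff l a = vec_emb l (iso_F a)"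
definition gg :: "nat \<Rightarrow> nat \<Rightarrow> complex fls clf" where "gg l a = vec_emb l (iso_G a)"

lemma ff_gg_rel:
  assumes "a < l" "b < l"
  shows "ff l a * ff l b = - (ff l b * ff l a)" "gg l a * gg l b = - (gg l b * gg l a)"
    "a \<noteq> b \<Longrightarrow> ff l a * gg l b = - (gg l b * ff l a)" "ff l a * gg l a = 1 - gg l a * ff l a"
    "ff l a * ff l a = 0" "gg l a * gg l a = 0"
    "ee 0 * ff l a = - (ff l a * ee 0)" "ee 0 * gg l a = - (gg l a * ee 0)"
proof -
  show "ff l a * ff l b = - (ff l b * ff l a)" "gg l a * gg l b = - (gg l b * gg l a)"
    "a \<noteq> b \<Longrightarrow> ff l a * gg l b = - (gg l b * ff l a)" "ff l a * gg l a = 1 - gg l a * ff l a"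
    unfolding ff_def gg_def using assms
    by (subst vec_emb_commute, simp add: dot_iso_iso)+
  show "ff l a * ff l a = 0" "gg l a * gg l a = 0" unfolding ff_def gg_def vec_emb_sq dot_iso_iso[OF assms(1)] by simp_all
  show "ee 0 * ff l a = - (ff l a * ee 0)" "ee 0 * gg l a = - (gg l a * ee 0)" unfolding ff_def gg_def by (rule ee0_vec_emb)+
qed

lemma ff_gg_coords:
  assumes "a < l"
  shows "ff l a = cst (fls_const (1/2)) * ee (2 * Suc a) + cst (fls_const (\<i>/2)) * ee (Suc (2 * Suc a))"
    "gg l a = cst (fls_const (1/2)) * ee (2 * Suc a) - cst (fls_const (\<i>/2)) * ee (Suc (2 * Suc a))"
proof -
  have F: "iso_F a = (\<lambda>i. 1/2 * (if i = Suc (2*a) then 1 else 0) + \<i>/2 * (if i = Suc (Suc (2*a)) then 1 else 0))"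
    and G: "iso_G a = (\<lambda>i. 1/2 * (if i = Suc (2*a) then 1 else 0) - \<i>/2 * (if i = Suc (Suc (2*a)) then 1 else 0))"
    by (auto simp: iso_F_def iso_G_def fun_eq_iff)
  show "ff l a = cst (fls_const (1/2)) * ee (2 * Suc a) + cst (fls_const (\<i>/2)) * ee (Suc (2 * Suc a))"
    unfolding ff_def F vec_emb_add vec_emb_cmult using assms by (simp add: vec_emb_delta)
  show "gg l a = cst (fls_const (1/2)) * ee (2 * Suc a) - cst (fls_const (\<i>/2)) * ee (Suc (2 * Suc a))"
    unfolding gg_def G vec_emb_diff vec_emb_cmult using assms by (simp add: vec_emb_delta)
qed

lemma evalg_ff_gg:
  assumes "a < l" "b < l" "2 * Suc a \<in> S" "Suc (2 * Suc a) \<in> S" "2 * Suc b \<in> S" "Suc (2 * Suc b) \<in> S"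
  shows "ff l a * ff l b \<in> evalg S" "gg l a * gg l b \<in> evalg S" "ff l a * gg l b \<in> evalg S" "gg l a * ff l b \<in> evalg S"
  unfolding ff_gg_coords[OF assms(1)] ff_gg_coords[OF assms(2)] distrib_left distrib_right left_diff_distrib right_diff_distrib
    cst_mult_pair
  by (intro evalg_intros evalg.gen assms)+

lemma evalg_ee0_ff_gg:
  assumes "a < l" "2 * Suc a \<in> S" "Suc (2 * Suc a) \<in> S" "0 \<in> S"
  shows "ee 0 * ff l a \<in> evalg S" "ee 0 * gg l a \<in> evalg S"
  unfolding ff_gg_coords[OF assms(1)] distrib_left right_diff_distrib cst_left_commute[of "ee 0"]
  by (intro evalg_intros evalg.gen assms)+

lemma torus_ff_gg:
  assumes "a < l"
  shows "torus (Suc a) z = cst z * (ff l a * gg l a) + gg l a * ff l a"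
proof -
  define p q where "p = ee (2 * Suc a)" and "q = ee (Suc (2 * Suc a))"
  have pp: "p * p = 1" "q * q = 1" unfolding p_def q_def by (rule E_sq)+
  have qp: "q * p = - (p * q)" unfolding p_def q_def by (rule E_anticommute) simp
  have c: "fls_const (1/2) * fls_const (1/2) = (fls_const (1/4) :: complex fls)" "fls_const (\<i>/2) * fls_const (\<i>/2) = - fls_const (1/4)"
    "fls_const (1/2) * fls_const (\<i>/2) = fls_const (\<i>/4)" "fls_const (\<i>/2) * fls_const (1/2) = fls_const (\<i>/4)"
    unfolding fls_const_mult_const by (rule fls_eqI; simp)+
  define h k :: "complex fls clf" where "h = cst (fls_const (1/2))" and "k = cst (fls_const (\<i>/2)) * (p * q)"
  have hh: "cst (fls_const (1/4)) + cst (fls_const (1/4)) = h" "cst (fls_const (\<i>/4)) * x + cst (fls_const (\<i>/4)) * x = cst (fls_const (\<i>/2)) * x" for x :: "complex fls clf"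
    unfolding h_def distrib_right[symmetric] cst_add[symmetric] by (simp_all add: fls_plus_const)
  have fg: "ff l a * gg l a = h - k"
  proof -
    have "ff l a * gg l a = cst (fls_const (1/4)) * (p * p) - cst (fls_const (\<i>/4)) * (p * q)
       + (cst (fls_const (\<i>/4)) * (q * p) - cst (- fls_const (1/4)) * (q * q))"
      unfolding ff_gg_coords[OF assms] p_def[symmetric] q_def[symmetric]
      by (simp only: distrib_right right_diff_distrib cst_mult_pair c) (simp add: algebra_simps)
    also have "\<dots> = (cst (fls_const (1/4)) + cst (fls_const (1/4))) - (cst (fls_const (\<i>/4)) * (p * q) + cst (fls_const (\<i>/4)) * (p * q))"
      unfolding pp qp by (simp add: cst_minus)
    finally show ?thesis unfolding hh k_def .
  qed
  have gf: "gg l a * ff l a = h + k"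
  proof -
    have "gg l a * ff l a = cst (fls_const (1/4)) * (p * p) + cst (fls_const (\<i>/4)) * (p * q)
       - (cst (fls_const (\<i>/4)) * (q * p) + cst (- fls_const (1/4)) * (q * q))"
      unfolding ff_gg_coords[OF assms] p_def[symmetric] q_def[symmetric]
      by (simp only: distrib_left left_diff_distrib cst_mult_pair c) (simp add: algebra_simps)
    also have "\<dots> = (cst (fls_const (1/4)) + cst (fls_const (1/4))) + (cst (fls_const (\<i>/4)) * (p * q) + cst (fls_const (\<i>/4)) * (p * q))"
      unfolding pp qp by (simp add: cst_minus)
    finally show ?thesis unfolding hh k_def .
  qed
  have "torus (Suc a) z = cst (z * fls_const (1/2) + fls_const (1/2)) - cst (z * fls_const (\<i>/2) - fls_const (\<i>/2)) * (p * q)"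
  proof -
    have "(z + 1) / 2 = z * fls_const (1/2) + fls_const (1/2)" "fls_const \<i> * (z - 1) / 2 = z * fls_const (\<i>/2) - fls_const (\<i>/2)"
      by (simp_all add: fls_const_divide_const[symmetric] field_simps)
    then show ?thesis unfolding torus_def bivec_def p_def q_def by (simp only:)
  qed
  also have "\<dots> = cst z * (h - k) + (h + k)"
    by (simp add: cst_add cst_diff cst_mult h_def k_def algebra_simps)
  finally show ?thesis unfolding fg gf .
qed

text \<open>The share of one coordinate in \<open>std_n\<close>; on the idempotents of its plane it
  is -t and t^-1.\<close>

definition nu :: "nat \<Rightarrow> complex fls clf" where
  "nu k = cst Xi * torus k (- (X ^ 2))"

lemma std_n_Suc_Suc: "std_n (2 * r + 2) = std_n (2 * r) * (nu (2*r+1) * nu (2*r+2))"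
proof -
  have nn: "nu (2*r+1) * nu (2*r+2) = cst (Xi * Xi) * (torus (2*r+1) (- (X ^ 2)) * torus (2*r+2) (- (X ^ 2)))"
    unfolding nu_def by (rule cst_mult_pair)
  have "std_n (2 * r) * (nu (2*r+1) * nu (2*r+2)) = (cst (Xi ^ (2*r)) * torus_prod (- (X ^ 2)) (2*r)) * (cst (Xi * Xi) * (torus (2*r+1) (- (X ^ 2)) * torus (2*r+2) (- (X ^ 2))))"
    unfolding nn by (simp add: std_n_def mult.assoc)
  also have "\<dots> = cst (Xi ^ (2*r) * (Xi * Xi)) * (torus_prod (- (X ^ 2)) (2*r) * (torus (2*r+1) (- (X ^ 2)) * torus (2*r+2) (- (X ^ 2))))"
    by (rule cst_mult_pair)
  finally show ?thesis by (simp add: std_n_def mult_ac mult.assoc)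
qed

lemma std_n_Suc: "std_n (Suc (2 * r)) = std_n (2 * r) * (nu (Suc (2*r)) * torus 0 (-1))"
proof -
  have "std_n (2 * r) * (nu (Suc (2*r)) * torus 0 (-1)) = cst (Xi ^ (2*r)) * torus_prod (- (X ^ 2)) (2*r) * (cst Xi * (torus (Suc (2*r)) (- (X ^ 2)) * torus 0 (-1)))"
    by (simp add: std_n_def nu_def mult.assoc)
  also have "\<dots> = cst (Xi ^ (2*r) * Xi) * (torus_prod (- (X ^ 2)) (2*r) * (torus (Suc (2*r)) (- (X ^ 2)) * torus 0 (-1)))"
    by (rule cst_mult_pair)
  finally show ?thesis by (simp add: std_n_def mult.commute mult.assoc)
qed

lemma X2_O: "X ^ 2 \<in> fls_O" "- (X ^ 2) \<in> fls_O"
  using subring_power[OF subring_O X_O, of 2] subring_uminus[OF subring_O] by auto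

lemma X2_Xi2: "X ^ 2 * Xi ^ 2 = 1" "Xi ^ 2 * X ^ 2 = 1"
  by (simp_all add: power2_eq_square mult.assoc X_Xi) (simp_all add: mult.assoc[symmetric] X_Xi)

lemma nu_eq: "a < l \<Longrightarrow> nu (Suc a) = - cst X * (ff l a * gg l a) + cst Xi * (gg l a * ff l a)"
proof -
  assume a: "a < l"
  have "Xi * - (X ^ 2) = - X" by (simp add: power2_eq_square mult.assoc[symmetric] X_Xi)
  then have "cst Xi * (cst (- (X ^ 2)) * x) = - cst X * x" for x
    by (simp add: mult.assoc[symmetric] cst_mult[symmetric] cst_minus)
  then show ?thesis unfolding nu_def torus_ff_gg[OF a] by (simp add: distrib_left)
qed

text \<open>These are the relations demanded by \<open>rho_mult\<close>. The reversed order of the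
  two vectors in \<open>Q\<close> makes \<open>P * Q\<close> and \<open>Q * P\<close> products of
  idempotents without a sign.\<close>

lemma el1_neg_X2:
  assumes "a < l" "b < l" "a \<noteq> b"
  defines "P \<equiv> ff l a * ff l b" and "Q \<equiv> gg l b * gg l a"
  shows "P * P = 0" "Q * Q = 0" "P * Q * P = P" "Q * P * Q = Q"
    "P * Q = (ff l a * gg l a) * (ff l b * gg l b)" "Q * P = (gg l a * ff l a) * (gg l b * ff l b)"
proof -
  define f g f' g' where "f = ff l a" and "g = gg l a" and "f' = ff l b" and "g' = gg l b"
  have rel: "f' * f = - (f * f')" "g' * g = - (g * g')" "f' * g = - (g * f')" "g' * f = - (f * g')"
    "f * f = 0" "g * g = 0" "f' * f' = 0" "g' * g' = 0" "f * g = 1 - g * f" "f' * g' = 1 - g' * f'"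
    unfolding f_def g_def f'_def g'_def
    using ff_gg_rel[OF assms(1,2)] ff_gg_rel[OF assms(2,1)] assms(3) by (simp_all del: minus_mult_left)
  have rel': "f' * (f * x) = - (f * (f' * x))" "g' * (g * x) = - (g * (g' * x))" "f' * (g * x) = - (g * (f' * x))"
    "g' * (f * x) = - (f * (g' * x))" "f * (f * x) = 0" "g * (g * x) = 0" "f' * (f' * x) = 0" "g' * (g' * x) = 0" for x
    by (simp_all only: mult.assoc[symmetric] rel) simp_all
  have fgf: "f * (g * f) = f" "g * (f * g) = g" "f' * (g' * f') = f'" "g' * (f' * g') = g'"
  proof -
    show "f * (g * f) = f" "f' * (g' * f') = f'"
      by (simp_all only: mult.assoc[symmetric] rel(9,10) left_diff_distrib mult_1_left) (simp_all add: mult.assoc rel(5,7))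
    show "g * (f * g) = g" "g' * (f' * g') = g'" by (simp_all only: rel(9,10) right_diff_distrib mult_1_right rel' diff_zero)
  qed
  have PP: "P = f * f'" and QQ: "Q = g' * g" by (simp_all add: P_def Q_def f_def g_def f'_def g'_def)
  show "P * P = 0" "Q * Q = 0" unfolding PP QQ by (simp_all add: mult.assoc rel')
  show 1: "P * Q = (ff l a * gg l a) * (ff l b * gg l b)"
    unfolding PP QQ f_def[symmetric] g_def[symmetric] f'_def[symmetric] g'_def[symmetric]
    by (simp only: mult.assoc rel(2) rel' mult_minus_right mult_minus_left minus_minus)
  show 2: "Q * P = (gg l a * ff l a) * (gg l b * ff l b)"
    unfolding PP QQ f_def[symmetric] g_def[symmetric] f'_def[symmetric] g'_def[symmetric]
    by (simp only: mult.assoc rel(2) rel' mult_minus_right mult_minus_left minus_minus)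
  have fgf': "f * (g * (f * x)) = f * x" "g * (f * (g * x)) = g * x" for x
    using fgf(1,2) by (metis mult.assoc)+
  show "P * Q * P = P" unfolding 1 unfolding PP f_def[symmetric] g_def[symmetric] f'_def[symmetric] g'_def[symmetric]
    by (simp only: mult.assoc rel' mult_minus_right mult_minus_left minus_minus fgf fgf')
  show "Q * P * Q = Q" unfolding 2 unfolding QQ f_def[symmetric] g_def[symmetric] f'_def[symmetric] g'_def[symmetric]
    by (simp only: mult.assoc rel' rel(2) mult_minus_right mult_minus_left minus_minus fgf fgf')
qed

text \<open>In the copy of SL_2 the upper unipotent with entry t^-2, times the lower one with entry
  -t^2, equals an integral Weyl element times an integral unipotent times the diagonal matrix with
  entries -t^2 and -t^-2. Moving the lower unipotent to the right gives the double coset.\<close>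

lemma pair_decomp:
  assumes ab: "a < l" "b < l" "a \<noteq> b" and S: "2 * Suc a \<in> S" "Suc (2 * Suc a) \<in> S" "2 * Suc b \<in> S" "Suc (2 * Suc b) \<in> S"
  shows "\<exists>H H'. unit_O (Suc (Suc (2*l))) H \<and> unit_O (Suc (Suc (2*l))) H' \<and> H \<in> evalg S \<and> H' \<in> evalg S \<and>
    1 + cst (Xi ^ 2) * (ff l a * ff l b) = H * (nu (Suc a) * nu (Suc b)) * H'"
proof -
  let ?n = "Suc (Suc (2*l))"
  define P Q where "P = ff l a * ff l b" and "Q = gg l b * gg l a"
  note pq = el1_neg_X2[OF ab, folded P_def Q_def]
  note rm = rho_mult[OF pq(1-4)]
  define L where "L c = 1 + cst c * P" for c
  define U where "U c = 1 + cst c * Q" for c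
  have L: "L c = rho P Q 1 c 0 1" "U c = rho P Q 1 0 c 1" for c by (simp_all add: L_def U_def rho_def)
  have dF: "dot (Suc (2*l)) (iso_F a) (iso_F b) = 0" "dot (Suc (2*l)) (iso_F b) (iso_F b) = 0"
    "dot (Suc (2*l)) (iso_G b) (iso_G a) = 0" "dot (Suc (2*l)) (iso_G a) (iso_G a) = 0"
    using ab by (simp_all add: dot_iso_iso)
  have unit: "unit_O ?n (L c)" "unit_O ?n (U c)" if "c \<in> fls_O" "fls_twist c = c" for c
    using unit_O_el1[OF dF(1,2) that] unit_O_el1[OF dF(3,4) that]
    by (simp_all add: L_def U_def P_def Q_def el1_def ff_def gg_def)
  have ev: "L c \<in> evalg S" "U c \<in> evalg S" for c
    unfolding L_def U_def P_def Q_def using evalg_ff_gg[OF ab(1,2) S] evalg_ff_gg[OF ab(2,1) S(3,4,1,2)] by (auto intro: evalg_intros)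
  define N where "N = rho P Q (- (X ^ 2)) 0 0 (- (Xi ^ 2))"
  \<comment> \<open>On the two mixed products of idempotents the factors -t and t^-1 multiply to -1
    and not to 1. This explains the global sign between \<open>nu\<close> and the diagonal
    matrix.\<close>
  have nn: "nu (Suc a) * nu (Suc b) = - N"
  proof -
    define p p' q q' where "p = ff l a * gg l a" and "p' = gg l a * ff l a" and "q = ff l b * gg l b" and "q' = gg l b * ff l b"
    have one: "p' = 1 - p" "q' = 1 - q" unfolding p_def p'_def q_def q'_def using ff_gg_rel(4)[OF ab(1,1)] ff_gg_rel(4)[OF ab(2,2)] by simp_all
    have "nu (Suc a) * nu (Suc b) = (cst (- X) * p + cst Xi * p') * (cst (- X) * q + cst Xi * q')"
      unfolding nu_eq[OF ab(1)] nu_eq[OF ab(2)] p_def p'_def q_def q'_def by (simp only: cst_minus)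
    also have "\<dots> = cst (- X * - X) * (p * q) + cst (- X * Xi) * (p * q') + cst (Xi * - X) * (p' * q) + cst (Xi * Xi) * (p' * q')"
      by (simp only: distrib_left distrib_right cst_mult_pair add_ac)
    also have "\<dots> = cst (X ^ 2) * (p * q) - p * q' - p' * q + cst (Xi ^ 2) * (p' * q')"
      using X_Xi by (simp add: power2_eq_square cst_minus)
    also have "\<dots> = (cst (X ^ 2) + 1) * (p * q) + (cst (Xi ^ 2) + 1) * (p' * q') - 1"
      unfolding one by (simp add: algebra_simps)
    also have "\<dots> = - N" unfolding N_def rho_def pq(5,6) p_def q_def p'_def q'_def
      by (simp add: cst_diff cst_minus algebra_simps)
    finally show ?thesis .
  qed
  \<comment> \<open>The product of the three factors with entries -1, 1, -1 is the Weyl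
    element.\<close>
  have id: "L (Xi ^ 2) * U (- (X ^ 2)) = L (-1) * U 1 * L (-1) * L (- (X ^ 2)) * N"
    unfolding L N_def rm using X2_Xi2 by (simp add: algebra_simps)
  have inv: "U (- (X ^ 2)) * U (X ^ 2) = 1" unfolding L rm by (simp add: rho_def)
  have "L (Xi ^ 2) = L (Xi ^ 2) * (U (- (X ^ 2)) * U (X ^ 2))" by (simp add: inv)
  also have "\<dots> = L (-1) * U 1 * L (-1) * L (- (X ^ 2)) * N * U (X ^ 2)" by (simp only: mult.assoc[symmetric] id)
  also have "\<dots> = ((- 1) * L (-1) * U 1 * L (-1) * L (- (X ^ 2))) * (nu (Suc a) * nu (Suc b)) * U (X ^ 2)"
    unfolding nn by simp
  finally have eq: "L (Xi ^ 2) = ((- 1) * L (-1) * U 1 * L (-1) * L (- (X ^ 2))) * (nu (Suc a) * nu (Suc b)) * U (X ^ 2)" .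
  have O1: "1 \<in> fls_O" "-1 \<in> fls_O" using subring_1[OF subring_O] subring_uminus[OF subring_O] by auto
  define H where "H = (- 1) * L (-1) * U 1 * L (-1) * L (- (X ^ 2))"
  have "unit_O ?n H" "unit_O ?n (U (X ^ 2))"
    unfolding H_def by (intro unit_O_mult unit unit_O_sign; simp add: X2_O O1)+
  moreover have "H \<in> evalg S" "U (X ^ 2) \<in> evalg S"
    unfolding H_def by (intro evalg_intros ev)+
  ultimately show ?thesis using eq unfolding H_def[symmetric] L_def[of "Xi ^ 2"] P_def by auto
qed

text \<open>Again a computation with 2 by 2 matrices, now with e_0 in the matrix units and t^-1 in
  place of t^-2. The Weyl element \<open>W\<close> is negated by the twisted action and the sign
  matrix \<open>R\<close> has spinor norm -1; only their product with \<open>torus 0 (-1)\<close> is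
  an element of the twisted spin group.\<close>

lemma single_decomp:
  assumes a: "a < l" and S: "2 * Suc a \<in> S" "Suc (2 * Suc a) \<in> S" "0 \<in> S" "1 \<in> S"
  shows "\<exists>H H'. unit_O (Suc (Suc (2*l))) H \<and> unit_O (Suc (Suc (2*l))) H' \<and> H \<in> evalg S \<and>
    el0 l Xi (iso_F a) = H * (nu (Suc a) * torus 0 (-1)) * H'"
proof -
  let ?n = "Suc (Suc (2*l))"
  define f g e where "f = ff l a" and "g = gg l a" and "e = ee 0"
  define P Q where "P = e * f" and "Q = g * e"
  have rel: "e * f = - (f * e)" "e * g = - (g * e)" "f * f = 0" "g * g = 0" "f * g = 1 - g * f" "e * e = 1"
    unfolding f_def g_def e_def using ff_gg_rel[OF a a] by (simp_all add: E_sq)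
  have rel': "e * (f * x) = - (f * (e * x))" "e * (g * x) = - (g * (e * x))" "f * (f * x) = 0" "g * (g * x) = 0" "e * (e * x) = x" for x
    by (simp_all only: mult.assoc[symmetric] rel) simp_all
  have fgf: "f * (g * f) = f" "g * (f * g) = g"
  proof -
    show "f * (g * f) = f"
      by (simp only: mult.assoc[symmetric] rel(5) left_diff_distrib mult_1_left) (simp add: mult.assoc rel(3))
    show "g * (f * g) = g" by (simp only: rel(5) right_diff_distrib mult_1_right rel' diff_zero)
  qed
  have PQ: "P * Q = f * g" "Q * P = g * f" unfolding P_def Q_def by (simp_all add: mult.assoc rel' rel(6))
  have pq: "P * P = 0" "Q * Q = 0" "P * Q * P = P" "Q * P * Q = Q"
  proof -
    have fgf': "f * (g * (f * x)) = f * x" "g * (f * (g * x)) = g * x" for x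
      using fgf by (simp_all only: mult.assoc[symmetric])
    show "P * P = 0" "Q * Q = 0" unfolding P_def Q_def by (simp_all add: mult.assoc rel' rel(3,4))
    show "P * Q * P = P" unfolding PQ unfolding P_def by (simp only: mult.assoc rel(1) mult_minus_right fgf')
    show "Q * P * Q = Q" unfolding PQ unfolding Q_def by (simp only: mult.assoc fgf')
  qed
  note rm = rho_mult[OF pq]
  have L: "1 + cst c * P = rho P Q 1 c 0 1" "1 + cst c * Q = rho P Q 1 0 c 1" for c by (simp_all add: rho_def)
  have iso: "dot (Suc (2*l)) (iso_F a) (iso_F a) = 0" "dot (Suc (2*l)) (iso_G a) (iso_G a) = 0"
    using a by (simp_all add: dot_iso_iso)
  \<comment> \<open>This is \<open>W * R * torus 0 (-1)\<close>, a product of two constant unit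
    vectors orthogonal to e_0, which makes its integrality and invariance evident.\<close>
  define K where "K = ee (Suc (2 * Suc a)) * ee 1"
  have uK: "unit_O ?n K"
  proof -
    have "K = vec_emb l (\<lambda>i. if i = 2 * Suc a then 1 else 0) * vec_emb l (\<lambda>i. if i = 0 then 1 else 0)"
      unfolding K_def using a by (simp add: vec_emb_delta)
    moreover have "dot (Suc (2*l)) (\<lambda>i. if i = 2 * Suc a then 1 else 0) (\<lambda>i. if i = 2 * Suc a then 1 else (0::complex)) = 1"
      "dot (Suc (2*l)) (\<lambda>i. if i = 0 then 1 else 0) (\<lambda>i. if i = 0 then 1 else (0::complex)) = 1"
      using a by (simp_all add: dot_delta_left)
    ultimately show ?thesis by (simp only: unit_O_pair)
  qed
  have el: "el0 l c (iso_F a) = 1 + cst c * P" "el0 l c (iso_G a) = 1 + cst (- c) * Q" for c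
    unfolding el0_def P_def Q_def e_def f_def g_def by (simp_all add: ff_def gg_def ee0_vec_emb cst_minus)
  define R where "R = rho P Q (-1) 0 0 1"
  have R: "R = cst (fls_const \<i>) * bivec (Suc a)"
  proof -
    have "torus (Suc a) (-1) = cst (-1) * (f * g) + g * f" unfolding f_def g_def by (rule torus_ff_gg[OF a])
    also have "\<dots> = R" 
    proof -
      have m2: "cst (-1 - 1) = (- 1 - 1 :: complex fls clf)" by (simp only: cst_diff cst_minus cst_1)
      have gf: "g * f = 1 - f * g" using rel(5) by simp
      show ?thesis unfolding R_def rho_def PQ m2 gf by (simp add: cst_minus left_diff_distrib del: diff_numeral_special)
    qed
    finally have "R = torus (Suc a) (-1)" ..
    also have "\<dots> = cst (fls_const \<i>) * bivec (Suc a)" by (simp add: torus_def cst_minus)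
    finally show ?thesis .
  qed
  have t0: "torus 0 (-1) = cst (fls_const \<i>) * bivec 0" by (simp add: torus_def cst_minus)
  have nu: "nu (Suc a) = rho P Q (- X) 0 0 Xi"
  proof -
    have "rho P Q (- X) 0 0 Xi = cst (- X) * (f * g) + cst Xi * (g * f) + (1 - f * g - g * f)"
      unfolding rho_def PQ by (simp add: cst_diff algebra_simps)
    then show ?thesis unfolding nu_eq[OF a] rel(5) f_def[symmetric] g_def[symmetric] by (simp add: cst_minus)
  qed
  define W where "W = rho P Q 0 1 (-1) 0"
  have W: "W = e * ee (2 * Suc a)"
  proof -
    have "W = 1 - f * g - g * f + e * f - g * e" unfolding W_def rho_def PQ by (simp add: P_def Q_def cst_minus algebra_simps)
    also have "\<dots> = e * (f + g)" unfolding rel(5) by (simp add: distrib_left rel(2))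
    also have "f + g = ee (2 * Suc a)"
    proof -
      have "f + g = (cst (fls_const (1/2)) + cst (fls_const (1/2))) * ee (2 * Suc a)"
        unfolding f_def g_def ff_gg_coords[OF a] by (simp add: algebra_simps)
      also have "cst (fls_const (1/2)) + cst (fls_const (1/2)) = (1 :: complex fls clf)"
        unfolding cst_add[symmetric] by (simp add: fls_plus_const)
      finally show ?thesis by simp
    qed
    finally show ?thesis .
  qed
  have WR: "W * R * torus 0 (-1) = K"
  proof -
    define p q o1 where "p = ee (2 * Suc a)" and "q = ee (Suc (2 * Suc a))" and "o1 = ee 1"
    have ii: "fls_const \<i> * fls_const \<i> = -1" unfolding fls_const_mult_const by (rule fls_eqI) simp
    have "W * R * torus 0 (-1) = e * p * (cst (fls_const \<i>) * (p * q) * (cst (fls_const \<i>) * (e * o1)))"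
      unfolding W R t0 bivec_def by (simp add: p_def q_def o1_def e_def mult.assoc)
    also have "\<dots> = - (e * (p * (p * (q * (e * o1)))))" unfolding cst_mult_pair ii by (simp add: cst_minus mult.assoc)
    also have "p * (p * (q * (e * o1))) = q * (e * o1)" unfolding p_def by (rule E_sq')
    also have "q * (e * o1) = - (e * (q * o1))" unfolding q_def e_def by (rule E_anti') simp
    also have "- (e * - (e * (q * o1))) = q * o1" by (simp add: rel')
    finally show ?thesis by (simp add: K_def q_def o1_def)
  qed
  \<comment> \<open>Up to a constant the element is a product of two bivectors. One anticommutes
    with the factor \<open>f\<close> of \<open>P\<close>, the other with the factor
    \<open>e\<close>, and the signs cancel.\<close>
  have comm: "(1 + cst c * P) * (R * torus 0 (-1)) = (R * torus 0 (-1)) * (1 + cst c * P)" for c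
  proof -
    have bf: "bivec (Suc a) * f = - (f * bivec (Suc a))"
      unfolding f_def ff_gg_coords[OF a] distrib_left distrib_right cst_left_commute[of "bivec (Suc a)"]
      using bivec_E_same[of "2 * Suc a" "Suc a"] bivec_E_same[of "Suc (2 * Suc a)" "Suc a"] by (simp add: mult.assoc)
    have be: "bivec (Suc a) * e = e * bivec (Suc a)" unfolding e_def by (rule bivec_E_other) auto
    have b0e: "bivec 0 * e = - (e * bivec 0)" unfolding e_def by (rule bivec_E_same) simp
    have b0f: "bivec 0 * f = f * bivec 0"
      unfolding f_def ff_gg_coords[OF a] distrib_left distrib_right cst_left_commute[of "bivec 0"]
      using bivec_E_other[of "2 * Suc a" 0] bivec_E_other[of "Suc (2 * Suc a)" 0] by (simp add: mult.assoc)
    have "bivec (Suc a) * bivec 0 * P = P * (bivec (Suc a) * bivec 0)"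
    proof -
      have "bivec (Suc a) * bivec 0 * P = bivec (Suc a) * ((bivec 0 * e) * f)" by (simp only: P_def mult.assoc)
      also have "\<dots> = - ((bivec (Suc a) * e) * (bivec 0 * f))" unfolding b0e by (simp add: mult.assoc)
      also have "\<dots> = - (e * ((bivec (Suc a) * f) * bivec 0))" unfolding be b0f by (simp only: mult.assoc)
      also have "\<dots> = P * (bivec (Suc a) * bivec 0)" unfolding bf by (simp add: P_def mult.assoc)
      finally show ?thesis .
    qed
    then show ?thesis unfolding R t0 cst_mult_pair
      by (simp only: distrib_left distrib_right cst_mult_pair mult_1_left mult_1_right mult.commute[of c])
  qed
  have tt: "torus 0 (-1) * torus 0 (-1) = 1" by (simp add: torus_mult)
  have nuT: "nu (Suc a) * torus 0 (-1) = torus 0 (-1) * nu (Suc a)"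
    unfolding nu_def by (simp only: mult.assoc torus_torus_commute[of _ _ 0] cst_left_commute)
  \<comment> \<open>Both sides are the matrix with rows (0, t^-1) and (-t, 1).\<close>
  have "(1 + cst Xi * P) * (1 + cst (- X) * Q) = W * (1 + cst (- X) * P) * R * nu (Suc a)"
    unfolding L nu R_def W_def rm using X_Xi by (simp add: algebra_simps)
  also have "\<dots> = W * ((1 + cst (- X) * P) * (R * torus 0 (-1))) * (torus 0 (-1) * nu (Suc a))"
  proof -
    have "R * nu (Suc a) = R * (torus 0 (-1) * torus 0 (-1)) * nu (Suc a)" by (simp only: tt mult_1_right)
    then show ?thesis by (simp only: mult.assoc)
  qed
  also have "\<dots> = K * (1 + cst (- X) * P) * (nu (Suc a) * torus 0 (-1))"
    unfolding comm nuT WR[symmetric] by (simp only: mult.assoc)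
  finally have id: "el0 l Xi (iso_F a) * (1 + cst (- X) * Q) = K * el0 l (- X) (iso_F a) * (nu (Suc a) * torus 0 (-1))"
    unfolding el .
  have inv: "(1 + cst (- X) * Q) * (1 + cst X * Q) = 1" unfolding L rm by (simp add: rho_def)
  have "el0 l Xi (iso_F a) = el0 l Xi (iso_F a) * ((1 + cst (- X) * Q) * (1 + cst X * Q))" by (simp add: inv)
  also have "\<dots> = K * el0 l (- X) (iso_F a) * (nu (Suc a) * torus 0 (-1)) * el0 l (- X) (iso_G a)"
    by (simp only: mult.assoc[symmetric] id) (simp add: el)
  finally have eq: "el0 l Xi (iso_F a) = K * el0 l (- X) (iso_F a) * (nu (Suc a) * torus 0 (-1)) * el0 l (- X) (iso_G a)" .
  have XO: "- X \<in> fls_O" using X_O subring_uminus[OF subring_O] by auto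
  have "unit_O ?n (K * el0 l (- X) (iso_F a))" "unit_O ?n (el0 l (- X) (iso_G a))"
    by (intro unit_O_mult uK unit_O_el0 iso XO; simp)+
  moreover have "K * el0 l (- X) (iso_F a) \<in> evalg S"
    unfolding K_def el0_def ff_def[symmetric] by (intro evalg_intros evalg.gen evalg_ee0_ff_gg[OF a] S)
  ultimately show ?thesis using eq by auto
qed

section \<open>Assembling the factors of the different planes\<close>

fun pairs_prod :: "nat \<Rightarrow> nat \<Rightarrow> complex fls clf" where
  "pairs_prod l 0 = 1"
| "pairs_prod l (Suc r) = pairs_prod l r * (1 + cst (Xi ^ 2) * (ff l (2*r) * ff l (Suc (2*r))))"

lemma std_n_evalg: "std_n (2 * r) \<in> evalg {2..<2*(2*r)+2}"
proof -
  have "torus 0 ((-1) ^ (2 * r)) = 1" by simp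
  then show ?thesis unfolding std_n_def by (simp only: mult_1_right) (intro evalg.mult evalg.cst evalg_torus_prod)
qed

text \<open>The left factor of the new decomposition is moved across the old middle and right
  factors, and the new middle factor across the old right factor; all of this is commutation on
  disjoint coordinates.\<close>

lemma decomp_append:
  assumes "unit_O n A" "unit_O n B" "B \<in> evalg S" "N \<in> evalg S"
    and "unit_O n H" "unit_O n H'" "H \<in> evalg T" "M \<in> evalg T" "S \<inter> T = {}"
  shows "unit_O n (A * H)" "unit_O n (B * H')" "(A * N * B) * (H * M * H') = (A * H) * (N * M) * (B * H')"
proof -
  show "unit_O n (A * H)" "unit_O n (B * H')" using assms by (auto intro: unit_O_mult)
  have BH: "B * H = H * B" "B * M = M * B" "N * H = H * N" using assms by (auto intro: evalg_commute)
  have "(A * N * B) * (H * M * H') = A * N * (B * H) * M * H'" by (simp only: mult.assoc)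
  also have "\<dots> = A * (N * H) * (B * M) * H'" unfolding BH(1) by (simp only: mult.assoc)
  also have "\<dots> = (A * H) * (N * M) * (B * H')" unfolding BH by (simp only: mult.assoc)
  finally show "(A * N * B) * (H * M * H') = (A * H) * (N * M) * (B * H')" .
qed

lemma nu_evalg: "2*k \<in> S \<Longrightarrow> Suc (2*k) \<in> S \<Longrightarrow> nu k \<in> evalg S"
  unfolding nu_def by (intro evalg_intros evalg_torus)

text \<open>The coordinates of the right factor are recorded because the next plane has to be moved
  across it. The frame vector \<open>a\<close> lives on the coordinates \<open>2 * Suc a\<close> and
  \<open>Suc (2 * Suc a)\<close>, so coordinates 0 and 1 remain free.\<close>

lemma pairs_decomp:
  assumes "2 * r \<le> l"
  shows "\<exists>A B. unit_O (Suc (Suc (2*l))) A \<and> unit_O (Suc (Suc (2*l))) B \<and> B \<in> evalg {2..<2*(2*r)+2} \<and>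
    pairs_prod l r = A * std_n (2*r) * B"
  using assms
proof (induction r)
  case 0
  show ?case by (intro exI[of _ 1]) (simp add: unit_O_sign evalg_1 std_n_def)
next
  case (Suc r)
  let ?n = "Suc (Suc (2*l))" and ?T = "{2*(2*r)+2..<2*(2*Suc r)+2}"
  obtain A B where AB: "unit_O ?n A" "unit_O ?n B" "B \<in> evalg {2..<2*(2*r)+2}" "pairs_prod l r = A * std_n (2*r) * B"
    using Suc by auto
  obtain H H' where H: "unit_O ?n H" "unit_O ?n H'" "H \<in> evalg ?T" "H' \<in> evalg ?T"
    "1 + cst (Xi ^ 2) * (ff l (2*r) * ff l (Suc (2*r))) = H * (nu (Suc (2*r)) * nu (Suc (Suc (2*r)))) * H'"
    using pair_decomp[of "2*r" l "Suc (2*r)" ?T] Suc.prems by auto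
  have M: "nu (Suc (2*r)) * nu (Suc (Suc (2*r))) \<in> evalg ?T" by (intro evalg.mult nu_evalg) auto
  have disj: "{2..<2*(2*r)+2} \<inter> ?T = {}" by auto
  note app = decomp_append[OF AB(1,2,3) std_n_evalg H(1,2,3) M disj]
  have "B * H' \<in> evalg {2..<2*(2*Suc r)+2}"
    by (intro evalg.mult evalg_mono[OF AB(3)] evalg_mono[OF H(4)]) auto
  moreover have "pairs_prod l (Suc r) = (A * H) * std_n (2 * Suc r) * (B * H')"
    unfolding pairs_prod.simps AB(4) H(5) app(3) using std_n_Suc_Suc[of r] by simp
  ultimately show ?case using app(1,2) by auto
qed

text \<open>The extra direction uses its own plane together with the coordinates 0 and 1, which the
  preceding planes avoid.\<close>

lemma pairs_single_decomp:
  assumes "2 * r < l"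
  shows "\<exists>A B. unit_O (Suc (Suc (2*l))) A \<and> unit_O (Suc (Suc (2*l))) B \<and>
    pairs_prod l r * el0 l Xi (iso_F (2*r)) = A * std_n (Suc (2*r)) * B"
proof -
  let ?n = "Suc (Suc (2*l))" and ?T = "{0, 1, 2 * Suc (2*r), Suc (2 * Suc (2*r))}"
  obtain A B where AB: "unit_O ?n A" "unit_O ?n B" "B \<in> evalg {2..<2*(2*r)+2}" "pairs_prod l r = A * std_n (2*r) * B"
    using pairs_decomp[of r l] assms by auto
  obtain H H' where H: "unit_O ?n H" "unit_O ?n H'" "H \<in> evalg ?T"
    "el0 l Xi (iso_F (2*r)) = H * (nu (Suc (2*r)) * torus 0 (-1)) * H'"
    using single_decomp[OF assms, of ?T] by auto
  have M: "nu (Suc (2*r)) * torus 0 (-1) \<in> evalg ?T" by (intro evalg.mult nu_evalg evalg_torus) auto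
  have disj: "{2..<2*(2*r)+2} \<inter> ?T = {}" by auto
  note app = decomp_append[OF AB(1,2,3) std_n_evalg H(1,2,3) M disj]
  have "pairs_prod l r * el0 l Xi (iso_F (2*r)) = (A * H) * std_n (Suc (2*r)) * (B * H')"
    unfolding AB(4) H(4) app(3) std_n_Suc ..
  then show ?thesis using app(1,2) by auto
qed

text \<open>When the vector \<open>u\<close> lies in one of the planes, conjugation by an integral unipotent element removes it.\<close>

lemma absorb_single:
  fixes c :: complex
  assumes ab: "a < l" "b < l" "a \<noteq> b"
  defines "h \<equiv> 1 - cst (fls_const c * X) * (ee 0 * gg l b)"
    and "h' \<equiv> 1 + cst (fls_const c * X) * (ee 0 * gg l b)"
  shows "(1 + cst (Xi ^ 2) * (ff l a * ff l b)) * (1 + cst (fls_const c * Xi) * (ee 0 * ff l a)) =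
    h * (1 + cst (Xi ^ 2) * (ff l a * ff l b)) * (h' * (1 + cst (fls_const (c ^ 2)) * (ff l a * gg l b)))"
proof -
  define f p g e where "f = ff l a" and "p = ff l b" and "g = gg l b" and "e = ee 0"
  define k where "k = fls_const c"
  have k2: "fls_const (c ^ 2) = k * k" by (simp add: k_def fls_const_mult_const power2_eq_square)
  have rel: "p * f = - (f * p)" "g * f = - (f * g)" "p * g = 1 - g * p"
    "f * f = 0" "p * p = 0" "g * g = 0" "e * f = - (f * e)" "e * p = - (p * e)" "e * g = - (g * e)" "e * e = 1"
    unfolding f_def p_def g_def e_def
    using ff_gg_rel[OF ab(1,2)] ff_gg_rel[OF ab(2,1)] ff_gg_rel[OF ab(2,2)] ab(3) by (simp_all add: E_sq del: minus_mult_left)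
  have rel': "p * (f * x) = - (f * (p * x))" "g * (f * x) = - (f * (g * x))" "p * (g * x) = x - g * (p * x)"
    "f * (f * x) = 0" "p * (p * x) = 0" "g * (g * x) = 0" "e * (f * x) = - (f * (e * x))" "e * (p * x) = - (p * (e * x))"
    "e * (g * x) = - (g * (e * x))" "e * (e * x) = x" for x
    by (simp_all only: mult.assoc[symmetric] rel) (simp_all add: left_diff_distrib)
  define U V where "U = e * g" and "V = f * p"
  have UU: "U * U = 0" and VU: "V * U = U * V - f * e" unfolding U_def V_def
    by (simp_all add: mult.assoc rel rel' right_diff_distrib)
  have UVU: "U * V * U = f * g" unfolding U_def V_def by (simp add: mult.assoc rel rel' right_diff_distrib)
  have hh: "(1 - cst (k * X) * U) * (1 + cst (k * X) * U) = 1"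
    by (simp only: left_diff_distrib distrib_left mult_1_left mult_1_right cst_mult_pair UU mult_zero_right) simp
  have X1: "k * X * Xi ^ 2 = k * Xi" "Xi ^ 2 * (k * X) = k * Xi" "k * Xi * (k * X) = k * k"
    by (simp_all add: power2_eq_square mult_ac X_Xi)
  have "(1 - cst (k * X) * U) * (1 + cst (Xi ^ 2) * V) * (1 + cst (k * X) * U) =
     (1 - cst (k * X) * U) * (1 + cst (k * X) * U) + (1 - cst (k * X) * U) * (cst (Xi ^ 2) * V) * (1 + cst (k * X) * U)"
    by (simp only: distrib_left distrib_right mult_1_right add_ac)
  also have "(1 - cst (k * X) * U) * (cst (Xi ^ 2) * V) * (1 + cst (k * X) * U) =
     cst (Xi ^ 2) * V + cst (k * Xi) * (V * U) - cst (k * Xi) * (U * V) - cst (k * k) * (U * V * U)"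
    by (simp only: left_diff_distrib distrib_left mult_1_left mult_1_right cst_mult_pair X1) (simp add: algebra_simps)
  also have "\<dots> = cst (Xi ^ 2) * V - cst (k * Xi) * (f * e) - cst (k * k) * (f * g)"
    unfolding VU UVU by (simp add: algebra_simps)
  \<comment> \<open>Conjugation creates the wanted term linear in t^-1, because
    \<open>- (f * e)\<close> is \<open>e * f\<close>, and a constant multiple of
    \<open>f * g\<close>. The latter is integral and is cancelled by the last factor.\<close>
  finally have conj: "(1 - cst (k * X) * U) * (1 + cst (Xi ^ 2) * V) * (1 + cst (k * X) * U) =
     1 + cst (Xi ^ 2) * V - cst (k * Xi) * (f * e) - cst (k * k) * (f * g)" unfolding hh by (simp add: algebra_simps)
  have fz: "(f * x) * (f * y) = 0" if "x * f = - (f * x)" for x y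
  proof -
    have "(f * x) * (f * y) = f * (x * f) * y" by (simp only: mult.assoc)
    then show ?thesis unfolding that by (simp add: mult.assoc rel')
  qed
  have f0: "V * (f * g) = 0" "(f * e) * (f * g) = 0" "(f * g) * (f * g) = 0" "V * (f * e) = 0"
    unfolding V_def by (intro fz rel(1,2); simp add: rel)+
  have "(1 - cst (k * X) * U) * (1 + cst (Xi ^ 2) * V) * ((1 + cst (k * X) * U) * (1 + cst (k * k) * (f * g))) =
     (1 + cst (Xi ^ 2) * V - cst (k * Xi) * (f * e) - cst (k * k) * (f * g)) * (1 + cst (k * k) * (f * g))"
    unfolding conj[symmetric] by (simp only: mult.assoc)
  also have "\<dots> = 1 + cst (Xi ^ 2) * V - cst (k * Xi) * (f * e)"
    by (simp add: distrib_left distrib_right left_diff_distrib cst_mult_pair f0)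
  also have "\<dots> = (1 + cst (Xi ^ 2) * V) * (1 - cst (k * Xi) * (f * e))"
    by (simp add: distrib_left distrib_right right_diff_distrib cst_mult_pair f0)
  finally have id: "(1 + cst (Xi ^ 2) * V) * (1 - cst (k * Xi) * (f * e)) =
     (1 - cst (k * X) * U) * (1 + cst (Xi ^ 2) * V) * ((1 + cst (k * X) * U) * (1 + cst (k * k) * (f * g)))" ..
  have e1: "e * f = - (f * e)" by (rule rel(7))
  show ?thesis unfolding h_def h'_def k2 unfolding k_def[symmetric] f_def[symmetric] p_def[symmetric] g_def[symmetric] e_def[symmetric]
    using id unfolding U_def V_def e1 by (simp add: cst_minus)
qed

subsection \<open>Factorisation of the lifted elements\<close>

text \<open>The factor \<open>h\<close> involves e_0, so coordinate 0 is added to the set of the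
  last plane. The earlier planes start at coordinate 2 and still commute with it.\<close>

lemma pairs_absorbed_decomp:
  assumes "0 < r" "2 * r \<le> l"
  shows "\<exists>A B. unit_O (Suc (Suc (2*l))) A \<and> unit_O (Suc (Suc (2*l))) B \<and>
    pairs_prod l r * (1 + cst (fls_const c * Xi) * (ee 0 * ff l (2*r-2))) = A * std_n (2*r) * B"
proof -
  obtain q where q: "r = Suc q" using assms(1) by (cases r) auto
  let ?n = "Suc (Suc (2*l))" and ?T = "{0} \<union> {2*(2*q)+2..<2*(2*r)+2}" and ?a = "2*q" and ?b = "Suc (2*q)"
  have ab: "?a < l" "?b < l" "?a \<noteq> ?b" using assms q by auto
  define h h' k where "h = 1 - cst (fls_const c * X) * (ee 0 * gg l ?b)"
    and "h' = 1 + cst (fls_const c * X) * (ee 0 * gg l ?b)" and "k = 1 + cst (fls_const (c ^ 2)) * (ff l ?a * gg l ?b)"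
  have cX: "fls_const c * X \<in> fls_O" "- (fls_const c * X) \<in> fls_O"
    using subring_mult[OF subring_O fls_const_O X_O] subring_uminus[OF subring_O] by auto
  have iso: "dot (Suc (2*l)) (iso_G ?b) (iso_G ?b) = 0" "dot (Suc (2*l)) (iso_F ?a) (iso_G ?b) = 0"
    using ab by (simp_all add: dot_iso_iso)
  have h: "h = el0 l (- (fls_const c * X)) (iso_G ?b)" "h' = el0 l (fls_const c * X) (iso_G ?b)"
    "k = el1 l (fls_const (c ^ 2)) (iso_F ?a) (iso_G ?b)"
    unfolding h_def h'_def k_def by (simp_all add: el0_def el1_def ff_def gg_def cst_minus)
  have u: "unit_O ?n h" "unit_O ?n h'" "unit_O ?n k" unfolding h
    by (intro unit_O_el0 unit_O_el1 iso cX fls_const_O; simp)+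
  obtain A B where AB: "unit_O ?n A" "unit_O ?n B" "B \<in> evalg {2..<2*(2*q)+2}" "pairs_prod l q = A * std_n (2*q) * B"
    using pairs_decomp[of q l] assms q by auto
  obtain H H' where H: "unit_O ?n H" "unit_O ?n H'" "H \<in> evalg ?T"
    "1 + cst (Xi ^ 2) * (ff l ?a * ff l ?b) = H * (nu (Suc ?a) * nu (Suc ?b)) * H'"
    using pair_decomp[OF ab, of ?T] q by auto
  have hT: "h * H \<in> evalg ?T" unfolding h_def
    using ab q by (intro evalg_intros H(3) evalg_ee0_ff_gg) auto
  have M: "nu (Suc ?a) * nu (Suc ?b) \<in> evalg ?T" using q by (intro evalg.mult nu_evalg) auto
  have disj: "{2..<2*(2*q)+2} \<inter> ?T = {}" by auto
  note app = decomp_append[OF AB(1,2,3) std_n_evalg unit_O_mult[OF u(1) H(1)] unit_O_mult[OF H(2) unit_O_mult[OF u(2,3)]] hT M disj]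
  have "pairs_prod l r * (1 + cst (fls_const c * Xi) * (ee 0 * ff l (2*r-2))) =
     pairs_prod l q * ((1 + cst (Xi ^ 2) * (ff l ?a * ff l ?b)) * (1 + cst (fls_const c * Xi) * (ee 0 * ff l ?a)))"
    unfolding q by (simp add: mult.assoc)
  also have "\<dots> = (A * std_n (2*q) * B) * ((h * H) * (nu (Suc ?a) * nu (Suc ?b)) * (H' * (h' * k)))"
    unfolding absorb_single[OF ab] unfolding AB(4) h_def[symmetric] h'_def[symmetric] k_def[symmetric] H(4) by (simp only: mult.assoc)
  also have "\<dots> = (A * (h * H)) * std_n (2 * r) * (B * (H' * (h' * k)))"
    unfolding app(3) q using std_n_Suc_Suc[of q] by simp
  finally show ?thesis using app(1,2) by auto
qed

subsection \<open>Rotations\<close>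

lemma vec_emb_refl_conj:
  assumes "dot (Suc (2*l)) v v = 1"
  shows "vec_emb l v * vec_emb l x * vec_emb l v = - vec_emb l (refl (Suc (2*l)) v x)"
proof -
  have "vec_emb l v * vec_emb l x * vec_emb l v = cst (fls_const (2 * dot (Suc (2*l)) v x)) * vec_emb l v - vec_emb l x * (vec_emb l v * vec_emb l v)"
    unfolding vec_emb_commute[of l v x] by (simp add: left_diff_distrib mult.assoc)
  also have "\<dots> = - vec_emb l (refl (Suc (2*l)) v x)"
    unfolding refl_def vec_emb_diff vec_emb_cmult vec_emb_sq assms by simp
  finally show ?thesis .
qed

text \<open>Two unit vectors at a time: on the embedded space they act by two reflections, and e_0
  changes sign twice. Constant coefficients make the lift integral and invariant.\<close>

lemma rotation_even:
  assumes "units (Suc (2*l)) vs" "even (length vs)"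
  shows "\<exists>\<rho>. unit_O (Suc (Suc (2*l))) \<rho> \<and> (\<forall>x. \<rho> * vec_emb l x * rev_cl \<rho> = vec_emb l (refls (Suc (2*l)) vs x)) \<and>
    \<rho> * ee 0 * rev_cl \<rho> = ee 0"
  using assms
proof (induction "length vs" arbitrary: vs rule: less_induct)
  case less
  show ?case
  proof (cases vs)
    case Nil
    then show ?thesis by (intro exI[of _ 1]) (simp add: unit_O_sign)
  next
    case (Cons v ws)
    then obtain w us where vs: "vs = v # w # us" using less.prems by (cases ws) auto
    then have v: "dot (Suc (2*l)) v v = 1" "dot (Suc (2*l)) w w = 1" and us: "units (Suc (2*l)) us" "even (length us)"
      using less.prems by (auto simp: units_def)
    obtain \<rho> where \<rho>: "unit_O (Suc (Suc (2*l))) \<rho>" "\<And>x. \<rho> * vec_emb l x * rev_cl \<rho> = vec_emb l (refls (Suc (2*l)) us x)"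
      "\<rho> * ee 0 * rev_cl \<rho> = ee 0" using less.hyps[OF _ us] vs by auto
    let ?V = "vec_emb l v" and ?W = "vec_emb l w"
    have r: "rev_cl (?V * ?W * \<rho>) = rev_cl \<rho> * (?W * ?V)" by (simp add: rev_mult vec_emb_def)
    have conj: "?V * ?W * \<rho> * y * rev_cl (?V * ?W * \<rho>) = ?V * (?W * (\<rho> * y * rev_cl \<rho>) * ?W) * ?V" for y
      unfolding r by (simp only: mult.assoc)
    have "?V * (?W * vec_emb l x * ?W) * ?V = vec_emb l (refl (Suc (2*l)) v (refl (Suc (2*l)) w x))" for x
      using vec_emb_refl_conj[OF v(1)] by (simp add: vec_emb_refl_conj[OF v(2)])
    moreover have "?V * (?W * ee 0 * ?W) * ?V = ee 0"
    proof -
      have c: "vec_emb l x * ee 0 * vec_emb l x = - (ee 0 * (vec_emb l x * vec_emb l x))" for x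
      proof -
        have "vec_emb l x * ee 0 = - (ee 0 * vec_emb l x)" by (simp add: ee0_vec_emb)
        then have "vec_emb l x * ee 0 * vec_emb l x = - (ee 0 * vec_emb l x) * vec_emb l x" by (simp only:)
        then show ?thesis by (simp add: mult.assoc)
      qed
      have "?V * (?W * ee 0 * ?W) * ?V = - (?V * ee 0 * ?V)" unfolding c[of w] vec_emb_sq v by simp
      then show ?thesis unfolding c[of v] vec_emb_sq v by simp
    qed
    ultimately show ?thesis using unit_O_mult[OF unit_O_pair[OF v] \<rho>(1)] conj \<rho>(2,3)
      by (intro exI[of _ "?V * ?W * \<rho>"]) (simp add: vs)
  qed
qed

text \<open>A reflection in the coordinate vector \<open>0\<close>, which fixes the vectors \<open>iso_F a\<close>, adjusts the parity.\<close>

lemma rotation_frame: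
  assumes "units (Suc (2*l)) vs"
  shows "\<exists>\<rho>. unit_O (Suc (Suc (2*l))) \<rho> \<and>
    (\<forall>a<l. \<rho> * ff l a * rev_cl \<rho> = vec_emb l (refls (Suc (2*l)) vs (iso_F a))) \<and> \<rho> * ee 0 * rev_cl \<rho> = ee 0"
proof (cases "even (length vs)")
  case True
  then show ?thesis using rotation_even[OF assms] unfolding ff_def by auto
next
  case False
  define z :: "nat \<Rightarrow> complex" where "z = (\<lambda>i. if i = 0 then 1 else 0)"
  have z: "supported (Suc (2*l)) z" "dot (Suc (2*l)) z z = 1"
    unfolding z_def dot_delta0 by (simp_all add: supported_def)
  then have "units (Suc (2*l)) (vs @ [z])" using assms by (auto simp: units_def)
  then obtain \<rho> where "unit_O (Suc (Suc (2*l))) \<rho>"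
    "\<And>x. \<rho> * vec_emb l x * rev_cl \<rho> = vec_emb l (refls (Suc (2*l)) (vs @ [z]) x)" "\<rho> * ee 0 * rev_cl \<rho> = ee 0"
    using rotation_even[of l "vs @ [z]"] False by auto
  moreover have "refls (Suc (2*l)) (vs @ [z]) (iso_F a) = refls (Suc (2*l)) vs (iso_F a)" for a
  proof -
    have "iso_F a 0 = 0" by (simp add: iso_F_def)
    then show ?thesis unfolding z_def by (simp add: refl_def dot_delta0)
  qed
  ultimately show ?thesis unfolding ff_def by auto
qed

fun frame_prod :: "nat \<Rightarrow> (nat \<Rightarrow> nat \<Rightarrow> complex) \<Rightarrow> nat \<Rightarrow> complex fls clf" where
  "frame_prod l w 0 = 1"
| "frame_prod l w (Suc r) = frame_prod l w r * el1 l (Xi ^ 2) (w (2*r)) (w (Suc (2*r)))"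

lemma conj_mult: "rev_cl \<rho> * \<rho> = 1 \<Longrightarrow> \<rho> * (x * y) * rev_cl \<rho> = (\<rho> * x * rev_cl \<rho>) * (\<rho> * y * rev_cl \<rho>)"
proof -
  assume r: "rev_cl \<rho> * \<rho> = 1"
  have "(\<rho> * x * rev_cl \<rho>) * (\<rho> * y * rev_cl \<rho>) = \<rho> * x * (rev_cl \<rho> * \<rho>) * y * rev_cl \<rho>" by (simp only: mult.assoc)
  then show ?thesis by (simp add: r mult.assoc)
qed

lemma conj_1_plus: "\<rho> * rev_cl \<rho> = 1 \<Longrightarrow> \<rho> * (1 + cst c * x) * rev_cl \<rho> = 1 + cst c * (\<rho> * x * rev_cl \<rho>)"
  by (simp add: distrib_left distrib_right cst_left_commute mult.assoc)

lemma conj_pairs_prod: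
  assumes \<rho>: "unit_O n \<rho>" and w: "\<And>a. a < 2*r \<Longrightarrow> \<rho> * ff l a * rev_cl \<rho> = vec_emb l (w a)"
  shows "\<rho> * pairs_prod l r * rev_cl \<rho> = frame_prod l w r"
  using w
proof (induction r)
  case 0
  show ?case using unit_O_inverse[OF \<rho>] by simp
next
  case (Suc r)
  note inv = unit_O_inverse[OF \<rho>]
  show ?case unfolding pairs_prod.simps frame_prod.simps conj_mult[OF inv(2)] conj_1_plus[OF inv(1)]
    using Suc by (simp add: el1_def)
qed

text \<open>After a rotation the frame is standard. The three positions of \<open>U\<close> lead to
  the weights with \<open>j = 0\<close>, \<open>j = 2*r\<close> and \<open>j = 2*r + 1\<close>; the
  scalar in the second may be 0.\<close>

lemma lift_decomp:
  assumes vs: "units (Suc (2*l)) vs" and w: "w = (\<lambda>a. refls (Suc (2*l)) vs (iso_F a))" and r: "2*r \<le> l"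
    and u: "(r = 0 \<and> U = (\<lambda>_. 0)) \<or> (r > 0 \<and> (\<exists>c. U = (\<lambda>i. c * w (2*r-2) i))) \<or> (2*r < l \<and> U = w (2*r))"
  shows "\<exists>A B j. j \<le> l \<and> unit_O (Suc (Suc (2*l))) A \<and> unit_O (Suc (Suc (2*l))) B \<and>
    frame_prod l w r * el0 l Xi U = A * std_n j * B"
proof -
  let ?n = "Suc (Suc (2*l))"
  obtain \<rho> where \<rho>: "unit_O ?n \<rho>" "\<And>a. a < l \<Longrightarrow> \<rho> * ff l a * rev_cl \<rho> = vec_emb l (w a)" "\<rho> * ee 0 * rev_cl \<rho> = ee 0"
    using rotation_frame[OF vs] unfolding w by auto
  note inv = unit_O_inverse[OF \<rho>(1)]
  have conj: "frame_prod l w r = \<rho> * pairs_prod l r * rev_cl \<rho>"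
    using conj_pairs_prod[OF \<rho>(1), of r l w] \<rho>(2) r by simp
  have "\<exists>A B j U0. j \<le> l \<and> unit_O ?n A \<and> unit_O ?n B \<and> el0 l Xi U = \<rho> * U0 * rev_cl \<rho> \<and> pairs_prod l r * U0 = A * std_n j * B"
    using u
  proof (elim disjE conjE exE)
    assume "r = 0" "U = (\<lambda>_. 0)"
    then show ?thesis using inv
      by (intro exI[of _ 1] exI[of _ 0]) (simp add: unit_O_sign std_n_def el0_def vec_emb_0)
  next
    fix c assume r0: "0 < r" and U: "U = (\<lambda>i. c * w (2*r-2) i)"
    obtain A B where "unit_O ?n A" "unit_O ?n B"
      "pairs_prod l r * (1 + cst (fls_const c * Xi) * (ee 0 * ff l (2*r-2))) = A * std_n (2*r) * B"
      using pairs_absorbed_decomp[OF r0 r, of c] by auto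
    moreover have "el0 l Xi U = \<rho> * (1 + cst (fls_const c * Xi) * (ee 0 * ff l (2*r-2))) * rev_cl \<rho>"
    proof -
      have "2*r-2 < l" using r r0 by auto
      then have "\<rho> * (1 + cst (fls_const c * Xi) * (ee 0 * ff l (2*r-2))) * rev_cl \<rho> = 1 + cst (fls_const c * Xi) * (ee 0 * vec_emb l (w (2*r-2)))"
        unfolding conj_1_plus[OF inv(1)] conj_mult[OF inv(2)] using \<rho>(2,3) by simp
      also have "\<dots> = el0 l Xi U" unfolding el0_def U vec_emb_cmult
        by (simp add: cst_left_commute[of "ee 0"] cst_mult mult.assoc mult.commute[of _ Xi])
      finally show ?thesis ..
    qed
    ultimately show ?thesis using r by blast
  next
    assume r1: "2*r < l" and U: "U = w (2*r)"
    obtain A B where "unit_O ?n A" "unit_O ?n B" "pairs_prod l r * el0 l Xi (iso_F (2*r)) = A * std_n (Suc (2*r)) * B"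
      using pairs_single_decomp[OF r1] by auto
    moreover have "el0 l Xi U = \<rho> * el0 l Xi (iso_F (2*r)) * rev_cl \<rho>"
      unfolding el0_def conj_1_plus[OF inv(1)] conj_mult[OF inv(2)] ff_def[symmetric] using \<rho>(2)[OF r1] \<rho>(3) U by simp
    ultimately show ?thesis using r1 by (meson Suc_leI)
  qed
  then obtain A B j U0 where AB: "j \<le> l" "unit_O ?n A" "unit_O ?n B" "el0 l Xi U = \<rho> * U0 * rev_cl \<rho>" "pairs_prod l r * U0 = A * std_n j * B"
    by auto
  have "frame_prod l w r * el0 l Xi U = \<rho> * (pairs_prod l r * U0) * rev_cl \<rho>"
    unfolding conj AB(4) by (rule conj_mult[OF inv(2), symmetric])
  also have "\<dots> = (\<rho> * A) * std_n j * (B * rev_cl \<rho>)" unfolding AB(5) by (simp only: mult.assoc)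
  finally show ?thesis using AB(1-3) \<rho>(1) by (meson unit_O_mult unit_O_rev)
qed

subsection \<open>The lifted elements\<close>

definition one_at_infinity :: "complex fls clf \<Rightarrow> bool" where
  "one_at_infinity x \<longleftrightarrow> coefs_in fls_Ominus x \<and> (\<forall>S. fls_nth (coef x S) 0 = cl_one S)"

lemma one_at_infinity_mult:
  assumes x: "one_at_infinity x" and y: "coefs_in fls_Ominus y"
  shows "one_at_infinity (x * (1 + cst Xi * y))"
proof -
  have xy: "coefs_in fls_Ominus (x * y)" using x y by (simp add: one_at_infinity_def coefs_in_mult[OF subring_Ominus])
  have eq: "x * (1 + cst Xi * y) = x + cst Xi * (x * y)" by (simp add: distrib_left cst_left_commute)
  have "coefs_in fls_Ominus (cst Xi * (x * y))"
    by (intro coefs_in_mult[OF subring_Ominus] coefs_in_cst[OF subring_Ominus] Xi_Ominus xy)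
  moreover have "fls_nth (Xi * coef (x * y) S) 0 = 0" for S
  proof -
    have "fls_nth (coef (x * y) S) 1 = 0" using xy by (simp add: coefs_in_def fls_Ominus_def)
    then show ?thesis by (simp add: fls_X_inv_times_conv_shift)
  qed
  ultimately show ?thesis using x unfolding eq one_at_infinity_def
    by (simp add: coefs_in_add[OF subring_Ominus])
qed

lemma one_at_infinity_1: "one_at_infinity 1"
  by (auto simp: one_at_infinity_def coefs_in_1[OF subring_Ominus] coef_1 cl_basis_def)

lemma one_at_infinity_el:
  assumes "one_at_infinity x"
  shows "one_at_infinity (x * el0 l Xi y)" "one_at_infinity (x * el1 l (Xi ^ 2) y z)"
proof -
  have v: "coefs_in fls_Ominus (vec_emb l y)" for y by (rule coefs_in_vec_emb[OF subring_Ominus fls_const_Ominus])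
  show "one_at_infinity (x * el0 l Xi y)" unfolding el0_def
    by (intro one_at_infinity_mult assms coefs_in_mult[OF subring_Ominus] v coefs_in_E[OF subring_Ominus])
  have "el1 l (Xi ^ 2) y z = 1 + cst Xi * (cst Xi * (vec_emb l y * vec_emb l z))"
    by (simp add: el1_def power2_eq_square cst_mult mult.assoc)
  then show "one_at_infinity (x * el1 l (Xi ^ 2) y z)"
    by (simp only:) (intro one_at_infinity_mult assms coefs_in_mult[OF subring_Ominus] v coefs_in_cst[OF subring_Ominus Xi_Ominus])
qed

lemma loop_el_lift:
  assumes iso: "\<And>a b. a < 2*r \<Longrightarrow> b < 2*r \<Longrightarrow> dot (Suc (2*l)) (w a) (w b) = 0" and U: "dot (Suc (2*l)) U U = 0"
  shows "loop_el (Suc (Suc (2*l))) (frame_prod l w r * el0 l Xi U)"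
    and "one_at_infinity (frame_prod l w r * el0 l Xi U)"
proof -
  have "loop_el (Suc (Suc (2*l))) (frame_prod l w r) \<and> one_at_infinity (frame_prod l w r)" using iso
  proof (induction r)
    case 0
    show ?case by (simp add: loop_el_def spinor_sign one_at_infinity_1)
  next
    case (Suc r)
    have "loop_el (Suc (Suc (2*l))) (el1 l (Xi ^ 2) (w (2*r)) (w (Suc (2*r))))"
      unfolding loop_el_def using el1_props[of l "w (2*r)" "w (Suc (2*r))" "Xi ^ 2"] Suc.prems by simp
    then show ?case using Suc by (simp add: loop_el_mult one_at_infinity_el)
  qed
  moreover have "loop_el (Suc (Suc (2*l))) (el0 l Xi U)"
    unfolding loop_el_def using el0_props[OF U] by simp
  ultimately show "loop_el (Suc (Suc (2*l))) (frame_prod l w r * el0 l Xi U)"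
    and "one_at_infinity (frame_prod l w r * el0 l Xi U)"
    by (simp_all add: loop_el_mult one_at_infinity_el)
qed

text \<open>All frame vectors are isotropic and mutually orthogonal, so the displacement caused by
  one factor is invisible to the others and the contributions add up.\<close>

lemma frame_prod_conj:
  assumes iso: "\<And>a b. a < 2*r \<Longrightarrow> b < 2*r \<Longrightarrow> dot (Suc (2*l)) (w a) (w b) = 0"
  shows "frame_prod l w r * vecn (Suc (Suc (2*l))) z * rev_cl (frame_prod l w r) =
    vecn (Suc (Suc (2*l))) (\<lambda>i. z i + Xi ^ 2 * (\<Sum>a<r. 2 * (dot (Suc (Suc (2*l))) (emb (w (Suc (2*a)))) z * emb (w (2*a)) i
      - dot (Suc (Suc (2*l))) (emb (w (2*a))) z * emb (w (Suc (2*a))) i)))"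
  using iso
proof (induction r arbitrary: z)
  case 0
  show ?case by simp
next
  case (Suc r)
  let ?n = "Suc (Suc (2*l))" and ?x = "w (2*r)" and ?y = "w (Suc (2*r))"
  have d: "dot ?n (\<lambda>i. Xi ^ 2 * emb ?x i) (emb ?y) = 0" "dot ?n (emb ?y) (emb ?y) = 0" "dot ?n (emb ?x) (emb ?x) = 0"
    using Suc.prems by (simp_all add: dot_left dot_emb)
  define z' where "z' = (\<lambda>i. z i + 2 * Xi ^ 2 * (dot ?n (emb ?y) z * emb ?x i - dot ?n (emb ?x) z * emb ?y i))"
  have el: "el1 l (Xi ^ 2) ?x ?y * vecn ?n z * rev_cl (el1 l (Xi ^ 2) ?x ?y) = vecn ?n z'"
    unfolding el1_eq el_conj[OF d(1,2)] z'_def dot_left dot_right d(3) by (rule vecn_eqI) (simp add: algebra_simps)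
  have wz: "dot ?n (emb (w a)) z' = dot ?n (emb (w a)) z" if "a < 2*r" for a
  proof -
    have "dot ?n (emb (w a)) (emb ?x) = 0" "dot ?n (emb (w a)) (emb ?y) = 0"
      using Suc.prems that by (simp_all add: dot_emb)
    then show ?thesis unfolding z'_def dot_right by simp
  qed
  have "frame_prod l w (Suc r) * vecn ?n z * rev_cl (frame_prod l w (Suc r)) =
     frame_prod l w r * (el1 l (Xi ^ 2) ?x ?y * vecn ?n z * rev_cl (el1 l (Xi ^ 2) ?x ?y)) * rev_cl (frame_prod l w r)"
    by (simp add: rev_mult mult.assoc)
  also have "\<dots> = vecn ?n (\<lambda>i. z' i + Xi ^ 2 * (\<Sum>a<r. 2 * (dot ?n (emb (w (Suc (2*a)))) z' * emb (w (2*a)) i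
      - dot ?n (emb (w (2*a))) z' * emb (w (Suc (2*a))) i)))"
    unfolding el by (rule Suc.IH) (use Suc.prems in auto)
  also have "\<dots> = vecn ?n (\<lambda>i. z' i + Xi ^ 2 * (\<Sum>a<r. 2 * (dot ?n (emb (w (Suc (2*a)))) z * emb (w (2*a)) i
      - dot ?n (emb (w (2*a))) z * emb (w (Suc (2*a))) i)))"
    by (rule vecn_eqI) (simp add: wz)
  finally show ?case unfolding z'_def by (simp add: algebra_simps)
qed

text \<open>\<open>el0\<close> acts first and yields the linear term and the square of
  \<open>U\<close>. What it adds is orthogonal to the frame vectors, so the bivectors see only the
  original basis vector.\<close>

lemma lift_coef:
  assumes iso: "\<And>a b. a < 2*r \<Longrightarrow> b < 2*r \<Longrightarrow> dot (Suc (2*l)) (w a) (w b) = 0"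
    and U: "dot (Suc (2*l)) U U = 0" "\<And>a. a < 2*r \<Longrightarrow> dot (Suc (2*l)) (w a) U = 0"
    and s: "s = frame_prod l w r * el0 l Xi U" and ij: "i < Suc (Suc (2*l))" "j < Suc (Suc (2*l))"
  shows "coef (s * ee j * rev_cl s) {i} = (if i = j then 1 else 0)
    + Xi * (2 * emb U j * (if i = 0 then 1 else 0) - 2 * (if j = 0 then 1 else 0) * emb U i)
    + Xi ^ 2 * ((\<Sum>a<r. 2 * (emb (w (Suc (2*a))) j * emb (w (2*a)) i - emb (w (2*a)) j * emb (w (Suc (2*a))) i)) - 2 * emb U j * emb U i)"
proof -
  let ?n = "Suc (Suc (2*l))"
  let ?d = "\<lambda>i. if i = j then 1 else (0 :: complex fls)"
  let ?o = "\<lambda>i. Xi * (if i = 0 then 1 else (0 :: complex fls))"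
  have d: "dot ?n ?o (emb U) = 0" "dot ?n (emb U) (emb U) = 0" unfolding dot_left dot_delta0 dot_emb U by simp_all
  have oo: "dot ?n ?o ?o = Xi * Xi" "dot ?n ?o ?d = (if j = 0 then Xi else 0)" "dot ?n (emb U) ?d = emb U j"
    unfolding dot_left dot_right dot_delta0 dot_delta_right[OF ij(2)] by simp_all
  define z' where "z' = (\<lambda>i. ?d i + 2 * emb U j * ?o i - 2 * (if j = 0 then Xi else 0) * emb U i - 2 * (Xi * Xi) * emb U j * emb U i)"
  have el: "el0 l Xi U * ee j * rev_cl (el0 l Xi U) = vecn ?n z'"
    unfolding el0_eq vecn_delta[OF ij(2), symmetric] el_conj[OF d] oo z'_def ..
  have wz: "dot ?n (emb (w a)) z' = emb (w a) j" if "a < 2*r" for a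
  proof -
    have "dot ?n (emb (w a)) ?o = 0" unfolding dot_commute[of _ "emb (w a)"] dot_left dot_delta0 by simp
    moreover have "dot ?n (emb (w a)) (emb U) = 0" using U(2)[OF that] by (simp add: dot_emb)
    moreover have "dot ?n (emb (w a)) ?d = emb (w a) j" by (rule dot_delta_right[OF ij(2)])
    ultimately show ?thesis unfolding z'_def dot_right by simp
  qed
  have "s * ee j * rev_cl s = frame_prod l w r * (el0 l Xi U * ee j * rev_cl (el0 l Xi U)) * rev_cl (frame_prod l w r)"
    unfolding s by (simp add: rev_mult mult.assoc)
  also have "\<dots> = vecn ?n (\<lambda>i. z' i + Xi ^ 2 * (\<Sum>a<r. 2 * (dot ?n (emb (w (Suc (2*a)))) z' * emb (w (2*a)) i
      - dot ?n (emb (w (2*a))) z' * emb (w (Suc (2*a))) i)))"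
    unfolding el by (rule frame_prod_conj[OF iso])
  finally have "coef (s * ee j * rev_cl s) {i} = z' i + Xi ^ 2 * (\<Sum>a<r. 2 * (dot ?n (emb (w (Suc (2*a)))) z' * emb (w (2*a)) i
      - dot ?n (emb (w (2*a))) z' * emb (w (Suc (2*a))) i))"
    by (simp add: coef_vecn_single[OF ij(1)])
  also have "(\<Sum>a<r. 2 * (dot ?n (emb (w (Suc (2*a)))) z' * emb (w (2*a)) i - dot ?n (emb (w (2*a))) z' * emb (w (Suc (2*a))) i)) =
     (\<Sum>a<r. 2 * (emb (w (Suc (2*a))) j * emb (w (2*a)) i - emb (w (2*a)) j * emb (w (Suc (2*a))) i))"
    by (intro sum.cong refl) (simp add: wz)
  also have "z' i + Xi ^ 2 * T = (if i = j then 1 else 0)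
      + Xi * (2 * emb U j * (if i = 0 then 1 else 0) - 2 * (if j = 0 then 1 else 0) * emb U i)
      + Xi ^ 2 * (T - 2 * emb U j * emb U i)" for T
    unfolding z'_def by (cases "i = 0"; cases "j = 0"; cases "i = j"; simp add: power2_eq_square algebra_simps)
  finally show ?thesis .
qed

subsection \<open>Pole order of the translation elements\<close>

lemma rev_torus: "rev_cl (torus k z) = cst ((z + 1) / 2) + cst (fls_const \<i> * (z - 1) / 2) * bivec k"
  by (simp add: torus_def rev_diff rev_mult rev_bivec cst_commute)

lemma rev_torus_commute: "bivec k * x = x * bivec k \<Longrightarrow> rev_cl (torus k z) * x = x * rev_cl (torus k z)"
  unfolding rev_torus distrib_left distrib_right
  by (simp only: mult.assoc cst_commute[of x] cst_left_commute[of x])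

lemma torus_rev: "torus k z * rev_cl (torus k z) = cst z"
proof -
  define a b where "a = (z + 1) / 2" and "b = fls_const \<i> * (z - 1) / 2"
  have ii: "fls_const \<i> * fls_const \<i> = -1"
    unfolding fls_const_mult_const by (rule fls_eqI) simp
  have "b * b = (fls_const \<i> * fls_const \<i>) * ((z - 1) * (z - 1)) / 4"
    unfolding b_def by (simp only: times_divide_eq_left times_divide_eq_right divide_divide_eq_left mult_ac) simp
  then have bb: "a * a + b * b = z" unfolding ii a_def by (simp add: field_simps)
  have "torus k z * rev_cl (torus k z) = (cst a - cst b * bivec k) * (cst a + cst b * bivec k)"
    unfolding rev_torus by (simp only: torus_def a_def b_def)
  also have "\<dots> = cst a * cst a + cst a * (cst b * bivec k) - (cst b * bivec k) * cst a - (cst b * bivec k) * (cst b * bivec k)"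
    by (simp only: left_diff_distrib distrib_left) (simp add: algebra_simps)
  also have "(cst b * bivec k) * (cst b * bivec k) = - cst (b * b)" unfolding cst_mult_pair bivec_sq by simp
  also have "(cst b * bivec k) * cst a = cst a * (cst b * bivec k)" by (rule cst_commute)
  finally show ?thesis unfolding bb[symmetric] by (simp add: cst_add cst_mult)
qed

lemma torus_conj_commuting: "bivec k * y = y * bivec k \<Longrightarrow> torus k z * y * rev_cl (torus k z) = cst z * y"
  using torus_commute[of k y z] by (simp add: mult.assoc torus_rev cst_commute)

text \<open>A basis vector of the plane anticommutes with its bivector and thus turns the torus
  element into its reversal.\<close>

lemma torus_conj_same:
  assumes "i = 2*k \<or> i = Suc (2*k)"
  shows "torus k z * ee i * rev_cl (torus k z) = ee i * (rev_cl (torus k z) * rev_cl (torus k z))"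
proof -
  have "torus k z * ee i = ee i * rev_cl (torus k z)"
    unfolding rev_torus unfolding torus_def left_diff_distrib distrib_left
    using bivec_E_same[OF assms] by (simp add: mult.assoc cst_commute[of "ee i"] cst_left_commute[of "ee i"])
  then show ?thesis by (simp only: mult.assoc)
qed

lemma torus_prod_conj_commuting:
  "(\<And>k. 1 \<le> k \<Longrightarrow> k \<le> j \<Longrightarrow> bivec k * y = y * bivec k) \<Longrightarrow>
    torus_prod z j * y * rev_cl (torus_prod z j) = cst (z ^ j) * y"
proof (induction j)
  case (Suc j)
  have "torus_prod z (Suc j) * y * rev_cl (torus_prod z (Suc j)) =
    torus_prod z j * (torus (Suc j) z * y * rev_cl (torus (Suc j) z)) * rev_cl (torus_prod z j)"
    by (simp add: rev_mult mult.assoc)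
  also have "torus (Suc j) z * y * rev_cl (torus (Suc j) z) = cst z * y"
    by (rule torus_conj_commuting) (use Suc.prems in auto)
  also have "torus_prod z j * (cst z * y) * rev_cl (torus_prod z j) = cst z * (torus_prod z j * y * rev_cl (torus_prod z j))"
    by (simp only: cst_left_commute mult.assoc)
  also have "\<dots> = cst (z ^ Suc j) * y" using Suc by (simp add: cst_mult mult.assoc)
  finally show ?case .
qed simp

lemma bivec_ee_commute: "i div 2 \<noteq> k \<Longrightarrow> bivec k * ee i = ee i * bivec k"
  by (rule bivec_E_other) auto

lemma bivec_commute_rev_torus: "bivec j * rev_cl (torus k z) = rev_cl (torus k z) * bivec j"
  by (rule rev_torus_commute[symmetric]) (rule bivec_commute)

lemma coefs_in_torus_rev:
  assumes "z \<in> fls_O"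
  shows "coefs_in fls_O (rev_cl (torus k z))"
proof -
  have half: "f / 2 = f * fls_const (1/2)" for f :: "complex fls" by (simp add: fls_const_divide_const[symmetric])
  show ?thesis unfolding rev_torus bivec_def half
    using assms subring_1[OF subring_O] fls_const_O
    by (auto intro!: coefs_in_add[OF subring_O] coefs_in_mult[OF subring_O] coefs_in_cst[OF subring_O]
      coefs_in_E[OF subring_O] subring_mult[OF subring_O] subring_add[OF subring_O] subring_diff[OF subring_O])
qed

text \<open>The plane of \<open>i\<close> contributes the square of the reversed torus element; each
  of the other \<open>j - 1\<close> planes commutes with the vector and contributes its norm
  \<open>z\<close>.\<close>

lemma torus_prod_conj_same:
  assumes "1 \<le> k" "k \<le> j" "i = 2*k \<or> i = Suc (2*k)"
  shows "torus_prod z j * ee i * rev_cl (torus_prod z j) = cst (z ^ (j - 1)) * (ee i * (rev_cl (torus k z) * rev_cl (torus k z)))"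
  using assms(2,1)
proof (induction j)
  case (Suc j)
  have split: "torus_prod z (Suc j) * ee i * rev_cl (torus_prod z (Suc j)) =
    torus_prod z j * (torus (Suc j) z * ee i * rev_cl (torus (Suc j) z)) * rev_cl (torus_prod z j)"
    by (simp add: rev_mult mult.assoc)
  show ?case
  proof (cases "k = Suc j")
    case True
    have "torus (Suc j) z * ee i * rev_cl (torus (Suc j) z) = ee i * (rev_cl (torus k z) * rev_cl (torus k z))"
      unfolding True[symmetric] by (rule torus_conj_same[OF assms(3)])
    moreover have "bivec k' * (ee i * (rev_cl (torus k z) * rev_cl (torus k z))) = ee i * (rev_cl (torus k z) * rev_cl (torus k z)) * bivec k'"
      if "k' \<le> j" for k'
    proof -
      define R where "R = rev_cl (torus k z)"
      have c: "bivec k' * ee i = ee i * bivec k'" using that True assms(3) by (intro bivec_ee_commute) auto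
      have b: "bivec k' * R = R * bivec k'" unfolding R_def by (rule bivec_commute_rev_torus)
      have "bivec k' * (ee i * (R * R)) = (bivec k' * ee i) * (R * R)" by (simp only: mult.assoc)
      also have "\<dots> = ee i * ((bivec k' * R) * R)" unfolding c by (simp only: mult.assoc)
      also have "\<dots> = ee i * (R * (bivec k' * R))" unfolding b by (simp only: mult.assoc b)
      also have "\<dots> = ee i * (R * R) * bivec k'" unfolding b by (simp only: mult.assoc)
      finally show ?thesis unfolding R_def .
    qed
    ultimately show ?thesis unfolding split by (simp add: torus_prod_conj_commuting)
  next
    case False
    then have kj: "k \<le> j" using Suc.prems by simp
    have "torus (Suc j) z * ee i * rev_cl (torus (Suc j) z) = cst z * ee i"
      by (rule torus_conj_commuting, rule bivec_ee_commute) (use False assms(3) in auto)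
    then have "torus_prod z (Suc j) * ee i * rev_cl (torus_prod z (Suc j)) = cst z * (torus_prod z j * ee i * rev_cl (torus_prod z j))"
      unfolding split by (simp only: cst_left_commute mult.assoc)
    also have "\<dots> = cst (z * z ^ (j - 1)) * (ee i * (rev_cl (torus k z) * rev_cl (torus k z)))"
      using Suc.IH[OF kj] Suc.prems by (simp add: cst_mult mult.assoc)
    also have "z * z ^ (j - 1) = z ^ (Suc j - 1)" using kj Suc.prems by (cases j) auto
    finally show ?thesis .
  qed
qed simp

text \<open>The scalar of \<open>std_n\<close> contributes t^(-2j). For a vector outside the first
  \<open>j\<close> planes the norms of all these planes cancel it; inside one of them a norm is
  missing and exactly t^-2 is left over.\<close>

lemma std_n_pole:
  "coefs_in fls_O (cst (X ^ 2) * (std_n j * ee i * rev_cl (std_n j)))"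
proof -
  define z w where "z = - (X ^ 2)" and "w = ((-1) ^ j :: complex fls)"
  have zO: "z \<in> fls_O" using X2_O by (simp add: z_def)
  have wO: "w \<in> fls_O" unfolding w_def using subring_power[OF subring_O subring_uminus[OF subring_O subring_1[OF subring_O]]] .
  have Xz: "Xi ^ j * Xi ^ j * z ^ j = (-1) ^ j"
  proof -
    have "Xi ^ j * Xi ^ j * z ^ j = (Xi * Xi * z) ^ j" by (simp only: power_mult_distrib)
    also have "Xi * Xi * z = -1" unfolding z_def using X2_Xi2 by (simp add: power2_eq_square)
    finally show ?thesis .
  qed
  have conj_expand: "(cst c * (P * Q)) * e * rev_cl (cst c * (P * Q)) = cst (c * c) * (P * (Q * e * rev_cl Q) * rev_cl P)"
    for c and P Q e :: "complex fls clf"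
  proof -
    define P' Q' where "P' = rev_cl P" and "Q' = rev_cl Q"
    have "rev_cl (cst c * (P * Q)) = cst c * (Q' * P')"
      unfolding P'_def Q'_def rev_mult rev_cst cst_commute[of "rev_cl Q * rev_cl P"] ..
    then have "(cst c * (P * Q)) * e * rev_cl (cst c * (P * Q)) = cst c * (P * Q * e) * (cst c * (Q' * P'))"
      by (simp only: mult.assoc)
    also have "\<dots> = cst (c * c) * (P * (Q * e * Q') * P')" unfolding cst_mult_pair by (simp only: mult.assoc)
    finally show ?thesis unfolding P'_def Q'_def .
  qed
  have expand: "std_n j * ee i * rev_cl (std_n j) = cst (Xi ^ j * Xi ^ j) *
      (torus_prod z j * (torus 0 w * ee i * rev_cl (torus 0 w)) * rev_cl (torus_prod z j))"
    unfolding std_n_def z_def[symmetric] w_def[symmetric] by (rule conj_expand)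
  note O = coefs_in_mult[OF subring_O] coefs_in_cst[OF subring_O] coefs_in_E[OF subring_O] coefs_in_torus_rev
  have pm: "(-1) ^ j \<in> fls_O" using wO by (simp add: w_def)
  show ?thesis
  proof (cases "1 \<le> i div 2 \<and> i div 2 \<le> j")
    case True
    define k where "k = i div 2"
    have k: "1 \<le> k" "k \<le> j" using True unfolding k_def by auto
    have ik: "i = 2*k \<or> i = Suc (2*k)" unfolding k_def by presburger
    have "torus 0 w * ee i * rev_cl (torus 0 w) = cst w * ee i"
      by (rule torus_conj_commuting, rule bivec_ee_commute) (use k ik in auto)
    then have "cst (X ^ 2) * (std_n j * ee i * rev_cl (std_n j)) =
       cst (X ^ 2) * (cst (Xi ^ j * Xi ^ j) * (cst w * (torus_prod z j * ee i * rev_cl (torus_prod z j))))"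
      unfolding expand by (simp only: cst_left_commute[of "torus_prod z j"] mult.assoc)
    also have "\<dots> = cst (X ^ 2 * (Xi ^ j * Xi ^ j) * w * z ^ (j - 1)) * (ee i * (rev_cl (torus k z) * rev_cl (torus k z)))"
      unfolding torus_prod_conj_same[OF k ik] by (simp only: cst_mult mult.assoc)
    \<comment> \<open>The factor missing in the exponent \<open>j - 1\<close> is supplied by
      \<open>X ^ 2 = - z\<close>.\<close>
    also have "X ^ 2 * (Xi ^ j * Xi ^ j) * w * z ^ (j - 1) = - ((-1) ^ j * w)"
    proof -
      have "X ^ 2 = - z" by (simp add: z_def)
      moreover have "z ^ j = z * z ^ (j - 1)" using k by (cases j) auto
      ultimately have "X ^ 2 * (Xi ^ j * Xi ^ j) * w * z ^ (j - 1) = - (Xi ^ j * Xi ^ j * z ^ j) * w" by simp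
      then show ?thesis unfolding Xz by simp
    qed
    also have "coefs_in fls_O (cst (- ((-1) ^ j * w)) * (ee i * (rev_cl (torus k z) * rev_cl (torus k z))))"
      by (intro O subring_uminus[OF subring_O] subring_mult[OF subring_O] wO pm zO)
    finally show ?thesis .
  next
    case False
    define y where "y = torus 0 w * ee i * rev_cl (torus 0 w)"
    have comm: "bivec k * y = y * bivec k" if "1 \<le> k" "k \<le> j" for k
    proof -
      have c: "bivec k * ee i = ee i * bivec k" using False that by (intro bivec_ee_commute) auto
      have t: "bivec k * torus 0 w = torus 0 w * bivec k" by (rule torus_commute[symmetric]) (rule bivec_commute)
      have "bivec k * y = (bivec k * torus 0 w) * ee i * rev_cl (torus 0 w)" by (simp only: y_def mult.assoc)
      also have "\<dots> = torus 0 w * (bivec k * ee i) * rev_cl (torus 0 w)" unfolding t by (simp only: mult.assoc)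
      also have "\<dots> = torus 0 w * ee i * (bivec k * rev_cl (torus 0 w))" unfolding c by (simp only: mult.assoc)
      also have "\<dots> = y * bivec k" unfolding bivec_commute_rev_torus y_def by (simp only: mult.assoc)
      finally show ?thesis .
    qed
    have conj: "torus_prod z j * y * rev_cl (torus_prod z j) = cst (z ^ j) * y"
      by (rule torus_prod_conj_commuting) (rule comm)
    have "std_n j * ee i * rev_cl (std_n j) = cst (Xi ^ j * Xi ^ j) * (cst (z ^ j) * y)"
      unfolding expand unfolding y_def[symmetric] unfolding conj ..
    also have "\<dots> = cst (Xi ^ j * Xi ^ j * z ^ j) * y" by (simp only: cst_mult mult.assoc)
    also have "coefs_in fls_O \<dots>"
    proof -
      have "rev_cl (rev_cl (torus 0 w)) = torus 0 w" by simp
      then have "coefs_in fls_O (torus 0 w)" using coefs_in_rev[OF subring_O coefs_in_torus_rev[OF wO]] by metis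
      then show ?thesis unfolding Xz y_def by (intro O wO pm)
    qed
    finally show ?thesis by (intro coefs_in_mult[OF subring_O coefs_in_cst[OF subring_O X2_O(1)]])
  qed
qed

text \<open>Conjugation by \<open>h'\<close> turns a basis vector into an integral combination of
  basis vectors, to each of which the bound for \<open>std_n j\<close> applies; conjugation by
  \<open>h\<close> preserves integrality.\<close>

lemma double_coset_pole:
  assumes x: "x = h * std_n j * h'" and h: "loop_O_el n h" and h': "loop_O_el n h'" and i: "i < n"
  shows "coefs_in fls_O (cst (X ^ 2) * (x * ee i * rev_cl x))"
proof -
  obtain w where w: "h' * ee i * rev_cl h' = vecn n w"
    using h' unfolding loop_O_el_def loop_el_def spinor_def vecn_delta[OF i, symmetric] by blast
  have "coefs_in fls_O (h' * ee i * rev_cl h')"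
    using h' unfolding loop_O_el_def
    by (intro coefs_in_mult[OF subring_O] coefs_in_E[OF subring_O] coefs_in_rev[OF subring_O]) auto
  then have wO: "w a \<in> fls_O" if "a < n" for a
    unfolding w coefs_in_def using coef_vecn_single[OF that, of w] by metis
  have "cst (X ^ 2) * (x * ee i * rev_cl x) = cst (X ^ 2) * (h * (std_n j * (h' * ee i * rev_cl h') * rev_cl (std_n j)) * rev_cl h)"
    unfolding x by (simp add: rev_mult mult.assoc)
  also have "\<dots> = h * (\<Sum>a<n. cst (w a) * (cst (X ^ 2) * (std_n j * ee a * rev_cl (std_n j)))) * rev_cl h"
  proof -
    have "cst (X ^ 2) * (std_n j * vecn n w * rev_cl (std_n j)) = (\<Sum>a<n. cst (w a) * (cst (X ^ 2) * (std_n j * ee a * rev_cl (std_n j))))"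
      unfolding vecn_def sum_distrib_left sum_distrib_right
    proof (intro sum.cong refl)
      fix a
      have "cst (X ^ 2) * (std_n j * (cst (w a) * ee a) * rev_cl (std_n j)) = cst (X ^ 2) * (cst (w a) * (std_n j * ee a * rev_cl (std_n j)))"
        by (simp only: cst_left_commute[of "std_n j"] mult.assoc)
      also have "\<dots> = cst (w a) * (cst (X ^ 2) * (std_n j * ee a * rev_cl (std_n j)))" by (rule cst_left_commute)
      finally show "cst (X ^ 2) * (std_n j * (cst (w a) * ee a) * rev_cl (std_n j)) = cst (w a) * (cst (X ^ 2) * (std_n j * ee a * rev_cl (std_n j)))" .
    qed
    moreover have "cst (X ^ 2) * (h * y * rev_cl h) = h * (cst (X ^ 2) * y) * rev_cl h" for y
      by (simp only: cst_left_commute[of h] mult.assoc)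
    ultimately show ?thesis unfolding w by (simp only:)
  qed
  also have "coefs_in fls_O \<dots>"
    using h wO unfolding loop_O_el_def
    by (intro coefs_in_mult[OF subring_O] coefs_in_rev[OF subring_O] coefs_in_sum[OF subring_O] coefs_in_cst[OF subring_O] std_n_pole) auto
  finally show ?thesis .
qed

subsection \<open>The Grassmannian\<close>

lemma cl_vectors_eq: "(cl_vectors n :: 'a::comm_ring_1 cliff set) = range (\<lambda>v. coef (vecn n v))"
proof (intro Set.set_eqI iffI)
  fix v :: "'a cliff" assume v: "v \<in> cl_vectors n"
  have "v S = coef (vecn n (\<lambda>i. v {i})) S" for S
  proof (cases "\<exists>i<n. S = {i}")
    case True
    then show ?thesis by (auto simp: coef_vecn_single)
  next
    case False
    then have "coef (vecn n (\<lambda>i. v {i})) S = 0" by (intro coef_vecn_other) auto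
    moreover have "v S = 0"
    proof (cases "card S = 1")
      case True
      then obtain i where "S = {i}" by (auto simp: card_1_singleton_iff)
      then have "\<not> S \<subseteq> {..<n}" using False by auto
      then show ?thesis using v by (auto simp: cl_vectors_def cl_carrier_def)
    qed (use v in \<open>auto simp: cl_vectors_def\<close>)
    ultimately show ?thesis by simp
  qed
  then have "v = coef (vecn n (\<lambda>i. v {i}))" by (rule ext)
  then show "v \<in> range (\<lambda>v. coef (vecn n v))" by (rule range_eqI[of _ "\<lambda>v. coef (vecn n v)" "\<lambda>i. v {i}"])
next
  fix v :: "'a cliff" assume "v \<in> range (\<lambda>v. coef (vecn n v))"
  then obtain w where v: "v = coef (vecn n w)" by (rule rangeE)
  have "coef (vecn n w) S = 0" if "card S \<noteq> 1" for S using that by (intro coef_vecn_other) auto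
  then show "v \<in> cl_vectors n" unfolding v cl_vectors_def using supp_in_vecn[of n w, unfolded supp_in_def] by blast
qed

lemma coef_inj: "coef x = coef y \<longleftrightarrow> x = y"
  by (rule coef_inject)

lemma spin_iff: "coef x \<in> spin n \<longleftrightarrow> spinor n x"
proof (cases "supp_in n x")
  case True
  have r: "supp_in n (rev_cl x)" by (rule supp_in_rev[OF True])
  have 1: "cl_mult n (coef x) (cl_rev (coef x)) = cl_one \<longleftrightarrow> x * rev_cl x = 1"
    "cl_mult n (cl_rev (coef x)) (coef x) = cl_one \<longleftrightarrow> rev_cl x * x = 1"
    unfolding coef_rev_fun[symmetric] coef_mult[OF True r, symmetric] coef_mult[OF r True, symmetric] coef_1_fun[symmetric]
    by (rule coef_inj)+
  have 2: "cl_mult n (cl_mult n (coef x) (coef (vecn n v))) (cl_rev (coef x)) = coef (x * vecn n v * rev_cl x)" for v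
    unfolding coef_rev_fun[symmetric]
    by (simp only: coef_mult[OF True supp_in_vecn] coef_mult[OF supp_in_mult[OF True supp_in_vecn] r])
  have "(\<forall>v\<in>cl_vectors n. cl_mult n (cl_mult n (coef x) v) (cl_rev (coef x)) \<in> cl_vectors n) \<longleftrightarrow>
      (\<forall>v. \<exists>w. x * vecn n v * rev_cl x = vecn n w)"
    unfolding cl_vectors_eq by (simp add: 2 image_iff coef_inj)
  then show ?thesis unfolding spin_def spinor_def mem_Collect_eq 1 evn_def
    using True by (simp add: supp_in_def)
next
  case False
  then show ?thesis by (simp add: spin_def spinor_def supp_in_def)
qed

lemma coef_surj: "s \<in> cl_carrier n \<Longrightarrow> \<exists>x. s = coef x"
  by (metis coef_Clf)

lemma carrier_loop_group: "carrier (loop_group l) = coef ` {x. loop_el (Suc (Suc (2*l))) x}"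
proof -
  have "s \<in> carrier (loop_group l) \<longleftrightarrow> (\<exists>x. s = coef x \<and> loop_el (Suc (Suc (2*l))) x)" for s
  proof
    assume s: "s \<in> carrier (loop_group l)"
    then obtain x where x: "s = coef x" using coef_surj[of s "2*l+2"] by (auto simp: loop_group_def spin_def)
    then show "\<exists>x. s = coef x \<and> loop_el (Suc (Suc (2*l))) x"
      using s by (intro exI[of _ x]) (simp add: loop_group_def loop_el_def spin_iff coef_sg_fun[symmetric] coef_inj)
  next
    assume "\<exists>x. s = coef x \<and> loop_el (Suc (Suc (2*l))) x"
    then show "s \<in> carrier (loop_group l)"
      by (auto simp: loop_group_def loop_el_def spin_iff coef_sg_fun[symmetric])
  qed
  then show ?thesis by auto
qed

lemma loop_O_eq: "loop_O l = coef ` {x. loop_O_el (Suc (Suc (2*l))) x}"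
  unfolding loop_O_def carrier_loop_group by (auto simp: loop_O_el_def coefs_in_def)

lemma loop_Ominus0_eq: "loop_Ominus0 l = coef ` {x. loop_el (Suc (Suc (2*l))) x \<and> one_at_infinity x}"
  unfolding loop_Ominus0_def loop_Ominus_def carrier_loop_group
  by (auto simp: one_at_infinity_def coefs_in_def)

lemma l_coset_eq:
  assumes "supp_in (Suc (Suc (2*l))) x" "\<And>y. P y \<Longrightarrow> supp_in (Suc (Suc (2*l))) y"
  shows "coef x <#\<^bsub>loop_group l\<^esub> (coef ` {y. P y}) = coef ` {x * y | y. P y}"
proof -
  have "coef x <#\<^bsub>loop_group l\<^esub> (coef ` {y. P y}) = (\<lambda>y. cl_mult (Suc (Suc (2*l))) (coef x) (coef y)) ` {y. P y}"
    unfolding l_coset_def by (auto simp: loop_group_def)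
  also have "\<dots> = (\<lambda>y. coef (x * y)) ` {y. P y}"
    by (rule image_cong) (simp_all add: coef_mult[OF assms(1) assms(2)])
  also have "\<dots> = coef ` {x * y | y. P y}" by auto
  finally show ?thesis .
qed

lemma loop_O_el_supp: "loop_O_el n x \<Longrightarrow> supp_in n x" and loop_el_supp: "loop_el n x \<Longrightarrow> supp_in n x"
  by (simp_all add: loop_O_el_def loop_el_def spinor_def)

lemma coset_base:
  assumes "supp_in (Suc (Suc (2*l))) x"
  shows "coef x <#\<^bsub>loop_group l\<^esub> base_point l = coef ` {x * y | y. loop_O_el (Suc (Suc (2*l))) y}"
  unfolding base_point_def loop_O_eq by (rule l_coset_eq[OF assms loop_O_el_supp])

lemma Gr_orbit_eq:
  "Gr_orbit l m = {coef ` {h * (n_el l m * y) | y. loop_O_el (Suc (Suc (2*l))) y} | h. loop_O_el (Suc (Suc (2*l))) h}"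
proof -
  have sup: "supp_in (Suc (Suc (2*l))) (n_el l m)" using coef_n_el(2)[of l m] by simp
  have n: "n_elt l m <#\<^bsub>loop_group l\<^esub> base_point l = coef ` {z. \<exists>y. z = n_el l m * y \<and> loop_O_el (Suc (Suc (2*l))) y}"
    unfolding coef_n_el(1)[symmetric] coset_base[OF sup] ..
  have "coef h <#\<^bsub>loop_group l\<^esub> (n_elt l m <#\<^bsub>loop_group l\<^esub> base_point l) =
      coef ` {h * z | z. \<exists>y. z = n_el l m * y \<and> loop_O_el (Suc (Suc (2*l))) y}" if "loop_O_el (Suc (Suc (2*l))) h" for h
    unfolding n by (rule l_coset_eq[OF loop_O_el_supp[OF that]])
      (use supp_in_mult[OF sup loop_O_el_supp] in auto)
  moreover have "{h * z | z. \<exists>y. z = n_el l m * y \<and> loop_O_el (Suc (Suc (2*l))) y} = {h * (n_el l m * y) | y. loop_O_el (Suc (Suc (2*l))) y}" for h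
    by auto
  ultimately have key: "coef h <#\<^bsub>loop_group l\<^esub> (n_elt l m <#\<^bsub>loop_group l\<^esub> base_point l) =
      coef ` {h * (n_el l m * y) | y. loop_O_el (Suc (Suc (2*l))) y}" if "loop_O_el (Suc (Suc (2*l))) h" for h
    using that by (simp only:)
  have "Gr_orbit l m = (\<lambda>h. h <#\<^bsub>loop_group l\<^esub> (n_elt l m <#\<^bsub>loop_group l\<^esub> base_point l)) ` (coef ` {h. loop_O_el (Suc (Suc (2*l))) h})"
    unfolding Gr_orbit_def loop_O_eq by auto
  also have "\<dots> = (\<lambda>h. coef ` {h * (n_el l m * y) | y. loop_O_el (Suc (Suc (2*l))) y}) ` {h. loop_O_el (Suc (Suc (2*l))) h}"
    unfolding image_image by (rule image_cong) (simp_all only: key mem_Collect_eq)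
  finally show ?thesis by auto
qed

lemma loop_O_el_1: "loop_O_el n 1" and loop_O_el_minus: "loop_O_el n x \<Longrightarrow> loop_O_el n (- x)"
  using unit_O_sign[of n] loop_O_el_mult[of n "-1" x] by (simp_all add: unit_O_def)

text \<open>The coset of \<open>x\<close> contains \<open>x\<close> itself, and equality with a
  coset in the orbit displays \<open>x\<close> in the double coset. A possible sign is put into the
  left factor.\<close>

lemma small_orbit_imp:
  assumes l: "1 \<le> l" and x: "supp_in (Suc (Suc (2*l))) x" and mem: "coef x <#\<^bsub>loop_group l\<^esub> base_point l \<in> small_M l"
  shows "\<exists>h h' j. loop_O_el (Suc (Suc (2*l))) h \<and> loop_O_el (Suc (Suc (2*l))) h' \<and> x = h * std_n j * h'"
proof -
  obtain m h where m: "small_dominant l (coinv_class l m)" and h: "loop_O_el (Suc (Suc (2*l))) h"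
    and eq: "coef ` {x * y | y. loop_O_el (Suc (Suc (2*l))) y} = coef ` {h * (n_el l m * y) | y. loop_O_el (Suc (Suc (2*l))) y}"
    using mem unfolding small_M_def Gr_orbit_eq coset_base[OF x] by auto
  obtain j where j: "j \<le> l" "\<And>k. k \<in> {1..l} \<Longrightarrow> coinv_class l m k = (if k \<le> j then 1 else 0)"
    using small_dominant_iff[OF l] m by auto
  have "coef (x * 1) \<in> coef ` {x * y | y. loop_O_el (Suc (Suc (2*l))) y}" using loop_O_el_1 by blast
  then obtain y where y: "loop_O_el (Suc (Suc (2*l))) y" "coef (x * 1) = coef (h * (n_el l m * y))" unfolding eq by auto
  then have xe: "x = h * (n_el l m * y)" by (simp add: coef_inj)
  show ?thesis using n_el_eq[OF l j]
  proof
    assume "n_el l m = std_n j"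
    then show ?thesis using xe h y(1) by (auto simp: mult.assoc)
  next
    assume "n_el l m = - std_n j"
    then have "x = (- h) * std_n j * y" using xe by (simp add: mult.assoc)
    then show ?thesis using loop_O_el_minus[OF h] y(1) by blast
  qed
qed

lemma small_orbit_if:
  assumes l: "1 \<le> l" and j: "j \<le> l" and x: "x = A * std_n j * B" and A: "unit_O (Suc (Suc (2*l))) A" and B: "unit_O (Suc (Suc (2*l))) B"
    and loop: "loop_el (Suc (Suc (2*l))) x" "one_at_infinity x"
  shows "coef x <#\<^bsub>loop_group l\<^esub> base_point l \<in> small_M l"
proof -
  \<comment> \<open>The partial sums of (1^j 0^(l-j)) are the coefficients of the coroots; the total
    \<open>j\<close> is placed at the coroot \<open>l\<close> and nothing at its mirror image
    \<open>l+1\<close>.\<close>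
  define m :: "nat \<Rightarrow> int" where "m i = (if i < l then int (min i j) else if i = l then int j else 0)" for i
  have cl: "coinv_class l m k = (if k \<le> j then 1 else 0)" if "k \<in> {1..l}" for k
  proof -
    have "coinv_class l m k = m k - (if k = 1 then 0 else m (k - 1)) + m (l+1) * gam l (l+1) k"
      unfolding coinv_class_def using sum_gam[OF that, of m] by simp
    then show ?thesis using that j by (auto simp: m_def)
  qed
  have small: "small_dominant l (coinv_class l m)" unfolding small_dominant_iff[OF l] using j cl by auto
  have Oel: "loop_O_el (Suc (Suc (2*l))) A" "loop_O_el (Suc (Suc (2*l))) (- A)" "loop_O_el (Suc (Suc (2*l))) B" "loop_O_el (Suc (Suc (2*l))) (rev_cl B)"
    using A B loop_O_el_minus by (auto simp: unit_O_def)
  obtain h where h: "loop_O_el (Suc (Suc (2*l))) h" "x = h * (n_el l m * B)"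
  proof (cases "n_el l m = std_n j")
    case True
    then show ?thesis using that[of A] Oel x by (simp add: mult.assoc)
  next
    case False
    then have "n_el l m = - std_n j" using n_el_eq[OF l j cl] by auto
    then show ?thesis using that[of "- A"] Oel x by (simp add: mult.assoc)
  qed
  have "{x * y | y. loop_O_el (Suc (Suc (2*l))) y} = {h * (n_el l m * y) | y. loop_O_el (Suc (Suc (2*l))) y}"
  proof (intro Set.set_eqI iffI)
    fix z assume "z \<in> {x * y | y. loop_O_el (Suc (Suc (2*l))) y}"
    then obtain y where "z = x * y" "loop_O_el (Suc (Suc (2*l))) y" by auto
    then have "z = h * (n_el l m * (B * y))" "loop_O_el (Suc (Suc (2*l))) (B * y)"
      using h(2) Oel(3) by (auto simp: mult.assoc intro: loop_O_el_mult)
    then show "z \<in> {h * (n_el l m * y) | y. loop_O_el (Suc (Suc (2*l))) y}" by blast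
  next
    fix z assume "z \<in> {h * (n_el l m * y) | y. loop_O_el (Suc (Suc (2*l))) y}"
    then obtain y where y: "z = h * (n_el l m * y)" "loop_O_el (Suc (Suc (2*l))) y" by auto
    have "x * (rev_cl B * y) = h * (n_el l m * (B * rev_cl B * y))" unfolding h(2) by (simp only: mult.assoc)
    then have "z = x * (rev_cl B * y)" "loop_O_el (Suc (Suc (2*l))) (rev_cl B * y)"
      using y unit_O_inverse(1)[OF B] Oel(4) by (auto intro: loop_O_el_mult)
    then show "z \<in> {x * y | y. loop_O_el (Suc (Suc (2*l))) y}" by blast
  qed
  then have "coef x <#\<^bsub>loop_group l\<^esub> base_point l \<in> Gr_orbit l m"
    unfolding coset_base[OF loop_el_supp[OF loop(1)]] Gr_orbit_eq using h(1) by auto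
  moreover have "coef x <#\<^bsub>loop_group l\<^esub> base_point l \<in> Gr_minus l"
  proof -
    have "coef x \<in> loop_Ominus l" using loop
      unfolding loop_Ominus_def carrier_loop_group by (auto simp: one_at_infinity_def coefs_in_def)
    then show ?thesis unfolding Gr_minus_def by auto
  qed
  ultimately show ?thesis unfolding small_M_def using small by blast
qed

lemma spin_cover_coef:
  assumes "supp_in n x" "i < n" "j < n"
  shows "spin_cover n (coef x) $$ (i, j) = coef (x * ee j * rev_cl x) {i}"
proof -
  have E: "cl_basis {j} = coef (ee j)" by (simp add: coef_E_fun cl_basis_def fun_eq_iff)
  have "cl_mult n (cl_mult n (coef x) (cl_basis {j})) (cl_rev (coef x)) = coef (x * ee j * rev_cl x)"
    unfolding E coef_rev_fun[symmetric]
    by (simp only: coef_mult[OF assms(1) supp_in_E_single[OF assms(3)]]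
      coef_mult[OF supp_in_mult[OF assms(1) supp_in_E_single[OF assms(3)]] supp_in_rev[OF assms(1)]])
  then show ?thesis using assms(2,3) by (simp add: spin_cover_def)
qed

lemma X2_nth: "fls_nth (X ^ 2 * f) k = fls_nth f (k - 2)"
  by (simp add: fls_X_power_times_conv_shift)

lemma small_M_SO_pole:
  assumes l: "1 \<le> l" and g: "g \<in> small_M_SO l" and ij: "i < Suc (Suc (2*l))" "j < Suc (Suc (2*l))" and k: "k < -2"
  shows "fls_nth (g $$ (i, j)) k = 0"
proof -
  obtain x where x: "loop_el (Suc (Suc (2*l))) x" "spin_cover (Suc (Suc (2*l))) (coef x) = g" "coef x <#\<^bsub>loop_group l\<^esub> base_point l \<in> small_M l"
    using g unfolding small_M_SO_def loop_Ominus0_eq by auto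
  obtain h h' p where "loop_O_el (Suc (Suc (2*l))) h" "loop_O_el (Suc (Suc (2*l))) h'" "x = h * std_n p * h'"
    using small_orbit_imp[OF l loop_el_supp[OF x(1)] x(3)] by auto
  then have "coefs_in fls_O (cst (X ^ 2) * (x * ee j * rev_cl x))" using double_coset_pole ij(2) by blast
  then have "X ^ 2 * coef (x * ee j * rev_cl x) {i} \<in> fls_O" unfolding coefs_in_def coef_cst_mult by blast
  then have "fls_nth (X ^ 2 * coef (x * ee j * rev_cl x) {i}) (k + 2) = 0" using k by (simp add: fls_O_def)
  then show ?thesis unfolding X2_nth x(2)[symmetric] spin_cover_coef[OF loop_el_supp[OF x(1)] ij] by simp
qed

lemma lift_exists:
  assumes l: "1 \<le> l" and D: "skew_nil (Suc (2*l)) D"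
    and u: "supported (Suc (2*l)) u" "dot (Suc (2*l)) u u = 0" "mapply (Suc (2*l)) D u = (\<lambda>_. 0)"
    and g: "g \<in> carrier_mat (Suc (Suc (2*l))) (Suc (Suc (2*l)))"
      "\<And>i j. i < Suc (Suc (2*l)) \<Longrightarrow> j < Suc (Suc (2*l)) \<Longrightarrow> g $$ (i, j) = (if i = j then 1 else 0)
        + Xi * ((if j = 0 then 1 else 0) * emb u i - (if i = 0 then 1 else 0) * emb u j)
        + Xi ^ 2 * ((if i = 0 \<or> j = 0 then 0 else fls_const (D (i - 1) (j - 1))) - fls_const (1/2) * emb u i * emb u j)"
  shows "\<exists>s\<in>loop_Ominus0 l. spin_cover (Suc (Suc (2*l))) s = g \<and> s <#\<^bsub>loop_group l\<^esub> base_point l \<in> small_M l"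
proof -
  let ?n = "Suc (Suc (2*l))"
  obtain r vs where vs: "units (Suc (2*l)) vs" and r: "2*r \<le> l"
    and Dw: "\<And>i j. D i j = (\<Sum>a<r. 2 * wedge (refls (Suc (2*l)) vs (iso_F (2*a))) (refls (Suc (2*l)) vs (iso_F (Suc (2*a)))) i j)"
    and uw: "(r = 0 \<and> u = (\<lambda>_. 0)) \<or>
      (r > 0 \<and> (\<exists>c. u = (\<lambda>i. - 2 * c * refls (Suc (2*l)) vs (iso_F (2*r-2)) i))) \<or>
      (2*r < l \<and> u = (\<lambda>i. - 2 * refls (Suc (2*l)) vs (iso_F (2*r)) i))"
    using skew_nil_standard_form[OF D u] by auto
  define w where "w = (\<lambda>a. refls (Suc (2*l)) vs (iso_F a))"
  \<comment> \<open>The action of \<open>el0\<close> involves \<open>-2 * U\<close>, so this scaling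
    makes \<open>u\<close> the coefficient of t^-1.\<close>
  define U where "U = (\<lambda>i. - (1/2) * u i)"
  have U: "(r = 0 \<and> U = (\<lambda>_. 0)) \<or> (r > 0 \<and> (\<exists>c. U = (\<lambda>i. c * w (2*r-2) i))) \<or> (2*r < l \<and> U = w (2*r))"
    using uw unfolding U_def w_def by auto
  have iso: "dot (Suc (2*l)) (w a) (w b) = 0" if "a < l" "b < l" for a b
    unfolding w_def refls_dot[OF vs] using that by (simp add: dot_iso_iso)
  have iso': "dot (Suc (2*l)) (w a) (w b) = 0" if "a < 2*r" "b < 2*r" for a b using iso that r by auto
  have UU: "dot (Suc (2*l)) U U = 0" unfolding U_def dot_left dot_right u(2) by simp
  have wU: "dot (Suc (2*l)) (w a) U = 0" if "a < 2*r" for a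
    using U
  proof (elim disjE conjE exE)
    assume "U = (\<lambda>_. 0)" then show ?thesis by (simp add: dot_right)
  next
    fix c assume "0 < r" "U = (\<lambda>i. c * w (2*r-2) i)"
    then show ?thesis using iso'[OF that, of "2*r-2"] by (simp add: dot_right)
  next
    assume "2*r < l" "U = w (2*r)" then show ?thesis using iso[of a "2*r"] that by simp
  qed
  define x where "x = frame_prod l w r * el0 l Xi U"
  obtain A B j where AB: "j \<le> l" "unit_O ?n A" "unit_O ?n B" "x = A * std_n j * B"
    using lift_decomp[OF vs w_def r U] unfolding x_def by auto
  have lp: "loop_el ?n x" "one_at_infinity x" unfolding x_def by (rule loop_el_lift; simp add: iso' UU)+
  have "coef x <#\<^bsub>loop_group l\<^esub> base_point l \<in> small_M l"
    using small_orbit_if[OF l AB(1,4)] AB(2,3) lp by simp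
  moreover have "coef x \<in> loop_Ominus0 l" unfolding loop_Ominus0_eq using lp by auto
  moreover have "spin_cover (Suc (Suc (2*l))) (coef x) = g"
  proof (rule eq_matI)
    show "dim_row (spin_cover (Suc (Suc (2*l))) (coef x)) = dim_row g" "dim_col (spin_cover (Suc (Suc (2*l))) (coef x)) = dim_col g"
      using g(1) by (auto simp: spin_cover_def)
    fix i j assume "i < dim_row g" "j < dim_col g"
    then have ij: "i < ?n" "j < ?n" using g(1) by auto
    have eU: "emb U i = - (fls_const (1/2) * emb u i)" for i
      by (cases i) (simp_all add: U_def fls_const_mult_const fls_const_uminus)
    have half: "2 * fls_const (1/2 :: complex) = 1" "fls_const (1/2 :: complex) * 2 = 1" by (simp_all add: mult_2 mult_2_right fls_plus_const)
    have quarter: "2 * fls_const (1/4 :: complex) = fls_const (1/2)" by (simp add: mult_2 fls_plus_const)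
    have S: "(\<Sum>a<r. 2 * (emb (w (Suc (2*a))) j * emb (w (2*a)) i - emb (w (2*a)) j * emb (w (Suc (2*a))) i)) =
        (if i = 0 \<or> j = 0 then 0 else fls_const (D (i - 1) (j - 1)))"
    proof (cases "i = 0 \<or> j = 0")
      case True then show ?thesis by auto
    next
      case False
      then obtain i' j' where "i = Suc i'" "j = Suc j'" by (metis not0_implies_Suc)
      moreover have two: "2 * fls_const c = fls_const (2 * c)" for c :: complex by (simp only: mult_2 fls_plus_const)
      ultimately show ?thesis unfolding Dw w_def fls_const_sum
        by (simp add: wedge_def fls_const_mult_const fls_minus_const two mult.commute)
    qed
    have "spin_cover (Suc (Suc (2*l))) (coef x) $$ (i, j) = coef (x * ee j * rev_cl x) {i}"
      using spin_cover_coef[OF loop_el_supp[OF lp(1)] ij] by simp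
    also note lift_coef[OF iso' UU wU x_def ij]
    also have "(if i = j then 1 else 0) + Xi * (2 * emb U j * (if i = 0 then 1 else 0) - 2 * (if j = 0 then 1 else 0) * emb U i)
      + Xi ^ 2 * ((\<Sum>a<r. 2 * (emb (w (Suc (2*a))) j * emb (w (2*a)) i - emb (w (2*a)) j * emb (w (Suc (2*a))) i)) - 2 * emb U j * emb U i)
      = g $$ (i, j)"
      unfolding S g(2)[OF ij] eU
      by (cases "i = 0"; cases "j = 0"; simp add: half quarter algebra_simps)
    finally show "spin_cover (Suc (Suc (2*l))) (coef x) $$ (i, j) = g $$ (i, j)" .
  qed
  ultimately show ?thesis by blast
qed

subsection \<open>Quadratic loops in the orthogonal group\<close>

lemma fls_nth_0_mult:
  assumes "f \<in> fls_Ominus" "g \<in> fls_Ominus"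
  shows "fls_nth (f * g) 0 = fls_nth f 0 * fls_nth g 0"
proof -
  have "fls_nth ((f - fls_const (fls_nth f 0)) * g) 0 = 0"
  proof (rule fls_times_nth_zero)
    fix k :: int
    consider "k > 0" | "k = 0" | "k < 0" by linarith
    then show "fls_nth (f - fls_const (fls_nth f 0)) k * fls_nth g (0 - k) = 0"
      using assms by cases (auto simp: fls_Ominus_def)
  qed
  then show ?thesis by (simp add: left_diff_distrib)
qed

lemma fls_nth_0_prod:
  "(\<And>i. i \<in> I \<Longrightarrow> f i \<in> fls_Ominus) \<Longrightarrow> fls_nth (prod f I) 0 = (\<Prod>i\<in>I. fls_nth (f i) 0)"
proof (induction I rule: infinite_finite_induct)
  case (insert i I)
  have "prod f I \<in> fls_Ominus" by (rule subring_prod[OF subring_Ominus]) (use insert in auto)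
  then show ?case using insert by (simp add: fls_nth_0_mult)
qed simp_all

text \<open>On polynomials in t^-1 the constant coefficient is the evaluation at infinity, a ring
  homomorphism, and hence passes through the determinant.\<close>

lemma fls_nth_0_det:
  assumes g: "g \<in> carrier_mat n n" and O: "\<And>i j. i < n \<Longrightarrow> j < n \<Longrightarrow> g $$ (i, j) \<in> fls_Ominus"
  shows "fls_nth (det g) 0 = det (map_mat (\<lambda>f. fls_nth f 0) g)"
proof -
  have "fls_nth (signof p * (\<Prod>i = 0..<n. g $$ (i, p i))) 0 = signof p * (\<Prod>i = 0..<n. fls_nth (g $$ (i, p i)) 0)"
    if p: "p permutes {0..<n}" for p
  proof -
    have "fls_nth (\<Prod>i = 0..<n. g $$ (i, p i)) 0 = (\<Prod>i = 0..<n. fls_nth (g $$ (i, p i)) 0)"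
      by (rule fls_nth_0_prod) (use O p permutes_in_image[OF p] in auto)
    then show ?thesis by (simp add: sign_def)
  qed
  moreover have "(\<Prod>i = 0..<n. map_mat (\<lambda>f. fls_nth f 0) g $$ (i, p i)) = (\<Prod>i = 0..<n. fls_nth (g $$ (i, p i)) 0)"
    if p: "p permutes {0..<n}" for p
    by (rule prod.cong) (use g permutes_in_image[OF p] in auto)
  ultimately show ?thesis
    unfolding det_def'[OF g] det_def'[OF map_carrier_mat[THEN iffD2, OF g, of "\<lambda>f. fls_nth f 0"]] fls_nth_sum by simp
qed

lemma Xi_power_nth: "fls_nth (Xi ^ m * f) k = fls_nth f (k + int m)"
proof (induction m arbitrary: k)
  case (Suc m)
  have "fls_nth (Xi ^ Suc m * f) k = fls_nth (Xi * (Xi ^ m * f)) k" by (simp add: mult.assoc)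
  also have "\<dots> = fls_nth (Xi ^ m * f) (k + 1)" by (simp add: fls_X_inv_times_conv_shift)
  finally show ?case by (simp add: Suc.IH add_ac)
qed simp

definition quad :: "(nat \<Rightarrow> nat \<Rightarrow> complex) \<Rightarrow> (nat \<Rightarrow> nat \<Rightarrow> complex) \<Rightarrow> nat \<Rightarrow> nat \<Rightarrow> complex fls" where
  "quad x y i j = fls_const (if i = j then 1 else 0) + Xi * fls_const (x i j) + Xi ^ 2 * fls_const (y i j)"

lemma quad_nth: "fls_nth (quad x y i j) k =
    (if k = 0 then if i = j then 1 else 0 else if k = -1 then x i j else if k = -2 then y i j else 0)"
proof -
  have "fls_nth (Xi * fls_const c) k = (if k = -1 then c else 0)" "fls_nth (Xi ^ 2 * fls_const c) k = (if k = -2 then c else 0)" for c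
    using Xi_power_nth[of 1 "fls_const c" k] Xi_power_nth[of 2 "fls_const c" k] by auto
  then show ?thesis by (simp add: quad_def)
qed

lemma quadratic_mult:
  "(a + z * b + z ^ 2 * c) * (a' + z * b' + z ^ 2 * c') = a * a' + z ^ 1 * (a * b' + a' * b) +
    z ^ 2 * (a * c' + a' * c + b * b') + z ^ 3 * (b * c' + c * b') + z ^ 4 * (c * c')"
  for z :: "'a::comm_ring_1"
  by (simp add: algebra_simps power2_eq_square power3_eq_cube power4_eq_xxxx)

lemma quad_gram:
  assumes ij: "i < n" "j < n"
  shows "(\<Sum>k<n. quad x y k i * quad x y k j) = fls_const (if i = j then 1 else 0) + Xi ^ 1 * fls_const (x i j + x j i)
    + Xi ^ 2 * fls_const (y i j + y j i + (\<Sum>k<n. x k i * x k j)) + Xi ^ 3 * fls_const (\<Sum>k<n. x k i * y k j + y k i * x k j)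
    + Xi ^ 4 * fls_const (\<Sum>k<n. y k i * y k j)"
proof -
  define d where "d k i = (if k = i then 1 else 0 :: complex)" for k i :: nat
  have dd: "(\<Sum>k<n. d k i * f k) = f i" if "i < n" for i and f :: "nat \<Rightarrow> complex"
    using that by (simp add: d_def if_distrib if_distribR cong: if_cong)
  have tm: "quad x y k i * quad x y k j = fls_const (d k i * d k j) + Xi ^ 1 * fls_const (d k i * x k j + d k j * x k i)
    + Xi ^ 2 * fls_const (d k i * y k j + d k j * y k i + x k i * x k j) + Xi ^ 3 * fls_const (x k i * y k j + y k i * x k j)
    + Xi ^ 4 * fls_const (y k i * y k j)" for k
    unfolding quad_def d_def[symmetric] fls_plus_const[symmetric] fls_const_mult_const[symmetric] by (rule quadratic_mult)
  have "(\<Sum>k<n. quad x y k i * quad x y k j) = fls_const (\<Sum>k<n. d k i * d k j) + Xi ^ 1 * fls_const (\<Sum>k<n. d k i * x k j + d k j * x k i)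
    + Xi ^ 2 * fls_const (\<Sum>k<n. d k i * y k j + d k j * y k i + x k i * x k j) + Xi ^ 3 * fls_const (\<Sum>k<n. x k i * y k j + y k i * x k j)
    + Xi ^ 4 * fls_const (\<Sum>k<n. y k i * y k j)"
    unfolding tm sum.distrib sum_distrib_left[symmetric] fls_const_sum[symmetric] ..
  then show ?thesis unfolding sum.distrib dd[OF ij(1)] dd[OF ij(2)] by (simp only: d_def)
qed

lemma quad_gram_eq_iff:
  assumes ij: "i < n" "j < n"
  shows "(\<Sum>k<n. quad x y k i * quad x y k j) = fls_const (if i = j then 1 else 0) \<longleftrightarrow>
    x i j + x j i = 0 \<and> y i j + y j i + (\<Sum>k<n. x k i * x k j) = 0 \<and>
    (\<Sum>k<n. x k i * y k j + y k i * x k j) = 0 \<and> (\<Sum>k<n. y k i * y k j) = 0"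
proof -
  have "c + Xi ^ 1 * fls_const a1 + Xi ^ 2 * fls_const a2 + Xi ^ 3 * fls_const a3 + Xi ^ 4 * fls_const a4 = c \<longleftrightarrow>
      a1 = 0 \<and> a2 = 0 \<and> a3 = 0 \<and> a4 = 0" for c a1 a2 a3 a4
  proof
    assume "c + Xi ^ 1 * fls_const a1 + Xi ^ 2 * fls_const a2 + Xi ^ 3 * fls_const a3 + Xi ^ 4 * fls_const a4 = c"
    then have z: "Xi ^ 1 * fls_const a1 + Xi ^ 2 * fls_const a2 + Xi ^ 3 * fls_const a3 + Xi ^ 4 * fls_const a4 = 0"
      by (simp only: add.assoc add_cancel_left_right)
    have "fls_nth (Xi ^ 1 * fls_const a1 + Xi ^ 2 * fls_const a2 + Xi ^ 3 * fls_const a3 + Xi ^ 4 * fls_const a4) k = 0" for k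
      unfolding z by simp
    from this[of "-1"] this[of "-2"] this[of "-3"] this[of "-4"] show "a1 = 0 \<and> a2 = 0 \<and> a3 = 0 \<and> a4 = 0"
      unfolding fls_plus_nth Xi_power_nth by simp
  qed simp
  then show ?thesis unfolding quad_gram[OF ij] .
qed

definition xblock :: "(nat \<Rightarrow> complex) \<Rightarrow> nat \<Rightarrow> nat \<Rightarrow> complex" where
  "xblock u i j = (case i of 0 \<Rightarrow> (case j of 0 \<Rightarrow> 0 | Suc j \<Rightarrow> - u j) | Suc i \<Rightarrow> (case j of 0 \<Rightarrow> u i | Suc j \<Rightarrow> 0))"

text \<open>The correction comes from orthogonality in degree t^-2: the linear term contributes u
  u^T to the Gram matrix, and half of it has to be subtracted.\<close>

definition yblock :: "(nat \<Rightarrow> complex) \<Rightarrow> (nat \<Rightarrow> nat \<Rightarrow> complex) \<Rightarrow> nat \<Rightarrow> nat \<Rightarrow> complex" where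
  "yblock u D i j = (case i of 0 \<Rightarrow> 0 | Suc i \<Rightarrow> (case j of 0 \<Rightarrow> 0 | Suc j \<Rightarrow> D i j - u i * u j / 2))"

lemma block_simps [simp]:
  "xblock u 0 0 = 0" "xblock u (Suc i) 0 = u i" "xblock u 0 (Suc j) = - u j" "xblock u (Suc i) (Suc j) = 0"
  "yblock u D 0 j = 0" "yblock u D i 0 = 0" "yblock u D (Suc i) (Suc j) = D i j - u i * u j / 2"
  by (simp_all add: xblock_def yblock_def split: nat.split)

lemma dot_split: "(\<Sum>k<n. (f k - u k * a / 2) * (g k - u k * b / 2)) =
   (\<Sum>k<n. f k * g k) - (\<Sum>k<n. f k * u k) * b / 2 - (\<Sum>k<n. g k * u k) * a / 2 + dot n u u * a * b / 4" for a b :: complex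
  by (simp add: dot_def sum.distrib sum_subtractf sum_distrib_left sum_distrib_right sum_divide_distrib algebra_simps)

lemma yblock_conditions:
  assumes D: "skew_nil n D" and u: "dot n u u = 0" "mapply n D u = (\<lambda>_. 0)"
  shows "xblock u i j + xblock u j i = 0"
    and "yblock u D i j + yblock u D j i + (\<Sum>k<Suc n. xblock u k i * xblock u k j) = 0"
    and "(\<Sum>k<Suc n. xblock u k i * yblock u D k j + yblock u D k i * xblock u k j) = 0"
    and "(\<Sum>k<Suc n. yblock u D k i * yblock u D k j) = 0"
proof -
  have Du: "(\<Sum>k<n. D k i * u k) = 0" for i
  proof -
    have "(\<Sum>k<n. D k i * u k) = - mapply n D u i"
      unfolding mapply_def sum_negf[symmetric] by (rule sum.cong) (simp_all add: skew_nilD(1)[OF D, of _ i])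
    then show ?thesis by (simp add: u)
  qed
  have DD: "(\<Sum>k<n. D k i * D k j) = 0" for i j
  proof -
    have "(\<Sum>k<n. D k i * D k j) = - (\<Sum>k<n. D i k * D k j)"
      unfolding sum_negf[symmetric] by (rule sum.cong) (simp_all add: skew_nilD(1)[OF D, of _ i])
    then show ?thesis by (simp add: skew_nilD(4)[OF D])
  qed
  have uu: "(\<Sum>k<n. u k * u k) = 0" using u(1) by (simp add: dot_def)
  have uD: "(\<Sum>k<n. u k * (D k j - u k * u j / 2)) = 0" for j
  proof -
    have "(\<Sum>k<n. u k * (D k j - u k * u j / 2)) = (\<Sum>k<n. D k j * u k) - (\<Sum>k<n. u k * u k) * u j / 2"
      by (simp add: sum.distrib sum_subtractf sum_distrib_left sum_distrib_right sum_divide_distrib algebra_simps)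
    then show ?thesis by (simp add: Du uu)
  qed
  show "xblock u i j + xblock u j i = 0" by (cases i; cases j) simp_all
  show "yblock u D i j + yblock u D j i + (\<Sum>k<Suc n. xblock u k i * xblock u k j) = 0"
  proof (cases i; cases j)
    fix i' j' assume "i = Suc i'" "j = Suc j'"
    then show ?thesis using skew_nilD(1)[OF D, of i' j'] by (simp add: sum.lessThan_Suc_shift del: sum.lessThan_Suc)
  qed (simp_all add: sum.lessThan_Suc_shift uu del: sum.lessThan_Suc)
  show "(\<Sum>k<Suc n. xblock u k i * yblock u D k j + yblock u D k i * xblock u k j) = 0"
    using uD by (cases i; cases j) (simp_all add: sum.lessThan_Suc_shift mult.commute del: sum.lessThan_Suc)
  show "(\<Sum>k<Suc n. yblock u D k i * yblock u D k j) = 0"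
    by (cases i; cases j) (simp_all add: sum.lessThan_Suc_shift dot_split DD Du u del: sum.lessThan_Suc)
qed

text \<open>Degree t^-2 makes \<open>D\<close> skew and clears the corner entry of \<open>y\<close>,
  degree t^-3 gives \<open>D u = 0\<close>, and degree t^-4 gives that the square is zero once
  \<open>u\<close> is known to be isotropic and in the kernel. The mixed entries assumed to vanish
  are those excluded by the twisted action.\<close>

lemma conditions_yblock:
  assumes u: "dot n u u = 0" "supported n u"
    and y0: "\<And>i. 0 < i \<Longrightarrow> i < Suc n \<Longrightarrow> y i 0 = 0" "\<And>i. 0 < i \<Longrightarrow> i < Suc n \<Longrightarrow> y 0 i = 0"
    and A: "\<And>i j. i < Suc n \<Longrightarrow> j < Suc n \<Longrightarrow> y i j + y j i + (\<Sum>k<Suc n. xblock u k i * xblock u k j) = 0"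
    and B: "\<And>i j. i < Suc n \<Longrightarrow> j < Suc n \<Longrightarrow> (\<Sum>k<Suc n. xblock u k i * y k j + y k i * xblock u k j) = 0"
    and C: "\<And>i j. i < Suc n \<Longrightarrow> j < Suc n \<Longrightarrow> (\<Sum>k<Suc n. y k i * y k j) = 0"
    and D: "D = (\<lambda>i j. if i < n \<and> j < n then y (Suc i) (Suc j) + u i * u j / 2 else 0)"
  shows "skew_nil n D" "mapply n D u = (\<lambda>_. 0)" "\<And>i j. i < Suc n \<Longrightarrow> j < Suc n \<Longrightarrow> y i j = yblock u D i j"
proof -
  have uu: "(\<Sum>k<n. u k * u k) = 0" using u(1) by (simp add: dot_def)
  have "2 * y 0 0 = 0" using A[of 0 0] by (simp add: sum.lessThan_Suc_shift uu del: sum.lessThan_Suc)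
  then have y00: "y 0 0 = 0" by simp
  show yb: "y i j = yblock u D i j" if "i < Suc n" "j < Suc n" for i j
    using that y0 y00 by (cases i; cases j) (auto simp: D)
  have sk: "D i j = - D j i" for i j
  proof (cases "i < n \<and> j < n")
    case True
    then have "y (Suc i) (Suc j) + y (Suc j) (Suc i) + u i * u j = 0"
      using A[of "Suc i" "Suc j"] by (simp add: sum.lessThan_Suc_shift del: sum.lessThan_Suc)
    then have "y (Suc i) (Suc j) = - (y (Suc j) (Suc i)) - u i * u j" by (simp add: algebra_simps eq_neg_iff_add_eq_0)
    then show ?thesis using True by (simp add: D)
  qed (auto simp: D)
  have Du: "(\<Sum>k<n. D k j * u k) = 0" for j
  proof (cases "j < n")
    case True
    have "(\<Sum>k<n. u k * y (Suc k) (Suc j)) = 0"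
      using B[of 0 "Suc j"] True y0(1) y00 by (simp add: sum.lessThan_Suc_shift del: sum.lessThan_Suc)
    moreover have "(\<Sum>k<n. D k j * u k) = (\<Sum>k<n. u k * y (Suc k) (Suc j)) + (\<Sum>k<n. u k * u k) * u j / 2"
      using True by (simp add: D sum.distrib sum_distrib_left sum_distrib_right sum_divide_distrib algebra_simps)
    ultimately show ?thesis using uu by simp
  qed (simp add: D)
  have "mapply n D u i = - (\<Sum>k<n. D k i * u k)" for i
    unfolding mapply_def sum_negf[symmetric] by (rule sum.cong) (simp_all add: sk[of i])
  then show "mapply n D u = (\<lambda>_. 0)" by (intro ext) (simp add: Du)
  have DD: "(\<Sum>k<n. D k i * D k j) = 0" for i j
  proof (cases "i < n \<and> j < n")
    case True
    have "0 = (\<Sum>k<Suc n. y k (Suc i) * y k (Suc j))" using C[of "Suc i" "Suc j"] True by simp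
    also have "\<dots> = (\<Sum>k<Suc n. yblock u D k (Suc i) * yblock u D k (Suc j))"
      by (rule sum.cong) (use yb True in auto)
    also have "\<dots> = (\<Sum>k<n. D k i * D k j)"
      by (simp add: sum.lessThan_Suc_shift dot_split Du u del: sum.lessThan_Suc)
    finally show ?thesis by simp
  qed (auto simp: D)
  have "(\<Sum>k<n. D i k * D k j) = - (\<Sum>k<n. D k i * D k j)" for i j
    unfolding sum_negf[symmetric] by (rule sum.cong) (simp_all add: sk[of i])
  then have "(\<Sum>k<n. D i k * D k j) = 0" for i j unfolding DD by simp
  moreover have "D i j = 0" if "n \<le> i" for i j using that by (simp add: D)
  ultimately show "skew_nil n D" unfolding skew_nil_def using sk by blast
qed

subsection \<open>The fibers\<close>

definition fib_mat :: "nat \<Rightarrow> (nat \<Rightarrow> complex) \<Rightarrow> (nat \<Rightarrow> nat \<Rightarrow> complex) \<Rightarrow> complex fls mat" where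
  "fib_mat l u D = mat (Suc (Suc (2*l))) (Suc (Suc (2*l))) (\<lambda>(i, j). quad (xblock u) (yblock u D) i j)"

lemma fib_mat_simps:
  "fib_mat l u D \<in> carrier_mat (Suc (Suc (2*l))) (Suc (Suc (2*l)))"
  "i < Suc (Suc (2*l)) \<Longrightarrow> j < Suc (Suc (2*l)) \<Longrightarrow> fib_mat l u D $$ (i, j) = quad (xblock u) (yblock u D) i j"
  "dim_row (fib_mat l u D) = Suc (Suc (2*l))" "dim_col (fib_mat l u D) = Suc (Suc (2*l))"
  by (simp_all add: fib_mat_def)

lemma w0_carrier: "w0 n \<in> carrier_mat n n"
  by (simp add: w0_def)

lemma w0_conj_entry:
  fixes M :: "'a::comm_ring_1 mat"
  assumes M: "M \<in> carrier_mat n n" and ij: "i < n" "j < n"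
  shows "(w0 n * M * w0 n) $$ (i, j) = (if i = 0 then -1 else 1) * (if j = 0 then -1 else 1) * M $$ (i, j)"
proof -
  note w = w0_carrier[of n, where 'a = 'a]
  have wij: "(w0 n :: 'a mat) $$ (a, b) = (if a = b then if b = 0 then -1 else 1 else 0)" if "a < n" "b < n" for a b
    using that by (simp add: w0_def)
  have 1: "(w0 n * M) $$ (a, b) = (if a = 0 then -1 else 1) * M $$ (a, b)" if ab: "a < n" "b < n" for a b
  proof -
    have "(w0 n * M) $$ (a, b) = (\<Sum>k<n. if k = a then (if a = 0 then -1 else 1) * M $$ (a, b) else 0)"
      unfolding mult_mat_entry[OF w M ab] by (rule sum.cong) (use ab in \<open>auto simp: wij\<close>)
    then show ?thesis using ab by simp
  qed
  have "(w0 n * M * w0 n) $$ (i, j) = (\<Sum>k<n. if k = j then (w0 n * M) $$ (i, j) * (if j = 0 then -1 else 1) else 0)"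
    unfolding mult_mat_entry[OF mult_carrier_mat[OF w M] w ij] by (rule sum.cong) (use ij in \<open>auto simp: wij\<close>)
  then show ?thesis using ij 1[OF ij] by simp
qed

lemma transpose_mult_entry:
  assumes "g \<in> carrier_mat n n" "i < n" "j < n"
  shows "(transpose_mat g * g) $$ (i, j) = (\<Sum>k<n. g $$ (k, i) * g $$ (k, j))"
  using mult_mat_entry[of "transpose_mat g" n n g n i j] assms by simp

lemma elements_mat_subset_iff:
  "g \<in> carrier_mat n m \<Longrightarrow> elements_mat g \<subseteq> S \<longleftrightarrow> (\<forall>i<n. \<forall>j<m. g $$ (i, j) \<in> S)"
  by (auto simp: elements_mat_def UN_subset_iff image_subset_iff)

lemma SO_Ominus0_iff:
  assumes g: "g \<in> carrier_mat (Suc (Suc (2*l))) (Suc (Suc (2*l)))" (is "g \<in> carrier_mat ?N ?N")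
  shows "g \<in> SO_Ominus0 l \<longleftrightarrow>
    (\<forall>i<?N. \<forall>j<?N. (\<Sum>k<?N. g $$ (k, i) * g $$ (k, j)) = fls_const (if i = j then 1 else 0) \<and> g $$ (i, j) \<in> fls_Ominus \<and>
      fls_nth (g $$ (i, j)) 0 = (if i = j then 1 else 0) \<and>
      (if i = 0 then -1 else 1) * (if j = 0 then -1 else 1) * fls_twist (g $$ (i, j)) = g $$ (i, j))"
    (is "_ \<longleftrightarrow> (\<forall>i<?N. \<forall>j<?N. ?P i j \<and> ?Q i j \<and> ?R i j \<and> ?S i j)")
proof -
  have N: "2*l + 2 = ?N" by simp
  have P: "transpose_mat g * g = 1\<^sub>m ?N \<longleftrightarrow> (\<forall>i<?N. \<forall>j<?N. ?P i j)"
  proof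
    assume e: "transpose_mat g * g = 1\<^sub>m ?N"
    show "\<forall>i<?N. \<forall>j<?N. ?P i j"
    proof (intro allI impI)
      fix i j assume "i < ?N" "j < ?N"
      note ij = this
      have "(transpose_mat g * g) $$ (i, j) = (if i = j then 1 else 0)" unfolding e using ij by simp
      then show "?P i j" using transpose_mult_entry[OF g ij] by (simp del: sum.lessThan_Suc)
    qed
  next
    assume p: "\<forall>i<?N. \<forall>j<?N. ?P i j"
    show "transpose_mat g * g = 1\<^sub>m ?N"
    proof (rule eq_matI)
      fix i j assume "i < dim_row (1\<^sub>m ?N :: complex fls mat)" "j < dim_col (1\<^sub>m ?N :: complex fls mat)"
      then have ij: "i < ?N" "j < ?N" by simp_all
      then show "(transpose_mat g * g) $$ (i, j) = 1\<^sub>m ?N $$ (i, j)" unfolding transpose_mult_entry[OF g ij] using p ij by (simp del: sum.lessThan_Suc)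
    qed (use g in auto)
  qed
  have Q: "elements_mat g \<subseteq> fls_Ominus \<longleftrightarrow> (\<forall>i<?N. \<forall>j<?N. ?Q i j)"
    by (rule elements_mat_subset_iff[OF g])
  have R: "map_mat (\<lambda>f. fls_nth f 0) g = 1\<^sub>m ?N \<longleftrightarrow> (\<forall>i<?N. \<forall>j<?N. ?R i j)"
    using g by (simp add: mat_eq_iff)
  have gt: "map_mat fls_twist g \<in> carrier_mat ?N ?N" using g by simp
  have S: "w0 ?N * map_mat fls_twist g * w0 ?N = g \<longleftrightarrow> (\<forall>i<?N. \<forall>j<?N. ?S i j)"
  proof -
    have "w0 ?N * map_mat fls_twist g * w0 ?N \<in> carrier_mat ?N ?N"
      by (intro mult_carrier_mat[OF mult_carrier_mat[OF w0_carrier gt] w0_carrier])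
    then have "w0 ?N * map_mat fls_twist g * w0 ?N = g \<longleftrightarrow>
      (\<forall>i<?N. \<forall>j<?N. (w0 ?N * map_mat fls_twist g * w0 ?N) $$ (i, j) = g $$ (i, j))"
      using g unfolding mat_eq_iff carrier_mat_def by auto
    then show ?thesis using g by (simp add: w0_conj_entry[OF gt])
  qed
  \<comment> \<open>Orthogonality leaves the values 1 and -1, and the evaluation at infinity decides
    for 1.\<close>
  have det: "det g = 1" if "transpose_mat g * g = 1\<^sub>m ?N" "\<forall>i<?N. \<forall>j<?N. ?Q i j" "map_mat (\<lambda>f. fls_nth f 0) g = 1\<^sub>m ?N"
  proof -
    have "det g * det g = 1"
      using det_mult[of "transpose_mat g" ?N g] det_transpose[OF g] g unfolding that(1) by simp
    then have "det g = 1 \<or> det g = -1" by (simp add: square_eq_1_iff)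
    moreover have "fls_nth (det g) 0 = 1" using fls_nth_0_det[OF g] that(2,3) by simp
    ultimately show ?thesis by auto
  qed
  have "g \<in> SO_Ominus0 l \<longleftrightarrow> transpose_mat g * g = 1\<^sub>m ?N \<and> det g = 1 \<and> elements_mat g \<subseteq> fls_Ominus \<and>
      map_mat (\<lambda>f. fls_nth f 0) g = 1\<^sub>m ?N \<and> w0 ?N * map_mat fls_twist g * w0 ?N = g"
    unfolding SO_Ominus0_def N using g by (simp only: mem_Collect_eq simp_thms)
  also have "\<dots> \<longleftrightarrow> transpose_mat g * g = 1\<^sub>m ?N \<and> elements_mat g \<subseteq> fls_Ominus \<and>
      map_mat (\<lambda>f. fls_nth f 0) g = 1\<^sub>m ?N \<and> w0 ?N * map_mat fls_twist g * w0 ?N = g"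
    using det[unfolded Q[symmetric]] by blast
  finally show ?thesis unfolding P Q R S by (simp only: imp_conjR all_conj_distrib)
qed

lemma fib_mat_mem:
  assumes l: "1 \<le> l" and D: "skew_nil (Suc (2*l)) D"
    and u: "supported (Suc (2*l)) u" "dot (Suc (2*l)) u u = 0" "mapply (Suc (2*l)) D u = (\<lambda>_. 0)"
  shows "fib_mat l u D \<in> small_M_SO l"
proof -
  let ?N = "Suc (Suc (2*l))"
  have SO: "fib_mat l u D \<in> SO_Ominus0 l"
    unfolding SO_Ominus0_iff[OF fib_mat_simps(1)]
  proof (intro allI impI conjI)
    fix i j assume ij: "i < ?N" "j < ?N"
    have "(\<Sum>k<?N. fib_mat l u D $$ (k, i) * fib_mat l u D $$ (k, j)) = (\<Sum>k<?N. quad (xblock u) (yblock u D) k i * quad (xblock u) (yblock u D) k j)"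
      by (rule sum.cong) (use ij in \<open>auto simp: fib_mat_simps\<close>)
    then show "(\<Sum>k<?N. fib_mat l u D $$ (k, i) * fib_mat l u D $$ (k, j)) = fls_const (if i = j then 1 else 0)"
      using quad_gram_eq_iff[OF ij] yblock_conditions[OF D u(2,3), of i j] by (simp only:)
    show "fib_mat l u D $$ (i, j) \<in> fls_Ominus" unfolding fib_mat_simps(2)[OF ij] fls_Ominus_def by (simp add: quad_nth)
    show "fls_nth (fib_mat l u D $$ (i, j)) 0 = (if i = j then 1 else 0)" unfolding fib_mat_simps(2)[OF ij] by (simp add: quad_nth)
    have "fls_twist (quad (xblock u) (yblock u D) i j) = quad (\<lambda>i j. - xblock u i j) (yblock u D) i j"
      by (rule fls_eqI) (simp add: fls_twist_nth quad_nth)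
    moreover have "(if i = 0 then -1 else 1) * (if j = 0 then -1 else 1) * quad (\<lambda>i j. - xblock u i j) (yblock u D) i j = quad (xblock u) (yblock u D) i j"
      by (rule fls_eqI, cases i; cases j) (simp_all add: quad_nth)
    ultimately show "(if i = 0 then -1 else 1) * (if j = 0 then -1 else 1) * fls_twist (fib_mat l u D $$ (i, j)) = fib_mat l u D $$ (i, j)"
      unfolding fib_mat_simps(2)[OF ij] by (simp only:)
  qed
  have "\<exists>s\<in>loop_Ominus0 l. spin_cover ?N s = fib_mat l u D \<and> s <#\<^bsub>loop_group l\<^esub> base_point l \<in> small_M l"
  proof (rule lift_exists[OF l D u fib_mat_simps(1)])
    fix i j assume ij: "i < ?N" "j < ?N"
    show "fib_mat l u D $$ (i, j) = (if i = j then 1 else 0) + Xi * ((if j = 0 then 1 else 0) * emb u i - (if i = 0 then 1 else 0) * emb u j)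
      + Xi ^ 2 * ((if i = 0 \<or> j = 0 then 0 else fls_const (D (i - 1) (j - 1))) - fls_const (1/2) * emb u i * emb u j)"
      unfolding fib_mat_simps(2)[OF ij] quad_def
      by (cases i; cases j) (simp_all add: emb_def fls_const_mult_const fls_minus_const fls_const_uminus)
  qed
  then show ?thesis using SO unfolding small_M_SO_def by simp
qed

lemma small_M_SO_fib:
  assumes l: "1 \<le> l" and g: "g \<in> small_M_SO l" and u: "supported (Suc (2*l)) u" "dot (Suc (2*l)) u u = 0"
    and x: "\<And>i j. i < Suc (Suc (2*l)) \<Longrightarrow> j < Suc (Suc (2*l)) \<Longrightarrow> fls_nth (g $$ (i, j)) (-1) = xblock u i j"
    and D: "D = (\<lambda>i j. if i < Suc (2*l) \<and> j < Suc (2*l) then fls_nth (g $$ (Suc i, Suc j)) (-2) + u i * u j / 2 else 0)"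
  shows "skew_nil (Suc (2*l)) D" "mapply (Suc (2*l)) D u = (\<lambda>_. 0)" "g = fib_mat l u D"
proof -
  let ?N = "Suc (Suc (2*l))"
  define y where "y i j = fls_nth (g $$ (i, j)) (-2)" for i j
  have SO: "g \<in> SO_Ominus0 l" using g by (simp add: small_M_SO_def)
  then have gc: "g \<in> carrier_mat ?N ?N" by (simp add: SO_Ominus0_def)
  note props = SO[unfolded SO_Ominus0_iff[OF gc], rule_format]
  have gq: "g $$ (i, j) = quad (xblock u) y i j" if ij: "i < ?N" "j < ?N" for i j
  proof (rule fls_eqI)
    fix k :: int
    consider "k > 0" | "k = 0" | "k = -1" | "k = -2" | "k < -2" by linarith
    then show "fls_nth (g $$ (i, j)) k = fls_nth (quad (xblock u) y i j) k"
      using props[OF ij] x[OF ij] small_M_SO_pole[OF l g ij]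
      by cases (auto simp: quad_nth y_def fls_Ominus_def)
  qed
  \<comment> \<open>Entries with exactly one index 0 are odd in t, so their coefficient of t^-2 is
    zero.\<close>
  have tw: "y i j = 0" if ij: "i < ?N" "j < ?N" "i = 0 \<longleftrightarrow> j \<noteq> 0" for i j
  proof -
    have "(if i = 0 then -1 else 1) * (if j = 0 then -1 else 1) * fls_twist (g $$ (i, j)) = g $$ (i, j)"
      using props[OF ij(1,2)] by blast
    moreover have "(if i = 0 then -1 else 1) * (if j = 0 then -1 else 1) = (-1 :: complex fls)" using ij(3) by auto
    ultimately have "- fls_twist (g $$ (i, j)) = g $$ (i, j)" by (simp only:) simp
    then have "fls_nth (- fls_twist (g $$ (i, j))) (-2) = fls_nth (g $$ (i, j)) (-2)" by simp
    then show ?thesis by (simp add: fls_twist_nth y_def)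
  qed
  have cond: "y i j + y j i + (\<Sum>k<?N. xblock u k i * xblock u k j) = 0 \<and>
    (\<Sum>k<?N. xblock u k i * y k j + y k i * xblock u k j) = 0 \<and> (\<Sum>k<?N. y k i * y k j) = 0" if ij: "i < ?N" "j < ?N" for i j
  proof -
    have "(\<Sum>k<?N. quad (xblock u) y k i * quad (xblock u) y k j) = (\<Sum>k<?N. g $$ (k, i) * g $$ (k, j))"
      by (rule sum.cong) (use ij in \<open>auto simp: gq\<close>)
    also have "\<dots> = fls_const (if i = j then 1 else 0)" using props[OF ij] by blast
    finally show ?thesis unfolding quad_gram_eq_iff[OF ij] by blast
  qed
  have D': "D = (\<lambda>i j. if i < Suc (2*l) \<and> j < Suc (2*l) then y (Suc i) (Suc j) + u i * u j / 2 else 0)"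
    unfolding D y_def ..
  note cy = conditions_yblock[OF u(2,1) _ _ _ _ _ D']
  show sn: "skew_nil (Suc (2*l)) D" by (rule cy) (use tw cond in auto)
  show "mapply (Suc (2*l)) D u = (\<lambda>_. 0)" by (rule cy) (use tw cond in auto)
  have "y i j = yblock u D i j" if "i < ?N" "j < ?N" for i j by (rule cy(3)) (use tw cond that in auto)
  then show "g = fib_mat l u D" using gc gq
    by (intro eq_matI) (auto simp: fib_mat_simps quad_def)
qed

lemma p_block_entry:
  assumes u: "u \<in> carrier_vec n" and ij: "i < Suc n" "j < Suc n"
  shows "p_block u $$ (i, j) = xblock (\<lambda>i. if i < n then vec_index u i else 0) i j"
  using u ij unfolding p_block_def
  by (cases i; cases j) (auto simp: mat_of_rows_def mat_of_cols_def)

lemma p_block_carrier: "u \<in> carrier_vec n \<Longrightarrow> p_block u \<in> carrier_mat (Suc n) (Suc n)"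
  unfolding p_block_def by (auto intro!: carrier_matI)

text \<open>The square of \<open>p_block u\<close> multiplies the first basis vector by
  \<open>- c\<close>, where \<open>c\<close> is the square of \<open>u\<close>. The even powers thus
  have corner entry \<open>(- c) ^ m\<close>, and nilpotency forces \<open>c = 0\<close>.\<close>

lemma nilpotent_isotropic:
  assumes u: "u \<in> carrier_vec n" and nil: "p_block u ^\<^sub>m k = 0\<^sub>m (Suc n) (Suc n)"
  shows "dot n (\<lambda>i. if i < n then vec_index u i else 0) (\<lambda>i. if i < n then vec_index u i else 0) = 0"
proof -
  let ?x = "p_block u"
  define v where "v = (\<lambda>i. if i < n then vec_index u i else 0)"
  define c where "c = dot n v v"
  note xc = p_block_carrier[OF u]
  have xx: "(?x * ?x) $$ (i, 0) = (if i = 0 then - c else 0)" if "i < Suc n" for i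
  proof -
    have "(?x * ?x) $$ (i, 0) = (\<Sum>k<Suc n. xblock v i k * xblock v k 0)"
      unfolding mult_mat_entry[OF xc xc that zero_less_Suc] by (rule sum.cong) (use that in \<open>auto simp: p_block_entry[OF u] v_def\<close>)
    then show ?thesis by (cases i) (simp_all add: sum.lessThan_Suc_shift c_def dot_def sum_negf del: sum.lessThan_Suc)
  qed
  have pc: "?x ^\<^sub>m m \<in> carrier_mat (Suc n) (Suc n)" for m using xc by simp
  have even: "(?x ^\<^sub>m (2*m)) $$ (0, 0) = (- c) ^ m" for m
  proof (induction m)
    case (Suc m)
    have "?x ^\<^sub>m (2 * Suc m) = ?x ^\<^sub>m (2*m) * (?x * ?x)" using assoc_mult_mat[OF pc[of "2*m"] xc xc] by simp
    then have "(?x ^\<^sub>m (2 * Suc m)) $$ (0, 0) = (\<Sum>k<Suc n. (?x ^\<^sub>m (2*m)) $$ (0, k) * (?x * ?x) $$ (k, 0))"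
      by (simp only: mult_mat_entry[OF pc mult_carrier_mat[OF xc xc] zero_less_Suc zero_less_Suc])
    also have "\<dots> = (\<Sum>k<Suc n. if k = 0 then (?x ^\<^sub>m (2*m)) $$ (0, 0) * (- c) else 0)"
      by (rule sum.cong) (auto simp: xx)
    also have "\<dots> = (?x ^\<^sub>m (2*m)) $$ (0, 0) * (- c)" by (simp add: sum.lessThan_Suc_shift del: sum.lessThan_Suc)
    finally show ?case using Suc.IH by simp
  qed (use xc in simp)
  have "?x ^\<^sub>m (k + m) = 0\<^sub>m (Suc n) (Suc n)" for m
    by (induction m) (use nil xc in auto)
  from this[of k] have "(- c) ^ k = 0" using even[of k] by (simp add: mult_2)
  then show ?thesis unfolding c_def v_def by simp
qed


section \<open>Coordinates on the fiber and the isomorphism\<close>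

definition fib_vecs :: "nat \<Rightarrow> (nat \<Rightarrow> complex) \<Rightarrow> (nat \<times> nat \<Rightarrow> complex) set" where
  "fib_vecs n u = {v. skew_nil n (\<lambda>i j. v (i, j)) \<and> mapply n (\<lambda>i j. v (i, j)) u = (\<lambda>_. 0)}"

text \<open>The coordinates of the loop as a polynomial expression in those of \<open>D\<close>,
  defined for all \<open>v\<close> so that it is a polynomial map of affine spaces and not just a
  map on the variety.\<close>

definition fib_coords :: "nat \<Rightarrow> (nat \<Rightarrow> complex) \<Rightarrow> (nat \<times> nat \<Rightarrow> complex) \<Rightarrow> nat \<times> nat \<times> nat \<Rightarrow> complex" where
  "fib_coords l u v = (\<lambda>(k, i, j). if k = 2 then yblock u (\<lambda>i j. v (i, j)) i j
     else if k = 1 then xblock u i j else if k = 0 \<and> i = j \<and> i < Suc (Suc (2*l)) then 1 else 0)"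

lemma polyfun_fib_coords: "(\<lambda>v. fib_coords l u v c) \<in> polyfun"
proof (cases c)
  case (fields k i j)
  have "(\<lambda>v. yblock u (\<lambda>i j. v (i, j)) i j) \<in> polyfun"
    by (cases i; cases j) (auto intro!: polyfun_intros)
  then show ?thesis unfolding fields fib_coords_def prod.case by (intro polyfun_if polyfun.const)
qed

lemma zclosed_fib_vecs: "zclosed (fib_vecs n u)"
proof -
  obtain F where F: "F \<subseteq> polyfun" "{v. skew_nil n (\<lambda>i j. v (i, j))} = {v. \<forall>f\<in>F. f v = 0}"
    using zclosed_skew_nil unfolding zclosed_def by blast
  let ?F = "F \<union> range (\<lambda>i v. \<Sum>j<n. v (i, j) * u j)"
  have "?F \<subseteq> polyfun" using F(1) by (auto intro!: polyfun_intros)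
  moreover have "{v. \<forall>f\<in>?F. f v = 0} = {v. \<forall>f\<in>F. f v = 0} \<inter> {v. \<forall>i. (\<Sum>j<n. v (i, j) * u j) = 0}"
    by (simp add: ball_Un Collect_conj_eq)
  then have "fib_vecs n u = {v. \<forall>f\<in>?F. f v = 0}"
    unfolding F(2)[symmetric] fib_vecs_def mapply_def by (auto simp: fun_eq_iff)
  ultimately show ?thesis by (simp only: zclosedI)
qed

text \<open>A polynomial map with a polynomial left inverse \<open>R\<close> has closed images: the
  equations are those of \<open>T\<close> pulled back along \<open>R\<close>, together with
  \<open>L (R w) = w\<close>.\<close>

lemma zclosed_image_section:
  fixes L :: "('i \<Rightarrow> complex) \<Rightarrow> 'j \<Rightarrow> complex"
  assumes T: "zclosed T" and L: "\<And>c. (\<lambda>v. L v c) \<in> polyfun" and R: "\<And>c. (\<lambda>w. R w c) \<in> polyfun" and RL: "\<And>v. R (L v) = v"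
  shows "zclosed (L ` T)"
proof -
  obtain F where F: "F \<subseteq> polyfun" "T = {v. \<forall>f\<in>F. f v = 0}" using T unfolding zclosed_def by blast
  let ?F = "(\<lambda>f w. f (R w)) ` F \<union> range (\<lambda>c w. L (R w) c - w c)"
  have "(\<lambda>w. f (R w)) \<in> polyfun" if "f \<in> F" for f using F(1) that by (intro polyfun_compose[OF _ R]) auto
  moreover have "(\<lambda>w. L (R w) c - w c) \<in> polyfun" for c by (intro polyfun_intros polyfun_compose[OF L R])
  ultimately have "?F \<subseteq> polyfun" by auto
  moreover have "L ` T = {w. \<forall>f\<in>?F. f w = 0}"
  proof (intro Set.set_eqI iffI)
    fix w assume "w \<in> L ` T"
    then show "w \<in> {w. \<forall>f\<in>?F. f w = 0}" using F(2) by (auto simp: RL)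
  next
    fix w assume w: "w \<in> {w. \<forall>f\<in>?F. f w = 0}"
    then have "R w \<in> T" unfolding F(2) by auto
    moreover have "w = L (R w)" using w by (intro ext) (simp add: ball_Un)
    ultimately show "w \<in> L ` T" by (metis imageI)
  qed
  ultimately show ?thesis by (simp only: zclosedI)
qed

lemma loop_coords_fib_mat:
  assumes D: "skew_nil (Suc (2*l)) (\<lambda>i j. v (i, j))" and u: "supported (Suc (2*l)) u"
  shows "loop_coords (fib_mat l u (\<lambda>i j. v (i, j))) = fib_coords l u v"
proof (rule ext, clarify)
  fix k i j :: nat
  show "loop_coords (fib_mat l u (\<lambda>i j. v (i, j))) (k, i, j) = fib_coords l u v (k, i, j)"
  proof (cases "i < Suc (Suc (2*l)) \<and> j < Suc (Suc (2*l))")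
    case True
    then show ?thesis by (auto simp: loop_coords_def fib_mat_simps fib_coords_def quad_nth)
  next
    case False
    have "v (a, b) = 0" if "Suc (2*l) \<le> a \<or> Suc (2*l) \<le> b" for a b using that skew_nilD(2,3)[OF D] by blast
    moreover have "u a = 0" if "Suc (2*l) \<le> a" for a using that u by (simp add: supported_def)
    ultimately have "yblock u (\<lambda>i j. v (i, j)) i j = 0" "xblock u i j = 0"
      using False by (cases i; cases j; auto simp: not_less)+
    then show ?thesis using False by (auto simp: loop_coords_def fib_mat_simps fib_coords_def)
  qed
qed

lemma pi_fiber_eq:
  assumes l: "1 \<le> l" and u: "supported (Suc (2*l)) u" "dot (Suc (2*l)) u u = 0"
    and x: "x \<in> carrier_mat (Suc (Suc (2*l))) (Suc (Suc (2*l)))"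
      "\<And>i j. i < Suc (Suc (2*l)) \<Longrightarrow> j < Suc (Suc (2*l)) \<Longrightarrow> x $$ (i, j) = xblock u i j"
  shows "pi_fiber l x = (\<lambda>v. fib_mat l u (\<lambda>i j. v (i, j))) ` fib_vecs (Suc (2*l)) u"
proof (intro Set.set_eqI iffI)
  fix g assume "g \<in> pi_fiber l x"
  then have g: "g \<in> small_M_SO l" "proj_pi g = x" by (auto simp: pi_fiber_def)
  then have gc: "g \<in> carrier_mat (Suc (Suc (2*l))) (Suc (Suc (2*l)))" by (simp add: small_M_SO_def SO_Ominus0_def)
  have gx: "fls_nth (g $$ (i, j)) (-1) = xblock u i j" if "i < Suc (Suc (2*l))" "j < Suc (Suc (2*l))" for i j
    using x(2)[OF that] g(2)[symmetric] gc that by (simp add: proj_pi_def)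
  define D where "D = (\<lambda>i j. if i < Suc (2*l) \<and> j < Suc (2*l) then fls_nth (g $$ (Suc i, Suc j)) (-2) + u i * u j / 2 else 0)"
  note fib = small_M_SO_fib[OF l g(1) u gx D_def]
  show "g \<in> (\<lambda>v. fib_mat l u (\<lambda>i j. v (i, j))) ` fib_vecs (Suc (2*l)) u"
    by (rule image_eqI[of _ _ "\<lambda>(i, j). D i j"]) (use fib in \<open>simp_all add: fib_vecs_def\<close>)
next
  fix g assume "g \<in> (\<lambda>v. fib_mat l u (\<lambda>i j. v (i, j))) ` fib_vecs (Suc (2*l)) u"
  then obtain v where v: "g = fib_mat l u (\<lambda>i j. v (i, j))" "skew_nil (Suc (2*l)) (\<lambda>i j. v (i, j))" "mapply (Suc (2*l)) (\<lambda>i j. v (i, j)) u = (\<lambda>_. 0)"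
    unfolding fib_vecs_def by blast
  have "proj_pi g = x"
    by (rule eq_matI) (use x in \<open>auto simp: v(1) proj_pi_def fib_mat_simps quad_nth\<close>)
  then show "g \<in> pi_fiber l x" unfolding pi_fiber_def using fib_mat_mem[OF l v(2) u v(3)] v(1) by simp
qed

lemma mat_coords_inj: "inj_on mat_coords (carrier_mat n n)"
proof (rule inj_onI)
  fix A B assume A: "A \<in> carrier_mat n n" "B \<in> carrier_mat n n" "mat_coords A = mat_coords B"
  show "A = B"
  proof (rule eq_matI)
    fix i j assume "i < dim_row B" "j < dim_col B"
    then show "A $$ (i, j) = B $$ (i, j)" using A(1,2) fun_cong[OF A(3), of "(i, j)"] by (simp add: mat_coords_def)
  qed (use A in auto)
qed

lemma mat_coords_image:
  assumes u: "u \<in> carrier_vec n"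
  shows "mat_coords ` {D \<in> skew_mats n. D *\<^sub>v u = 0\<^sub>v n \<and> D * D = 0\<^sub>m n n} = fib_vecs n (\<lambda>i. if i < n then vec_index u i else 0)"
    and "v \<in> fib_vecs n (\<lambda>i. if i < n then vec_index u i else 0) \<Longrightarrow> mat_coords (mat n n v) = v"
proof -
  let ?u = "\<lambda>i. if i < n then vec_index u i else 0"
  have key: "mat_coords A \<in> fib_vecs n ?u \<longleftrightarrow> A \<in> skew_mats n \<and> A *\<^sub>v u = 0\<^sub>v n \<and> A * A = 0\<^sub>m n n"
    if A: "A \<in> carrier_mat n n" for A
  proof -
    have "mapply n (\<lambda>i j. mat_coords A (i, j)) ?u i = (if i < n then vec_index (A *\<^sub>v u) i else 0)" for i
      using A u unfolding mapply_def mat_coords_def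
      by (auto simp: scalar_prod_def lessThan_atLeast0 intro!: sum.cong)
    then have "mapply n (\<lambda>i j. mat_coords A (i, j)) ?u = (\<lambda>_. 0) \<longleftrightarrow> A *\<^sub>v u = 0\<^sub>v n"
      using A by (auto simp: fun_eq_iff vec_eq_iff)
    then show ?thesis unfolding fib_vecs_def mem_Collect_eq skew_nil_mat_iff[OF A] by blast
  qed
  show v: "mat_coords (mat n n v) = v" if "v \<in> fib_vecs n ?u" for v
  proof (rule ext, clarify)
    fix i j
    have "skew_nil n (\<lambda>i j. v (i, j))" using that by (simp add: fib_vecs_def)
    then show "mat_coords (mat n n v) (i, j) = v (i, j)"
      using skew_nilD(2)[of n "\<lambda>i j. v (i, j)" i j] skew_nilD(3)[where D = "\<lambda>i j. v (i, j)" and i = i and j = j]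
      by (auto simp: mat_coords_def not_less)
  qed
  show "mat_coords ` {D \<in> skew_mats n. D *\<^sub>v u = 0\<^sub>v n \<and> D * D = 0\<^sub>m n n} = fib_vecs n ?u"
  proof (intro Set.set_eqI iffI)
    fix v assume "v \<in> mat_coords ` {D \<in> skew_mats n. D *\<^sub>v u = 0\<^sub>v n \<and> D * D = 0\<^sub>m n n}"
    then show "v \<in> fib_vecs n ?u" using key by (auto simp: skew_mats_def)
  next
    fix w assume w: "w \<in> fib_vecs n ?u"
    have "mat n n w \<in> {D \<in> skew_mats n. D *\<^sub>v u = 0\<^sub>v n \<and> D * D = 0\<^sub>m n n}"
      using key[of "mat n n w"] w v[OF w] by simp
    then show "w \<in> mat_coords ` {D \<in> skew_mats n. D *\<^sub>v u = 0\<^sub>v n \<and> D * D = 0\<^sub>m n n}"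
      by (rule image_eqI[rotated]) (simp add: v[OF w])
  qed
qed

text \<open>Both varieties are parametrised by the same closed set \<open>fib_vecs\<close>. On one
  side the parametrisation is the coordinate map itself, on the other \<open>fib_coords\<close> with
  a polynomial left inverse; these give the two regular maps. The image formula is kept for the
  dimension.\<close>

lemma pi_fiber_iso:
  assumes l: "1 \<le> l" and u: "u \<in> carrier_vec (Suc (2*l))" and nil: "p_block u ^\<^sub>m k = 0\<^sub>m (Suc (Suc (2*l))) (Suc (Suc (2*l)))"
  shows "variety_iso loop_coords (pi_fiber l (p_block u)) mat_coords
      {D \<in> skew_mats (Suc (2*l)). D *\<^sub>v u = 0\<^sub>v (Suc (2*l)) \<and> D * D = 0\<^sub>m (Suc (2*l)) (Suc (2*l))}"
    and "loop_coords ` pi_fiber l (p_block u) = fib_coords l (\<lambda>i. if i < Suc (2*l) then vec_index u i else 0) `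
      fib_vecs (Suc (2*l)) (\<lambda>i. if i < Suc (2*l) then vec_index u i else 0)"
proof -
  let ?n = "Suc (2*l)"
  define v where "v = (\<lambda>i. if i < ?n then vec_index u i else 0)"
  have vs: "supported ?n v" by (simp add: v_def supported_def)
  have vv: "dot ?n v v = 0" unfolding v_def by (rule nilpotent_isotropic[OF u nil])
  define X where "X = pi_fiber l (p_block u)"
  define Y where "Y = {D \<in> skew_mats ?n. D *\<^sub>v u = 0\<^sub>v ?n \<and> D * D = 0\<^sub>m ?n ?n}"
  define T where "T = fib_vecs ?n v"
  define fm where "fm = (\<lambda>w :: nat \<times> nat \<Rightarrow> complex. fib_mat l v (\<lambda>i j. w (i, j)))"
  \<comment> \<open>Reads \<open>D\<close> off the coefficient of t^-2: the indices are shifted past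
    e_0 and the correction by u u^T/2 is undone.\<close>
  define R where "R = (\<lambda>(w :: nat \<times> nat \<times> nat \<Rightarrow> complex) (i, j). w (2, Suc i, Suc j) + v i * v j / 2)"
  have X: "X = fm ` T"
    unfolding X_def T_def fm_def by (rule pi_fiber_eq[OF l vs vv p_block_carrier[OF u]]) (simp add: p_block_entry[OF u] v_def)
  have Y: "mat_coords ` Y = T" and mc: "w \<in> T \<Longrightarrow> mat_coords (mat ?n ?n w) = w" for w
    using mat_coords_image[OF u] unfolding Y_def T_def v_def by blast+
  have Yc: "Y \<subseteq> carrier_mat ?n ?n" by (auto simp: Y_def skew_mats_def)
  have lc: "loop_coords (fm w) = fib_coords l v w" if "w \<in> T" for w
    unfolding fm_def using that vs by (intro loop_coords_fib_mat) (simp_all add: T_def fib_vecs_def)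
  have R: "(\<lambda>w. R w c) \<in> polyfun" for c unfolding R_def by (cases c) (auto intro!: polyfun_intros)
  have RL: "R (fib_coords l v w) = w" for w by (rule ext) (auto simp: R_def fib_coords_def)
  have lX: "loop_coords ` X = fib_coords l v ` T" unfolding X image_image by (rule image_cong) (simp_all add: lc)
  have YT: "mat_coords A \<in> T" if "A \<in> Y" for A using Y that by blast
  have TY: "mat ?n ?n w \<in> Y" if w: "w \<in> T" for w
  proof -
    obtain A where A: "A \<in> Y" "w = mat_coords A" using w Y by blast
    then have "mat ?n ?n w = A" using mc[OF w] Yc inj_onD[OF mat_coords_inj, of "mat ?n ?n w" A ?n] by auto
    then show ?thesis using A by simp
  qed
  have aX: "affine_variety loop_coords X"
    unfolding affine_variety_def
  proof (intro conjI exI ballI)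
    show "inj_on loop_coords X" unfolding X
    proof (rule inj_onI, clarify)
      fix w w' assume w: "w \<in> T" "w' \<in> T" "loop_coords (fm w) = loop_coords (fm w')"
      then have "R (fib_coords l v w) = R (fib_coords l v w')" by (simp add: lc)
      then show "fm w = fm w'" by (simp add: RL)
    qed
    show "zclosed (loop_coords ` X)" unfolding lX T_def
      by (rule zclosed_image_section[OF zclosed_fib_vecs polyfun_fib_coords R RL])
    \<comment> \<open>Only the coefficients of 1, t^-1 and t^-2 can be non-zero, which yields the
      finite set of coordinates required of an affine variety.\<close>
    show "finite ({..2} \<times> {..<Suc ?n} \<times> {..<Suc ?n} :: (nat \<times> nat \<times> nat) set)" by simp
    fix x assume "x \<in> X"
    then obtain w where w: "w \<in> T" "x = fm w" using X by blast
    show "\<forall>i. i \<notin> {..2} \<times> {..<Suc ?n} \<times> {..<Suc ?n} \<longrightarrow> loop_coords x i = 0"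
    proof (rule allI, rule impI)
      fix i :: "nat \<times> nat \<times> nat" assume "i \<notin> {..2} \<times> {..<Suc ?n} \<times> {..<Suc ?n}"
      moreover obtain a b c where i: "i = (a, b, c)" by (cases i)
      ultimately have out: "(a, b, c) \<notin> {..2} \<times> {..<Suc ?n} \<times> {..<Suc ?n}" by simp
      have "loop_coords x (a, b, c) = 0"
      proof (cases "a \<le> 2")
        case True
        then show ?thesis using out by (auto simp: loop_coords_def w fm_def fib_mat_simps)
      next
        case False
        then show ?thesis unfolding w(2) lc[OF w(1)] by (simp add: fib_coords_def)
      qed
      then show "loop_coords x i = 0" unfolding i .
    qed
  qed
  have aY: "affine_variety mat_coords Y"
    unfolding affine_variety_def
  proof (intro conjI exI ballI)
    show "inj_on mat_coords Y" using inj_on_subset[OF mat_coords_inj Yc] .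
    show "zclosed (mat_coords ` Y)" unfolding Y T_def by (rule zclosed_fib_vecs)
    show "finite ({..<?n} \<times> {..<?n})" by simp
    fix A assume "A \<in> Y"
    then show "\<forall>i. i \<notin> {..<?n} \<times> {..<?n} \<longrightarrow> mat_coords A i = 0" using Yc by (auto simp: mat_coords_def)
  qed
  have reg: "regular_map loop_coords X mat_coords Y (\<lambda>g. mat ?n ?n (R (loop_coords g)))"
    unfolding regular_map_def
  proof (intro conjI ballI allI)
    fix x assume "x \<in> X"
    then obtain w where w: "w \<in> T" "x = fm w" using X by blast
    show "mat ?n ?n (R (loop_coords x)) \<in> Y" unfolding w(2) lc[OF w(1)] RL by (rule TY[OF w(1)])
  next
    fix c
    show "\<exists>f\<in>polyfun. \<forall>x\<in>X. mat_coords (mat ?n ?n (R (loop_coords x))) c = f (loop_coords x)"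
    proof (rule bexI[OF ballI R])
      fix x assume "x \<in> X"
      then obtain w where w: "w \<in> T" "x = fm w" using X by blast
      show "mat_coords (mat ?n ?n (R (loop_coords x))) c = R (loop_coords x) c" unfolding w(2) lc[OF w(1)] RL mc[OF w(1)] ..
    qed
  qed
  have reg': "regular_map mat_coords Y loop_coords X (\<lambda>A. fm (mat_coords A))"
    unfolding regular_map_def
  proof (intro conjI ballI allI)
    fix A assume "A \<in> Y"
    then show "fm (mat_coords A) \<in> X" using YT X by blast
  next
    fix c
    show "\<exists>f\<in>polyfun. \<forall>A\<in>Y. loop_coords (fm (mat_coords A)) c = f (mat_coords A)"
      by (rule bexI[OF ballI polyfun_fib_coords]) (simp add: lc YT)
  qed
  have left_inv: "fm (mat_coords (mat ?n ?n (R (loop_coords x)))) = x" if x: "x \<in> X" for x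
  proof -
    obtain w where w: "w \<in> T" "x = fm w" using X x by blast
    show ?thesis unfolding w(2) lc[OF w(1)] RL mc[OF w(1)] ..
  qed
  have right_inv: "mat ?n ?n (R (loop_coords (fm (mat_coords A)))) = A" if A: "A \<in> Y" for A
  proof -
    have "mat ?n ?n (mat_coords A) = A"
      by (rule inj_onD[OF mat_coords_inj mc[OF YT[OF A]]]) (use A Yc in auto)
    then show ?thesis unfolding lc[OF YT[OF A]] RL .
  qed
  have iso: "\<exists>\<phi> \<psi>. regular_map loop_coords X mat_coords Y \<phi> \<and> regular_map mat_coords Y loop_coords X \<psi> \<and>
      (\<forall>x\<in>X. \<psi> (\<phi> x) = x) \<and> (\<forall>y\<in>Y. \<phi> (\<psi> y) = y)"
    by (rule exI[of _ "\<lambda>g. mat ?n ?n (R (loop_coords g))"], rule exI[of _ "\<lambda>A. fm (mat_coords A)"], intro conjI ballI)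
      (rule reg, rule reg', erule left_inv, erule right_inv)
  have "variety_iso loop_coords X mat_coords Y" unfolding variety_iso_def by (intro conjI aX aY iso)
  then show "variety_iso loop_coords (pi_fiber l (p_block u)) mat_coords
      {D \<in> skew_mats ?n. D *\<^sub>v u = 0\<^sub>v ?n \<and> D * D = 0\<^sub>m ?n ?n}" unfolding X_def Y_def .
  show "loop_coords ` pi_fiber l (p_block u) = fib_coords l (\<lambda>i. if i < ?n then vec_index u i else 0) `
      fib_vecs ?n (\<lambda>i. if i < ?n then vec_index u i else 0)" using lX unfolding X_def T_def v_def .
qed

theorem proposition4p15:
  fixes l :: nat
  assumes "l \<ge> 2"
  shows "(\<forall>x \<in> nilcone_p l. \<forall>u \<in> carrier_vec (2*l+1). x = p_block u \<longrightarrow>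
            variety_iso loop_coords (pi_fiber l x)
              mat_coords {D \<in> skew_mats (2*l+1).
                            D *\<^sub>v u = 0\<^sub>v (2*l+1) \<and> D * D = 0\<^sub>m (2*l+1) (2*l+1)}) \<and>
         variety_iso loop_coords (pi_fiber l (0\<^sub>m (2*l+2) (2*l+2)))
           mat_coords (max_order2_variety l) \<and>
         krull_dim (loop_coords ` pi_fiber l (0\<^sub>m (2*l+2) (2*l+2))) =
           enat (if even l then l^2 else l^2 - 1)"
proof -
  let ?n = "Suc (2*l)"
  have N: "2*l+1 = ?n" "2*l+2 = Suc ?n" by simp_all
  have l: "1 \<le> l" using assms by simp
  \<comment> \<open>The special fiber is the case \<open>u = 0\<close> of the general one, where the
    condition \<open>D u = 0\<close> is void.\<close>
  have z: "p_block (0\<^sub>v ?n) = 0\<^sub>m (Suc ?n) (Suc ?n)"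
  proof (rule eq_matI)
    fix i j assume "i < dim_row (0\<^sub>m (Suc ?n) (Suc ?n) :: complex mat)" "j < dim_col (0\<^sub>m (Suc ?n) (Suc ?n) :: complex mat)"
    then have ij: "i < Suc ?n" "j < Suc ?n" by simp_all
    then show "p_block (0\<^sub>v ?n) $$ (i, j) = 0\<^sub>m (Suc ?n) (Suc ?n) $$ (i, j)"
      unfolding p_block_entry[OF zero_carrier_vec ij] by (cases i; cases j) simp_all
  qed (use p_block_carrier[OF zero_carrier_vec, of ?n] in auto)
  have nil0: "p_block (0\<^sub>v ?n) ^\<^sub>m 1 = 0\<^sub>m (Suc ?n) (Suc ?n)" unfolding z by simp
  note iso0 = pi_fiber_iso[OF l zero_carrier_vec nil0, unfolded z]
  have max: "max_order2_variety l = {D \<in> skew_mats ?n. D *\<^sub>v 0\<^sub>v ?n = 0\<^sub>v ?n \<and> D * D = 0\<^sub>m ?n ?n}"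
    unfolding max_order2_variety_eq by (auto simp: skew_mats_def)
  have zero: "(\<lambda>i. if i < ?n then vec_index (0\<^sub>v ?n) i else 0) = (\<lambda>_. 0 :: complex)" by auto
  have fv: "fib_vecs ?n (\<lambda>_. 0) = {v. skew_nil ?n (\<lambda>i j. v (i, j))}" by (simp add: fib_vecs_def mapply_def)
  have lc: "loop_coords ` pi_fiber l (0\<^sub>m (Suc ?n) (Suc ?n)) = fib_coords l (\<lambda>_. 0) ` {v. skew_nil ?n (\<lambda>i j. v (i, j))}"
    using iso0(2) unfolding zero fv .
  have "fib_coords l (\<lambda>_. 0) v (case ij of (i, j) \<Rightarrow> (2, Suc i, Suc j)) = v ij" for v ij
    by (cases ij) (simp add: fib_coords_def)
  moreover have "zclosed (loop_coords ` pi_fiber l (0\<^sub>m (Suc ?n) (Suc ?n)))"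
    using iso0(1) by (simp add: variety_iso_def affine_variety_def)
  ultimately have "enat (2 * (l div 2) * (2*l - 2 * (l div 2))) \<le> krull_dim (loop_coords ` pi_fiber l (0\<^sub>m (Suc ?n) (Suc ?n)))"
    unfolding lc by (intro krull_dim_skew_nil_ge[where \<iota> = "\<lambda>ij. case ij of (i, j) \<Rightarrow> (2, Suc i, Suc j)"] polyfun_fib_coords) auto
  then have "krull_dim (loop_coords ` pi_fiber l (0\<^sub>m (Suc ?n) (Suc ?n))) = enat (2 * (l div 2) * (2*l - 2 * (l div 2)))"
    using krull_dim_skew_nil_le[of "fib_coords l (\<lambda>_. 0)" l] polyfun_fib_coords unfolding lc by (simp add: order.antisym)
  \<comment> \<open>The maximal rank K is \<open>l\<close> or \<open>l - 1\<close>, and K (2l - K)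
    is accordingly l^2 or (l - 1)(l + 1).\<close>
  also have "2 * (l div 2) * (2*l - 2 * (l div 2)) = (if even l then l^2 else l^2 - 1)"
  proof (cases "even l")
    case True
    then show ?thesis by (simp add: power2_eq_square)
  next
    case False
    then obtain m where "l = Suc (2*m)" by (auto elim: oddE)
    then show ?thesis by (simp add: power2_eq_square algebra_simps)
  qed
  finally have dim: "krull_dim (loop_coords ` pi_fiber l (0\<^sub>m (Suc ?n) (Suc ?n))) = enat (if even l then l^2 else l^2 - 1)" .
  have part1: "variety_iso loop_coords (pi_fiber l x) mat_coords {D \<in> skew_mats ?n. D *\<^sub>v u = 0\<^sub>v ?n \<and> D * D = 0\<^sub>m ?n ?n}"
    if x: "x \<in> nilcone_p l" "x = p_block u" and u: "u \<in> carrier_vec ?n" for x u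
  proof -
    obtain k where "x ^\<^sub>m k = 0\<^sub>m (Suc ?n) (Suc ?n)" using x(1) unfolding nilcone_p_def N by blast
    then show ?thesis using pi_fiber_iso(1)[OF l u, of k] x(2) by simp
  qed
  show ?thesis unfolding N max using part1 iso0(1) dim by blast
qed

end
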